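(* For $0\le k\le n$, the map $\psi_{n,k}:R^q_{n,k}\otimes_{\mathbb{Z}[q,q^{-1}]}\mathbb{Z}[q^{1/2},q^{-1/2}]\to S^q_{n,k}$ is an isomorphism.
   Context: Quantum Russell space. A diagram is a crossingless matching of the points $1,\ldots,2n$ on a line (arcs below the line) with exactly $k$ of its arcs dotted (one dot each). Arc $(p,p')$ is nested in arc $(e,e')$ if $e<p<p'<e'$. $\widetilde R^q_{n,k}$ is the free $\mathbb{Z}[q,q^{-1}]$-module on diagrams, and $R^q_{n,k}$ is its quotient by the quantum Type I and II relations. In these, $a<b<c<d$; the diagrams are identical except as indicated; a bar marks a dotted arc; $x_1,\ldots,x_\alpha$ are all undotted arcs $(e,e')$ with $e<a$, $d<e'$, ordered from innermost to outermost, $x_i=(x_{i_1},x_{i_2})$; $n_i$ is the number of dotted arcs $(y_1,y_2)$ with $x_{i_1}<y_1<a$ and $d<y_2<x_{i_2}$. Type I: $[ad,\overline{bc}]=[\overline{ab},cd]+[ab,\overline{cd}]+q^{-1}[\overline{ad},bc]+(1-q^{-2})\sum_{i=1}^\alpha q^{\,i-n_i}[ab,cd,\overline{x_i}]$. Type II: $[\overline{ab},\overline{cd}]=[\overline{ad},\overline{bc}]+(1-q^{-2})\sum_{i=1}^\alpha q^{\,i-1-n_i}[\overline{ad},bc,\overline{x_i}]$. (Here $[\ldots,\overline{x_i}]$ means that $x_i$ is dotted, the other $x_j$ staying undotted.) Kauffman--Lins space. Fix $2(n+k)$ points on a line; the leftmost $k$ and the rightmost $k$ form the left and right "projectors". $\widetilde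 S^q_{n,k}$ is the $\mathbb{Z}[q^{1/2},q^{-1/2}]$-module spanned by tangle diagrams below the line (up to regular isotopy) consisting of $n+k$ arcs with the given endpoints and finitely many circles, modulo: (i) a diagram having an arc with both endpoints in one projector is $0$; (ii) a circle equals $-q-q^{-1}$; (iii) a crossing whose over-strand runs from upper left to lower right equals $q^{1/2}$ times the smoothing joining the two upper ends and the two lower ends plus $q^{-1/2}$ times the smoothing joining the two left ends and the two right ends (the other crossing is the 90-degree rotation). The map $\varphi_{n,k-1}:\widetilde S^q_{n,k-1}\to\widetilde S^q_{n,k}$ adds one new endpoint at the far left (in the left projector) and one at the far right (in the right projector), joined by an arc below everything else. For $k\ge1$, $S^q_{n,k}=\operatorname{coker}\varphi_{n,k-1}$; $S^q_{n,0}=\widetilde S^q_{n,0}$. The map. For a diagram $x$, $\widetilde\psi_{n,k}(x)$ is defined as follows. Add $k$ points on each side of its $2n$ points, forming the projectors. Keep the undotted arcs. Replace each dotted arc $(p,r)$ by a strand from $p$ to the left projector and a strand from $r$ to the right projector, where the left endpoints $p_1<\cdots<p_k$ of dotted arcs are joined so that $p_j$ goes to the $j$-th point from the right in the left projector, and the right endpoints $r_1<\cdots<r_k$ so that $r_j$ goes to the $j$-th point from the right in the right projector. Crossings are minimal: if a dotted arc is nested in an undotted arc, its left strand passes under and its right strand passes over that undotted arc (once each); otherwise its strands do not meet that undotted arc; strands from nested dotted arcs are disjoint; for unnested dotted arcs the only crossing is that the right strand of the left dotted arc passes over the left strand of the right dotted arc. Finally multiply by $q^{-1/2}$ for each pair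 of nested dotted arcs. Extend linearly; composing with the quotient map $\widetilde S^q_{n,k}\to S^q_{n,k}$ gives a map that is well defined on $R^q_{n,k}$, and $\psi_{n,k}$ is its $\mathbb{Z}[q^{1/2},q^{-1/2}]$-linear extension.
   Formalization: Relation (i) is imposed only for arcs with both endpoints in one projector that take part in no crossing; imposed on crossed arcs too, it makes the claim false for every k ≥ 2 (for n=k=2 a clasp would make S torsion). *)

theory Defs
  imports
    "HOL-Library.Poly_Mapping"
    "HOL-Library.FuncSet"
    "HOL-Algebra.Module"
    "HOL-Algebra.AbelCoset"
    "HOL-Algebra.Generated_Groups"
    "HOL-Algebra.Algebraic_Closure_Type"
begin

section \<open>Laurent polynomials\<close>

text \<open>
  Finitely supported functions from exponents to coefficients, with the convolution product.
  The variable is the square root of \<open>q\<close>, so that \<open>\<int>[q, q\<^sup>-\<^sup>1]\<close> is the subring of elements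
  all of whose exponents are even.
\<close>

type_synonym laurent = "int \<Rightarrow>\<^sub>0 int"

definition qhalf_pow :: "int \<Rightarrow> laurent" where
  "qhalf_pow i = Poly_Mapping.single i 1"

definition q_pow :: "int \<Rightarrow> laurent" where
  "q_pow i = qhalf_pow (2 * i)"

definition Laurent_qhalf :: "laurent ring" where
  "Laurent_qhalf = ring_of_type_algebra"

definition Laurent_q :: "laurent ring" where
  "Laurent_q = Laurent_qhalf\<lparr>carrier := {f. \<forall>i\<in>Poly_Mapping.keys f. even i}\<rparr>"


section \<open>Modules\<close>

text \<open>The multiplicative fields of the module records below carry no information.\<close>

definition scale :: "'r::comm_ring_1 \<Rightarrow> ('x \<Rightarrow>\<^sub>0 'r) \<Rightarrow> ('x \<Rightarrow>\<^sub>0 'r)" where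
  "scale c = Poly_Mapping.map ((*) c)"

definition free_module :: "'r::comm_ring_1 ring \<Rightarrow> 'x set \<Rightarrow> ('r, 'x \<Rightarrow>\<^sub>0 'r) module" where
  "free_module R B =
     \<lparr>carrier = {f. Poly_Mapping.keys f \<subseteq> B \<and> (\<forall>x. Poly_Mapping.lookup f x \<in> carrier R)},
      monoid.mult = undefined, monoid.one = undefined,
      ring.zero = 0, ring.add = (+), module.smult = scale\<rparr>"

definition linear_extension ::
    "('x \<Rightarrow> ('y \<Rightarrow>\<^sub>0 'r)) \<Rightarrow> ('x \<Rightarrow>\<^sub>0 'r) \<Rightarrow> ('y \<Rightarrow>\<^sub>0 'r::comm_ring_1)" where
  "linear_extension g f =
     (\<Sum>x\<in>Poly_Mapping.keys f. scale (Poly_Mapping.lookup f x) (g x))"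

definition module_span :: "'r ring \<Rightarrow> ('r, 'm) module \<Rightarrow> 'm set \<Rightarrow> 'm set" where
  "module_span R M G = (\<lambda>N. submodule N R M) hull G"

definition quot_module :: "('r, 'm) module \<Rightarrow> 'm set \<Rightarrow> ('r, 'm set) module" where
  "quot_module M N =
     \<lparr>carrier = a_rcosets\<^bsub>M\<^esub> N,
      monoid.mult = undefined, monoid.one = undefined,
      ring.zero = N, ring.add = set_add M,
      module.smult = (\<lambda>a C. \<Union>x\<in>C. N +>\<^bsub>M\<^esub> (a \<odot>\<^bsub>M\<^esub> x))\<rparr>"

text \<open>
  The map that \<open>f\<close> induces on cosets. It is meaningful where \<open>f\<close> is constant on the coset.
\<close>

definition induced :: "('m \<Rightarrow> 'n) \<Rightarrow> 'm set \<Rightarrow> 'n" where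
  "induced f C = the_elem (f ` C)"

definition module_hom ::
    "'r ring \<Rightarrow> ('r, 'm) module \<Rightarrow> ('r, 'n) module \<Rightarrow> ('m \<Rightarrow> 'n) set" where
  "module_hom R M N =
     {h \<in> carrier M \<rightarrow> carrier N.
        (\<forall>x\<in>carrier M. \<forall>y\<in>carrier M. h (x \<oplus>\<^bsub>M\<^esub> y) = h x \<oplus>\<^bsub>N\<^esub> h y) \<and>
        (\<forall>a\<in>carrier R. \<forall>x\<in>carrier M. h (a \<odot>\<^bsub>M\<^esub> x) = a \<odot>\<^bsub>N\<^esub> h x)}"

definition module_iso ::
    "'r ring \<Rightarrow> ('r, 'm) module \<Rightarrow> ('r, 'n) module \<Rightarrow> ('m \<Rightarrow> 'n) set" where
  "module_iso R M N = {h \<in> module_hom R M N. bij_betw h (carrier M) (carrier N)}"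

text \<open>
  The tensor product \<open>M \<otimes>\<^sub>R S\<close> of an \<open>R\<close>-module \<open>M\<close> with a ring \<open>S\<close> containing \<open>R\<close>: the free
  abelian group on \<open>M \<times> S\<close> modulo the subgroup of balanced relations, with \<open>S\<close> acting on the
  right-hand factor.
\<close>

definition tensor_pairs :: "('r, 'm) module \<Rightarrow> 's ring \<Rightarrow> ('s, ('m \<times> 's) \<Rightarrow>\<^sub>0 int) module" where
  "tensor_pairs M S =
     \<lparr>carrier = {f. Poly_Mapping.keys f \<subseteq> carrier M \<times> carrier S},
      monoid.mult = undefined, monoid.one = undefined,
      ring.zero = 0, ring.add = (+),
      module.smult = (\<lambda>c. frag_extend (\<lambda>(m, s). frag_of (m, c \<otimes>\<^bsub>S\<^esub> s)))\<rparr>"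

inductive_set tensor_relations :: "'s ring \<Rightarrow> ('s, 'm) module \<Rightarrow> 's ring \<Rightarrow> (('m \<times> 's) \<Rightarrow>\<^sub>0 int) set"
  for R M S where
  add_left: "\<lbrakk>m \<in> carrier M; m' \<in> carrier M; s \<in> carrier S\<rbrakk>
    \<Longrightarrow> frag_of (m \<oplus>\<^bsub>M\<^esub> m', s) - frag_of (m, s) - frag_of (m', s) \<in> tensor_relations R M S"
| add_right: "\<lbrakk>m \<in> carrier M; s \<in> carrier S; s' \<in> carrier S\<rbrakk>
    \<Longrightarrow> frag_of (m, s \<oplus>\<^bsub>S\<^esub> s') - frag_of (m, s) - frag_of (m, s') \<in> tensor_relations R M S"
| balanced: "\<lbrakk>a \<in> carrier R; m \<in> carrier M; s \<in> carrier S\<rbrakk>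
    \<Longrightarrow> frag_of (a \<odot>\<^bsub>M\<^esub> m, s) - frag_of (m, a \<otimes>\<^bsub>S\<^esub> s) \<in> tensor_relations R M S"

definition extend_scalars ::
    "'s ring \<Rightarrow> 's ring \<Rightarrow> ('s, 'm) module \<Rightarrow> ('s, (('m \<times> 's) \<Rightarrow>\<^sub>0 int) set) module" where
  "extend_scalars R S M =
     quot_module (tensor_pairs M S)
       (generate (add_monoid (tensor_pairs M S)) (tensor_relations R M S))"

text \<open>
  The \<open>S\<close>-linear extension \<open>m \<otimes> s \<mapsto> s \<cdot> h(m)\<close> of an \<open>R\<close>-linear map \<open>h\<close> from \<open>M\<close> to an
  \<open>S\<close>-module \<open>N\<close>.
\<close>

definition extend_map ::
    "('s, 'n) module \<Rightarrow> ('m \<Rightarrow> 'n) \<Rightarrow> (('m \<times> 's) \<Rightarrow>\<^sub>0 int) set \<Rightarrow> 'n" where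
  "extend_map N h = induced (\<lambda>f.
     \<Oplus>\<^bsub>N\<^esub>p\<in>Poly_Mapping.keys f.
       [Poly_Mapping.lookup f p] \<cdot>\<^bsub>N\<^esub> (snd p \<odot>\<^bsub>N\<^esub> h (fst p)))"


section \<open>The quantum Russell space\<close>

text \<open>An arc is the pair of its endpoints, the smaller one first.\<close>

type_synonym arc = "nat \<times> nat"

definition crossingless_matching :: "nat \<Rightarrow> arc set \<Rightarrow> bool" where
  "crossingless_matching n M \<longleftrightarrow>
     (\<forall>(a, b)\<in>M. 1 \<le> a \<and> a < b \<and> b \<le> 2 * n) \<and>
     (\<forall>p\<in>{1..2 * n}. \<exists>!x. x \<in> M \<and> (p = fst x \<or> p = snd x)) \<and>
     (\<forall>(a, b)\<in>M. \<forall>(c, d)\<in>M. \<not> (a < c \<and> c < b \<and> b < d))"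

definition nested_in :: "arc \<Rightarrow> arc \<Rightarrow> bool" where
  "nested_in x y \<longleftrightarrow> fst y < fst x \<and> fst x < snd x \<and> snd x < snd y"

text \<open>A diagram is a matching together with the set of its dotted arcs.\<close>

type_synonym diagram = "arc set \<times> arc set"

definition diagrams :: "nat \<Rightarrow> nat \<Rightarrow> diagram set" where
  "diagrams n k = {(M, D). crossingless_matching n M \<and> D \<subseteq> M \<and> card D = k}"

text \<open>
  In the relations, \<open>M\<close> and \<open>D\<close> are the arcs and the dotted arcs common to all diagrams involved.
  The arcs \<open>x\<^sub>1, \<dots>, x\<^sub>\<alpha>\<close> are pairwise nested, so \<open>surround_index M D a d x\<close> is the \<open>i\<close> with
  \<open>x = x\<^sub>i\<close>, and \<open>surround_dotted D a d x\<close> is \<open>n\<^sub>i\<close>.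
\<close>

definition surrounding :: "arc set \<Rightarrow> arc set \<Rightarrow> nat \<Rightarrow> nat \<Rightarrow> arc set" where
  "surrounding M D a d = {x \<in> M - D. fst x < a \<and> d < snd x}"

definition surround_index :: "arc set \<Rightarrow> arc set \<Rightarrow> nat \<Rightarrow> nat \<Rightarrow> arc \<Rightarrow> int" where
  "surround_index M D a d x = int (card {y \<in> surrounding M D a d. y = x \<or> nested_in y x})"

definition surround_dotted :: "arc set \<Rightarrow> nat \<Rightarrow> nat \<Rightarrow> arc \<Rightarrow> int" where
  "surround_dotted D a d x =
     int (card {y \<in> D. fst x < fst y \<and> fst y < a \<and> d < snd y \<and> snd y < snd x})"

inductive_set russell_relations :: "nat \<Rightarrow> nat \<Rightarrow> (diagram \<Rightarrow>\<^sub>0 laurent) set" for n k where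
  type_I:
   "\<lbrakk>a < b; b < c; c < d; D \<subseteq> M; card D + 1 = k;
     crossingless_matching n (M \<union> {(a, d), (b, c)});
     crossingless_matching n (M \<union> {(a, b), (c, d)})\<rbrakk>
    \<Longrightarrow> Poly_Mapping.single (M \<union> {(a, d), (b, c)}, D \<union> {(b, c)}) 1
        - (Poly_Mapping.single (M \<union> {(a, b), (c, d)}, D \<union> {(a, b)}) 1
           + Poly_Mapping.single (M \<union> {(a, b), (c, d)}, D \<union> {(c, d)}) 1
           + Poly_Mapping.single (M \<union> {(a, d), (b, c)}, D \<union> {(a, d)}) (q_pow (-1))
           + (\<Sum>x\<in>surrounding M D a d.
                Poly_Mapping.single (M \<union> {(a, b), (c, d)}, D \<union> {x})
                  ((1 - q_pow (-2))
                   * q_pow (surround_index M D a d x - surround_dotted D a d x))))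
        \<in> russell_relations n k"
| type_II:
   "\<lbrakk>a < b; b < c; c < d; D \<subseteq> M; card D + 2 = k;
     crossingless_matching n (M \<union> {(a, d), (b, c)});
     crossingless_matching n (M \<union> {(a, b), (c, d)})\<rbrakk>
    \<Longrightarrow> Poly_Mapping.single (M \<union> {(a, b), (c, d)}, D \<union> {(a, b), (c, d)}) 1
        - (Poly_Mapping.single (M \<union> {(a, d), (b, c)}, D \<union> {(a, d), (b, c)}) 1
           + (\<Sum>x\<in>surrounding M D a d.
                Poly_Mapping.single (M \<union> {(a, d), (b, c)}, D \<union> {(a, d), x})
                  ((1 - q_pow (-2))
                   * q_pow (surround_index M D a d x - 1 - surround_dotted D a d x))))
        \<in> russell_relations n k"

definition free_russell :: "nat \<Rightarrow> nat \<Rightarrow> (laurent, diagram \<Rightarrow>\<^sub>0 laurent) module" where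
  "free_russell n k = free_module Laurent_q (diagrams n k)"

definition russell :: "nat \<Rightarrow> nat \<Rightarrow> (laurent, (diagram \<Rightarrow>\<^sub>0 laurent) set) module" where
  "russell n k =
     quot_module (free_russell n k) (module_span Laurent_q (free_russell n k) (russell_relations n k))"


section \<open>Tangle diagrams\<close>

text \<open>
  A tangle diagram below a line is put in general position with respect to height and cut into
  horizontal slices, each containing one local minimum (\<open>Cup\<close>), one local maximum (\<open>Cap\<close>) or one
  crossing. The list of slices is read from bottom to top, starting from the empty level. The
  second component of a slice is the number of strands to the left of the distinguished piece.
  The over-strand runs from lower left to upper right in \<open>Pos\<close>, and from upper left to lower right
  in \<open>Neg\<close>.
\<close>

datatype piece = Cup | Cap | Pos | Neg

type_synonym tangle = "(piece \<times> nat) list"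

fun legs_below :: "piece \<Rightarrow> nat" where
  "legs_below Cup = 0"
| "legs_below Cap = 2"
| "legs_below Pos = 2"
| "legs_below Neg = 2"

fun legs_above :: "piece \<Rightarrow> nat" where
  "legs_above Cup = 2"
| "legs_above Cap = 0"
| "legs_above Pos = 2"
| "legs_above Neg = 2"

fun top_width :: "nat \<Rightarrow> tangle \<Rightarrow> nat option" where
  "top_width w [] = Some w"
| "top_width w ((s, i) # u) =
     (if i + legs_below s \<le> w then top_width (w - legs_below s + legs_above s) u else None)"

text \<open>The endpoints of a diagram in \<open>tangles m\<close> are numbered \<open>0, \<dots>, m - 1\<close> from left to right.\<close>

definition tangles :: "nat \<Rightarrow> tangle set" where
  "tangles m = {u. top_width 0 u = Some m}"

text \<open>
  Regular isotopy of sliced diagrams: planar isotopy is generated by exchanging distant pieces,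
  straightening a strand, and sliding a strand past a local extremum; to this are added the second
  and third Reidemeister moves. The remaining versions of the third move follow from the one listed
  by means of the second.
\<close>

inductive regular_move :: "tangle \<Rightarrow> tangle \<Rightarrow> bool" where
  exchange:
    "regular_move [(s, i), (t, i + legs_above s + j)] [(t, i + legs_below s + j), (s, i)]"
| straighten_right: "regular_move [(Cup, i), (Cap, i + 1)] []"
| straighten_left: "regular_move [(Cup, i + 1), (Cap, i)] []"
| slide_Cup_over: "regular_move [(Cup, i), (Pos, i + 1)] [(Cup, i + 1), (Neg, i)]"
| slide_Cup_under: "regular_move [(Cup, i), (Neg, i + 1)] [(Cup, i + 1), (Pos, i)]"
| slide_Cap_under: "regular_move [(Pos, i + 1), (Cap, i)] [(Neg, i), (Cap, i + 1)]"
| slide_Cap_over: "regular_move [(Neg, i + 1), (Cap, i)] [(Pos, i), (Cap, i + 1)]"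
| R2_Pos_Neg: "regular_move [(Pos, i), (Neg, i)] []"
| R2_Neg_Pos: "regular_move [(Neg, i), (Pos, i)] []"
| R3: "regular_move [(Pos, i), (Pos, i + 1), (Pos, i)] [(Pos, i + 1), (Pos, i), (Pos, i + 1)]"

text \<open>
  The point \<open>(l, x)\<close> is the \<open>x\<close>-th strand just below slice number \<open>l\<close>, and for \<open>l = length u\<close> it
  is the endpoint \<open>x\<close> of the diagram. Two points are related when a slice joins them.
\<close>

inductive joined_in_slice :: "tangle \<Rightarrow> nat \<times> nat \<Rightarrow> nat \<times> nat \<Rightarrow> bool" for u where
  left: "\<lbrakk>l < length u; u ! l = (s, i); x < i\<rbrakk> \<Longrightarrow> joined_in_slice u (l, x) (l + 1, x)"
| right: "\<lbrakk>l < length u; u ! l = (s, i)\<rbrakk>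
    \<Longrightarrow> joined_in_slice u (l, i + legs_below s + x) (l + 1, i + legs_above s + x)"
| Cup: "\<lbrakk>l < length u; u ! l = (Cup, i)\<rbrakk> \<Longrightarrow> joined_in_slice u (l + 1, i) (l + 1, i + 1)"
| Cap: "\<lbrakk>l < length u; u ! l = (Cap, i)\<rbrakk> \<Longrightarrow> joined_in_slice u (l, i) (l, i + 1)"
| rising: "\<lbrakk>l < length u; u ! l = (s, i); s = Pos \<or> s = Neg\<rbrakk>
    \<Longrightarrow> joined_in_slice u (l, i) (l + 1, i + 1)"
| falling: "\<lbrakk>l < length u; u ! l = (s, i); s = Pos \<or> s = Neg\<rbrakk>
    \<Longrightarrow> joined_in_slice u (l, i + 1) (l + 1, i)"

definition same_component :: "tangle \<Rightarrow> nat \<times> nat \<Rightarrow> nat \<times> nat \<Rightarrow> bool" where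
  "same_component u = equivclp (joined_in_slice u)"

definition uncrossed :: "tangle \<Rightarrow> nat \<times> nat \<Rightarrow> bool" where
  "uncrossed u p \<longleftrightarrow>
     (\<forall>l<length u. \<forall>s i. u ! l = (s, i) \<and> (s = Pos \<or> s = Neg) \<longrightarrow>
        \<not> same_component u p (l, i) \<and> \<not> same_component u p (l, i + 1))"


section \<open>The Kauffman--Lins space\<close>

definition left_projector :: "nat \<Rightarrow> nat \<Rightarrow> nat set" where
  "left_projector n k = {0..<k}"

definition right_projector :: "nat \<Rightarrow> nat \<Rightarrow> nat set" where
  "right_projector n k = {2 * n + k..<2 * n + 2 * k}"

text \<open>
  The arc that makes a diagram vanish must not take part in any crossing (the rest of the diagram may).
  Without this proviso the relation would be inconsistent with the others: an arc between two
  neighbouring points of a projector that is clasped with an arc outside the projector would make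
  \<open>1 - q\<^sup>-\<^sup>2\<close> times a nonzero crossingless diagram vanish.
\<close>

definition has_projector_arc :: "nat \<Rightarrow> nat \<Rightarrow> tangle \<Rightarrow> bool" where
  "has_projector_arc n k u \<longleftrightarrow>
     (\<exists>x y. x \<noteq> y \<and>
        ({x, y} \<subseteq> left_projector n k \<or> {x, y} \<subseteq> right_projector n k) \<and>
        same_component u (length u, x) (length u, y) \<and> uncrossed u (length u, x))"

inductive_set kauffman_lins_relations :: "nat \<Rightarrow> nat \<Rightarrow> (tangle \<Rightarrow>\<^sub>0 laurent) set" for n k where
  isotopy:
   "\<lbrakk>regular_move l r; u @ l @ v \<in> tangles (2 * (n + k)); u @ r @ v \<in> tangles (2 * (n + k))\<rbrakk>
    \<Longrightarrow> Poly_Mapping.single (u @ l @ v) 1 - Poly_Mapping.single (u @ r @ v) 1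
        \<in> kauffman_lins_relations n k"
| projector:
   "\<lbrakk>u \<in> tangles (2 * (n + k)); has_projector_arc n k u\<rbrakk>
    \<Longrightarrow> Poly_Mapping.single u 1 \<in> kauffman_lins_relations n k"
| circle:
   "u @ [(Cup, i), (Cap, i)] @ v \<in> tangles (2 * (n + k))
    \<Longrightarrow> Poly_Mapping.single (u @ [(Cup, i), (Cap, i)] @ v) 1
        - Poly_Mapping.single (u @ v) (- q_pow 1 - q_pow (-1))
        \<in> kauffman_lins_relations n k"
| crossing_Neg:
   "u @ [(Neg, i)] @ v \<in> tangles (2 * (n + k))
    \<Longrightarrow> Poly_Mapping.single (u @ [(Neg, i)] @ v) 1
        - (Poly_Mapping.single (u @ [(Cap, i), (Cup, i)] @ v) (qhalf_pow 1)
           + Poly_Mapping.single (u @ v) (qhalf_pow (-1)))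
        \<in> kauffman_lins_relations n k"
| crossing_Pos:
   "u @ [(Pos, i)] @ v \<in> tangles (2 * (n + k))
    \<Longrightarrow> Poly_Mapping.single (u @ [(Pos, i)] @ v) 1
        - (Poly_Mapping.single (u @ v) (qhalf_pow 1)
           + Poly_Mapping.single (u @ [(Cap, i), (Cup, i)] @ v) (qhalf_pow (-1)))
        \<in> kauffman_lins_relations n k"

definition free_kauffman_lins :: "nat \<Rightarrow> nat \<Rightarrow> (laurent, tangle \<Rightarrow>\<^sub>0 laurent) module" where
  "free_kauffman_lins n k = free_module Laurent_qhalf (tangles (2 * (n + k)))"

definition kauffman_lins_span :: "nat \<Rightarrow> nat \<Rightarrow> (tangle \<Rightarrow>\<^sub>0 laurent) set" where
  "kauffman_lins_span n k =
     module_span Laurent_qhalf (free_kauffman_lins n k) (kauffman_lins_relations n k)"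

definition kauffman_lins_tilde :: "nat \<Rightarrow> nat \<Rightarrow> (laurent, (tangle \<Rightarrow>\<^sub>0 laurent) set) module" where
  "kauffman_lins_tilde n k = quot_module (free_kauffman_lins n k) (kauffman_lins_span n k)"

definition class_tilde :: "nat \<Rightarrow> nat \<Rightarrow> (tangle \<Rightarrow>\<^sub>0 laurent) \<Rightarrow> (tangle \<Rightarrow>\<^sub>0 laurent) set" where
  "class_tilde n k f = kauffman_lins_span n k +>\<^bsub>free_kauffman_lins n k\<^esub> f"

definition add_outer_arc :: "tangle \<Rightarrow> tangle" where
  "add_outer_arc u = (Cup, 0) # map (\<lambda>(s, i). (s, i + 1)) u"

text \<open>\<open>phi n k\<close> goes from the space with parameters \<open>n, k\<close> to the one with \<open>n, k + 1\<close>.\<close>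

definition phi :: "nat \<Rightarrow> nat \<Rightarrow> (tangle \<Rightarrow>\<^sub>0 laurent) set \<Rightarrow> (tangle \<Rightarrow>\<^sub>0 laurent) set" where
  "phi n k = induced (\<lambda>f.
     class_tilde n (k + 1)
       (linear_extension (\<lambda>u. Poly_Mapping.single (add_outer_arc u) 1) f))"

text \<open>
  For \<open>k = 0\<close> the submodule is zero, so that the quotient is a copy of \<open>kauffman_lins_tilde n 0\<close>
  with singletons for elements.
\<close>

definition phi_image :: "nat \<Rightarrow> nat \<Rightarrow> (tangle \<Rightarrow>\<^sub>0 laurent) set set" where
  "phi_image n k =
     (if k = 0 then {\<zero>\<^bsub>kauffman_lins_tilde n k\<^esub>}
      else phi n (k - 1) ` carrier (kauffman_lins_tilde n (k - 1)))"

definition kauffman_lins ::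
    "nat \<Rightarrow> nat \<Rightarrow> (laurent, (tangle \<Rightarrow>\<^sub>0 laurent) set set) module" where
  "kauffman_lins n k = quot_module (kauffman_lins_tilde n k) (phi_image n k)"

definition class_kl ::
    "nat \<Rightarrow> nat \<Rightarrow> (tangle \<Rightarrow>\<^sub>0 laurent) set \<Rightarrow> (tangle \<Rightarrow>\<^sub>0 laurent) set set" where
  "class_kl n k C = phi_image n k +>\<^bsub>kauffman_lins_tilde n k\<^esub> C"


section \<open>The map\<close>

text \<open>
  A strand \<open>(a, b, h)\<close> joins the endpoints \<open>a < b\<close> at height \<open>h\<close> above the plane of the diagram.
  Right strands of dotted arcs (height 2) pass over everything they meet, left strands (height 0)
  pass under everything they meet, and undotted arcs (height 1) lie in between; two strands of equal
  height never meet. Point \<open>p\<close> of the diagram becomes endpoint \<open>k + p - 1\<close>; the \<open>j\<close>-th point from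
  the right is endpoint \<open>k - j\<close> in the left projector and \<open>2 (n + k) - j\<close> in the right one.
\<close>

type_synonym strand = "nat \<times> nat \<times> nat"

definition strands :: "nat \<Rightarrow> nat \<Rightarrow> diagram \<Rightarrow> strand set" where
  "strands n k = (\<lambda>(M, D).
     {(k - card {x \<in> D. fst x \<le> p}, k + p - 1, 0) | p r. (p, r) \<in> D}
     \<union> {(k + p - 1, k + r - 1, 1) | p r. (p, r) \<in> M - D}
     \<union> {(k + r - 1, 2 * (n + k) - card {x \<in> D. snd x \<le> r}, 2) | p r. (p, r) \<in> D})"

text \<open>
  The diagram in which the strands of \<open>C\<close> are drawn as semicircles, so that two strands meet
  exactly if their endpoints interleave, and then once. The strands are added from bottom to top in
  the order of their left endpoints. When \<open>(a, b, h)\<close> is added, exactly the endpoints below \<open>a\<close> lie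
  to its left; its right leg then crosses, from left to right, the older strands that end between
  \<open>a\<close> and \<open>b\<close>, whose heights are collected in \<open>crossed_heights\<close>. It moves from lower left to upper
  right, and so is the over-strand of a \<open>Pos\<close>.
\<close>

definition crossed_heights :: "strand set \<Rightarrow> nat \<Rightarrow> nat \<Rightarrow> nat list" where
  "crossed_heights C a b =
     [h. e \<leftarrow> [a + 1..<b], a' \<leftarrow> [0..<a], h \<leftarrow> [0, 1, 2], (a', e, h) \<in> C]"

definition add_strand :: "strand set \<Rightarrow> strand \<Rightarrow> tangle" where
  "add_strand C = (\<lambda>(a, b, h). let hs = crossed_heights C a b in
     (Cup, a) # map (\<lambda>j. (if hs ! j < h then Pos else Neg, a + 1 + j)) [0..<length hs])"

definition semicircle_tangle :: "nat \<Rightarrow> strand set \<Rightarrow> tangle" where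
  "semicircle_tangle m C =
     concat [add_strand C (a, b, h).
       a \<leftarrow> [0..<m], b \<leftarrow> [a + 1..<m], h \<leftarrow> [0, 1, 2], (a, b, h) \<in> C]"

definition psi_diagram :: "nat \<Rightarrow> nat \<Rightarrow> diagram \<Rightarrow> (tangle \<Rightarrow>\<^sub>0 laurent)" where
  "psi_diagram n k x =
     Poly_Mapping.single (semicircle_tangle (2 * (n + k)) (strands n k x))
       (qhalf_pow (- int (card {(y, z). y \<in> snd x \<and> z \<in> snd x \<and> nested_in y z})))"

definition psi_tilde :: "nat \<Rightarrow> nat \<Rightarrow> (diagram \<Rightarrow>\<^sub>0 laurent) \<Rightarrow> (tangle \<Rightarrow>\<^sub>0 laurent) set" where
  "psi_tilde n k f = class_tilde n k (linear_extension (psi_diagram n k) f)"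

definition psi_russell ::
    "nat \<Rightarrow> nat \<Rightarrow> (diagram \<Rightarrow>\<^sub>0 laurent) set \<Rightarrow> (tangle \<Rightarrow>\<^sub>0 laurent) set set" where
  "psi_russell n k = induced (\<lambda>f. class_kl n k (psi_tilde n k f))"

definition psi ::
    "nat \<Rightarrow> nat \<Rightarrow> (((diagram \<Rightarrow>\<^sub>0 laurent) set \<times> laurent) \<Rightarrow>\<^sub>0 int) set
       \<Rightarrow> (tangle \<Rightarrow>\<^sub>0 laurent) set set" where
  "psi n k = extend_map (kauffman_lins n k) (psi_russell n k)"

end

(* Colour the strands of a tangle by spins and weight cups, caps and crossings as in the state model
   of the Kauffman bracket. The state sum at a boundary word +^k w +^k respects all relations (the spins
   at the two ends of an uncrossed arc are opposite, so a projector arc contributes 0) and vanishes on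
   the image of phi. Every tangle reduces to diagrams consisting of cups only. Those that are not zero
   in S have linearly independent state sums: the word with + exactly at the left ends of the arcs
   between points outside the projectors is a leading word. So a combination of tangles is zero in S if
   and only if all its state sums vanish.

   On the Russell side, each arc acts on a state polynomial of its interior, in a variable that counts
   spin flips still to be made by arcs further out. Relations of Type I and II follow from two local
   identities between these operators and from the rule for moving the variable outwards through the
   surrounding arcs. The constant coefficient is, up to a unit depending on k only, the state sum of the
   image of the diagram under psi. By Type I and II, the diagrams whose dotted arcs are nested in no
   other arc span R, and their state sums are, up to a unit, those of the nonzero cup diagrams. *)

theory Submission
 imports Defs "HOL-Computational_Algebra.Polynomial"
begin

text \<open>The obstacle is that the two sides are organised differently. The tangle of a diagram is
  built from left to right, while Type I and II are local in the nesting of arcs and have correction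
  terms that dot arcs arbitrarily far outside. The polynomial variable reconciles them: it stands
  for an operator that turns a down spin up at the right end of an arc that is still open. Commuting
  it with an undotted arc costs a factor q and leaves (1 - q^(-2)) times the same arc dotted;
  commuting it with a dotted arc costs q^(-1). Hence the sums over the x_i and the exponents i -
  n_i. A scan of the points from left to right, with the flip operator in place of the variable, is
  then compared both with the nested polynomials and with the slices of the tangle. The factor
  q^(-1/2) put in for each nested pair of dots complements the q^(-1/2) that each unnested pair
  produces by its crossing, so the unit depends only on the number k(k-1)/2 of all pairs.
  Well-definedness, injectivity and surjectivity all rest on the fact that state sums detect zero in
  S; injectivity after tensoring also uses that standard diagrams are independent over the larger
  ring.\<close>

lemma qhalf_pow_mult [simp]: "qhalf_pow i * qhalf_pow j = qhalf_pow (i + j)"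
 by (simp add: qhalf_pow_def mult_single)

lemma qhalf_pow_0 [simp]: "qhalf_pow 0 = 1"
 by (simp add: qhalf_pow_def)

lemma qhalf_pow_mult_left [simp]: "qhalf_pow i * (qhalf_pow j * x) = qhalf_pow (i + j) * x"
 by (simp flip: mult.assoc)

lemma qhalf_pow_nonzero [simp]: "qhalf_pow i \<noteq> 0"
 by (simp add: qhalf_pow_def)

abbreviation "keys \<equiv> Poly_Mapping.keys"
abbreviation "lookup \<equiv> Poly_Mapping.lookup"
abbreviation "single \<equiv> Poly_Mapping.single"

section \<open>State sums\<close>

text \<open>As matrices, the cup and cap weights are inverse to each other, which straightens
  strands, and their full contraction is the circle value -q - q^(-1). The powers are distributed
  asymmetrically so that a cup with an up spin on its left has weight 1; this normalises the leading
  coefficients later.\<close>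

definition cup_weight :: "bool => bool => laurent" where
 "cup_weight c d = (if c = d then 0 else if c then 1 else - qhalf_pow (-2))"

definition cap_weight :: "bool => bool => laurent" where
 "cap_weight c d = (if c = d then 0 else if c then - qhalf_pow 2 else 1)"

text \<open>The first word is read above the slice, the second below it. Crossings are defined
  through their two smoothings, so the crossing relations are built in and the burden lies on the
  moves.\<close>

fun piece_weight :: "piece => bool list => bool list => laurent" where
 "piece_weight Cup [a, b] [] = cup_weight a b"
| "piece_weight Cap [] [a, b] = cap_weight a b"
| "piece_weight Pos [a, b] [c, d] =
   (if a = c \<and> b = d then qhalf_pow 1 else 0) + qhalf_pow (-1) * (cup_weight a b * cap_weight c d)"
| "piece_weight Neg [a, b] [c, d] =
   (if a = c \<and> b = d then qhalf_pow (-1) else 0) + qhalf_pow 1 * (cup_weight a b * cap_weight c d)"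
| "piece_weight _ _ _ = 0"

definition words :: "nat => bool list set" where
 "words m = {w. length w = m}"

lemma words_0: "words 0 = {[]}"
 by (auto simp: words_def)

lemma words_2: "words 2 = {[True, True], [True, False], [False, True], [False, False]}"
proof -
 have "w \<in> {[True, True], [True, False], [False, True], [False, False]}" if "length w = 2" for w
  using that by (auto simp: length_Suc_conv numeral_2_eq_2)
 then show ?thesis by (auto simp: words_def)
qed

lemma finite_words [simp]: "finite (words m)"
 using finite_lists_length_eq[of "UNIV :: bool set" m] by (simp add: words_def)

text \<open>The value at a word just above the slice is a sum over words just below it. Functions on
  all words stand in for vectors of a fixed dimension; a word too short for the slice gets the value
  0.\<close>

definition apply_piece :: "piece \<times> nat => (bool list => laurent) => bool list => laurent" where
 "apply_piece = (\<lambda>(s, i) g w.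
   if i + legs_above s \<le> length w
   then \<Sum>b\<in>words (legs_below s).
    piece_weight s (take (legs_above s) (drop i w)) b
     * g (take i w @ b @ drop (i + legs_above s) w)
   else 0)"

definition state_sum :: "tangle => bool list => laurent" where
 "state_sum u = fold apply_piece u (\<lambda>w. if w = [] then 1 else 0)"

lemma state_sum_Nil: "state_sum [] w = (if w = [] then 1 else 0)"
 by (simp add: state_sum_def)

lemma state_sum_append: "state_sum (u @ v) = fold apply_piece v (state_sum u)"
 by (simp add: state_sum_def)

lemma apply_piece_append:
 assumes "length x = i" "length a = legs_above s"
 shows "apply_piece (s, i) g (x @ a @ y) =
  (\<Sum>b\<in>words (legs_below s). piece_weight s a b * g (x @ b @ y))"
 using assms by (simp add: apply_piece_def)

lemma top_width_append:
 "top_width w (u @ v) = (case top_width w u of None => None | Some w' => top_width w' v)"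
 by (induction w u rule: top_width.induct) auto

text \<open>Records the width that the type of functions on words forgets. With it, two operators
  agree as soon as they agree on words of one length.\<close>

definition supported_on :: "nat => (bool list => laurent) => bool" where
 "supported_on m g \<longleftrightarrow> (\<forall>w. g w \<noteq> 0 \<longrightarrow> length w = m)"

lemma apply_piece_supported:
 assumes "supported_on m g" "i + legs_below s \<le> m"
 shows "supported_on (m - legs_below s + legs_above s) (apply_piece (s, i) g)"
 unfolding supported_on_def
proof (intro allI impI)
 fix w assume nz: "apply_piece (s, i) g w \<noteq> 0"
 then have len: "i + legs_above s \<le> length w"
  by (auto simp: apply_piece_def split: if_splits)
 have "\<exists>b\<in>words (legs_below s). g (take i w @ b @ drop (i + legs_above s) w) \<noteq> 0"
 proof (rule ccontr)
  assume "\<not> ?thesis"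
  then have "apply_piece (s, i) g w = 0" by (simp add: apply_piece_def)
  with nz show False by simp
 qed
 then obtain b where b: "length b = legs_below s" "g (take i w @ b @ drop (i + legs_above s) w) \<noteq> 0"
  by (auto simp: words_def)
 with assms(1) have "length (take i w @ b @ drop (i + legs_above s) w) = m"
  unfolding supported_on_def by blast
 with b len assms(2) show "length w = m - legs_below s + legs_above s"
  by (simp add: min_def split: if_splits)
qed

lemma fold_apply_piece_supported:
 assumes "supported_on m g" "top_width m u = Some m'"
 shows "supported_on m' (fold apply_piece u g)"
 using assms
proof (induction m u arbitrary: g rule: top_width.induct)
 case (2 w s i u)
 then show ?case
  using apply_piece_supported by (auto split: if_splits)
qed auto

lemma state_sum_supported: "u \<in> tangles m ==> supported_on m (state_sum u)"
 unfolding state_sum_def tangles_def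
 by (rule fold_apply_piece_supported[of 0]) (auto simp: supported_on_def)

lemma supported_eqI:
 assumes "supported_on m g" "supported_on m h" "\<And>w. length w = m ==> g w = h w"
 shows "g = h"
 using assms unfolding supported_on_def by (metis ext)

lemma split_word:
 fixes w :: "bool list"
 assumes "i + n \<le> length w"
 obtains x a y where "w = x @ a @ y" "length x = i" "length a = n"
 using assms
 by (intro that[of "take i w" "take n (drop i w)" "drop (i + n) w"])
  (simp_all, metis append_take_drop_id drop_drop add.commute)

lemma apply_Cup:
 "length x = i ==> apply_piece (Cup, i) g (x @ a # b # y) = cup_weight a b * g (x @ y)"
 using apply_piece_append[of x i "[a, b]" Cup g y] by (simp add: words_0)

lemma apply_Cap:
 "length x = i ==> apply_piece (Cap, i) g (x @ y) =
   g (x @ False # True # y) - qhalf_pow 2 * g (x @ True # False # y)"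
 using apply_piece_append[of x i "[]" Cap g y] by (simp add: words_2 cap_weight_def)

lemma apply_Pos:
 "length x = i ==> apply_piece (Pos, i) g (x @ a # b # y) =
   qhalf_pow 1 * g (x @ a # b # y) + qhalf_pow (-1) * cup_weight a b *
    (g (x @ False # True # y) - qhalf_pow 2 * g (x @ True # False # y))"
 using apply_piece_append[of x i "[a, b]" Pos g y]
 by (cases a; cases b) (simp_all add: words_2 cap_weight_def algebra_simps)

lemma apply_Neg:
 "length x = i ==> apply_piece (Neg, i) g (x @ a # b # y) =
   qhalf_pow (-1) * g (x @ a # b # y) + qhalf_pow 1 * cup_weight a b *
    (g (x @ False # True # y) - qhalf_pow 2 * g (x @ True # False # y))"
 using apply_piece_append[of x i "[a, b]" Neg g y]
 by (cases a; cases b) (simp_all add: words_2 cap_weight_def algebra_simps)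

text \<open>Both sides of a move touch only \<open>n\<close> neighbouring strands from position
  \<open>i\<close> on, so it suffices to compare them at words cut as \<open>x @ a @ y\<close>; the
  support condition takes care of all other lengths.\<close>

lemma local_ruleI:
 assumes g: "supported_on w g"
  and w: "top_width w l = Some w'" "top_width w r = Some w'"
  and n: "\<And>v::bool list. length v = w' ==> i + n \<le> length v"
  and eq: "\<And>x a y. \<lbrakk>length x = i; length a = n; length (x @ a @ y) = w'\<rbrakk>
    \<Longrightarrow> fold apply_piece l g (x @ a @ y) = fold apply_piece r g (x @ a @ y)"
 shows "fold apply_piece l g = fold apply_piece r g"
proof (rule supported_eqI[OF fold_apply_piece_supported[OF g w(1)] fold_apply_piece_supported[OF g w(2)]])
 fix v :: "bool list" assume v: "length v = w'"
 show "fold apply_piece l g v = fold apply_piece r g v"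
  using split_word[OF n[OF v]] eq v by metis
qed

lemma length_1: "length a = Suc 0 \<longleftrightarrow> (\<exists>c. a = [c])"
 by (auto simp: length_Suc_conv)

lemma length_2: "length a = 2 \<longleftrightarrow> (\<exists>c d. a = [c, d])"
 by (auto simp: length_Suc_conv numeral_2_eq_2)

lemma length_3: "length a = 3 \<longleftrightarrow> (\<exists>c d e. a = [c, d, e])"
 by (auto simp: length_Suc_conv numeral_3_eq_3)

lemma apply_Cup': "length x = i ==> apply_piece (Cup, Suc i) g (x @ c # a # b # y) =
   cup_weight a b * g (x @ c # y)"
 using apply_Cup[of "x @ [c]" "Suc i"] by simp

lemma apply_Cap': "length x = i ==> apply_piece (Cap, Suc i) g (x @ c # y) =
   g (x @ c # False # True # y) - qhalf_pow 2 * g (x @ c # True # False # y)"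
 using apply_Cap[of "x @ [c]" "Suc i"] by simp

lemma apply_Pos':
 "length x = i ==> apply_piece (Pos, Suc i) g (x @ c # a # b # y) =
   qhalf_pow 1 * g (x @ c # a # b # y) + qhalf_pow (-1) * cup_weight a b *
    (g (x @ c # False # True # y) - qhalf_pow 2 * g (x @ c # True # False # y))"
 using apply_Pos[of "x @ [c]" "Suc i"] by simp

lemma apply_Neg':
 "length x = i ==> apply_piece (Neg, Suc i) g (x @ c # a # b # y) =
   qhalf_pow (-1) * g (x @ c # a # b # y) + qhalf_pow 1 * cup_weight a b *
    (g (x @ c # False # True # y) - qhalf_pow 2 * g (x @ c # True # False # y))"
 using apply_Neg[of "x @ [c]" "Suc i"] by simp

lemmas apply_rules = apply_Cup apply_Cap apply_Pos apply_Neg apply_Cup' apply_Cap' apply_Pos' apply_Neg'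

text \<open>The two slices sum over disjoint stretches of the word, so the sums may be interchanged.
  The position of \<open>t\<close> shifts by the number of strands that \<open>s\<close> adds or
  removes.\<close>

lemma exchange_pieces:
 assumes "length x = i" "length a = legs_above s" "length m = j" "length b = legs_above t"
 shows "apply_piece (t, i + legs_above s + j) (apply_piece (s, i) g) (x @ a @ m @ b @ y) =
  apply_piece (s, i) (apply_piece (t, i + legs_below s + j) g) (x @ a @ m @ b @ y)"
proof -
 have 1: "apply_piece (t, i + legs_above s + j) (apply_piece (s, i) g) (x @ a @ m @ b @ y) =
  (\<Sum>d\<in>words (legs_below t). piece_weight t b d *
   (\<Sum>c\<in>words (legs_below s). piece_weight s a c * g (x @ c @ m @ d @ y)))"
  using assms apply_piece_append[of "x @ a @ m" "i + legs_above s + j" b t "apply_piece (s, i) g" y]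
  by (simp add: apply_piece_append)
 have 2: "apply_piece (t, i + legs_below s + j) g (x @ c @ m @ b @ y) =
   (\<Sum>d\<in>words (legs_below t). piece_weight t b d * g (x @ c @ m @ d @ y))"
  if "c \<in> words (legs_below s)" for c
  using assms that apply_piece_append[of "x @ c @ m" "i + legs_below s + j" b t g y]
  by (simp add: words_def)
 show ?thesis
  unfolding 1 using assms
  by (simp add: apply_piece_append 2 sum_distrib_left sum.swap[of _ "words (legs_below s)"] mult.left_commute)
qed

text \<open>After localisation, every move except the exchange is a finite check over the spins of
  at most three strands.\<close>

lemma regular_move_state:
 assumes "regular_move l r" "supported_on w g"
  "top_width w l = Some w'" "top_width w r = Some w'"
 shows "fold apply_piece l g = fold apply_piece r g"
 using assms
proof (induction rule: regular_move.induct)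
 case (exchange s i t j)
 have len: "i + (legs_above s + j + legs_above t) \<le> w'" and w': "w' = w - legs_below s + legs_above s - legs_below t + legs_above t"
  using exchange by (auto split: if_splits)
 show ?case
 proof (rule local_ruleI[OF exchange(1-3), of i "legs_above s + j + legs_above t"])
  fix x c y :: "bool list"
  assume c: "length x = i" "length c = legs_above s + j + legs_above t"
  let ?a = "take (legs_above s) c" and ?m = "take j (drop (legs_above s) c)"
   and ?b = "drop (legs_above s + j) c"
  have "c = ?a @ ?m @ ?b"
   by (metis append_take_drop_id drop_drop add.commute)
  then have *: "x @ c @ y = x @ ?a @ ?m @ ?b @ y" by (metis append.assoc)
  show "fold apply_piece [(s, i), (t, i + legs_above s + j)] g (x @ c @ y) =
   fold apply_piece [(t, i + legs_below s + j), (s, i)] g (x @ c @ y)"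
   unfolding * using c by (simp add: exchange_pieces)
 qed (use len in auto)
next
 case (straighten_right i)
 show ?case
  by (rule local_ruleI[OF straighten_right, of i 1])
   (use straighten_right in \<open>auto simp: length_1 apply_rules cup_weight_def split: if_splits\<close>)
next
 case (straighten_left i)
 show ?case
  by (rule local_ruleI[OF straighten_left, of i 1])
   (use straighten_left in \<open>auto simp: length_1 apply_rules cup_weight_def split: if_splits\<close>)
next
 case (slide_Cup_over i)
 show ?case
  by (rule local_ruleI[OF slide_Cup_over, of i 3])
   (use slide_Cup_over in \<open>auto simp: length_3 apply_rules cup_weight_def algebra_simps split: if_splits\<close>)
next
 case (slide_Cup_under i)
 show ?case
  by (rule local_ruleI[OF slide_Cup_under, of i 3])
   (use slide_Cup_under in \<open>auto simp: length_3 apply_rules cup_weight_def algebra_simps split: if_splits\<close>)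
next
 case (slide_Cap_under i)
 show ?case
  by (rule local_ruleI[OF slide_Cap_under, of i 1])
   (use slide_Cap_under in \<open>auto simp: length_1 apply_rules cup_weight_def algebra_simps split: if_splits\<close>)
next
 case (slide_Cap_over i)
 show ?case
  by (rule local_ruleI[OF slide_Cap_over, of i 1])
   (use slide_Cap_over in \<open>auto simp: length_1 apply_rules cup_weight_def algebra_simps split: if_splits\<close>)
next
 case (R2_Pos_Neg i)
 show ?case
  by (rule local_ruleI[OF R2_Pos_Neg, of i 2])
   (use R2_Pos_Neg in \<open>auto simp: length_2 apply_rules cup_weight_def algebra_simps split: if_splits\<close>)
next
 case (R2_Neg_Pos i)
 show ?case
  by (rule local_ruleI[OF R2_Neg_Pos, of i 2])
   (use R2_Neg_Pos in \<open>auto simp: length_2 apply_rules cup_weight_def algebra_simps split: if_splits\<close>)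
next
 case (R3 i)
 show ?case
  by (rule local_ruleI[OF R3, of i 3])
   (use R3 in \<open>auto simp: length_3 apply_rules cup_weight_def algebra_simps split: if_splits\<close>)
qed

section \<open>Spins along an uncrossed arc\<close>

definition compatible :: "piece \<times> nat => bool list => bool list => bool" where
 "compatible = (\<lambda>(s, i) v w. \<exists>x a b y. v = x @ b @ y \<and> w = x @ a @ y \<and> length x = i
   \<and> length a = legs_above s \<and> length b = legs_below s \<and> piece_weight s a b \<noteq> 0)"

text \<open>A nonzero sum has a nonzero term. Choosing one at each slice, from the top down, gives a
  colouring \<open>\<sigma>\<close> of all levels in which every slice has nonzero weight; arcs can
  then be followed in this one colouring.\<close>

lemma state_sum_nonzero:
 assumes "state_sum u w \<noteq> 0"
 shows "\<exists>\<sigma>. \<sigma> (length u) = w \<and> \<sigma> 0 = [] \<and> (\<forall>l<length u. compatible (u ! l) (\<sigma> l) (\<sigma> (Suc l)))"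
 using assms
proof (induction u arbitrary: w rule: rev_induct)
 case Nil
 then show ?case by (auto simp: state_sum_Nil split: if_splits)
next
 case (snoc p u)
 obtain s i where p: "p = (s, i)" by fastforce
 have nz: "apply_piece (s, i) (state_sum u) w \<noteq> 0"
  using snoc.prems by (simp add: state_sum_append p)
 then have "i + legs_above s \<le> length w" by (auto simp: apply_piece_def split: if_splits)
 then obtain x a y where w: "w = x @ a @ y" "length x = i" "length a = legs_above s"
  by (rule split_word)
 have "\<exists>b\<in>words (legs_below s). piece_weight s a b * state_sum u (x @ b @ y) \<noteq> 0"
  using nz unfolding w(1) apply_piece_append[OF w(2,3)] by (metis (no_types, lifting) sum.neutral)
 then obtain b where b: "length b = legs_below s" "piece_weight s a b \<noteq> 0" "state_sum u (x @ b @ y) \<noteq> 0"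
  by (auto simp: words_def)
 obtain \<sigma> where \<sigma>: "\<sigma> (length u) = x @ b @ y" "\<sigma> 0 = []"
  "\<forall>l<length u. compatible (u ! l) (\<sigma> l) (\<sigma> (Suc l))"
  using snoc.IH[OF b(3)] by blast
 have "compatible p (x @ b @ y) w"
  using w b by (auto simp: compatible_def p)
 then show ?case
  using \<sigma> by (intro exI[of _ "\<sigma>(Suc (length u) := w)"]) (auto simp: nth_append less_Suc_eq)
qed

inductive through :: "tangle => nat => nat => nat => bool" for u l where
 left: "\<lbrakk>l < length u; u ! l = (s, i); x < i\<rbrakk> \<Longrightarrow> through u l x x"
| right: "\<lbrakk>l < length u; u ! l = (s, i)\<rbrakk> \<Longrightarrow> through u l (i + legs_below s + x) (i + legs_above s + x)"
| rising: "\<lbrakk>l < length u; u ! l = (s, i); s = Pos \<or> s = Neg\<rbrakk> \<Longrightarrow> through u l i (i + 1)"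
| falling: "\<lbrakk>l < length u; u ! l = (s, i); s = Pos \<or> s = Neg\<rbrakk> \<Longrightarrow> through u l (i + 1) i"

text \<open>The second component of a directed point tells whether the strand is followed upwards.\<close>

inductive passes :: "tangle => (nat \<times> nat) \<times> bool => (nat \<times> nat) \<times> bool => bool" for u where
 up: "through u l x y ==> passes u ((l, x), True) ((Suc l, y), True)"
| down: "through u l x y ==> passes u ((Suc l, y), False) ((l, x), False)"
| cup_right: "\<lbrakk>l < length u; u ! l = (Cup, i)\<rbrakk> \<Longrightarrow> passes u ((Suc l, i), False) ((Suc l, Suc i), True)"
| cup_left: "\<lbrakk>l < length u; u ! l = (Cup, i)\<rbrakk> \<Longrightarrow> passes u ((Suc l, Suc i), False) ((Suc l, i), True)"
| cap_right: "\<lbrakk>l < length u; u ! l = (Cap, i)\<rbrakk> \<Longrightarrow> passes u ((l, i), True) ((l, Suc i), False)"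
| cap_left: "\<lbrakk>l < length u; u ! l = (Cap, i)\<rbrakk> \<Longrightarrow> passes u ((l, Suc i), True) ((l, i), False)"

lemma passes_reverse: "passes u (p, d) (p', d') ==> passes u (p', \<not> d') (p, \<not> d)"
 by (cases rule: passes.cases, assumption) (auto intro: passes.intros)

lemma through_deterministic: "through u l x y ==> through u l x y' ==> y = y'"
 by (auto elim!: through.cases)

lemma through_injective: "through u l x y ==> through u l x' y ==> x = x'"
 by (auto elim!: through.cases)

lemma through_not_Cup: "through u l x y ==> u ! l = (Cup, i) ==> y \<noteq> i \<and> y \<noteq> Suc i"
 by (erule through.cases) simp_all

lemma through_not_Cap: "through u l x y ==> u ! l = (Cap, i) ==> x \<noteq> i \<and> x \<noteq> Suc i"
 by (erule through.cases) simp_all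

text \<open>A point has at most one continuation above and one below, so a directed walk never has a
  choice.\<close>

lemma passes_deterministic:
 assumes "passes u a b" "passes u a b'"
 shows "b = b'"
 using assms
 by (elim passes.cases)
  (auto dest: through_deterministic through_injective through_not_Cup through_not_Cap)

lemma joined_passes: "joined_in_slice u p p' ==> \<exists>d d'. passes u (p, d) (p', d')"
proof (induction rule: joined_in_slice.induct)
 case (left l s i x)
 then show ?case using passes.up[OF through.left[OF left]] by auto
next
 case (right l s i x)
 then show ?case using passes.up[OF through.right[OF right]] by auto
next
 case (Cup l i)
 then show ?case using passes.cup_right by fastforce
next
 case (Cap l i)
 then show ?case using passes.cap_right by fastforce
next
 case (rising l s i)
 then show ?case using passes.up[OF through.rising[OF rising]] by auto
next
 case (falling l s i)
 then show ?case using passes.up[OF through.falling[OF falling]] by auto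
qed

lemma no_passes_top: "\<not> passes u ((length u, x), True) b"
 by (auto elim!: passes.cases elim: through.cases)

lemma through_joined: "through u l x y ==> joined_in_slice u (l, x) (Suc l, y)"
 by (erule through.cases) (auto intro: joined_in_slice.intros[folded Suc_eq_plus1])

lemma passes_joined: "passes u (p, d) (p', d') ==> joined_in_slice u p p' \<or> joined_in_slice u p' p"
 by (erule passes.cases)
  (auto dest: through_joined intro: joined_in_slice.intros[folded Suc_eq_plus1])

text \<open>A joint at the current point either continues the walk or reverses the step just taken;
  determinism excludes anything else. At the starting endpoint there is nothing above to turn
  to.\<close>

lemma walk_covers_component:
 assumes "same_component u (length u, x) p"
 shows "\<exists>d. (passes u)\<^sup>*\<^sup>* ((length u, x), False) (p, d)"
 using assms unfolding same_component_def
proof (induction rule: equivclp_induct)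
 case base
 then show ?case by blast
next
 case (step p p')
 then obtain d where walk: "(passes u)\<^sup>*\<^sup>* ((length u, x), False) (p, d)" by blast
 obtain e e' where pass: "passes u (p, e) (p', e')"
  using step(2) joined_passes passes_reverse by blast
 show ?case
 proof (cases "e = d")
  case True
  then show ?thesis using walk pass by (meson rtranclp.rtrancl_into_rtrancl)
 next
  case False
  then have e: "e = (\<not> d)" by blast
  from walk show ?thesis
  proof (cases rule: rtranclp.cases)
   case rtrancl_refl
   then show ?thesis using pass e no_passes_top by auto
  next
   case (rtrancl_into_rtrancl b)
   then obtain p0 d0 where "(passes u)\<^sup>*\<^sup>* ((length u, x), False) (p0, d0)" "passes u (p0, d0) (p, d)"
    by (cases b) auto
   then show ?thesis
    using passes_reverse[of u p0 d0 p d] pass e passes_deterministic by blast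
  qed
 qed
qed

text \<open>Passing through a slice keeps both spin and direction, while a cup or cap reverses both,
  so the spin relative to the direction of travel is constant. Crossings must be excluded: some
  colourings of nonzero weight change the spin of a strand at a crossing.\<close>

lemma walk_spin:
 assumes walk: "(passes u)\<^sup>*\<^sup>* ((length u, x), False) (p, d)"
  and \<sigma>: "\<And>l. l < length u ==> compatible (u ! l) (\<sigma> l) (\<sigma> (Suc l))"
  and x: "x < length (\<sigma> (length u))" and unc: "uncrossed u (length u, x)"
 shows "same_component u (length u, x) p \<and> snd p < length (\<sigma> (fst p)) \<and>
  (\<sigma> (fst p) ! snd p \<longleftrightarrow> \<sigma> (length u) ! x \<noteq> d)"
 using walk
proof (induction rule: rtranclp_induct2)
 case refl
 then show ?case using x by (simp add: same_component_def)
next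
 case (step p d p' d')
 have comp: "same_component u (length u, x) p'"
  using step passes_joined[OF step(2)] unfolding same_component_def
  by (metis equivclp_into_equivclp)
 have nc: "s \<noteq> Pos \<and> s \<noteq> Neg"
  if "l < length u" "u ! l = (s, i)" "p = (l, i) \<or> p = (l, Suc i) \<or> p' = (l, i) \<or> p' = (l, Suc i)" for l s i
  using that unc comp step.IH unfolding uncrossed_def by auto
 have thr: "y < length (\<sigma> l) \<longleftrightarrow> z < length (\<sigma> (Suc l))" "y < length (\<sigma> l) ==> \<sigma> l ! y = \<sigma> (Suc l) ! z"
  if "through u l y z" "p = (l, y) \<or> p' = (l, y)" for l y z
 proof -
  have "\<exists>s i. l < length u \<and> u ! l = (s, i)
   \<and> (y < i \<and> z = y \<or> (\<exists>x. y = i + legs_below s + x \<and> z = i + legs_above s + x))"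
   using that(1)
  proof (cases rule: through.cases)
   case (rising s)
   then show ?thesis using nc[of l s] that(2) by auto
  next
   case (falling s)
   then show ?thesis using nc[of l s] that(2) by auto
  qed blast+
  then obtain s i where si: "l < length u" "u ! l = (s, i)"
   "y < i \<and> z = y \<or> (\<exists>x. y = i + legs_below s + x \<and> z = i + legs_above s + x)"
   by blast
  obtain x a b v where "\<sigma> l = x @ b @ v" "\<sigma> (Suc l) = x @ a @ v" "length x = i"
   "length a = legs_above s" "length b = legs_below s"
   using \<sigma>[OF si(1)] si(2) by (auto simp: compatible_def)
  then show "y < length (\<sigma> l) \<longleftrightarrow> z < length (\<sigma> (Suc l))" "y < length (\<sigma> l) ==> \<sigma> l ! y = \<sigma> (Suc l) ! z"
   using si(3) by (auto simp: nth_append)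
 qed
 have cup: "Suc i < length (\<sigma> (Suc l)) \<and> \<sigma> (Suc l) ! i \<noteq> \<sigma> (Suc l) ! Suc i"
  if "l < length u" "u ! l = (Cup, i)" for l i
  using \<sigma>[OF that(1)] that(2)
  by (auto simp: compatible_def length_2 nth_append cup_weight_def split: if_splits)
 have cap: "Suc i < length (\<sigma> l) \<and> \<sigma> l ! i \<noteq> \<sigma> l ! Suc i"
  if "l < length u" "u ! l = (Cap, i)" for l i
  using \<sigma>[OF that(1)] that(2)
  by (auto simp: compatible_def length_2 nth_append cap_weight_def split: if_splits)
 from step(2) show ?case
 proof (cases rule: passes.cases)
  case (up l x y)
  then show ?thesis using step.IH comp thr by auto
 next
  case (down l x y)
  then show ?thesis using step.IH comp thr by auto
 next
  case (cup_right l i)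
  then show ?thesis using step.IH comp cup by force
 next
  case (cup_left l i)
  then show ?thesis using step.IH comp cup by force
 next
  case (cap_right l i)
  then show ?thesis using step.IH comp cap by force
 next
  case (cap_left l i)
  then show ?thesis using step.IH comp cap by force
 qed
qed

lemma uncrossed_arc_spins:
 assumes "same_component u (length u, x) (length u, y)" "x \<noteq> y" "uncrossed u (length u, x)"
  and "state_sum u w \<noteq> 0" "x < length w"
 shows "w ! x \<noteq> w ! y"
proof -
 obtain \<sigma> where \<sigma>: "\<sigma> (length u) = w" "\<And>l. l < length u ==> compatible (u ! l) (\<sigma> l) (\<sigma> (Suc l))"
  using state_sum_nonzero[OF assms(4)] by auto
 obtain d where d: "(passes u)\<^sup>*\<^sup>* ((length u, x), False) ((length u, y), d)"
  using walk_covers_component[OF assms(1)] by blast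
 \<comment> \<open>A top endpoint other than the start is reached upwards: a step arriving there
   downwards would reverse to one that leaves the top level upwards.\<close>
 have d
 proof (rule ccontr)
  assume "\<not> d"
  from d show False
  proof (cases rule: rtranclp.cases)
   case rtrancl_refl
   then show ?thesis using assms(2) by simp
  next
   case (rtrancl_into_rtrancl b)
   then show ?thesis
    using passes_reverse[of u "fst b" "snd b" "(length u, y)" d] no_passes_top \<open>\<not> d\<close> by auto
  qed
 qed
 then show ?thesis
  using walk_spin[OF d \<sigma>(2) _ assms(3)] \<sigma>(1) assms(5) by auto
qed

section \<open>Linear maps on free modules\<close>

lemma lookup_scale [simp]: "lookup (scale c f) x = c * lookup f x"
 by (simp add: scale_def Poly_Mapping.map.rep_eq when_def)

lemma scale_0 [simp]: "scale c 0 = 0" "scale 0 f = 0"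
 by (rule poly_mapping_eqI, simp)+

lemma scale_1 [simp]: "scale 1 f = f"
 by (rule poly_mapping_eqI) simp

lemma scale_add_right: "scale c (f + g) = scale c f + scale c g"
 by (rule poly_mapping_eqI) (simp add: lookup_add algebra_simps)

lemma scale_add_left: "scale (c + d) f = scale c f + scale d f"
 by (rule poly_mapping_eqI) (simp add: lookup_add algebra_simps)

lemma scale_scale: "scale c (scale d f) = scale (c * d) f"
 by (rule poly_mapping_eqI) (simp add: algebra_simps)

lemma scale_diff_right: "scale c (f - g) = scale c f - scale c g"
 by (rule poly_mapping_eqI) (simp add: lookup_minus algebra_simps)

lemma scale_single [simp]: "scale c (single x d) = single x (c * d)"
 by (rule poly_mapping_eqI) (simp add: lookup_single when_def)

lemma scale_sum: "scale c (sum f A) = (\<Sum>x\<in>A. scale c (f x))"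
 by (induction A rule: infinite_finite_induct) (simp_all add: scale_add_right)

lemma scale_minus_left: "scale (- c) f = - scale c f"
 by (rule poly_mapping_eqI) simp

lemma keys_scale: "keys (scale c f) \<subseteq> keys f"
 by (auto simp: in_keys_iff)

lemma linear_extension_superset:
 assumes "finite A" "keys f \<subseteq> A"
 shows "linear_extension g f = (\<Sum>x\<in>A. scale (lookup f x) (g x))"
 unfolding linear_extension_def using assms
 by (intro sum.mono_neutral_left) (auto simp: in_keys_iff)

lemma linear_extension_0 [simp]: "linear_extension g 0 = 0"
 by (simp add: linear_extension_def)

lemma linear_extension_add: "linear_extension g (f + f') = linear_extension g f + linear_extension g f'"
proof -
 let ?A = "keys f \<union> keys f'"
 have "linear_extension g f'' = (\<Sum>x\<in>?A. scale (lookup f'' x) (g x))"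
  if "f'' \<in> {f, f', f + f'}" for f''
  using that keys_add[of f f'] by (intro linear_extension_superset) auto
 then show ?thesis by (simp add: lookup_add scale_add_left sum.distrib)
qed

lemma linear_extension_scale: "linear_extension g (scale c f) = scale c (linear_extension g f)"
 using linear_extension_superset[OF _ keys_scale, of f g c]
 by (simp add: linear_extension_def scale_sum scale_scale)

lemma linear_extension_single [simp]: "linear_extension g (single x c) = scale c (g x)"
 by (cases "c = 0") (simp_all add: linear_extension_def)

lemma linear_extension_minus: "linear_extension g (- f) = - linear_extension g f"
 using linear_extension_add[of g f "- f"] by (simp add: eq_neg_iff_add_eq_0 add.commute)

lemma linear_extension_diff: "linear_extension g (f - f') = linear_extension g f - linear_extension g f'"
 using linear_extension_add[of g f "- f'"] by (simp add: linear_extension_minus)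

lemma linear_extension_sum: "linear_extension g (sum f A) = (\<Sum>x\<in>A. linear_extension g (f x))"
 by (induction A rule: infinite_finite_induct) (simp_all add: linear_extension_add)

text \<open>The linear functional with the values \<open>\<phi>\<close> on the basis. State sums of
  tangles and states of diagrams are both evaluated through it.\<close>

definition pairing :: "('x => 'r) => ('x \<Rightarrow>\<^sub>0 'r::comm_ring_1) => 'r" where
 "pairing \<phi> f = (\<Sum>x\<in>keys f. lookup f x * \<phi> x)"

lemma pairing_superset:
 assumes "finite A" "keys f \<subseteq> A"
 shows "pairing \<phi> f = (\<Sum>x\<in>A. lookup f x * \<phi> x)"
 unfolding pairing_def using assms
 by (intro sum.mono_neutral_left) (auto simp: in_keys_iff)

lemma pairing_0 [simp]: "pairing \<phi> 0 = 0"
 by (simp add: pairing_def)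

lemma pairing_add: "pairing \<phi> (f + f') = pairing \<phi> f + pairing \<phi> f'"
proof -
 let ?A = "keys f \<union> keys f'"
 have "pairing \<phi> f'' = (\<Sum>x\<in>?A. lookup f'' x * \<phi> x)"
  if "f'' \<in> {f, f', f + f'}" for f''
  using that keys_add[of f f'] by (intro pairing_superset) auto
 then show ?thesis by (simp add: lookup_add distrib_right sum.distrib)
qed

lemma pairing_scale: "pairing \<phi> (scale c f) = c * pairing \<phi> f"
 using pairing_superset[OF _ keys_scale, of f \<phi> c]
 by (simp add: pairing_def sum_distrib_left mult.assoc)

lemma pairing_single [simp]: "pairing \<phi> (single x c) = c * \<phi> x"
 by (cases "c = 0") (simp_all add: pairing_def)

lemma pairing_minus: "pairing \<phi> (- f) = - pairing \<phi> f"
 using pairing_add[of \<phi> f "- f"] by (simp add: eq_neg_iff_add_eq_0 add.commute)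

lemma pairing_diff: "pairing \<phi> (f - f') = pairing \<phi> f - pairing \<phi> f'"
 using pairing_add[of \<phi> f "- f'"] by (simp add: pairing_minus)

lemma pairing_sum: "pairing \<phi> (sum f A) = (\<Sum>x\<in>A. pairing \<phi> (f x))"
 by (induction A rule: infinite_finite_induct) (simp_all add: pairing_add)

lemma pairing_linear_extension:
 "pairing \<phi> (linear_extension g f) = pairing (\<lambda>x. pairing \<phi> (g x)) f"
 by (simp add: linear_extension_def pairing_sum pairing_scale) (simp add: pairing_def)

lemma poly_mapping_expand: "f = (\<Sum>x\<in>keys f. single x (lookup f x))"
 by (rule poly_mapping_eqI) (auto simp: lookup_sum lookup_single when_def in_keys_iff)

section \<open>Quotients\<close>

text \<open>Only additive structure is assumed, because the pairs from which a tensor product is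
  formed do not make up a module: scalars act inside the second entry of each pair, so the action is
  not additive in the scalar.\<close>

locale additive_quotient = abelian_group M for M :: "('r, 'm) module" (structure) +
 fixes N assumes subgroup: "subgroup N (add_monoid M)"
begin

sublocale sub: abelian_subgroup N M
 by (rule abelian_subgroupI3[OF additive_subgroupI[OF subgroup] abelian_group_axioms])

lemma subset: "N \<subseteq> carrier M"
 using subgroup.subset[OF subgroup] by simp

abbreviation "Q \<equiv> quot_module M N"

lemma carrier_quot: "carrier Q = (\<lambda>x. N +> x) ` carrier M"
 by (auto simp: quot_module_def A_RCOSETS_def' )

lemma coset_in_quot [simp]: "x \<in> carrier M ==> N +> x \<in> carrier Q"
 by (simp add: carrier_quot)

lemma add_quot: "\<lbrakk>x \<in> carrier M; y \<in> carrier M\<rbrakk> \<Longrightarrow> (N +> x) \<oplus>\<^bsub>Q\<^esub> (N +> y) = N +> (x \<oplus> y)"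
 by (simp add: quot_module_def sub.a_rcos_sum)

lemma zero_quot: "\<zero>\<^bsub>Q\<^esub> = N +> \<zero>"
 using subset by (simp add: quot_module_def a_coset_add_zero)

lemma coset_eq_iff:
 assumes "x \<in> carrier M" "y \<in> carrier M"
 shows "N +> x = N +> y \<longleftrightarrow> x \<ominus> y \<in> N"
 using assms sub.a_rcos_module[of y x] sub.a_repr_independence'[of x y] sub.a_rcos_self[of x]
 by (auto simp: a_minus_def)

lemma abelian_group_quot: "abelian_group Q"
proof (rule abelian_groupI)
 show "\<exists>y\<in>carrier Q. y \<oplus>\<^bsub>Q\<^esub> x = \<zero>\<^bsub>Q\<^esub>" if x: "x \<in> carrier Q" for x
 proof -
  obtain a where "a \<in> carrier M" "x = N +> a" using x by (auto simp: carrier_quot)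
  then show ?thesis
   by (intro bexI[of _ "N +> (\<ominus> a)"]) (simp_all add: add_quot zero_quot l_neg)
 qed
qed (auto simp: carrier_quot add_quot zero_quot a_ac)

text \<open>The union in the definition of the quotient action collapses to one coset exactly
  because the action preserves the carrier and the congruence; these two facts are taken as
  hypotheses so that the lemma also serves the tensor product.\<close>

lemma smult_quot:
 assumes "x \<in> carrier M"
  and closed: "\<And>y. y \<in> carrier M ==> a \<odot> y \<in> carrier M"
  and cong: "\<And>y n. \<lbrakk>y \<in> carrier M; n \<in> N\<rbrakk> \<Longrightarrow> (a \<odot> (n \<oplus> y)) \<ominus> (a \<odot> y) \<in> N"
 shows "a \<odot>\<^bsub>Q\<^esub> (N +> x) = N +> (a \<odot> x)"
proof -
 have "N +> (a \<odot> y) = N +> (a \<odot> x)" if y: "y \<in> N +> x" for y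
 proof -
  obtain n where n: "n \<in> N" "y = n \<oplus> x" using y by (auto simp: a_r_coset_def')
  then show ?thesis using assms subset by (subst coset_eq_iff) auto
 qed
 then have "(\<Union>y\<in>N +> x. N +> (a \<odot> y)) = (\<Union>y\<in>N +> x. N +> (a \<odot> x))"
  by (intro SUP_cong refl)
 also have "\<dots> = N +> (a \<odot> x)"
  using sub.a_rcos_self[OF assms(1)] by (rule UN_constant_eq) simp
 finally show ?thesis
  by (simp add: quot_module_def)
qed

end

lemma module_quotient:
 assumes "module R M" "submodule N R M"
 shows "additive_quotient M N"
  and "module R (quot_module M N)"
  and "\<And>a x. \<lbrakk>a \<in> carrier R; x \<in> carrier M\<rbrakk> \<Longrightarrow>
      a \<odot>\<^bsub>quot_module M N\<^esub> (N +>\<^bsub>M\<^esub> x) = N +>\<^bsub>M\<^esub> (a \<odot>\<^bsub>M\<^esub> x)"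
proof -
 interpret module R M by fact
 interpret N: submodule N R M by fact
 show quot: "additive_quotient M N"
  by unfold_locales (auto simp: N.subgroup_axioms)
 interpret quot: additive_quotient M N by (rule quot)
 show smult: "a \<odot>\<^bsub>quot_module M N\<^esub> (N +>\<^bsub>M\<^esub> x) = N +>\<^bsub>M\<^esub> (a \<odot>\<^bsub>M\<^esub> x)"
  if "a \<in> carrier R" "x \<in> carrier M" for a x
 proof (rule quot.smult_quot)
  fix y n assume "y \<in> carrier M" "n \<in> N"
  then have "n \<in> carrier M" "a \<odot>\<^bsub>M\<^esub> n \<in> N"
   using quot.subset that N.smult_closed by auto
  with that \<open>y \<in> carrier M\<close> show "a \<odot>\<^bsub>M\<^esub> (n \<oplus>\<^bsub>M\<^esub> y) \<ominus>\<^bsub>M\<^esub> a \<odot>\<^bsub>M\<^esub> y \<in> N"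
   by (simp add: smult_r_distr M.minus_eq M.a_assoc M.r_neg)
 qed (use that in auto)
 show "module R (quot_module M N)"
  by (rule moduleI) (auto simp: quot.carrier_quot quot.add_quot smult quot.abelian_group_quot
    is_cring smult_l_distr smult_r_distr smult_assoc1)
qed

section \<open>Free modules and submodules\<close>

lemma cring_Laurent_qhalf: "cring Laurent_qhalf"
 unfolding Laurent_qhalf_def by (rule cring_from_type_algebra)

lemma Laurent_qhalf_simps [simp]:
 "carrier Laurent_qhalf = UNIV" "x \<otimes>\<^bsub>Laurent_qhalf\<^esub> y = x * y" "x \<oplus>\<^bsub>Laurent_qhalf\<^esub> y = x + y"
 "\<zero>\<^bsub>Laurent_qhalf\<^esub> = 0" "\<one>\<^bsub>Laurent_qhalf\<^esub> = 1"
 by (simp_all add: Laurent_qhalf_def ring_of_type_algebra_def)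

lemma Laurent_q_simps [simp]:
 "x \<otimes>\<^bsub>Laurent_q\<^esub> y = x * y" "x \<oplus>\<^bsub>Laurent_q\<^esub> y = x + y"
 "\<zero>\<^bsub>Laurent_q\<^esub> = 0" "\<one>\<^bsub>Laurent_q\<^esub> = 1"
 by (simp_all add: Laurent_q_def)

lemma Laurent_q_carrier: "x \<in> carrier Laurent_q \<longleftrightarrow> (\<forall>i\<in>keys x. even i)"
 by (simp add: Laurent_q_def)

lemma Laurent_q_closed [simp]:
 "0 \<in> carrier Laurent_q" "1 \<in> carrier Laurent_q" "q_pow i \<in> carrier Laurent_q"
 "x \<in> carrier Laurent_q ==> - x \<in> carrier Laurent_q"
 "x \<in> carrier Laurent_q ==> y \<in> carrier Laurent_q ==> x + y \<in> carrier Laurent_q"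
 "x \<in> carrier Laurent_q ==> y \<in> carrier Laurent_q ==> x * y \<in> carrier Laurent_q"
proof -
 show "x + y \<in> carrier Laurent_q" if "x \<in> carrier Laurent_q" "y \<in> carrier Laurent_q"
  using that keys_add[of x y] by (auto simp: Laurent_q_carrier)
 show "x * y \<in> carrier Laurent_q" if "x \<in> carrier Laurent_q" "y \<in> carrier Laurent_q"
  using that keys_mult[of x y] by (fastforce simp: Laurent_q_carrier)
qed (auto simp: Laurent_q_carrier q_pow_def qhalf_pow_def)

lemma Laurent_q_diff [simp]:
 "x \<in> carrier Laurent_q ==> y \<in> carrier Laurent_q ==> x - y \<in> carrier Laurent_q"
 using Laurent_q_closed(5)[of x "- y"] by simp

lemma cring_Laurent_q: "cring Laurent_q"
proof (rule cringI)
 show "abelian_group Laurent_q"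
  by (rule abelian_groupI) (auto simp: algebra_simps intro: bexI[of _ "- x" for x])
 show "comm_monoid Laurent_q"
  by (rule comm_monoidI) (auto simp: algebra_simps)
qed (simp add: algebra_simps)

lemma free_module_simps [simp]:
 "x \<oplus>\<^bsub>free_module R B\<^esub> y = x + y" "\<zero>\<^bsub>free_module R B\<^esub> = 0" "a \<odot>\<^bsub>free_module R B\<^esub> x = scale a x"
 by (simp_all add: free_module_def)

lemma free_module_carrier:
 "f \<in> carrier (free_module R B) \<longleftrightarrow>
   keys f \<subseteq> B \<and> (\<forall>x. lookup f x \<in> carrier R)"
 by (simp add: free_module_def)

text \<open>Treats the full Laurent ring and its even part alike: both are subsets of one type that
  carry the operations of that type.\<close>

locale coefficient_ring =
 fixes R :: "'r::comm_ring_1 ring"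
 assumes cring: "cring R"
  and R_simps [simp]: "\<And>x y. x \<otimes>\<^bsub>R\<^esub> y = x * y" "\<And>x y. x \<oplus>\<^bsub>R\<^esub> y = x + y" "\<zero>\<^bsub>R\<^esub> = 0" "\<one>\<^bsub>R\<^esub> = 1"
begin

sublocale cring R by (rule cring)

lemma uminus_closed [simp]: "x \<in> carrier R ==> - x \<in> carrier R"
 using a_inv_closed[of x] r_neg[of x] by (metis R_simps(2,3) add_eq_0_iff)

lemma ring_closed [simp]:
 "0 \<in> carrier R" "1 \<in> carrier R"
 "x \<in> carrier R ==> y \<in> carrier R ==> x + y \<in> carrier R"
 "x \<in> carrier R ==> y \<in> carrier R ==> x * y \<in> carrier R"
 using zero_closed one_closed add.m_closed[of x y] m_closed[of x y] by simp_all

lemma free_closed [simp]: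
 "0 \<in> carrier (free_module R B)"
 "f \<in> carrier (free_module R B) ==> g \<in> carrier (free_module R B) ==> f + g \<in> carrier (free_module R B)"
 "f \<in> carrier (free_module R B) ==> - f \<in> carrier (free_module R B)"
 "c \<in> carrier R ==> f \<in> carrier (free_module R B) ==> scale c f \<in> carrier (free_module R B)"
 using keys_add[of f g] keys_scale[of c f]
 by (auto simp: free_module_carrier lookup_add)

lemma free_closed_diff [simp]:
 "f \<in> carrier (free_module R B) ==> g \<in> carrier (free_module R B) ==> f - g \<in> carrier (free_module R B)"
 using free_closed(2)[of f B "- g"] by simp

lemma free_closed_single [simp]:
 "c \<in> carrier R ==> x \<in> B ==> single x c \<in> carrier (free_module R B)"
 by (auto simp: free_module_carrier lookup_single when_def)

lemma free_closed_sum [simp]: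
 "(\<And>x. x \<in> A ==> f x \<in> carrier (free_module R B)) ==> sum f A \<in> carrier (free_module R B)"
 by (induction A rule: infinite_finite_induct) simp_all

lemma module_free: "module R (free_module R B)"
proof (rule moduleI)
 show "abelian_group (free_module R B)"
  by (rule abelian_groupI) (auto simp: algebra_simps intro: bexI[of _ "- x" for x])
qed (auto simp: cring scale_add_left scale_add_right scale_scale)

lemma free_minus: 
 assumes "f \<in> carrier (free_module R B)" "g \<in> carrier (free_module R B)"
 shows "f \<ominus>\<^bsub>free_module R B\<^esub> g = f - g"
proof -
 interpret module R "free_module R B" by (rule module_free)
 have "\<ominus>\<^bsub>free_module R B\<^esub> g + g = 0" using assms M.l_neg[of g] by simp
 then have "\<ominus>\<^bsub>free_module R B\<^esub> g = - g" by (simp add: eq_neg_iff_add_eq_0)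
 then show ?thesis by (simp add: M.minus_eq)
qed

lemma submodule_freeI:
 assumes "N \<subseteq> carrier (free_module R B)" "0 \<in> N"
  and "\<And>f g. f \<in> N ==> g \<in> N ==> f + g \<in> N"
  and "\<And>c f. c \<in> carrier R ==> f \<in> N ==> scale c f \<in> N"
 shows "submodule N R (free_module R B)"
proof -
 interpret module R "free_module R B" by (rule module_free)
 have neg: "\<ominus>\<^bsub>free_module R B\<^esub> f = - f" if "f \<in> carrier (free_module R B)" for f
  using free_minus[of 0 B f] that by (simp add: a_minus_def)
 have "- f \<in> N" if "f \<in> N" for f
  using assms(4)[of "-1" f] that by (simp add: scale_minus_left)
 then show ?thesis
  using assms by (intro submoduleI) (auto simp: neg subset_iff)
qed

lemma submodule_freeD:
 assumes "submodule N R (free_module R B)"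
 shows "N \<subseteq> carrier (free_module R B)" "0 \<in> N"
  and "\<And>f g. f \<in> N ==> g \<in> N ==> f + g \<in> N" "\<And>f g. f \<in> N ==> g \<in> N ==> f - g \<in> N"
  and "\<And>c f. c \<in> carrier R ==> f \<in> N ==> scale c f \<in> N"
  and "\<And>A f. (\<And>x. x \<in> A ==> f x \<in> N) ==> sum f A \<in> N"
proof -
 interpret module R "free_module R B" by (rule module_free)
 note N = submoduleE[OF assms]
 show *: "N \<subseteq> carrier (free_module R B)" "0 \<in> N"
  "\<And>f g. f \<in> N ==> g \<in> N ==> f + g \<in> N"
  "\<And>c f. c \<in> carrier R ==> f \<in> N ==> scale c f \<in> N"
  using N assms by (auto dest: subgroup.one_closed[OF submodule.axioms(1)])
 show "f - g \<in> N" if "f \<in> N" "g \<in> N" for f g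
  using *(3)[OF that(1) *(4)[of "-1" g]] that(2) by (simp add: scale_minus_left)
 show "sum f A \<in> N" if "\<And>x. x \<in> A ==> f x \<in> N" for A f
  using that by (induction A rule: infinite_finite_induct) (auto simp: *)
qed

lemma submodule_span:
 assumes "G \<subseteq> carrier (free_module R B)"
 shows "submodule (module_span R (free_module R B) G) R (free_module R B)"
proof (rule submodule_freeI)
 let ?F = "free_module R B"
 interpret module R ?F by (rule module_free)
 show "module_span R ?F G \<subseteq> carrier ?F"
  unfolding module_span_def using hull_minimal[of G, OF assms, of "\<lambda>N. submodule N R ?F"] carrier_is_submodule by blast
qed (auto simp: module_span_def hull_def dest: submodule_freeD)

lemma span_minimal:
 "G \<subseteq> N ==> submodule N R (free_module R B) ==> module_span R (free_module R B) G \<subseteq> N"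
 unfolding module_span_def by (rule hull_minimal)

lemma span_inc: "G \<subseteq> module_span R (free_module R B) G"
 unfolding module_span_def by (rule hull_subset)

end

interpretation qhalf: coefficient_ring Laurent_qhalf
 by (rule coefficient_ring.intro) (simp_all add: cring_Laurent_qhalf)

interpretation qring: coefficient_ring Laurent_q
 by (rule coefficient_ring.intro) (simp_all add: cring_Laurent_q)

section \<open>The defining relations in the state model\<close>

lemma apply_piece_linear:
 "apply_piece p (\<lambda>w. c * g w + d * h w) = (\<lambda>w. c * apply_piece p g w + d * apply_piece p h w)"
 by (rule ext) (auto simp: apply_piece_def sum.distrib sum_distrib_left algebra_simps split: prod.splits)

lemma fold_apply_piece_linear:
 "fold apply_piece v (\<lambda>w. c * g w + d * h w) = (\<lambda>w. c * fold apply_piece v g w + d * fold apply_piece v h w)"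
 by (induction v arbitrary: g h) (simp_all add: apply_piece_linear)

lemma fold_apply_piece_scale:
 "fold apply_piece v (\<lambda>w. c * g w) = (\<lambda>w. c * fold apply_piece v g w)"
 using fold_apply_piece_linear[of v c g 0 g] by simp

lemma tangles_append:
 "u @ v \<in> tangles m \<longleftrightarrow> (\<exists>w. u \<in> tangles w \<and> top_width w v = Some m)"
 by (auto simp: tangles_def top_width_append split: option.splits)

lemma crossing_state_sum:
 assumes "supported_on m g" "i + 2 \<le> m"
 shows "apply_piece (Neg, i) g = (\<lambda>w. qhalf_pow 1 * apply_piece (Cup, i) (apply_piece (Cap, i) g) w + qhalf_pow (-1) * g w)"
  and "apply_piece (Pos, i) g = (\<lambda>w. qhalf_pow 1 * g w + qhalf_pow (-1) * apply_piece (Cup, i) (apply_piece (Cap, i) g) w)"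
proof -
 have cap: "supported_on (m - 2) (apply_piece (Cap, i) g)"
  using apply_piece_supported[OF assms(1), of i Cap] assms(2) by simp
 have cupcap: "supported_on m (apply_piece (Cup, i) (apply_piece (Cap, i) g))"
  using apply_piece_supported[OF cap, of i Cup] assms(2) by (auto simp: le_diff_conv2 Suc_diff_Suc numeral_2_eq_2)
 have cross: "supported_on m (apply_piece (Neg, i) g)" "supported_on m (apply_piece (Pos, i) g)"
  using apply_piece_supported[OF assms(1), of i Neg] apply_piece_supported[OF assms(1), of i Pos] assms(2)
  by (auto simp: Suc_diff_Suc numeral_2_eq_2)
 have lin: "supported_on m (\<lambda>w. c * f w + d * h w)" if "supported_on m f" "supported_on m h" for c d f h
  using that by (auto simp: supported_on_def) (metis add.right_neutral mult_zero_right)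
 show "apply_piece (Neg, i) g = (\<lambda>w. qhalf_pow 1 * apply_piece (Cup, i) (apply_piece (Cap, i) g) w + qhalf_pow (-1) * g w)"
 proof (rule supported_eqI[OF cross(1) lin[OF cupcap assms(1)]])
  fix w :: "bool list" assume "length w = m"
  then obtain x a y where w: "w = x @ a @ y" "length x = i" "length a = 2"
   using split_word[of i 2 w] assms(2) by auto
  then show "apply_piece (Neg, i) g w = qhalf_pow 1 * apply_piece (Cup, i) (apply_piece (Cap, i) g) w + qhalf_pow (-1) * g w"
   by (auto simp: length_2 apply_rules algebra_simps)
 qed
 show "apply_piece (Pos, i) g = (\<lambda>w. qhalf_pow 1 * g w + qhalf_pow (-1) * apply_piece (Cup, i) (apply_piece (Cap, i) g) w)"
 proof (rule supported_eqI[OF cross(2) lin[OF assms(1) cupcap]])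
  fix w :: "bool list" assume "length w = m"
  then obtain x a y where w: "w = x @ a @ y" "length x = i" "length a = 2"
   using split_word[of i 2 w] assms(2) by auto
  then show "apply_piece (Pos, i) g w = qhalf_pow 1 * g w + qhalf_pow (-1) * apply_piece (Cup, i) (apply_piece (Cap, i) g) w"
   by (auto simp: length_2 apply_rules algebra_simps)
 qed
qed

lemma circle_state_sum:
 assumes "supported_on m g" "i \<le> m"
 shows "apply_piece (Cap, i) (apply_piece (Cup, i) g) = (\<lambda>w. (- q_pow 1 - q_pow (-1)) * g w)"
proof (rule supported_eqI)
 have cup: "supported_on (m + 2) (apply_piece (Cup, i) g)"
  using apply_piece_supported[OF assms(1), of i Cup] assms(2) by simp
 show "supported_on m (apply_piece (Cap, i) (apply_piece (Cup, i) g))"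
  using apply_piece_supported[OF cup, of i Cap] assms(2) by simp
 show "supported_on m (\<lambda>w. (- q_pow 1 - q_pow (-1)) * g w)"
  using assms(1) by (auto simp: supported_on_def)
 fix w :: "bool list" assume "length w = m"
 then obtain x y where w: "w = x @ y" "length x = i"
  using assms(2) by (metis append_take_drop_id length_take min.absorb2)
 then show "apply_piece (Cap, i) (apply_piece (Cup, i) g) w = (- q_pow 1 - q_pow (-1)) * g w"
  by (simp add: apply_rules cup_weight_def q_pow_def algebra_simps)
qed

definition good_words :: "nat => nat => bool list set" where
 "good_words n k = {replicate k True @ w @ replicate k True | w. length w = 2 * n}"

lemma good_words_length: "w \<in> good_words n k ==> length w = 2 * (n + k)"
 by (auto simp: good_words_def)

lemma good_words_projector:
 assumes "w \<in> good_words n k" "x \<in> left_projector n k \<or> x \<in> right_projector n k"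
 shows "w ! x"
 using assms by (auto simp: good_words_def left_projector_def right_projector_def nth_append)

abbreviation good_word :: "nat => nat => (nat => bool) => bool list" where
 "good_word n k S \<equiv> replicate k True @ map S [1..<2 * n + 1] @ replicate k True"

abbreviation evaluate :: "bool list => (tangle \<Rightarrow>\<^sub>0 laurent) => laurent" where
 "evaluate w \<equiv> pairing (\<lambda>u. state_sum u w)"

text \<open>Whatever lies above the place of a relation is a linear operator, so each case reduces
  to an identity for the slices involved, applied to the state sum of what lies below.\<close>

lemma evaluate_relation:
 assumes "r \<in> kauffman_lins_relations n k" "w \<in> good_words n k"
 shows "evaluate w r = 0"
 using assms(1)
proof cases
 case (isotopy l r u v)
 from isotopy(3,4) obtain m m1 m2 where m: "u \<in> tangles m"
  "top_width m l = Some m1" "top_width m1 v = Some (2 * (n + k))"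
  "top_width m r = Some m2" "top_width m2 v = Some (2 * (n + k))"
  by (auto simp: tangles_def top_width_append split: option.splits)
 have "m1 = m2"
  using isotopy(2) m(2,4) by cases (auto split: if_splits)
 then show ?thesis
  using regular_move_state[OF isotopy(2) state_sum_supported[OF m(1)] m(2)] m(4)
  by (simp add: isotopy(1) pairing_diff state_sum_append)
next
 case (projector u)
 from projector(3) obtain x y where xy: "x \<noteq> y" "{x, y} \<subseteq> left_projector n k \<or> {x, y} \<subseteq> right_projector n k"
  "same_component u (length u, x) (length u, y)" "uncrossed u (length u, x)"
  by (auto simp: has_projector_arc_def)
 have "x < length w"
  using xy(2) good_words_length[OF assms(2)] by (auto simp: left_projector_def right_projector_def)
 moreover have "w ! x" "w ! y"
  using good_words_projector[OF assms(2)] xy(2) by auto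
 ultimately have "state_sum u w = 0"
  using uncrossed_arc_spins[OF xy(3,1,4), of w] by blast
 then show ?thesis by (simp add: projector(1))
next
 case (circle u i v)
 then obtain m where "u \<in> tangles m" "i \<le> m"
  by (auto simp: tangles_append split: if_splits)
 then show ?thesis
  by (simp add: circle(1) pairing_diff state_sum_append
    circle_state_sum[OF state_sum_supported] fold_apply_piece_scale)
next
 case (crossing_Neg u i v)
 then obtain m where "u \<in> tangles m" "i + 2 \<le> m"
  by (auto simp: tangles_append split: if_splits)
 then show ?thesis
  by (simp add: crossing_Neg(1) pairing_diff pairing_add state_sum_append
    crossing_state_sum(1)[OF state_sum_supported] fold_apply_piece_linear)
next
 case (crossing_Pos u i v)
 then obtain m where "u \<in> tangles m" "i + 2 \<le> m"
  by (auto simp: tangles_append split: if_splits)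
 then show ?thesis
  by (simp add: crossing_Pos(1) pairing_diff pairing_add state_sum_append
    crossing_state_sum(2)[OF state_sum_supported] fold_apply_piece_linear)
qed

lemma add_outer_arc_snoc: "add_outer_arc (u @ [(s, i)]) = add_outer_arc u @ [(s, Suc i)]"
 by (simp add: add_outer_arc_def)

lemma top_width_shift:
 "top_width (w + 2) (map (\<lambda>(s, i). (s, i + 1)) u) = Some (m + 2)" if "top_width w u = Some m"
 using that
proof (induction w u rule: top_width.induct)
 case (2 w s i u)
 then have "i + legs_below s \<le> w" "w + 2 - legs_below s + legs_above s = w - legs_below s + legs_above s + 2"
  by (auto split: if_splits)
 then show ?case using 2 by simp
qed simp

lemma add_outer_arc_tangle: "u \<in> tangles m ==> add_outer_arc u \<in> tangles (m + 2)"
 using top_width_shift[of 0 u m] by (simp add: tangles_def add_outer_arc_def numeral_2_eq_2)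

text \<open>The shift keeps all slices strictly between the two legs of the new arc, so the legs
  ride along unchanged and contribute just the weight of their cup.\<close>

lemma state_sum_add_outer_arc:
 assumes "u \<in> tangles m" "length v = m"
 shows "state_sum (add_outer_arc u) (c # v @ [d]) = cup_weight c d * state_sum u v"
 using assms
proof (induction u arbitrary: m v rule: rev_induct)
 case Nil
 then show ?case
  using apply_Cup[of "[]" 0 _ c d "[]"]
  by (simp add: tangles_def add_outer_arc_def state_sum_def)
next
 case (snoc p u)
 obtain s i where p: "p = (s, i)" by fastforce
 from snoc.prems obtain w where w: "u \<in> tangles w" "i + legs_below s \<le> w" "m = w - legs_below s + legs_above s"
  by (auto simp: p tangles_append split: if_splits)
 then have "i + legs_above s \<le> length v" using snoc.prems(2) by linarith
 then obtain x a y where v: "v = x @ a @ y" "length x = i" "length a = legs_above s"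
  by (rule split_word)
 have IH: "state_sum (add_outer_arc u) (c # x @ b @ y @ [d]) = cup_weight c d * state_sum u (x @ b @ y)"
  if "b \<in> words (legs_below s)" for b
 proof -
  have "length (x @ b @ y) = w" using v w snoc.prems(2) that by (auto simp: words_def)
  from snoc.IH[OF w(1) this] show ?thesis by simp
 qed
 show ?case
  using v apply_piece_append[of "c # x" "Suc i" a s "state_sum (add_outer_arc u)" "y @ [d]"]
   apply_piece_append[of x i a s "state_sum u" y]
  by (simp add: p add_outer_arc_snoc state_sum_append IH sum_distrib_left mult.left_commute)
qed

lemma evaluate_outer_arc:
 assumes "u \<in> tangles (2 * (n + k))" "w \<in> good_words n (Suc k)"
 shows "state_sum (add_outer_arc u) w = 0"
proof -
 obtain v where v: "w = replicate (Suc k) True @ v @ replicate (Suc k) True" "length v = 2 * n"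
  using assms(2) by (auto simp: good_words_def)
 let ?v = "replicate k True @ v @ replicate k True"
 have "w = True # ?v @ [True]"
  unfolding v(1) by (simp flip: replicate_append_same)
 then show ?thesis
  using state_sum_add_outer_arc[OF assms(1), of ?v True True] v(2) by (simp add: cup_weight_def)
qed

section \<open>Adding an outer arc\<close>

text \<open>\<open>joined_in_slice\<close> also relates positions to the right of the last strand,
  and after the shift the first of them is the right leg of the new arc. Bounding positions by the
  width separates the strands of \<open>u\<close> from that leg.\<close>

definition level_width :: "tangle => nat => nat" where
 "level_width u l = the (top_width 0 (take l u))"

lemma level_width_0 [simp]: "level_width u 0 = 0"
 by (simp add: level_width_def)

lemma level_width_top: "u \<in> tangles m ==> level_width u (length u) = m"
 by (simp add: level_width_def tangles_def)

lemma level_width_Suc: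
 assumes "u \<in> tangles m" "l < length u" "u ! l = (s, i)"
 shows "i + legs_below s \<le> level_width u l"
  and "level_width u (Suc l) = level_width u l - legs_below s + legs_above s"
proof -
 have "u = take l u @ (s, i) # drop (Suc l) u"
  using assms(2,3) by (metis id_take_nth_drop)
 then have "top_width 0 (take l u @ (s, i) # drop (Suc l) u) = Some m"
  using assms(1) by (simp add: tangles_def)
 then obtain w where w: "top_width 0 (take l u) = Some w" "i + legs_below s \<le> w"
  by (auto simp: top_width_append split: option.splits if_splits)
 then show "i + legs_below s \<le> level_width u l" by (simp add: level_width_def)
 show "level_width u (Suc l) = level_width u l - legs_below s + legs_above s"
  using w assms(2,3) by (simp add: level_width_def take_Suc_conv_app_nth top_width_append)
qed

lemma length_add_outer_arc [simp]: "length (add_outer_arc u) = Suc (length u)"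
 by (simp add: add_outer_arc_def)

lemma nth_add_outer_arc: "l < length u ==> u ! l = (s, i) ==> add_outer_arc u ! Suc l = (s, Suc i)"
 by (simp add: add_outer_arc_def)

lemma nth_add_outer_arc_cases:
 assumes "l < length (add_outer_arc u)" "add_outer_arc u ! l = (s, i)"
 obtains "l = 0" "s = Cup" "i = 0"
  | l' i' where "l = Suc l'" "i = Suc i'" "l' < length u" "u ! l' = (s, i')"
 using assms by (cases l) (auto simp: add_outer_arc_def split: prod.splits)

definition shift_point :: "nat \<times> nat => nat \<times> nat" where
 "shift_point = (\<lambda>(l, x). (Suc l, Suc x))"

lemma joined_add_outer_arc:
 "joined_in_slice u p p' ==> joined_in_slice (add_outer_arc u) (shift_point p) (shift_point p')"
proof (induction rule: joined_in_slice.induct)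
 case (left l s i x)
 then show ?case
  using joined_in_slice.left[of "Suc l" "add_outer_arc u" s "Suc i" "Suc x"]
  by (simp add: shift_point_def nth_add_outer_arc)
next
 case (right l s i x)
 then show ?case
  using joined_in_slice.right[of "Suc l" "add_outer_arc u" s "Suc i" x]
  by (simp add: shift_point_def nth_add_outer_arc)
next
 case (Cup l i)
 then show ?case
  using joined_in_slice.Cup[of "Suc l" "add_outer_arc u" "Suc i"]
  by (simp add: shift_point_def nth_add_outer_arc)
next
 case (Cap l i)
 then show ?case
  using joined_in_slice.Cap[of "Suc l" "add_outer_arc u" "Suc i"]
  by (simp add: shift_point_def nth_add_outer_arc)
next
 case (rising l s i)
 then show ?case
  using joined_in_slice.rising[of "Suc l" "add_outer_arc u" s "Suc i"]
  by (simp add: shift_point_def nth_add_outer_arc)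
next
 case (falling l s i)
 then show ?case
  using joined_in_slice.falling[of "Suc l" "add_outer_arc u" s "Suc i"]
  by (simp add: shift_point_def nth_add_outer_arc)
qed

lemma same_component_add_outer_arc:
 "same_component u p p' ==> same_component (add_outer_arc u) (shift_point p) (shift_point p')"
 unfolding same_component_def
 by (induction rule: equivclp_induct) (auto dest: joined_add_outer_arc intro: equivclp_into_equivclp)

lemma joined_add_outer_arcD:
 assumes "joined_in_slice (add_outer_arc u) p p'" "u \<in> tangles m"
 shows "x < level_width u l ==> p = (Suc l, Suc x) ==>
   \<exists>l' x'. p' = (Suc l', Suc x') \<and> x' < level_width u l' \<and> joined_in_slice u (l, x) (l', x')"
  and "x < level_width u l ==> p' = (Suc l, Suc x) ==>
   \<exists>l' x'. p = (Suc l', Suc x') \<and> x' < level_width u l' \<and> joined_in_slice u (l', x') (l, x)"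
proof -
 have "x < level_width u l \<longrightarrow> (p = (Suc l, Suc x) \<longrightarrow>
   (\<exists>l' x'. p' = (Suc l', Suc x') \<and> x' < level_width u l' \<and> joined_in_slice u (l, x) (l', x')))
  \<and> (p' = (Suc l, Suc x) \<longrightarrow>
   (\<exists>l' x'. p = (Suc l', Suc x') \<and> x' < level_width u l' \<and> joined_in_slice u (l', x') (l, x)))"
  using assms(1)
 proof (cases rule: joined_in_slice.cases)
  case (left l1 s i x1)
  from left(3,4) show ?thesis
  proof (cases rule: nth_add_outer_arc_cases)
   case (2 l2 i2)
   then show ?thesis
    using left level_width_Suc[OF assms(2) 2(3,4)] joined_in_slice.left[OF 2(3,4), of x]
    by auto
  qed (use left in auto)
 next
  case (right l1 s i x1)
  from right(3,4) show ?thesis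
  proof (cases rule: nth_add_outer_arc_cases)
   case 1
   then show ?thesis using right by auto
  next
   case (2 l2 i2)
   then show ?thesis
    using right level_width_Suc[OF assms(2) 2(3,4)] joined_in_slice.right[OF 2(3,4), of x1]
    by auto
  qed
 next
  case (Cup l1 i)
  from Cup(3,4) show ?thesis
  proof (cases rule: nth_add_outer_arc_cases)
   case (2 l2 i2)
   then show ?thesis
    using Cup level_width_Suc[OF assms(2) 2(3,4)] joined_in_slice.Cup[OF 2(3,4)]
    by auto
  qed (use Cup in \<open>cases "l = 0"; auto\<close>)
 next
  case (Cap l1 i)
  from Cap(3,4) show ?thesis
  proof (cases rule: nth_add_outer_arc_cases)
   case (2 l2 i2)
   then show ?thesis
    using Cap level_width_Suc[OF assms(2) 2(3,4)] joined_in_slice.Cap[OF 2(3,4)]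
    by auto
  qed (use Cap in \<open>cases "l = 0"; auto\<close>)
 next
  case (rising l1 s i)
  from rising(3,4) show ?thesis
  proof (cases rule: nth_add_outer_arc_cases)
   case (2 l2 i2)
   then show ?thesis
    using rising level_width_Suc[OF assms(2) 2(3,4)] joined_in_slice.rising[OF 2(3,4)]
    by auto
  qed (use rising in \<open>cases "l = 0"; auto\<close>)
 next
  case (falling l1 s i)
  from falling(3,4) show ?thesis
  proof (cases rule: nth_add_outer_arc_cases)
   case (2 l2 i2)
   then show ?thesis
    using falling level_width_Suc[OF assms(2) 2(3,4)] joined_in_slice.falling[OF 2(3,4)]
    by auto
  qed (use falling in \<open>cases "l = 0"; auto\<close>)
 qed
 then show "x < level_width u l ==> p = (Suc l, Suc x) ==>
   \<exists>l' x'. p' = (Suc l', Suc x') \<and> x' < level_width u l' \<and> joined_in_slice u (l, x) (l', x')"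
  and "x < level_width u l ==> p' = (Suc l, Suc x) ==>
   \<exists>l' x'. p = (Suc l', Suc x') \<and> x' < level_width u l' \<and> joined_in_slice u (l', x') (l, x)"
  by blast+
qed

text \<open>Strands of \<open>u\<close> do not become connected to the new arc. This converse
  direction is required because being uncrossed is a negative statement about components.\<close>

lemma same_component_add_outer_arcD:
 assumes "same_component (add_outer_arc u) (Suc l, Suc x) p" "u \<in> tangles m" "x < level_width u l"
 shows "\<exists>l' x'. p = (Suc l', Suc x') \<and> x' < level_width u l' \<and> same_component u (l, x) (l', x')"
 using assms(1) unfolding same_component_def
proof (induction rule: equivclp_induct)
 case base
 then show ?case using assms(3) by auto
next
 case (step p p')
 then obtain l' x' where p: "p = (Suc l', Suc x')" "x' < level_width u l'"
  "equivclp (joined_in_slice u) (l, x) (l', x')" by blast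
 from step(2) show ?case
  using joined_add_outer_arcD[OF _ assms(2), of p p' x' l'] joined_add_outer_arcD(2)[OF _ assms(2), of p' p x' l'] p
  by (meson equivclp_into_equivclp)
qed

lemma uncrossed_add_outer_arc:
 assumes "uncrossed u (l, x)" "u \<in> tangles m" "x < level_width u l"
 shows "uncrossed (add_outer_arc u) (Suc l, Suc x)"
 unfolding uncrossed_def
proof (intro allI impI)
 fix l1 s i
 assume l1: "l1 < length (add_outer_arc u)" and si: "add_outer_arc u ! l1 = (s, i) \<and> (s = Pos \<or> s = Neg)"
 obtain l2 i2 where "l1 = Suc l2" "i = Suc i2" "l2 < length u" "u ! l2 = (s, i2)"
  by (rule nth_add_outer_arc_cases[OF l1 conjunct1[OF si]]) (use si in auto)
 moreover from this have "\<not> same_component u (l, x) (l2, i2)" "\<not> same_component u (l, x) (l2, Suc i2)"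
  using assms(1) si unfolding uncrossed_def by auto
 ultimately show "\<not> same_component (add_outer_arc u) (Suc l, Suc x) (l1, i) \<and>
   \<not> same_component (add_outer_arc u) (Suc l, Suc x) (l1, i + 1)"
  using same_component_add_outer_arcD[OF _ assms(2,3), of "(l1, i)"]
   same_component_add_outer_arcD[OF _ assms(2,3), of "(l1, Suc i)"] by auto
qed

lemma has_projector_arc_add_outer_arc:
 assumes "has_projector_arc n k u" "u \<in> tangles (2 * (n + k))"
 shows "has_projector_arc n (Suc k) (add_outer_arc u)"
proof -
 obtain x y where xy: "x \<noteq> y" "{x, y} \<subseteq> left_projector n k \<or> {x, y} \<subseteq> right_projector n k"
  "same_component u (length u, x) (length u, y)" "uncrossed u (length u, x)"
  using assms(1) by (auto simp: has_projector_arc_def)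
 have "x < level_width u (length u)"
  using xy(2) level_width_top[OF assms(2)] by (auto simp: left_projector_def right_projector_def)
 then have "uncrossed (add_outer_arc u) (Suc (length u), Suc x)"
  using uncrossed_add_outer_arc[OF xy(4) assms(2)] by blast
 moreover have "same_component (add_outer_arc u) (Suc (length u), Suc x) (Suc (length u), Suc y)"
  using same_component_add_outer_arc[OF xy(3)] by (simp add: shift_point_def)
 moreover have "{Suc x, Suc y} \<subseteq> left_projector n (Suc k) \<or> {Suc x, Suc y} \<subseteq> right_projector n (Suc k)"
  using xy(2) by (auto simp: left_projector_def right_projector_def)
 ultimately show ?thesis
  unfolding has_projector_arc_def using xy(1) by (intro exI[of _ "Suc x"] exI[of _ "Suc y"]) simp
qed

lemma regular_move_shift:
 "regular_move l r ==> regular_move (map (\<lambda>(s, i). (s, i + 1)) l) (map (\<lambda>(s, i). (s, i + 1)) r)"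
proof (induction rule: regular_move.induct)
 case (exchange s i t j)
 show ?case using regular_move.exchange[of s "Suc i" t j] by simp
next
 case (straighten_right i)
 show ?case using regular_move.straighten_right[of "Suc i"] by simp
next
 case (straighten_left i)
 show ?case using regular_move.straighten_left[of "Suc i"] by simp
next
 case (slide_Cup_over i)
 show ?case using regular_move.slide_Cup_over[of "Suc i"] by simp
next
 case (slide_Cup_under i)
 show ?case using regular_move.slide_Cup_under[of "Suc i"] by simp
next
 case (slide_Cap_under i)
 show ?case using regular_move.slide_Cap_under[of "Suc i"] by simp
next
 case (slide_Cap_over i)
 show ?case using regular_move.slide_Cap_over[of "Suc i"] by simp
next
 case (R2_Pos_Neg i)
 show ?case using regular_move.R2_Pos_Neg[of "Suc i"] by simp
next
 case (R2_Neg_Pos i)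
 show ?case using regular_move.R2_Neg_Pos[of "Suc i"] by simp
next
 case (R3 i)
 show ?case using regular_move.R3[of "Suc i"] by simp
qed

abbreviation outer_extension :: "(tangle \<Rightarrow>\<^sub>0 laurent) => (tangle \<Rightarrow>\<^sub>0 laurent)" where
 "outer_extension \<equiv> linear_extension (\<lambda>u. single (add_outer_arc u) 1)"

text \<open>The shift preserves the shape of every slice, so a relation goes to a relation of the
  same kind. Hence \<open>phi\<close> is well defined on cosets.\<close>

lemma relations_add_outer_arc:
 assumes "r \<in> kauffman_lins_relations n k"
 shows "outer_extension r \<in> kauffman_lins_relations n (Suc k)"
proof -
 have width: "add_outer_arc u \<in> tangles (2 * (n + Suc k))" if "u \<in> tangles (2 * (n + k))" for u
  using add_outer_arc_tangle[OF that] by simp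
 have app: "add_outer_arc (u @ l @ v) =
   add_outer_arc u @ map (\<lambda>(s, i). (s, i + 1)) l @ map (\<lambda>(s, i). (s, i + 1)) v" for u l v
  by (simp add: add_outer_arc_def)
 have app2: "add_outer_arc (u @ v) = add_outer_arc u @ map (\<lambda>(s, i). (s, i + 1)) v" for u v
  by (simp add: add_outer_arc_def)
 from assms show ?thesis
 proof cases
  case (isotopy l r u v)
  show ?thesis
   using kauffman_lins_relations.isotopy[OF regular_move_shift[OF isotopy(2)],
     OF width[OF isotopy(3), unfolded app] width[OF isotopy(4), unfolded app]]
   by (simp add: isotopy(1) linear_extension_diff app)
 next
  case (projector u)
  show ?thesis
   using kauffman_lins_relations.projector[OF width[OF projector(2)] has_projector_arc_add_outer_arc[OF projector(3,2)]]
   by (simp add: projector(1))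
 next
  case (circle u i v)
  from width[OF circle(2)] have "add_outer_arc u @ [(Cup, Suc i), (Cap, Suc i)] @ map (\<lambda>(s, i). (s, i + 1)) v
    \<in> tangles (2 * (n + Suc k))" unfolding app by simp
  from kauffman_lins_relations.circle[OF this] show ?thesis
   by (simp add: circle(1) linear_extension_diff add_outer_arc_def)
 next
  case (crossing_Neg u i v)
  from width[OF crossing_Neg(2)] have "add_outer_arc u @ [(Neg, Suc i)] @ map (\<lambda>(s, i). (s, i + 1)) v
    \<in> tangles (2 * (n + Suc k))" unfolding app by simp
  from kauffman_lins_relations.crossing_Neg[OF this] show ?thesis
   by (simp add: crossing_Neg(1) linear_extension_diff linear_extension_add add_outer_arc_def)
 next
  case (crossing_Pos u i v)
  from width[OF crossing_Pos(2)] have "add_outer_arc u @ [(Pos, Suc i)] @ map (\<lambda>(s, i). (s, i + 1)) v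
    \<in> tangles (2 * (n + Suc k))" unfolding app by simp
  from kauffman_lins_relations.crossing_Pos[OF this] show ?thesis
   by (simp add: crossing_Pos(1) linear_extension_diff linear_extension_add add_outer_arc_def)
 qed
qed

section \<open>The Kauffman--Lins space as a single quotient\<close>

abbreviation "free_kl n k \<equiv> carrier (free_kauffman_lins n k)"

lemma free_kl_iff: "f \<in> free_kl n k \<longleftrightarrow> keys f \<subseteq> tangles (2 * (n + k))"
 by (simp add: free_kauffman_lins_def free_module_carrier)

lemma free_kl_single: "u \<in> tangles (2 * (n + k)) ==> single u c \<in> free_kl n k"
 by (simp add: free_kauffman_lins_def)

lemma free_kl_closed [simp]:
 "0 \<in> free_kl n k"
 "f \<in> free_kl n k ==> g \<in> free_kl n k ==> f + g \<in> free_kl n k"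
 "f \<in> free_kl n k ==> g \<in> free_kl n k ==> f - g \<in> free_kl n k"
 "f \<in> free_kl n k ==> - f \<in> free_kl n k"
 "f \<in> free_kl n k ==> scale c f \<in> free_kl n k"
 "(\<And>x. x \<in> A ==> h x \<in> free_kl n k) ==> sum h A \<in> free_kl n k"
 by (simp_all add: free_kauffman_lins_def)

lemma free_kl_simps [simp]:
 "x \<oplus>\<^bsub>free_kauffman_lins n k\<^esub> y = x + y" "\<zero>\<^bsub>free_kauffman_lins n k\<^esub> = 0"
 "a \<odot>\<^bsub>free_kauffman_lins n k\<^esub> x = scale a x"
 by (simp_all add: free_kauffman_lins_def)

lemma module_free_kl: "module Laurent_qhalf (free_kauffman_lins n k)"
 by (simp add: free_kauffman_lins_def qhalf.module_free)

lemma crossing_resolution_tangles: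
 assumes "u @ [(s, i)] @ v \<in> tangles m" "s = Pos \<or> s = Neg"
 shows "u @ v \<in> tangles m" "u @ [(Cap, i), (Cup, i)] @ v \<in> tangles m"
proof -
 obtain w where w: "u \<in> tangles w" "i + 2 \<le> w" "top_width w v = Some m"
  using assms unfolding tangles_append[of u] by (auto split: if_splits)
 then have "w - 2 + 2 = w" by simp
 with w show "u @ v \<in> tangles m" "u @ [(Cap, i), (Cup, i)] @ v \<in> tangles m"
  unfolding tangles_append[of u] by auto
qed

lemma relations_closed: "kauffman_lins_relations n k \<subseteq> free_kl n k"
proof
 fix r assume "r \<in> kauffman_lins_relations n k"
 then show "r \<in> free_kl n k"
 proof cases
  case (circle u i v)
  then have "u @ v \<in> tangles (2 * (n + k))" by (auto simp: tangles_append split: if_splits)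
  with circle show ?thesis by (simp add: free_kl_single)
 next
  case (crossing_Neg u i v)
  with crossing_resolution_tangles[OF crossing_Neg(2)] show ?thesis by (simp add: free_kl_single)
 next
  case (crossing_Pos u i v)
  with crossing_resolution_tangles[OF crossing_Pos(2)] show ?thesis by (simp add: free_kl_single)
 qed (simp_all add: free_kl_single)
qed

lemma submodule_kl_span: "submodule (kauffman_lins_span n k) Laurent_qhalf (free_kauffman_lins n k)"
 unfolding kauffman_lins_span_def using relations_closed
 by (simp add: free_kauffman_lins_def qhalf.submodule_span)

lemmas kl_span_closed = qhalf.submodule_freeD[OF submodule_kl_span[unfolded free_kauffman_lins_def],
  folded free_kauffman_lins_def, simplified]

lemma kl_span_inc: "r \<in> kauffman_lins_relations n k ==> r \<in> kauffman_lins_span n k"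
 unfolding kauffman_lins_span_def free_kauffman_lins_def using qhalf.span_inc by blast

lemma kl_span_minimal:
 assumes "kauffman_lins_relations n k \<subseteq> N" "0 \<in> N" "N \<subseteq> free_kl n k"
  "\<And>f g. f \<in> N ==> g \<in> N ==> f + g \<in> N" "\<And>c f. f \<in> N ==> scale c f \<in> N"
 shows "kauffman_lins_span n k \<subseteq> N"
 unfolding kauffman_lins_span_def free_kauffman_lins_def
 by (rule qhalf.span_minimal) (use assms in \<open>auto intro!: qhalf.submodule_freeI simp: free_kauffman_lins_def\<close>)

lemma outer_extension_closed: "f \<in> free_kl n k ==> outer_extension f \<in> free_kl n (Suc k)"
 using add_outer_arc_tangle[of _ "2 * (n + k)"]
 by (auto simp: linear_extension_def free_kl_iff[of f] intro!: free_kl_closed free_kl_single)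

lemma outer_extension_span:
 "f \<in> kauffman_lins_span n k ==> outer_extension f \<in> kauffman_lins_span n (Suc k)"
proof -
 have "kauffman_lins_span n k \<subseteq> {f \<in> free_kl n k. outer_extension f \<in> kauffman_lins_span n (Suc k)}"
  by (rule kl_span_minimal)
   (auto simp: linear_extension_add linear_extension_scale kl_span_closed
    dest: relations_add_outer_arc relations_closed[THEN subsetD] intro: kl_span_inc)
 then show "f \<in> kauffman_lins_span n k ==> outer_extension f \<in> kauffman_lins_span n (Suc k)" by blast
qed

interpretation tilde: module Laurent_qhalf "kauffman_lins_tilde n k" for n k
 unfolding kauffman_lins_tilde_def by (rule module_quotient(2)[OF module_free_kl submodule_kl_span])

interpretation tilde_quotient: additive_quotient "free_kauffman_lins n k" "kauffman_lins_span n k" for n k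
 by (rule module_quotient(1)[OF module_free_kl submodule_kl_span])

lemma free_kl_minus: "f \<in> free_kl n k ==> g \<in> free_kl n k ==> f \<ominus>\<^bsub>free_kauffman_lins n k\<^esub> g = f - g"
 by (simp add: free_kauffman_lins_def qhalf.free_minus)

lemma class_tilde_eq_iff:
 "f \<in> free_kl n k ==> g \<in> free_kl n k ==> class_tilde n k f = class_tilde n k g \<longleftrightarrow> f - g \<in> kauffman_lins_span n k"
 by (simp add: class_tilde_def tilde_quotient.coset_eq_iff free_kl_minus)

lemma class_tilde_closed: "f \<in> free_kl n k ==> class_tilde n k f \<in> carrier (kauffman_lins_tilde n k)"
 by (simp add: class_tilde_def kauffman_lins_tilde_def)

lemma class_tilde_add: "f \<in> free_kl n k ==> g \<in> free_kl n k ==>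
  class_tilde n k f \<oplus>\<^bsub>kauffman_lins_tilde n k\<^esub> class_tilde n k g = class_tilde n k (f + g)"
 by (simp add: class_tilde_def kauffman_lins_tilde_def tilde_quotient.add_quot)

lemma class_tilde_smult: "f \<in> free_kl n k ==>
  c \<odot>\<^bsub>kauffman_lins_tilde n k\<^esub> class_tilde n k f = class_tilde n k (scale c f)"
 by (simp add: class_tilde_def kauffman_lins_tilde_def module_quotient(3)[OF module_free_kl submodule_kl_span])

lemma class_tilde_zero: "class_tilde n k 0 = \<zero>\<^bsub>kauffman_lins_tilde n k\<^esub>"
 by (simp add: class_tilde_def kauffman_lins_tilde_def tilde_quotient.zero_quot)

lemma carrier_tilde: "carrier (kauffman_lins_tilde n k) = class_tilde n k ` free_kl n k"
 by (auto simp: kauffman_lins_tilde_def tilde_quotient.carrier_quot class_tilde_def)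

lemma class_tilde_member: "f \<in> free_kl n k ==> g \<in> class_tilde n k f \<longleftrightarrow> g \<in> free_kl n k \<and> g - f \<in> kauffman_lins_span n k"
 using tilde_quotient.sub.a_rcos_module[of f n k g] tilde_quotient.sub.a_elemrcos_carrier[of f n k g] free_kl_minus[of g n k f]
 by (auto simp: class_tilde_def a_minus_def)

lemma induced_eq:
 assumes "x \<in> C" "\<And>y. y \<in> C ==> f y = f x"
 shows "induced f C = f x"
proof -
 have "f ` C = (\<lambda>_. f x) ` C" using assms(2) by (intro image_cong refl)
 then have "f ` C = {f x}" using assms(1) by auto
 then show ?thesis by (simp add: induced_def)
qed

lemma phi_class_tilde:
 assumes "f \<in> free_kl n k"
 shows "phi n k (class_tilde n k f) = class_tilde n (Suc k) (outer_extension f)"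
 unfolding phi_def
proof (subst induced_eq[of f])
 show "f \<in> class_tilde n k f" using assms kl_span_closed by (simp add: class_tilde_member)
 fix g assume "g \<in> class_tilde n k f"
 then have "g \<in> free_kl n k" "outer_extension (g - f) \<in> kauffman_lins_span n (Suc k)"
  using assms outer_extension_span by (simp_all add: class_tilde_member)
 then show "class_tilde n (k + 1) (outer_extension g) = class_tilde n (k + 1) (outer_extension f)"
  using assms by (simp add: class_tilde_eq_iff outer_extension_closed linear_extension_diff)
qed simp

text \<open>A lift of \<open>phi_image\<close> to the free module, so that the second quotient can
  be studied before passing to cosets of the first.\<close>

definition outer_image :: "nat => nat => (tangle \<Rightarrow>\<^sub>0 laurent) set" where
 "outer_image n k = (if k = 0 then {0} else outer_extension ` free_kl n (k - 1))"

lemma outer_image_closed: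
 "0 \<in> outer_image n k" "outer_image n k \<subseteq> free_kl n k"
 "f \<in> outer_image n k ==> g \<in> outer_image n k ==> f + g \<in> outer_image n k"
 "f \<in> outer_image n k ==> scale c f \<in> outer_image n k"
proof -
 show "0 \<in> outer_image n k"
  using free_kl_closed(1)[of n "k - 1"] by (auto simp: outer_image_def intro!: image_eqI[of _ _ 0])
 show "outer_image n k \<subseteq> free_kl n k"
  using outer_extension_closed[of _ n "k - 1"] by (auto simp: outer_image_def)
 show "f + g \<in> outer_image n k" if "f \<in> outer_image n k" "g \<in> outer_image n k"
  using that by (auto simp: outer_image_def simp flip: linear_extension_add split: if_splits)
 show "scale c f \<in> outer_image n k" if "f \<in> outer_image n k"
  using that by (auto simp: outer_image_def simp flip: linear_extension_scale split: if_splits)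
qed

lemma phi_image_eq: "phi_image n k = class_tilde n k ` outer_image n k"
proof (cases k)
 case 0
 then show ?thesis by (simp add: phi_image_def outer_image_def class_tilde_zero)
next
 case (Suc k')
 then show ?thesis
  by (auto simp: phi_image_def outer_image_def carrier_tilde phi_class_tilde image_image)
qed

lemma submodule_phi_image: "submodule (phi_image n k) Laurent_qhalf (kauffman_lins_tilde n k)"
proof (rule tilde.submoduleI)
 note [simp] = subsetD[OF outer_image_closed(2)]
 show "phi_image n k \<subseteq> carrier (kauffman_lins_tilde n k)"
  by (auto simp: phi_image_eq class_tilde_closed)
 show "\<zero>\<^bsub>kauffman_lins_tilde n k\<^esub> \<in> phi_image n k"
  unfolding phi_image_eq class_tilde_zero[symmetric] using outer_image_closed(1) by blast
 show smult: "c \<odot>\<^bsub>kauffman_lins_tilde n k\<^esub> C \<in> phi_image n k" if "C \<in> phi_image n k" for c C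
  using that by (auto simp: phi_image_eq class_tilde_smult outer_image_closed)
 show "C \<oplus>\<^bsub>kauffman_lins_tilde n k\<^esub> D \<in> phi_image n k" if "C \<in> phi_image n k" "D \<in> phi_image n k" for C D
  using that by (auto simp: phi_image_eq class_tilde_add outer_image_closed)
 fix C assume C: "C \<in> phi_image n k"
 then obtain f where f: "f \<in> outer_image n k" "C = class_tilde n k f" by (auto simp: phi_image_eq)
 have "\<ominus>\<^bsub>kauffman_lins_tilde n k\<^esub> C = class_tilde n k (scale (-1) f)"
  using f class_tilde_add[of f n k "scale (-1) f"]
  by (intro tilde.minus_equality)
   (simp_all add: class_tilde_closed scale_minus_left class_tilde_zero class_tilde_add)
 then show "\<ominus>\<^bsub>kauffman_lins_tilde n k\<^esub> C \<in> phi_image n k"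
  using f outer_image_closed(4) by (auto simp: phi_image_eq)
qed

interpretation kl: module Laurent_qhalf "kauffman_lins n k" for n k
 unfolding kauffman_lins_def by (rule module_quotient(2)[OF tilde.module_axioms submodule_phi_image])

interpretation kl_quotient: additive_quotient "kauffman_lins_tilde n k" "phi_image n k" for n k
 by (rule module_quotient(1)[OF tilde.module_axioms submodule_phi_image])

definition kl_class :: "nat => nat => (tangle \<Rightarrow>\<^sub>0 laurent) => (tangle \<Rightarrow>\<^sub>0 laurent) set set" where
 "kl_class n k f = class_kl n k (class_tilde n k f)"

text \<open>The kernel of the composite of the two quotient maps. Membership in it replaces equality
  of cosets of cosets from here on.\<close>

definition kl_kernel :: "nat => nat => (tangle \<Rightarrow>\<^sub>0 laurent) set" where
 "kl_kernel n k = {f + g | f g. f \<in> kauffman_lins_span n k \<and> g \<in> outer_image n k}"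

lemma kl_kernel_closed:
 "kl_kernel n k \<subseteq> free_kl n k" "0 \<in> kl_kernel n k"
 "f \<in> kl_kernel n k ==> g \<in> kl_kernel n k ==> f + g \<in> kl_kernel n k"
 "f \<in> kl_kernel n k ==> scale c f \<in> kl_kernel n k"
proof -
 show "kl_kernel n k \<subseteq> free_kl n k"
  using kl_span_closed(1) outer_image_closed(2) by (fastforce simp: kl_kernel_def)
 show "0 \<in> kl_kernel n k"
  using kl_span_closed(2) outer_image_closed(1) by (force simp: kl_kernel_def)
 show "f + g \<in> kl_kernel n k" if "f \<in> kl_kernel n k" "g \<in> kl_kernel n k"
 proof -
  from that obtain f1 f2 g1 g2 where "f1 \<in> kauffman_lins_span n k" "f2 \<in> outer_image n k"
   "g1 \<in> kauffman_lins_span n k" "g2 \<in> outer_image n k" "f = f1 + f2" "g = g1 + g2"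
   by (auto simp: kl_kernel_def)
  then have "f1 + g1 \<in> kauffman_lins_span n k" "f2 + g2 \<in> outer_image n k" "f + g = (f1 + g1) + (f2 + g2)"
   by (auto simp: kl_span_closed outer_image_closed)
  then show ?thesis unfolding kl_kernel_def by blast
 qed
 show "scale c f \<in> kl_kernel n k" if "f \<in> kl_kernel n k"
  using that kl_span_closed(5) outer_image_closed(4)
  by (fastforce simp: kl_kernel_def scale_add_right)
qed

lemma kl_class_closed: "f \<in> free_kl n k ==> kl_class n k f \<in> carrier (kauffman_lins n k)"
 by (simp add: kl_class_def class_kl_def kauffman_lins_def class_tilde_closed)

lemma carrier_kl: "carrier (kauffman_lins n k) = kl_class n k ` free_kl n k"
 by (auto simp: kauffman_lins_def kl_quotient.carrier_quot carrier_tilde kl_class_def class_kl_def)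

lemma kl_class_add: "f \<in> free_kl n k ==> g \<in> free_kl n k ==>
  kl_class n k f \<oplus>\<^bsub>kauffman_lins n k\<^esub> kl_class n k g = kl_class n k (f + g)"
 by (simp add: kl_class_def class_kl_def kauffman_lins_def kl_quotient.add_quot class_tilde_closed class_tilde_add)

lemma kl_class_smult: "f \<in> free_kl n k ==>
  c \<odot>\<^bsub>kauffman_lins n k\<^esub> kl_class n k f = kl_class n k (scale c f)"
 by (simp add: kl_class_def class_kl_def kauffman_lins_def class_tilde_closed class_tilde_smult
   module_quotient(3)[OF tilde.module_axioms submodule_phi_image])

lemma kl_class_zero: "kl_class n k 0 = \<zero>\<^bsub>kauffman_lins n k\<^esub>"
 by (simp add: kl_class_def class_kl_def kauffman_lins_def kl_quotient.zero_quot class_tilde_zero)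

lemma class_tilde_minus: "f \<in> free_kl n k ==> g \<in> free_kl n k ==>
  class_tilde n k f \<ominus>\<^bsub>kauffman_lins_tilde n k\<^esub> class_tilde n k g = class_tilde n k (f - g)"
proof -
 assume fg: "f \<in> free_kl n k" "g \<in> free_kl n k"
 then have "\<ominus>\<^bsub>kauffman_lins_tilde n k\<^esub> class_tilde n k g = class_tilde n k (- g)"
  by (intro tilde.minus_equality) (simp_all add: class_tilde_closed class_tilde_add class_tilde_zero)
 with fg show ?thesis by (simp add: tilde.minus_eq class_tilde_add)
qed

lemma kl_class_eq_iff:
 assumes "f \<in> free_kl n k" "g \<in> free_kl n k"
 shows "kl_class n k f = kl_class n k g \<longleftrightarrow> f - g \<in> kl_kernel n k"
proof -
 have "kl_class n k f = kl_class n k g \<longleftrightarrow> class_tilde n k (f - g) \<in> phi_image n k"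
  using assms by (simp add: kl_class_def class_kl_def kl_quotient.coset_eq_iff class_tilde_closed class_tilde_minus)
 also have "\<dots> \<longleftrightarrow> (\<exists>h\<in>outer_image n k. f - g - h \<in> kauffman_lins_span n k)"
  using assms outer_image_closed(2)[of n k] by (auto simp: phi_image_eq image_iff class_tilde_eq_iff subset_iff)
 also have "\<dots> \<longleftrightarrow> f - g \<in> kl_kernel n k"
  unfolding kl_kernel_def by (auto simp: algebra_simps) (metis add_diff_cancel_right' diff_add_cancel)+
 finally show ?thesis .
qed

text \<open>The easy half of the description of the kernel by state sums; the other half is
  \<open>annihilator_kernel\<close>.\<close>

lemma evaluate_kernel:
 assumes "f \<in> kl_kernel n k" "w \<in> good_words n k"
 shows "evaluate w f = 0"
proof -
 have "kauffman_lins_span n k \<subseteq> {f \<in> free_kl n k. evaluate w f = 0}"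
  by (rule kl_span_minimal)
   (use relations_closed evaluate_relation[OF _ assms(2)] in \<open>auto simp: pairing_add pairing_scale\<close>)
 moreover have "evaluate w g = 0" if g: "g \<in> outer_image n k" for g
 proof (cases k)
  case (Suc k')
  then obtain h where h: "h \<in> free_kl n k'" "g = outer_extension h"
   using g by (auto simp: outer_image_def)
  have "evaluate w g = (\<Sum>u\<in>keys h. lookup h u * state_sum (add_outer_arc u) w)"
   unfolding h(2) pairing_linear_extension by (simp add: pairing_def)
  also have "\<dots> = 0"
   using h(1) assms(2) Suc by (intro sum.neutral) (auto simp: free_kl_iff evaluate_outer_arc)
  finally show ?thesis .
 qed (use g in \<open>simp add: outer_image_def\<close>)
 ultimately show ?thesis
  using assms(1) by (auto simp: kl_kernel_def pairing_add)
qed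

section \<open>Reduction to cups\<close>

definition cups :: "nat list => tangle" where
 "cups c = map (Pair Cup) c"

lemma cups_simps [simp]: "cups [] = []" "cups (c @ d) = cups c @ cups d" "cups (i # c) = (Cup, i) # cups c"
  "length (cups c) = length c"
 by (simp_all add: cups_def)

lemma cups_snoc_tangles:
 "cups (c @ [i]) \<in> tangles m \<longleftrightarrow> (\<exists>w. m = w + 2 \<and> cups c \<in> tangles w \<and> i \<le> w)"
 by (auto simp: tangles_append)

lemma cups_tangles_width: "cups c \<in> tangles m ==> m = 2 * length c"
 by (induction c arbitrary: m rule: rev_induct) (auto simp: cups_snoc_tangles tangles_def[of 0] tangles_def top_width_append split: if_splits option.splits)

lemma kernel_relation: "r \<in> kauffman_lins_relations n k ==> r \<in> kl_kernel n k"
 using kl_span_inc outer_image_closed(1) unfolding kl_kernel_def by force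

lemma kernel_outer: "u \<in> tangles (2 * (n + k)) ==> single (add_outer_arc u) c \<in> kl_kernel n (Suc k)"
proof -
 assume u: "u \<in> tangles (2 * (n + k))"
 have "outer_extension (single u c) \<in> outer_image n (Suc k)"
  using free_kl_single[OF u] by (simp add: outer_image_def del: linear_extension_single)
 then show ?thesis
  using kl_span_closed(2) unfolding kl_kernel_def by force
qed

definition kl_equiv :: "nat => nat => (tangle \<Rightarrow>\<^sub>0 laurent) => (tangle \<Rightarrow>\<^sub>0 laurent) => bool" where
 "kl_equiv n k f g \<longleftrightarrow> f - g \<in> kl_kernel n k"

lemma kl_kernel_uminus: "f \<in> kl_kernel n k ==> - f \<in> kl_kernel n k"
 using kl_kernel_closed(4)[of f n k "-1"] by (simp add: scale_minus_left)

lemma kl_equiv_refl [simp]: "kl_equiv n k f f"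
 by (simp add: kl_equiv_def kl_kernel_closed)

lemma kl_equiv_sym: "kl_equiv n k f g ==> kl_equiv n k g f"
 using kl_kernel_uminus[of "f - g" n k] by (simp add: kl_equiv_def)

lemma kl_equiv_trans [trans]: "kl_equiv n k f g ==> kl_equiv n k g h ==> kl_equiv n k f h"
 using kl_kernel_closed(3)[of "f - g" n k "g - h"] by (simp add: kl_equiv_def)

lemma kl_equiv_add: "kl_equiv n k f g ==> kl_equiv n k f' g' ==> kl_equiv n k (f + f') (g + g')"
 using kl_kernel_closed(3)[of "f - g" n k "f' - g'"] by (simp add: kl_equiv_def algebra_simps)

lemma kl_equiv_scale: "kl_equiv n k f g ==> kl_equiv n k (scale c f) (scale c g)"
 using kl_kernel_closed(4)[of "f - g" n k c] by (simp add: kl_equiv_def scale_diff_right)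

lemma kl_equiv_sum: "(\<And>x. x \<in> A ==> kl_equiv n k (f x) (g x)) ==> kl_equiv n k (sum f A) (sum g A)"
 by (induction A rule: infinite_finite_induct) (auto intro: kl_equiv_add)

lemma isotopy_equiv:
 assumes "regular_move l r" "u @ l @ v \<in> tangles (2 * (n + k))"
  and "\<And>w w'. top_width w l = Some w' ==> top_width w r = Some w'"
 shows "u @ r @ v \<in> tangles (2 * (n + k))"
  and "kl_equiv n k (single (u @ l @ v) 1) (single (u @ r @ v) 1)"
proof -
 show r: "u @ r @ v \<in> tangles (2 * (n + k))"
 proof -
  obtain w w' where "u \<in> tangles w" "top_width w l = Some w'" "top_width w' v = Some (2 * (n + k))"
   using assms(2) by (auto simp: tangles_append top_width_append split: option.splits)
  then show ?thesis
   using assms(3)[of w w'] by (auto simp: tangles_append top_width_append intro!: exI[of _ w])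
 qed
 show "kl_equiv n k (single (u @ l @ v) 1) (single (u @ r @ v) 1)"
  unfolding kl_equiv_def
  by (rule kernel_relation) (rule kauffman_lins_relations.isotopy[OF assms(1,2) r])
qed

text \<open>The lowest cap is pushed down through the cups. Against the next cup it closes a circle,
  straightens a zigzag, or lies apart from it and can be exchanged. It has to cancel eventually,
  because a cap cannot be the bottom slice.\<close>

lemma cap_cancel:
 assumes "cups cs @ (Cap, i) # v \<in> tangles (2 * (n + k))"
 shows "\<exists>c cs'. cups cs' @ v \<in> tangles (2 * (n + k)) \<and>
  kl_equiv n k (single (cups cs @ (Cap, i) # v) 1) (single (cups cs' @ v) c)"
 using assms
proof (induction cs arbitrary: i v rule: rev_induct)
 case Nil
 then show ?case by (simp add: tangles_def)
next
 case (snoc j cs)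
 let ?T = "tangles (2 * (n + k))"
 let ?s = "\<lambda>u. single u (1 :: laurent)"
 have u: "cups cs @ [(Cup, j), (Cap, i)] @ v \<in> ?T" using snoc.prems by simp
 consider "i = j" | "i = j + 1" | "j = i + 1" | d where "i = j + 2 + d" | d where "j = i + 2 + d"
  by atomize_elim presburger
 then show ?case
 proof cases
  case 1
  have "cups cs @ v \<in> ?T" using u 1 by (auto simp: tangles_append split: if_splits)
  moreover have "kl_equiv n k (?s (cups cs @ [(Cup, j), (Cap, i)] @ v)) (single (cups cs @ v) (- q_pow 1 - q_pow (-1)))"
   unfolding kl_equiv_def using kernel_relation[OF kauffman_lins_relations.circle] u 1 by blast
  ultimately show ?thesis by auto
 next
  case 2
  have w: "top_width w [] = Some w'" if "top_width w [(Cup, j), (Cap, j + 1)] = Some w'" for w w'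
   using that by (auto split: if_splits)
  note iso = isotopy_equiv[OF regular_move.straighten_right u[unfolded 2] w]
  show ?thesis
   using iso 2 by (intro exI[of _ 1] exI[of _ cs]) simp
 next
  case 3
  have w: "top_width w [] = Some w'" if "top_width w [(Cup, i + 1), (Cap, i)] = Some w'" for w w'
   using that by (auto split: if_splits)
  note iso = isotopy_equiv[OF regular_move.straighten_left u[unfolded 3] w]
  show ?thesis
   using iso 3 by (intro exI[of _ 1] exI[of _ cs]) simp
 next
  case (4 d)
  have m: "regular_move [(Cup, j), (Cap, i)] [(Cap, j + d), (Cup, j)]"
   using regular_move.exchange[of Cup j Cap d] 4 by simp
  have w: "top_width w [(Cap, j + d), (Cup, j)] = Some w'" if "top_width w [(Cup, j), (Cap, i)] = Some w'" for w w'
   using that 4 by (auto split: if_splits)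
  note iso = isotopy_equiv[OF m u w]
  obtain c cs' where cs': "cups cs' @ (Cup, j) # v \<in> ?T"
   "kl_equiv n k (?s (cups cs @ (Cap, j + d) # (Cup, j) # v)) (single (cups cs' @ (Cup, j) # v) c)"
   using snoc.IH[of "j + d" "(Cup, j) # v"] iso(1) by auto
  have "kl_equiv n k (?s (cups (cs @ [j]) @ (Cap, i) # v)) (single (cups (cs' @ [j]) @ v) c)"
   using kl_equiv_trans[OF iso(2)] cs'(2) by simp
  with cs'(1) show ?thesis by (intro exI[of _ c] exI[of _ "cs' @ [j]"]) simp
 next
  case (5 d)
  have m: "regular_move [(Cap, i), (Cup, i + d)] [(Cup, j), (Cap, i)]"
   using regular_move.exchange[of Cap i Cup d] 5 by (simp add: add_ac)
  \<comment> \<open>The exchange is used from right to left here, so the diagram with the cap below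
    must first be seen to be valid: the cup lies to the right of both legs of the cap, which are
    therefore older strands.\<close>
  have t: "cups cs @ [(Cap, i), (Cup, i + d)] @ v \<in> ?T"
  proof -
   obtain w where w: "cups cs \<in> tangles w" "j \<le> w" "top_width w v = Some (2 * (n + k))"
    using u unfolding tangles_append[of "cups cs"] by (auto split: if_splits)
   then have "i + 2 \<le> w" "i + d \<le> w - 2" "Suc (Suc (w - 2)) = w"
    using 5 by auto
   with w show ?thesis unfolding tangles_append[of "cups cs"] by auto
  qed
  have w: "top_width w [(Cup, j), (Cap, i)] = Some w'" if "top_width w [(Cap, i), (Cup, i + d)] = Some w'" for w w'
   using that 5 by (auto split: if_splits)
  note iso = isotopy_equiv[OF m t w]
  obtain c cs' where cs': "cups cs' @ (Cup, i + d) # v \<in> ?T"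
   "kl_equiv n k (?s (cups cs @ (Cap, i) # (Cup, i + d) # v)) (single (cups cs' @ (Cup, i + d) # v) c)"
   using snoc.IH[of i "(Cup, i + d) # v"] t by auto
  have "kl_equiv n k (?s (cups (cs @ [j]) @ (Cap, i) # v)) (single (cups (cs' @ [i + d]) @ v) c)"
   using kl_equiv_trans[OF kl_equiv_sym[OF iso(2)]] cs'(2) by simp
  with cs'(1) show ?thesis by (intro exI[of _ c] exI[of _ "cs' @ [i + d]"]) simp
 qed
qed

definition cup_tangles :: "nat => nat => tangle set" where
 "cup_tangles n k = {cups c | c. cups c \<in> tangles (2 * (n + k))}"

definition spanned :: "nat => nat => tangle set => (tangle \<Rightarrow>\<^sub>0 laurent) set" where
 "spanned n k B = {f. \<exists>g. keys g \<subseteq> B \<and> kl_equiv n k f g}"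

lemma spanned_equiv: "kl_equiv n k f f' ==> f' \<in> spanned n k B ==> f \<in> spanned n k B"
 unfolding spanned_def using kl_equiv_trans by blast

lemma spanned_add: "f \<in> spanned n k B ==> f' \<in> spanned n k B ==> f + f' \<in> spanned n k B"
proof -
 assume "f \<in> spanned n k B" "f' \<in> spanned n k B"
 then obtain g g' where "keys g \<subseteq> B" "kl_equiv n k f g" "keys g' \<subseteq> B" "kl_equiv n k f' g'"
  by (auto simp: spanned_def)
 then show ?thesis
  unfolding spanned_def using keys_add[of g g'] kl_equiv_add by blast
qed

lemma spanned_scale: "f \<in> spanned n k B ==> scale c f \<in> spanned n k B"
proof -
 assume "f \<in> spanned n k B"
 then obtain g where "keys g \<subseteq> B" "kl_equiv n k f g" by (auto simp: spanned_def)
 then have "keys (scale c g) \<subseteq> B" "kl_equiv n k (scale c f) (scale c g)"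
  using keys_scale[of c g] kl_equiv_scale by blast+
 then show ?thesis by (auto simp: spanned_def)
qed

lemma spanned_sum: "(\<And>x. x \<in> A ==> f x \<in> spanned n k B) ==> sum f A \<in> spanned n k B"
proof (induction A rule: infinite_finite_induct)
 case empty
 show ?case by (auto simp: spanned_def intro: exI[of _ 0])
next
 case (infinite A)
 then show ?case by (auto simp: spanned_def intro: exI[of _ 0])
qed (auto intro: spanned_add)

lemma spanned_mult: "single u 1 \<in> spanned n k B ==> single u c \<in> spanned n k B"
 using spanned_scale[of "single u 1" n k B c] by simp

text \<open>The first cap has only cups below it, and cancelling it creates no new cap, so the
  number of caps decreases.\<close>

lemma crossingless_spanned:
 assumes "u \<in> tangles (2 * (n + k))" "\<forall>p\<in>set u. fst p = Cup \<or> fst p = Cap"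
 shows "single u 1 \<in> spanned n k (cup_tangles n k)"
 using assms
proof (induction "length (filter (\<lambda>p. fst p = Cap) u)" arbitrary: u)
 case 0
 then have "fst p = Cup" if "p \<in> set u" for p
  using that by (auto simp: filter_empty_conv)
 then have "cups (map snd u) = u"
  by (simp add: cups_def map_idI prod_eq_iff)
 then have "u \<in> cup_tangles n k" using 0 unfolding cup_tangles_def by (metis (mono_tags, lifting) mem_Collect_eq)
 then show ?case
  unfolding spanned_def by (intro CollectI exI[of _ "single u 1"]) auto
next
 case (Suc m)
 have "\<exists>p\<in>set u. fst p = Cap"
  using Suc.hyps(2) by (metis (mono_tags, lifting) Zero_not_Suc filter_False list.size(3))
 then obtain u1 p v where u: "u = u1 @ p # v" "fst p = Cap" "\<forall>p\<in>set u1. fst p \<noteq> Cap"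
  by (rule split_list_first_propE)
 obtain i where p: "p = (Cap, i)" using u(2) by (cases p) auto
 have "fst p = Cup" if "p \<in> set u1" for p
  using that u Suc.prems(2) by auto
 then have "cups (map snd u1) = u1"
  by (simp add: cups_def map_idI prod_eq_iff)
 then obtain c cs' where cs': "cups cs' @ v \<in> tangles (2 * (n + k))"
  "kl_equiv n k (single u 1) (single (cups cs' @ v) c)"
  using cap_cancel[of "map snd u1" i v n k] Suc.prems(1) u(1) p by auto
 have "filter (\<lambda>p. fst p = Cap) (cups cs') = []" by (auto simp: cups_def filter_empty_conv)
 moreover have "filter (\<lambda>p. fst p = Cap) u1 = []" using u(3) by (auto simp: filter_empty_conv)
 ultimately have "m = length (filter (\<lambda>p. fst p = Cap) (cups cs' @ v))"
  using Suc.hyps(2) u(1,2) by simp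
 moreover have "\<forall>p\<in>set (cups cs' @ v). fst p = Cup \<or> fst p = Cap"
  using Suc.prems(2) u(1) by (auto simp: cups_def)
 ultimately have "single (cups cs' @ v) 1 \<in> spanned n k (cup_tangles n k)"
  using Suc.hyps(1) cs'(1) by blast
 then show ?case using spanned_equiv[OF cs'(2)] spanned_mult by blast
qed

lemma tangle_spanned:
 assumes "u \<in> tangles (2 * (n + k))"
 shows "single u 1 \<in> spanned n k (cup_tangles n k)"
 using assms
proof (induction "length (filter (\<lambda>p. fst p = Pos \<or> fst p = Neg) u)" arbitrary: u)
 case 0
 then have "fst p = Cup \<or> fst p = Cap" if "p \<in> set u" for p
  using that by (cases "fst p") (auto simp: filter_empty_conv)
 then show ?case using crossingless_spanned[OF 0(2)] by blast
next
 case (Suc m)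
 have "\<exists>p\<in>set u. fst p = Pos \<or> fst p = Neg"
  using Suc.hyps(2) by (metis (mono_tags, lifting) Zero_not_Suc filter_False list.size(3))
 then obtain s i where si: "(s, i) \<in> set u" "s = Pos \<or> s = Neg" by auto
 obtain u1 v where "u = u1 @ (s, i) # v" using split_list[OF si(1)] by blast
 then have u: "u = u1 @ [(s, i)] @ v" "s = Pos \<or> s = Neg" using si(2) by simp_all
 note res = crossing_resolution_tangles[OF Suc.prems[unfolded u(1)] u(2)]
 have m: "m = length (filter (\<lambda>p. fst p = Pos \<or> fst p = Neg) (u1 @ v))"
  "m = length (filter (\<lambda>p. fst p = Pos \<or> fst p = Neg) (u1 @ [(Cap, i), (Cup, i)] @ v))"
  using Suc.hyps(2) u by auto
 note IH = Suc.hyps(1)[OF m(1) res(1)] Suc.hyps(1)[OF m(2) res(2)]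
 from u(2) show ?case
 proof
  assume s: "s = Pos"
  have "kl_equiv n k (single u 1) (single (u1 @ v) (qhalf_pow 1)
    + single (u1 @ [(Cap, i), (Cup, i)] @ v) (qhalf_pow (-1)))"
   unfolding kl_equiv_def u(1) s
   by (rule kernel_relation[OF kauffman_lins_relations.crossing_Pos[OF Suc.prems[unfolded u(1) s]]])
  then show ?thesis by (rule spanned_equiv[OF _ spanned_add[OF spanned_mult spanned_mult]]) (fact IH)+
 next
  assume s: "s = Neg"
  have "kl_equiv n k (single u 1) (single (u1 @ [(Cap, i), (Cup, i)] @ v) (qhalf_pow 1)
    + single (u1 @ v) (qhalf_pow (-1)))"
   unfolding kl_equiv_def u(1) s
   by (rule kernel_relation[OF kauffman_lins_relations.crossing_Neg[OF Suc.prems[unfolded u(1) s]]])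
  then show ?thesis by (rule spanned_equiv[OF _ spanned_add[OF spanned_mult spanned_mult]]) (fact IH)+
 qed
qed

section \<open>Matchings of cup diagrams\<close>

text \<open>The renumbering of old endpoints when a cup opens two new ones at \<open>i\<close> and
  \<open>i + 1\<close>.\<close>

definition skip :: "nat => nat => nat" where
 "skip i a = (if a < i then a else a + 2)"

definition insert_cup :: "nat => (nat \<times> nat) set => (nat \<times> nat) set" where
 "insert_cup i N = insert (i, Suc i) (map_prod (skip i) (skip i) ` N)"

definition cup_matching :: "nat list => (nat \<times> nat) set" where
 "cup_matching c = fold insert_cup c {}"

lemma cup_matching_snoc: "cup_matching (c @ [i]) = insert_cup i (cup_matching c)"
 by (simp add: cup_matching_def)

lemma cup_matching_Nil [simp]: "cup_matching [] = {}"
 by (simp add: cup_matching_def)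

lemma skip_inj: "skip i a = skip i b \<longleftrightarrow> a = b"
 by (auto simp: skip_def)

lemma skip_less: "skip i a < skip i b \<longleftrightarrow> a < b"
 by (auto simp: skip_def)

lemma skip_neq [simp]: "skip i a \<noteq> i" "skip i a \<noteq> Suc i" "i \<noteq> skip i a" "Suc i \<noteq> skip i a"
 by (auto simp: skip_def)

lemma skip_surj: "p \<noteq> i ==> p \<noteq> Suc i ==> \<exists>a. p = skip i a \<and> (i \<le> m \<longrightarrow> (a < m \<longleftrightarrow> p < m + 2))"
 by (rule exI[of _ "if p < i then p else p - 2"]) (auto simp: skip_def)

lemma inj_map_skip: "inj (map_prod (skip i) (skip i))"
 by (auto simp: inj_def skip_inj)

text \<open>The counterpart of \<open>crossingless_matching\<close> for the endpoints of tangles,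
  which are counted from 0.\<close>

definition perfect_matching :: "nat => (nat \<times> nat) set => bool" where
 "perfect_matching m N \<longleftrightarrow> (\<forall>(a, b)\<in>N. a < b \<and> b < m)
   \<and> (\<forall>p<m. \<exists>!x. x \<in> N \<and> (p = fst x \<or> p = snd x))
   \<and> (\<forall>(a, b)\<in>N. \<forall>(c, d)\<in>N. \<not> (a < c \<and> c < b \<and> b < d))"

lemma perfect_insert_cup:
 assumes "perfect_matching m N" "i \<le> m"
 shows "perfect_matching (m + 2) (insert_cup i N)"
 unfolding perfect_matching_def
proof (intro conjI allI impI)
 show "\<forall>(a, b)\<in>insert_cup i N. a < b \<and> b < m + 2"
  using assms by (fastforce simp: perfect_matching_def insert_cup_def skip_def)
 have arcs: "(c, d) \<in> insert_cup i N ==> (c, d) = (i, Suc i) \<or> (\<exists>a b. (a, b) \<in> N \<and> c = skip i a \<and> d = skip i b)" for c d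
  by (auto simp: insert_cup_def)
 have between: "\<not> (i < skip i a \<and> skip i a < Suc i)" "skip i a < i ==> i < skip i b ==> \<not> skip i b < Suc i" for a b
  by (auto simp: skip_def)
 show "\<forall>(a, b)\<in>insert_cup i N. \<forall>(c, d)\<in>insert_cup i N. \<not> (a < c \<and> c < b \<and> b < d)"
 proof (clarify)
  fix a b c d assume "(a, b) \<in> insert_cup i N" "(c, d) \<in> insert_cup i N" and abc: "a < c" "c < b" "b < d"
  then consider "(a, b) = (i, Suc i)" | "(c, d) = (i, Suc i)"
   | a' b' c' d' where "(a', b') \<in> N" "(c', d') \<in> N" "a = skip i a'" "b = skip i b'" "c = skip i c'" "d = skip i d'"
   using arcs by blast
  then show False
  proof cases
   case 3
   then show ?thesis using assms(1) abc by (auto simp: perfect_matching_def skip_less)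
  qed (use abc in auto)
 qed
 fix p assume p: "p < m + 2"
 show "\<exists>!x. x \<in> insert_cup i N \<and> (p = fst x \<or> p = snd x)"
 proof (cases "p = i \<or> p = Suc i")
  case True
  then show ?thesis by (intro ex1I[of _ "(i, Suc i)"]) (auto simp: insert_cup_def)
 next
  case False
  then obtain a where a: "p = skip i a" "a < m" using skip_surj[of p i m] p assms(2) by auto
  have "\<exists>!x. x \<in> N \<and> (a = fst x \<or> a = snd x)"
   using assms(1) a(2) unfolding perfect_matching_def by blast
  then obtain x where x: "x \<in> N" "a = fst x \<or> a = snd x" "\<And>y. y \<in> N ==> a = fst y \<or> a = snd y ==> y = x"
   unfolding Ex1_def by blast
  show ?thesis
  proof (rule ex1I[of _ "map_prod (skip i) (skip i) x"])
   show "map_prod (skip i) (skip i) x \<in> insert_cup i N \<and>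
    (p = fst (map_prod (skip i) (skip i) x) \<or> p = snd (map_prod (skip i) (skip i) x))"
    using x(1,2) a by (auto simp: insert_cup_def)
   fix y assume y: "y \<in> insert_cup i N \<and> (p = fst y \<or> p = snd y)"
   then obtain z where "z \<in> N" "y = map_prod (skip i) (skip i) z"
    using False by (auto simp: insert_cup_def)
   with y x(3)[of z] a(1) show "y = map_prod (skip i) (skip i) x" by (auto simp: skip_inj)
  qed
 qed
qed

lemma perfect_cup_matching: "cups c \<in> tangles m ==> perfect_matching m (cup_matching c)"
proof (induction c arbitrary: m rule: rev_induct)
 case Nil
 then show ?case by (simp add: tangles_def perfect_matching_def)
next
 case (snoc i c)
 then show ?case
  by (auto simp: cups_snoc_tangles cup_matching_snoc simp del: cups_simps(2) intro: perfect_insert_cup[simplified])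
qed

lemma finite_cup_matching [simp]: "finite (cup_matching c)"
 by (induction c rule: rev_induct) (simp_all add: cup_matching_snoc insert_cup_def)

lemma card_cup_matching: "card (cup_matching c) = length c"
proof (induction c rule: rev_induct)
 case (snoc i c)
 have "(i, Suc i) \<notin> map_prod (skip i) (skip i) ` cup_matching c" by auto
 then show ?case
  using snoc card_image[OF inj_on_subset[OF inj_map_skip[of i] subset_UNIV], of "cup_matching c"]
  by (simp add: cup_matching_snoc insert_cup_def)
qed simp

lemma nth_skip:
 assumes "length x = i"
 shows "(x @ c # d # y) ! skip i a = (x @ y) ! a"
 using assms by (auto simp: skip_def nth_append)

text \<open>Without caps and crossings no spin is summed over: the boundary word fixes the spins of
  all strands and the state sum is one product.\<close>

lemma state_sum_cups:
 assumes "cups c \<in> tangles m" "length w = m"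
 shows "state_sum (cups c) w = (\<Prod>(a, b)\<in>cup_matching c. cup_weight (w ! a) (w ! b))"
 using assms
proof (induction c arbitrary: m w rule: rev_induct)
 case Nil
 then show ?case by (simp add: tangles_def state_sum_Nil)
next
 case (snoc i c)
 then obtain m' where m': "m = m' + 2" "cups c \<in> tangles m'" "i \<le> m'"
  using cups_snoc_tangles by blast
 then have "i + 2 \<le> length w" using snoc.prems by simp
 then obtain x ab y where "w = x @ ab @ y" "length x = i" "length ab = 2" by (rule split_word)
 then obtain a b where w: "w = x @ a # b # y" "length x = i" by (auto simp: length_2)
 have notin: "(i, Suc i) \<notin> map_prod (skip i) (skip i) ` cup_matching c" by auto
 have "state_sum (cups (c @ [i])) w = cup_weight a b * state_sum (cups c) (x @ y)"
  using w by (simp add: state_sum_append apply_Cup)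
 also have "state_sum (cups c) (x @ y) = (\<Prod>(e, f)\<in>cup_matching c. cup_weight ((x @ y) ! e) ((x @ y) ! f))"
  using snoc.IH[OF m'(2)] w snoc.prems m'(1) by simp
 also have "\<dots> = (\<Prod>(e, f)\<in>map_prod (skip i) (skip i) ` cup_matching c. cup_weight (w ! e) (w ! f))"
  using w by (subst prod.reindex[OF inj_on_subset[OF inj_map_skip subset_UNIV]])
   (auto simp: nth_skip intro!: prod.cong)
 finally show ?case
  using w notin by (simp add: cup_matching_snoc insert_cup_def nth_append)
qed

lemma joined_in_slice_append: "joined_in_slice u p p' ==> joined_in_slice (u @ v) p p'"
proof (induction rule: joined_in_slice.induct)
 case (left l s i x)
 then show ?case using joined_in_slice.left[of l "u @ v" s i x] by (simp add: nth_append)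
next
 case (right l s i x)
 then show ?case using joined_in_slice.right[of l "u @ v" s i x] by (simp add: nth_append)
next
 case (Cup l i)
 then show ?case using joined_in_slice.Cup[of l "u @ v" i] by (simp add: nth_append)
next
 case (Cap l i)
 then show ?case using joined_in_slice.Cap[of l "u @ v" i] by (simp add: nth_append)
next
 case (rising l s i)
 then show ?case using joined_in_slice.rising[of l "u @ v" s i] by (simp add: nth_append)
next
 case (falling l s i)
 then show ?case using joined_in_slice.falling[of l "u @ v" s i] by (simp add: nth_append)
qed

lemma same_component_append: "same_component u p p' ==> same_component (u @ v) p p'"
 unfolding same_component_def
 by (induction rule: equivclp_induct) (auto dest: joined_in_slice_append[of _ _ _ v] intro: equivclp_into_equivclp)

lemma cup_matching_component:
 "(a, b) \<in> cup_matching c ==> same_component (cups c) (length c, a) (length c, b)"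
proof (induction c arbitrary: a b rule: rev_induct)
 case (snoc i c)
 have up: "same_component (cups (c @ [i])) (length c, x) (Suc (length c), skip i x)" for x
 proof -
  have "joined_in_slice (cups (c @ [i])) (length c, x) (Suc (length c), skip i x)"
  proof (cases "x < i")
   case True
   then show ?thesis
    using joined_in_slice.left[of "length c" "cups (c @ [i])" Cup i x] by (simp add: skip_def nth_append)
  next
   case False
   then show ?thesis
    using joined_in_slice.right[of "length c" "cups (c @ [i])" Cup i "x - i"] by (simp add: skip_def nth_append)
  qed
  then show ?thesis by (auto simp: same_component_def)
 qed
 show ?case
 proof (cases "(a, b) = (i, Suc i)")
  case True
  have "joined_in_slice (cups (c @ [i])) (Suc (length c), i) (Suc (length c), Suc i)"
   using joined_in_slice.Cup[of "length c" "cups (c @ [i])" i] by (simp add: nth_append)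
  then show ?thesis using True by (auto simp: same_component_def)
 next
  case False
  then obtain a' b' where ab: "(a', b') \<in> cup_matching c" "a = skip i a'" "b = skip i b'"
   using snoc.prems by (auto simp: cup_matching_snoc insert_cup_def)
  have "same_component (cups (c @ [i])) (length c, a') (length c, b')"
   using same_component_append[OF snoc.IH[OF ab(1)]] by simp
  then show ?thesis
   using up[of a'] up[of b'] ab(2,3) unfolding same_component_def
   by (simp del: cups_simps) (meson equivclp_sym equivclp_trans)
 qed
qed simp

lemma uncrossed_cups: "uncrossed (cups c) p"
 by (auto simp: uncrossed_def cups_def)

lemma projector_arc_kernel:
 assumes "cups c \<in> tangles (2 * (n + k))" "(a, b) \<in> cup_matching c" "a \<noteq> b"
  "{a, b} \<subseteq> left_projector n k \<or> {a, b} \<subseteq> right_projector n k"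
 shows "single (cups c) 1 \<in> kl_kernel n k"
proof (rule kernel_relation[OF kauffman_lins_relations.projector[OF assms(1)]])
 show "has_projector_arc n k (cups c)"
  unfolding has_projector_arc_def
  using assms(3,4) cup_matching_component[OF assms(2)] uncrossed_cups
  by (intro exI[of _ a] exI[of _ b]) simp
qed

text \<open>Generated by exchanges of distant cups alone. These already identify any two cup lists
  with the same matching, so crossingless diagrams without circles can be recognised by their
  matchings.\<close>

inductive cup_equiv :: "nat list => nat list => bool" where
 swap: "cup_equiv (u @ [i, i + 2 + j] @ v) (u @ [i + j, i] @ v)"
| cup_refl: "cup_equiv c c"
| cup_sym: "cup_equiv c d ==> cup_equiv d c"
| cup_trans: "cup_equiv c d ==> cup_equiv d e ==> cup_equiv c e"

lemma cup_equiv_append: "cup_equiv c d ==> cup_equiv (c @ e) (d @ e)"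
proof (induction rule: cup_equiv.induct)
 case (swap u i j v)
 show ?case using cup_equiv.swap[of u i j "v @ e"] by simp
qed (auto intro: cup_equiv.intros)

lemma cup_equiv_tangles: "cup_equiv c d ==> cups c \<in> tangles m \<longleftrightarrow> cups d \<in> tangles m"
proof (induction rule: cup_equiv.induct)
 case (swap u i j v)
 show ?case by (auto simp: tangles_append split: if_splits)
qed auto

lemma skip_skip: "skip (i + 2 + j) (skip i a) = skip i (skip (i + j) a)"
 by (auto simp: skip_def)

lemma cup_equiv_matching: "cup_equiv c d ==> cup_matching c = cup_matching d"
proof (induction rule: cup_equiv.induct)
 case (swap u i j v)
 have "insert_cup (i + 2 + j) (insert_cup i N) = insert_cup i (insert_cup (i + j) N)" for N
 proof -
  have "(\<lambda>x. map_prod (skip (i + 2 + j)) (skip (i + 2 + j)) (map_prod (skip i) (skip i) x)) ` N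
    = (\<lambda>x. map_prod (skip i) (skip i) (map_prod (skip (i + j)) (skip (i + j)) x)) ` N"
   by (rule image_cong) (auto simp only: map_prod_simp skip_skip)
  moreover have "skip (i + 2 + j) i = i" "skip (i + 2 + j) (Suc i) = Suc i"
    "skip i (i + j) = i + 2 + j" "skip i (Suc (i + j)) = Suc (i + 2 + j)"
   by (auto simp: skip_def)
  ultimately show ?thesis
   by (simp only: insert_cup_def image_insert image_image map_prod_simp insert_commute)
 qed
 then show ?case by (simp add: cup_matching_def)
qed auto

lemma cup_equiv_kl:
 "cup_equiv c d ==> cups c \<in> tangles (2 * (n + k)) ==>
  kl_equiv n k (single (cups c) 1) (single (cups d) 1)"
proof (induction rule: cup_equiv.induct)
 case (swap u i j v)
 have m: "regular_move [(Cup, i), (Cup, i + 2 + j)] [(Cup, i + j), (Cup, i)]"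
  using regular_move.exchange[of Cup i Cup j] by simp
 have w: "top_width w [(Cup, i + j), (Cup, i)] = Some w'" if "top_width w [(Cup, i), (Cup, i + 2 + j)] = Some w'" for w w'
  using that by (auto split: if_splits)
 show ?case
  using isotopy_equiv[OF m, of "cups u" "cups v" n k, OF _ w] swap.prems by simp
next
 case (cup_sym c d)
 then show ?case using kl_equiv_sym cup_equiv_tangles by blast
next
 case (cup_trans c d e)
 then show ?case using kl_equiv_trans cup_equiv_tangles by blast
qed simp

text \<open>The ends of the arc are still neighbours at the top, so a cup added after it was not
  inserted between them; it lies apart and the two can be exchanged.\<close>

lemma short_arc_last:
 assumes "cups c \<in> tangles m" "(i, Suc i) \<in> cup_matching c"
 shows "\<exists>d. cup_equiv c (d @ [i])"
 using assms
proof (induction c arbitrary: m i rule: rev_induct)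
 case (snoc j c)
 obtain m' where m': "cups c \<in> tangles m'" using snoc.prems(1) cups_snoc_tangles by blast
 show ?case
 proof (cases "j = i")
  case True
  then show ?thesis using cup_equiv.cup_refl by blast
 next
  case False
  then obtain a b where ab: "(a, b) \<in> cup_matching c" "i = skip j a" "Suc i = skip j b"
   using snoc.prems(2) by (auto simp: cup_matching_snoc insert_cup_def)
  have b: "b = Suc a" using ab(2,3) by (auto simp: skip_def split: if_splits)
  obtain d where d: "cup_equiv (c @ [j]) (d @ [a, j])"
   using snoc.IH[OF m' ab(1)[unfolded b]] cup_equiv_append[of c _ "[j]"] by fastforce
  show ?thesis
  proof (cases "a < j")
   case True
   then have "a = i" "i + 2 \<le> j" using ab(2,3) b by (auto simp: skip_def split: if_splits)
   then obtain e where "j = i + 2 + e" by (metis le_add_diff_inverse)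
   then have "cup_equiv (d @ [a, j]) ((d @ [i + e]) @ [i])"
    using cup_equiv.swap[of d i e "[]"] \<open>a = i\<close> by simp
   then show ?thesis using d cup_equiv.cup_trans by blast
  next
   case False
   then obtain e where e: "a = j + e" by (metis le_add_diff_inverse not_less)
   then have "cup_equiv (d @ [a, j]) ((d @ [j]) @ [i])"
    using cup_equiv.cup_sym[OF cup_equiv.swap[of d j e "[]"]] ab(2) by (simp add: skip_def)
   then show ?thesis using d cup_equiv.cup_trans by blast
  qed
 qed
qed simp

text \<open>The last cup of \<open>d\<close> is a short arc of the common matching. Moving it to the
  end of \<open>c\<close> too and removing it from both leaves a smaller instance.\<close>

lemma cup_equivI:
 assumes "cups c \<in> tangles m" "cups d \<in> tangles m" "cup_matching c = cup_matching d"
 shows "cup_equiv c d"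
 using assms
proof (induction d arbitrary: c m rule: rev_induct)
 case Nil
 then have "length c = 0" using card_cup_matching[of c] by simp
 then show ?case by (simp add: cup_equiv.cup_refl)
next
 case (snoc i d)
 obtain c' where c': "cup_equiv c (c' @ [i])"
  using short_arc_last[OF snoc.prems(1), of i] snoc.prems(3) by (auto simp: cup_matching_snoc insert_cup_def)
 then have "cups (c' @ [i]) \<in> tangles m" "cup_matching (c' @ [i]) = cup_matching (d @ [i])"
  using cup_equiv_tangles cup_equiv_matching snoc.prems by auto
 moreover have "map_prod (skip i) (skip i) ` N = insert_cup i N - {(i, Suc i)}" for N
  by (auto simp: insert_cup_def)
 ultimately have "map_prod (skip i) (skip i) ` cup_matching c' = map_prod (skip i) (skip i) ` cup_matching d"
  by (simp add: cup_matching_snoc)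
 then have "cup_matching c' = cup_matching d"
  using inj_image_eq_iff[OF inj_map_skip] by blast
 moreover obtain m' where "cups c' \<in> tangles m'" "cups d \<in> tangles m'"
  using \<open>cups (c' @ [i]) \<in> tangles m\<close> snoc.prems(2) cups_snoc_tangles by (metis add_right_cancel)
 ultimately have "cup_equiv c' d" using snoc.IH by blast
 then show ?case using c' cup_equiv_append cup_equiv.cup_trans by blast
qed

text \<open>A cup joins neighbours, so everything that an arc encloses is added after it. The
  outermost arc thus comes first and the remaining cups form a shifted diagram.\<close>

lemma outer_arc_first:
 assumes "cups c \<in> tangles (Suc (Suc m))" "(0, Suc m) \<in> cup_matching c"
 shows "\<exists>d. cup_equiv c (0 # map Suc d) \<and> cups d \<in> tangles m"
 using assms
proof (induction c arbitrary: m rule: rev_induct)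
 case (snoc i c)
 then have c: "cups c \<in> tangles m" "i \<le> m" using cups_snoc_tangles[of c i "Suc (Suc m)"] by auto
 show ?case
 proof (cases "i = 0 \<and> m = 0")
  case True
  then have "c = []" using cups_tangles_width[OF c(1)] by simp
  then show ?thesis using True by (intro exI[of _ "[]"]) (auto intro: cup_equiv.cup_refl simp: tangles_def)
 next
  case False
  then obtain a b where ab: "(a, b) \<in> cup_matching c" "skip i a = 0" "skip i b = Suc m"
   using snoc.prems(2) c(2) by (auto simp: cup_matching_snoc insert_cup_def)
  then have "a = 0" "0 < i" "b < m" using perfect_cup_matching[OF c(1)]
   by (auto simp: skip_def perfect_matching_def split: if_splits)
  moreover have "Suc (Suc b) = Suc m" "i \<le> b" using ab(3) \<open>b < m\<close> c(2) by (auto simp: skip_def split: if_splits)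
  moreover define m' where "m' = m - 2"
  ultimately have m': "m = Suc (Suc m')" "b = Suc m'" "i \<le> Suc m'" by auto
  obtain d where d: "cup_equiv c (0 # map Suc d)" "cups d \<in> tangles m'"
   using snoc.IH[of m'] c(1) ab(1) m' \<open>a = 0\<close> by auto
  have "cup_equiv (c @ [i]) (0 # map Suc (d @ [i - 1]))"
   using cup_equiv_append[OF d(1), of "[i]"] \<open>0 < i\<close> by simp
  moreover have "cups (d @ [i - 1]) \<in> tangles m"
   using d(2) m' \<open>0 < i\<close> by (auto simp: tangles_append)
  ultimately show ?thesis by blast
 qed
qed simp

lemma outer_arc_kernel:
 assumes "cups c \<in> tangles (2 * (n + Suc k))" "(0, 2 * (n + Suc k) - 1) \<in> cup_matching c"
 shows "single (cups c) 1 \<in> kl_kernel n (Suc k)"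
proof -
 obtain d where d: "cup_equiv c (0 # map Suc d)" "cups d \<in> tangles (2 * (n + k))"
  using outer_arc_first[of c "2 * (n + k)"] assms by auto
 have "cups (0 # map Suc d) = add_outer_arc (cups d)"
  by (simp add: add_outer_arc_def cups_def)
 then have "single (cups (0 # map Suc d)) 1 \<in> kl_kernel n (Suc k)"
  using kernel_outer[OF d(2)] by simp
 then show ?thesis
  using cup_equiv_kl[OF d(1) assms(1)] kl_kernel_closed(3) unfolding kl_equiv_def
  by (metis diff_add_cancel)
qed

section \<open>Arc operators\<close>

type_synonym lpoly = "laurent poly"

abbreviation xx :: lpoly where "xx \<equiv> [:0, 1:]"
abbreviation qq :: lpoly where "qq \<equiv> [:qhalf_pow 2:]"
abbreviation qi :: lpoly where "qi \<equiv> [:qhalf_pow (-2):]"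

definition dilate :: "laurent => lpoly => lpoly" where
 "dilate c P = pcompose P [:0, c:]"

abbreviation "Pq \<equiv> dilate (qhalf_pow 2)"
abbreviation "Pqi \<equiv> dilate (qhalf_pow (-2))"

lemma qq_qi: "qq * qi = 1"
 by (simp add: one_pCons)

lemma dilate_simps:
 "dilate c (P + Q) = dilate c P + dilate c Q" "dilate c (P - Q) = dilate c P - dilate c Q"
 "dilate c (P * Q) = dilate c P * dilate c Q" "dilate c (- P) = - dilate c P"
 "dilate c [:d:] = [:d:]" "dilate c 0 = 0" "dilate c 1 = 1" "dilate c (smult d P) = smult d (dilate c P)"
 by (simp_all add: dilate_def pcompose_add pcompose_diff pcompose_mult pcompose_uminus pcompose_pCons pcompose_smult pcompose_1)

lemma dilate_X: "dilate c xx = [:c:] * xx"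
 by (simp add: dilate_def pcompose_pCons)

lemma dilate_dilate: "dilate c (dilate d P) = dilate (c * d) P"
 by (simp add: dilate_def pcompose_pCons mult.commute flip: pcompose_assoc)

lemma dilate_1_left: "dilate 1 P = P"
 by (simp add: dilate_def)

lemma coeff_dilate_0 [simp]: "coeff (dilate c P) 0 = coeff P 0"
 by (induction P) (simp_all add: dilate_def pcompose_pCons)

lemma Pq_Pqi [simp]: "Pq (Pqi P) = P" "Pqi (Pq P) = P"
 by (simp_all add: dilate_dilate dilate_1_left)

text \<open>On constants this is multiplication by \<open>cup_weight\<close>. In general the
  polynomial P(X) becomes P(qX), or -q^(-1) P(q^(-1) X), or a q-difference quotient when both spins
  are down; these are the rules by which powers of a spin flip meet the two ends of an arc. The
  quotient is a polynomial because P(qX) and P(q^(-1) X) have the same constant term.\<close>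

definition plain_arc :: "bool => bool => lpoly => lpoly" where
 "plain_arc a b P = (if a then (if b then 0 else Pq P)
   else if b then - qi * Pqi P else qi * poly_shift 1 (Pq P - Pqi P))"

text \<open>A dotted arc demands a down spin at its left end. An up spin at its right end has to be
  paid for by one flip further out, hence the factor \<open>xx\<close>.\<close>

definition dotted_arc :: "bool => bool => lpoly => lpoly" where
 "dotted_arc a b P = (if a then 0 else if b then xx * Pqi P else Pqi P)"

lemma X_poly_shift: "coeff P 0 = 0 ==> xx * poly_shift 1 P = P"
 by (rule poly_eqI) (auto simp: coeff_poly_shift coeff_pCons split: nat.split)

lemma X_cancel: "xx * P = xx * Q ==> P = Q"
 using mult_left_cancel[of xx P Q] by simp

text \<open>Indicators of the two spins, used to write all spin cases of an arc operator as a single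
  polynomial expression.\<close>

definition minus_ind :: "bool => lpoly" where "minus_ind a = (if a then 0 else 1)"
definition plus_ind :: "bool => lpoly" where "plus_ind a = (if a then 1 else 0)"

lemma dilate_ind [simp]: "dilate c (minus_ind a) = minus_ind a" "dilate c (plus_ind a) = plus_ind a"
 by (simp_all add: minus_ind_def plus_ind_def dilate_simps)

text \<open>Multiplication by the variable clears the q-difference quotient and leaves a commutative
  expression in dilations and indicators. Operator identities are proved in this form, and the
  variable is cancelled afterwards.\<close>

lemma X_plain_arc:
 "xx * plain_arc a b P = qi * ((minus_ind a + qq * xx * plus_ind a) * Pq P * minus_ind b
   - minus_ind a * Pqi P * (minus_ind b + xx * plus_ind b))"
proof -
 have shift: "xx * poly_shift 1 (Pq P - Pqi P) = Pq P - Pqi P"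
  by (rule X_poly_shift) (simp only: coeff_diff coeff_dilate_0 diff_self)
 have q: "qi * (qq * y) = y" for y
  using qq_qi by (simp only: mult.assoc[symmetric] mult.commute[of qi qq] mult_1_left)
 have q': "qi * (xx * (qq * y)) = xx * y" for y
  by (simp only: mult.left_commute[of xx qq] q)
 show ?thesis
  by (cases a; cases b)
   (simp_all only: plain_arc_def minus_ind_def plus_ind_def if_True if_False mult_zero_left mult_zero_right
    mult_1_left mult_1_right add_0_left add_0_right diff_0 diff_0_right mult_minus_left mult_minus_right
    mult.left_commute[of xx qi] shift q q' mult.assoc minus_zero mult.commute[of _ xx])
qed

lemma dotted_arc_eq: "dotted_arc a b P = minus_ind a * Pqi P * (minus_ind b + xx * plus_ind b)"
 by (cases a; cases b)
  (simp_all only: dotted_arc_def minus_ind_def plus_ind_def if_True if_False mult_zero_left mult_zero_right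
    mult_1_left mult_1_right add_0_left add_0_right mult.commute[of _ xx])

lemma plain_arc_linear:
 "plain_arc a b (P + Q) = plain_arc a b P + plain_arc a b Q"
 "plain_arc a b ([:c:] * P) = [:c:] * plain_arc a b P"
 by (rule X_cancel, simp only: distrib_left mult.left_commute[of xx "[:c:]"] X_plain_arc dilate_simps,
   simp only: algebra_simps)+

lemma dotted_arc_linear:
 "dotted_arc a b (P + Q) = dotted_arc a b P + dotted_arc a b Q"
 "dotted_arc a b ([:c:] * P) = [:c:] * dotted_arc a b P"
 unfolding dotted_arc_eq dilate_simps by (simp_all only: algebra_simps)

lemma dotted_arc_X: "dotted_arc a b (xx * P) = qi * xx * dotted_arc a b P"
 unfolding dotted_arc_eq dilate_simps dilate_X by (simp only: algebra_simps)

lemma plain_arc_X_identity: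
 fixes x qq qi :: "'a::idom"
 assumes "qq * qi = 1"
 shows "qi * ((ma + qq * x * pa) * (qq * x * Pp) * mb - ma * (qi * x * Pm) * (mb + x * pb)) =
  x * ((1 - qi * qi) * (ma * Pm * (mb + x * pb))) + qq * x * (qi * ((ma + qq * x * pa) * Pp * mb - ma * Pm * (mb + x * pb)))"
proof -
 have q: "qi * (qq * y) = y" for y
  using assms by (metis mult.assoc mult.commute mult_1)
 show ?thesis by (simp only: algebra_simps mult_1_left mult_1_right) (simp only: q add_ac)
qed

text \<open>A Leibniz rule for the q-difference quotient. Its defect is the same arc with a dot,
  which is the origin of the coefficient 1 - q^(-2) in both relations.\<close>

lemma plain_arc_X: "plain_arc a b (xx * P) = (1 - qi * qi) * dotted_arc a b P + qq * xx * plain_arc a b P"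
proof (rule X_cancel)
 have expand: "xx * ((1 - qi * qi) * dotted_arc a b P + qq * xx * plain_arc a b P) =
   xx * ((1 - qi * qi) * dotted_arc a b P) + qq * xx * (xx * plain_arc a b P)"
  by (simp only: distrib_left mult.left_commute mult.assoc)
 show "xx * plain_arc a b (xx * P) = xx * ((1 - qi * qi) * dotted_arc a b P + qq * xx * plain_arc a b P)"
  unfolding expand unfolding X_plain_arc dotted_arc_eq dilate_simps dilate_X
  by (rule plain_arc_X_identity[OF qq_qi])
qed

lemma X_Pqi_identity:
 fixes qq qi :: "'a::idom"
 assumes "qq * qi = 1" "qi * (x * p) = qi * ((mb + qq * (qi * x) * pb) * B * mc - mb * B2 * (mc + qi * x * pc))"
 shows "x * p = (mb + x * pb) * B * mc - mb * B2 * (mc + qi * x * pc)"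
proof -
 have q: "qq * (qi * y) = y" for y
  using assms(1) by (simp flip: mult.assoc)
 have "qq * (qi * (x * p)) = qq * (qi * ((mb + qq * (qi * x) * pb) * B * mc - mb * B2 * (mc + qi * x * pc)))"
  by (simp only: assms(2))
 then show ?thesis by (simp only: q)
qed

lemma X_Pqi_plain_arc:
 "xx * Pqi (plain_arc b c B) = (minus_ind b + xx * plus_ind b) * B * minus_ind c
   - minus_ind b * Pqi (Pqi B) * (minus_ind c + qi * xx * plus_ind c)"
proof -
 have "qi * (xx * Pqi (plain_arc b c B)) = Pqi (xx * plain_arc b c B)"
  by (simp only: dilate_simps dilate_X mult.assoc)
 then show ?thesis
  unfolding X_plain_arc dilate_simps dilate_X dilate_ind Pq_Pqi by (rule X_Pqi_identity[OF qq_qi])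
qed

text \<open>The local Type I identity multiplied by the square of the variable. Dilated polynomials
  and indicators are treated as independent unknowns, so that the claim becomes a polynomial
  identity modulo \<open>qq * qi = 1\<close>.\<close>

lemma type_I_identity:
 fixes x qq qi :: "'a::idom"
 assumes "qq * qi = 1"
  and "x * p = (mb + x * pb) * B * mc - mb * B2 * (mc + qi * x * pc)"
  and "U = qi * ((ma + qq * x * pa) * (Ap * (mb * B * (mc + qq * x * pc)) * Cp) * md
   - ma * (Am * (mb * B2 * (mc + qi * x * pc)) * Cm) * (md + x * pd))"
  and "V = qi * ((ma + qq * x * pa) * Ap * mb - ma * Am * (mb + x * pb))"
  and "W = qi * ((mc + qq * x * pc) * Cp * md - mc * Cm * (md + x * pd))"
 shows "x * U = x * (ma * Am * (mb + x * pb) * B * W + V * B * (mc * Cm * (md + x * pd)))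
  + qi * x * (ma * (Am * (x * p) * Cm) * (md + x * pd)) + qq * x * (V * B * W)"
 unfolding assms(2-5) using assms(1) by Groebner_Basis.algebra

text \<open>Type I with all surroundings stripped off; \<open>A\<close>, \<open>B\<close> and
  \<open>C\<close> are the polynomials of the three gaps between the four points. The last summand
  still carries the variable, and moving it outwards will produce the sum over the surrounding
  arcs.\<close>

lemma type_I_local:
 "plain_arc a d (A * dotted_arc b c B * C) =
   dotted_arc a b A * B * plain_arc c d C + plain_arc a b A * B * dotted_arc c d C
   + qi * dotted_arc a d (A * plain_arc b c B * C)
   + qq * (xx * (plain_arc a b A * B * plain_arc c d C))" (is "?l = ?r")
proof -
 have "xx * (xx * plain_arc a d (A * dotted_arc b c B * C)) =
   xx * (dotted_arc a b A * B * (xx * plain_arc c d C) + (xx * plain_arc a b A) * B * dotted_arc c d C)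
   + qi * xx * (minus_ind a * (Pqi A * (xx * Pqi (plain_arc b c B)) * Pqi C) * (minus_ind d + xx * plus_ind d))
   + qq * xx * ((xx * plain_arc a b A) * B * (xx * plain_arc c d C))"
  unfolding dotted_arc_eq
  by (rule type_I_identity[OF qq_qi X_Pqi_plain_arc _ X_plain_arc X_plain_arc])
   (simp only: X_plain_arc dilate_simps dilate_X dilate_ind Pq_Pqi)
 also have "\<dots> = xx * (xx * ?r)"
  unfolding dotted_arc_eq[of a d] dilate_simps by (simp only: algebra_simps)
 finally show ?thesis by (intro X_cancel[of ?l ?r] X_cancel[of "xx * ?l"])
qed

text \<open>In contrast to Type I no factor \<open>qq\<close> precedes the variable, which is why
  the exponents of q in Type II are smaller by one.\<close>

lemma type_II_local:
 "dotted_arc a b A * B * dotted_arc c d C =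
   dotted_arc a d (A * dotted_arc b c B * C) + xx * dotted_arc a d (A * plain_arc b c B * C)"
proof -
 have "xx * dotted_arc a d (A * plain_arc b c B * C) =
   minus_ind a * (Pqi A * (xx * Pqi (plain_arc b c B)) * Pqi C) * (minus_ind d + xx * plus_ind d)"
  unfolding dotted_arc_eq[of a d] dilate_simps by (simp only: algebra_simps)
 then show ?thesis
  unfolding X_Pqi_plain_arc dotted_arc_eq dilate_simps dilate_X dilate_ind by (simp only: algebra_simps)
qed

section \<open>Intervals of a matching\<close>

text \<open>Intervals are half open: the points \<open>s\<close> to \<open>t - 1\<close> are matched
  among themselves.\<close>

definition closed_interval :: "arc set => nat => nat => bool" where
 "closed_interval M s t \<longleftrightarrow> (\<forall>x\<in>M. s \<le> fst x \<and> fst x < t \<longleftrightarrow> s \<le> snd x \<and> snd x < t)"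

definition mate :: "arc set => nat => nat" where
 "mate M s = (THE r. (s, r) \<in> M)"

locale matching =
 fixes n :: nat and M :: "arc set"
 assumes crossingless: "crossingless_matching n M"
begin

lemma arc_bounds: "(a, b) \<in> M ==> 1 \<le> a \<and> a < b \<and> b \<le> 2 * n"
 using crossingless unfolding crossingless_matching_def by blast

lemma arc_unique:
 assumes "x \<in> M" "y \<in> M" "p = fst x \<or> p = snd x" "p = fst y \<or> p = snd y"
 shows "x = y"
proof -
 have "1 \<le> p \<and> p \<le> 2 * n" using arc_bounds[of "fst x" "snd x"] assms by auto
 then have "\<exists>!x. x \<in> M \<and> (p = fst x \<or> p = snd x)"
  using crossingless unfolding crossingless_matching_def by auto
 then show ?thesis using assms by blast
qed

lemma arc_exists: "1 \<le> p ==> p \<le> 2 * n ==> \<exists>x\<in>M. p = fst x \<or> p = snd x"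
 using crossingless unfolding crossingless_matching_def by (meson atLeastAtMost_iff ex1_implies_ex)

lemma no_crossing: "(a, b) \<in> M ==> (c, d) \<in> M ==> a < c ==> c < b ==> b < d ==> False"
 using crossingless unfolding crossingless_matching_def by blast

lemma mate_eq: "(s, r) \<in> M ==> mate M s = r"
 unfolding mate_def
proof (rule the_equality)
 fix r' assume "(s, r) \<in> M" "(s, r') \<in> M"
 then show "r' = r" using arc_unique[of "(s, r')" "(s, r)" s] by simp
qed

lemma arc_cases:
 assumes "(a, b) \<in> M" "(s, r) \<in> M"
 shows "(a, b) = (s, r) \<or> b < s \<or> r < a \<or> (s < a \<and> b < r) \<or> (a < s \<and> r < b)"
proof (cases "(a, b) = (s, r)")
 case False
 have ne: "a \<noteq> s" "a \<noteq> r" "b \<noteq> s" "b \<noteq> r"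
  using arc_unique[OF assms, of s] arc_unique[OF assms, of r] False by force+
 have nc: "\<not> (a < s \<and> s < b \<and> b < r)" "\<not> (s < a \<and> a < r \<and> r < b)"
  using no_crossing[OF assms] no_crossing[OF assms(2,1)] by blast+
 have "a < b" "s < r" using arc_bounds[OF assms(1)] arc_bounds[OF assms(2)] by blast+
 then have "b < s \<or> r < a \<or> (s < a \<and> b < r) \<or> (a < s \<and> r < b)"
  using ne nc by presburger
 then show ?thesis by blast
qed simp

lemma finite_arcs: "finite M"
proof (rule finite_subset)
 show "M \<subseteq> {1..2 * n} \<times> {1..2 * n}" using arc_bounds by fastforce
qed simp

lemma closed_interval_whole: "closed_interval M 1 (2 * n + 1)"
 using arc_bounds by (fastforce simp: closed_interval_def)

lemma closed_interval_first:
 assumes "closed_interval M s t" "1 \<le> s" "s < t" "t \<le> 2 * n + 1"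
 obtains r where "(s, r) \<in> M" "s < r" "r < t" "closed_interval M (Suc s) r" "closed_interval M (Suc r) t"
  "mate M s = r"
proof -
 obtain x where x: "x \<in> M" "s = fst x \<or> s = snd x" using arc_exists[of s] assms by auto
 then have "s \<le> fst x \<and> fst x < t \<and> snd x < t" "fst x < snd x"
  using assms(1,3) arc_bounds[of "fst x" "snd x"] unfolding closed_interval_def by auto
 then obtain r where r: "(s, r) \<in> M" "s < r" "r < t" using x by (cases x) auto
 have "closed_interval M (Suc s) r"
  unfolding closed_interval_def
 proof
  fix x assume "x \<in> M"
  then show "(Suc s \<le> fst x \<and> fst x < r) = (Suc s \<le> snd x \<and> snd x < r)"
   using arc_cases[of "fst x" "snd x" s r] arc_bounds[of "fst x" "snd x"] r by auto
 qed
 moreover have "closed_interval M (Suc r) t"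
  unfolding closed_interval_def
 proof
  fix x assume x: "x \<in> M"
  then have "(s \<le> fst x \<and> fst x < t) = (s \<le> snd x \<and> snd x < t)"
   using assms(1) by (simp add: closed_interval_def)
  then show "(Suc r \<le> fst x \<and> fst x < t) = (Suc r \<le> snd x \<and> snd x < t)"
   using arc_cases[of "fst x" "snd x" s r] arc_bounds[of "fst x" "snd x"] r x by auto
 qed
 ultimately show thesis using that r mate_eq by blast
qed

text \<open>Peeling off the arc at the first point leaves two smaller closed intervals, its interior
  and what follows it. This mirrors the recursion of \<open>transfer\<close>.\<close>

lemma interval_induct [consumes 4, case_names empty arc]:
 assumes "closed_interval M s t" "1 \<le> s" "s \<le> t" "t \<le> 2 * n + 1"
  and "\<And>s. P s s"
  and "\<And>s r t. \<lbrakk>(s, r) \<in> M; s < r; r < t; 1 \<le> s; t \<le> 2 * n + 1; mate M s = r; closed_interval M s t;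
   closed_interval M (Suc s) r; closed_interval M (Suc r) t; P (Suc s) r; P (Suc r) t\<rbrakk> \<Longrightarrow> P s t"
 shows "P s t"
 using assms(1-4)
proof (induction "t - s" arbitrary: s t rule: less_induct)
 case less
 show ?case
 proof (cases "s = t")
  case True
  then show ?thesis using assms(5) by simp
 next
  case False
  then obtain r where "(s, r) \<in> M" "s < r" "r < t" "closed_interval M (Suc s) r" "closed_interval M (Suc r) t"
   "mate M s = r"
   using closed_interval_first[OF less.prems(1)] less.prems by (metis le_neq_implies_less)
  then show ?thesis
   using less by (intro assms(6)[of s r t]) auto
 qed
qed

end

lemma arc_op_linear:
 "(if b then dotted_arc else plain_arc) x y (P + Q)
   = (if b then dotted_arc else plain_arc) x y P + (if b then dotted_arc else plain_arc) x y Q"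
 "(if b then dotted_arc else plain_arc) x y ([:c:] * P) = [:c:] * (if b then dotted_arc else plain_arc) x y P"
 by (cases b; simp only: if_True if_False plain_arc_linear dotted_arc_linear)+

text \<open>The state polynomial of an interval: a product over its outermost arcs, each operator
  being applied to the polynomial of its interior. The guard secures termination; it holds for every
  nonempty closed interval of a matching.\<close>

function transfer :: "arc set => arc set => (nat => bool) => nat => nat => lpoly" where
 "transfer M D S s t = (if s < mate M s \<and> mate M s < t then
   (if (s, mate M s) \<in> D then dotted_arc else plain_arc) (S s) (S (mate M s))
    (transfer M D S (Suc s) (mate M s)) * transfer M D S (Suc (mate M s)) t
   else 1)"
 by pat_completeness auto
termination by (relation "Wellfounded.measure (\<lambda>(M, D, S, s, t). t - s)") auto

declare transfer.simps [simp del]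

context
 fixes M D :: "arc set" and S :: "nat => bool" and a d :: nat and P :: lpoly
begin

text \<open>The state polynomial of an interval in which the points from \<open>a\<close> to
  \<open>d\<close> are cut out and replaced by \<open>P\<close>. A relation changes only
  \<open>P\<close>, so linearity in \<open>P\<close> carries local identities to whole
  diagrams.\<close>

function context_transfer :: "nat => nat => lpoly" where
 "context_transfer s t = (if s < a \<and> s < mate M s \<and> mate M s < t then
   (if mate M s < a
   then (if (s, mate M s) \<in> D then dotted_arc else plain_arc) (S s) (S (mate M s))
     (transfer M D S (Suc s) (mate M s)) * context_transfer (Suc (mate M s)) t
   else (if (s, mate M s) \<in> D then dotted_arc else plain_arc) (S s) (S (mate M s))
     (context_transfer (Suc s) (mate M s)) * transfer M D S (Suc (mate M s)) t)
   else P * transfer M D S (Suc d) t)"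
 by pat_completeness auto
termination by (relation "Wellfounded.measure (\<lambda>(s, t). t - s)") auto

end

declare context_transfer.simps [simp del]

lemma transfer_empty [simp]: "transfer M D S s s = 1"
 by (subst transfer.simps, rule if_not_P) linarith

lemma (in matching) transfer_arc:
 "(s, r) \<in> M ==> r < t ==> transfer M D S s t =
   (if (s, r) \<in> D then dotted_arc else plain_arc) (S s) (S r) (transfer M D S (Suc s) r) * transfer M D S (Suc r) t"
 using arc_bounds[of s r] by (subst transfer.simps) (simp add: mate_eq)

definition inner :: "nat => nat => arc => bool" where
 "inner s t x \<longleftrightarrow> s \<le> fst x \<and> fst x < t"

lemma transfer_cong:
 assumes "matching n M" "matching n M'" "closed_interval M s t" "1 \<le> s" "s \<le> t" "t \<le> 2 * n + 1"
  and "\<And>x. inner s t x ==> (x \<in> M \<longleftrightarrow> x \<in> M') \<and> (x \<in> M \<longrightarrow> (x \<in> D \<longleftrightarrow> x \<in> D'))"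
 shows "transfer M D S s t = transfer M' D' S s t"
proof -
 interpret M: matching n M by fact
 interpret M': matching n M' by fact
 show ?thesis using assms(3-7)
 proof (induction rule: M.interval_induct)
  case (arc s r t)
  then have "(s, r) \<in> M'" "(s, r) \<in> D \<longleftrightarrow> (s, r) \<in> D'" by (auto simp: inner_def)
  moreover have "transfer M D S (Suc s) r = transfer M' D' S (Suc s) r"
   "transfer M D S (Suc r) t = transfer M' D' S (Suc r) t"
   using arc by (auto simp: inner_def)
  ultimately show ?case using arc by (simp add: M.transfer_arc M'.transfer_arc)
 qed simp
qed

locale matching_context = matching +
 fixes a d :: nat
 assumes inner_closed: "closed_interval M a (Suc d)" and bounds: "1 \<le> a" "a \<le> d" "d \<le> 2 * n"
begin

text \<open>The hole is at the start of the interval, behind the first arc, or inside it.\<close>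

lemma context_induct [consumes 4, case_names base left around]:
 assumes "closed_interval M s t" "1 \<le> s" "s \<le> a" "d < t \<and> t \<le> 2 * n + 1"
  and "\<And>t. \<lbrakk>d < t; t \<le> 2 * n + 1; closed_interval M a t; closed_interval M (Suc d) t\<rbrakk> \<Longrightarrow> P a t"
  and "\<And>s r t. \<lbrakk>(s, r) \<in> M; s < r; r < a; d < t; 1 \<le> s; t \<le> 2 * n + 1; closed_interval M s t;
   closed_interval M (Suc s) r; closed_interval M (Suc r) t; P (Suc r) t\<rbrakk> \<Longrightarrow> P s t"
  and "\<And>s r t. \<lbrakk>(s, r) \<in> M; s < a; d < r; r < t; 1 \<le> s; t \<le> 2 * n + 1; closed_interval M s t;
   closed_interval M (Suc s) r; closed_interval M (Suc r) t; P (Suc s) r\<rbrakk> \<Longrightarrow> P s t"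
 shows "P s t"
 using assms(1-4)
proof (induction "t - s" arbitrary: s t rule: less_induct)
 case less
 show ?case
 proof (cases "s = a")
  case True
  have "closed_interval M (Suc d) t"
   unfolding closed_interval_def
  proof
   fix x assume "x \<in> M"
   then show "(Suc d \<le> fst x \<and> fst x < t) = (Suc d \<le> snd x \<and> snd x < t)"
    using less.prems(1) inner_closed True bounds less.prems(4)
    unfolding closed_interval_def by (metis Suc_leI le_trans not_less not_less_eq_eq le_SucI)
  qed
  then show ?thesis using assms(5) less.prems True by blast
 next
  case False
  then have s: "s < a" using less.prems by simp
  then obtain r where r: "(s, r) \<in> M" "s < r" "r < t" "closed_interval M (Suc s) r" "closed_interval M (Suc r) t"
   using closed_interval_first[OF less.prems(1)] less.prems bounds by (metis le_less_trans less_trans le_less)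
  have "\<not> (a \<le> r \<and> r < Suc d)"
   using inner_closed r(1) s unfolding closed_interval_def by fastforce
  then consider "r < a" | "d < r" by linarith
  then show ?thesis
  proof cases
   case 1
   then show ?thesis using assms(6)[of s r t] less r by auto
  next
   case 2
   then show ?thesis using assms(7)[of s r t] less r s by auto
  qed
 qed
qed

lemma context_base: "context_transfer M D S a d P a t = P * transfer M D S (Suc d) t"
 by (subst context_transfer.simps, rule if_not_P) simp

lemma context_left:
 "(s, r) \<in> M ==> r < a ==> d < t ==> context_transfer M D S a d P s t =
   (if (s, r) \<in> D then dotted_arc else plain_arc) (S s) (S r) (transfer M D S (Suc s) r)
    * context_transfer M D S a d P (Suc r) t"
 using arc_bounds[of s r] bounds by (subst context_transfer.simps) (simp add: mate_eq)

lemma context_around: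
 "(s, r) \<in> M ==> s < a ==> d < r ==> r < t ==> context_transfer M D S a d P s t =
   (if (s, r) \<in> D then dotted_arc else plain_arc) (S s) (S r) (context_transfer M D S a d P (Suc s) r)
    * transfer M D S (Suc r) t"
 using arc_bounds[of s r] bounds by (subst context_transfer.simps) (simp add: mate_eq)

lemma transfer_split:
 assumes "closed_interval M a t" "d < t" "t \<le> 2 * n + 1"
 shows "transfer M D S a t = transfer M D S a (Suc d) * transfer M D S (Suc d) t"
proof -
 have split: "s \<le> Suc d \<longrightarrow> (closed_interval M s t \<longrightarrow> transfer M D S s t = transfer M D S s (Suc d) * transfer M D S (Suc d) t)"
  if "closed_interval M s u" "1 \<le> s" "s \<le> u" "u \<le> 2 * n + 1" "u = Suc d" for s u
  using that
 proof (induction rule: interval_induct)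
  case (arc s r u)
  then have "r < t" using assms by simp
  show ?case
  proof (intro impI)
   assume "closed_interval M s t"
   then have "closed_interval M (Suc r) t"
    using closed_interval_first[of s t] arc \<open>r < t\<close> assms(3) mate_eq[OF arc(1)]
    by (metis less_trans)
   then show "transfer M D S s t = transfer M D S s (Suc d) * transfer M D S (Suc d) t"
    using arc \<open>r < t\<close> by (simp add: transfer_arc mult.assoc)
  qed
 qed simp
 show ?thesis using split[of a "Suc d"] inner_closed assms bounds by simp
qed

lemma transfer_context:
 assumes "closed_interval M s t" "1 \<le> s" "s \<le> a" "d < t \<and> t \<le> 2 * n + 1"
 shows "transfer M D S s t = context_transfer M D S a d (transfer M D S a (Suc d)) s t"
 using assms
proof (induction rule: context_induct)
 case (base t)
 then show ?case by (simp add: context_base transfer_split)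
next
 case (left s r t)
 then show ?case using bounds by (simp add: context_left transfer_arc)
next
 case (around s r t)
 then show ?case by (simp add: context_around transfer_arc)
qed

lemma context_linear:
 assumes "closed_interval M s t" "1 \<le> s" "s \<le> a" "d < t \<and> t \<le> 2 * n + 1"
 shows context_add: "context_transfer M D S a d (P + Q) s t = context_transfer M D S a d P s t + context_transfer M D S a d Q s t"
  and context_smult: "context_transfer M D S a d ([:c:] * P) s t = [:c:] * context_transfer M D S a d P s t"
 using assms
proof (induction rule: context_induct)
 case (base t)
 { case 1 show ?case by (simp only: context_base distrib_right) }
 { case 2 show ?case by (simp only: context_base mult.assoc) }
next
 case (left s r t)
 note left_eq = context_left[OF left(1,3,4)]
 { case 1 show ?case by (simp only: left_eq left.IH(1) distrib_left) }
 { case 2 show ?case by (simp only: left_eq left.IH(2) mult.left_commute[of _ "[:c:]"]) }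
next
 case (around s r t)
 note around_eq = context_around[OF around(1-4)]
 { case 1 show ?case by (simp only: around_eq around.IH(1) arc_op_linear distrib_right) }
 { case 2 show ?case by (simp only: around_eq around.IH(2) arc_op_linear mult.assoc) }
qed

end

lemma context_cong:
 assumes "matching_context n M a d" "matching_context n M' a d" "closed_interval M s t" "1 \<le> s" "s \<le> a" "d < t \<and> t \<le> 2 * n + 1"
  and "\<And>x. inner s t x ==> \<not> inner a (Suc d) x ==> (x \<in> M \<longleftrightarrow> x \<in> M') \<and> (x \<in> M \<longrightarrow> (x \<in> D \<longleftrightarrow> x \<in> D'))"
 shows "context_transfer M D S a d P s t = context_transfer M' D' S a d P s t"
proof -
 interpret M: matching_context n M a d by fact
 interpret M': matching_context n M' a d by fact
 note mm = M.matching_axioms M'.matching_axioms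
 show ?thesis using assms(3-7)
 proof (induction rule: M.context_induct)
  case (base t)
  have "transfer M D S (Suc d) t = transfer M' D' S (Suc d) t"
   by (rule transfer_cong[OF mm]) (use base M.bounds in \<open>auto simp: inner_def\<close>)
  then show ?case by (simp add: M.context_base M'.context_base)
 next
  case (left s r t)
  have "transfer M D S (Suc s) r = transfer M' D' S (Suc s) r"
   by (rule transfer_cong[OF mm]) (use left M.bounds in \<open>auto simp: inner_def\<close>)
  moreover have "(s, r) \<in> M'" "(s, r) \<in> D \<longleftrightarrow> (s, r) \<in> D'"
   using left(11)[of "(s, r)"] left M.bounds by (auto simp: inner_def)
  moreover have "context_transfer M D S a d P (Suc r) t = context_transfer M' D' S a d P (Suc r) t"
   using left by (auto simp: inner_def)
  ultimately show ?case
   using left by (simp add: M.context_left M'.context_left)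
 next
  case (around s r t)
  have "transfer M D S (Suc r) t = transfer M' D' S (Suc r) t"
   by (rule transfer_cong[OF mm]) (use around M.bounds in \<open>auto simp: inner_def\<close>)
  moreover have "(s, r) \<in> M'" "(s, r) \<in> D \<longleftrightarrow> (s, r) \<in> D'"
   using around(11)[of "(s, r)"] around M.bounds by (auto simp: inner_def)
  moreover have "context_transfer M D S a d P (Suc s) r = context_transfer M' D' S a d P (Suc s) r"
   using around by (auto simp: inner_def)
  ultimately show ?case
   using around by (simp add: M.context_around M'.context_around)
 qed
qed

section \<open>Moving the variable outwards\<close>

lemma arc_op_sum:
 "(if b then dotted_arc else plain_arc) x y (sum f A) = (\<Sum>i\<in>A. (if b then dotted_arc else plain_arc) x y (f i))"
proof (induction A rule: infinite_finite_induct)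
 case (insert i A)
 show ?case unfolding sum.insert[OF insert(1,2)] arc_op_linear insert(3) by (rule refl)
qed (auto simp: plain_arc_def dotted_arc_def dilate_simps)

text \<open>Restricting the surrounding arcs to an interval lets the rule for the variable be proved
  by induction on that interval; on the whole line they are the arcs of
  \<open>surrounding\<close>.\<close>

definition local_surrounding :: "arc set => arc set => nat => nat => nat => nat => arc set" where
 "local_surrounding M D a d s t = {x \<in> M - D. s \<le> fst x \<and> fst x < a \<and> d < snd x \<and> snd x < t}"

definition local_dots :: "arc set => nat => nat => nat => nat => arc set" where
 "local_dots D a d s t = {x \<in> D. s \<le> fst x \<and> fst x < a \<and> d < snd x \<and> snd x < t}"

abbreviation qpoly :: "int => lpoly" where
 "qpoly i \<equiv> [:q_pow i:]"

lemma qpoly_mult: "qpoly i * qpoly j = qpoly (i + j)"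
 by (simp add: q_pow_def algebra_simps)

lemma qpoly_simps: "qq = qpoly 1" "qi = qpoly (-1)" "qpoly 0 = 1"
 by (simp_all add: q_pow_def one_pCons)

abbreviation kappa :: lpoly where "kappa \<equiv> [:1 - q_pow (-2):]"

lemma kappa_eq: "1 - qi * qi = kappa"
 by (simp add: q_pow_def one_pCons)

context matching_context
begin

lemma local_left:
 assumes "(s, r) \<in> M" "r < a" "D \<subseteq> M"
 shows "local_surrounding M D a d s t = local_surrounding M D a d (Suc r) t"
  and "local_dots D a d s t = local_dots D a d (Suc r) t"
proof -
 have "s \<le> fst x \<longleftrightarrow> Suc r \<le> fst x" if "x \<in> M" "fst x < a" "d < snd x" for x
  using that assms(2) bounds arc_cases[of "fst x" "snd x" s r] arc_bounds[of s r] assms(1) by auto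
 then show "local_surrounding M D a d s t = local_surrounding M D a d (Suc r) t"
  and "local_dots D a d s t = local_dots D a d (Suc r) t"
  using assms(3) by (auto simp: local_surrounding_def local_dots_def)
qed

text \<open>The index and the dot count of \<open>(s, r)\<close> depend only on what lies inside
  this arc, so they are known when the variable arrives there from within.\<close>

lemma local_around:
 assumes "(s, r) \<in> M" "s < a" "d < r" "r < t" "D \<subseteq> M"
 shows "local_surrounding M D a d s t =
   (if (s, r) \<in> D then local_surrounding M D a d (Suc s) r else insert (s, r) (local_surrounding M D a d (Suc s) r))"
  and "local_dots D a d s t =
   (if (s, r) \<in> D then insert (s, r) (local_dots D a d (Suc s) r) else local_dots D a d (Suc s) r)"
  and "(s, r) \<notin> D ==> surround_index M D a d (s, r) = int (card (insert (s, r) (local_surrounding M D a d (Suc s) r)))"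
  and "surround_dotted D a d (s, r) = int (card (local_dots D a d (Suc s) r))"
proof -
 have *: "s \<le> fst x \<and> snd x < t \<longleftrightarrow> x = (s, r) \<or> (Suc s \<le> fst x \<and> snd x < r)"
  if "x \<in> M" "fst x < a" "d < snd x" for x
  using that assms bounds arc_cases[of "fst x" "snd x" s r] by (cases x) auto
 show "local_surrounding M D a d s t =
   (if (s, r) \<in> D then local_surrounding M D a d (Suc s) r else insert (s, r) (local_surrounding M D a d (Suc s) r))"
  using * assms by (auto simp: local_surrounding_def)
 show "local_dots D a d s t =
   (if (s, r) \<in> D then insert (s, r) (local_dots D a d (Suc s) r) else local_dots D a d (Suc s) r)"
  using * assms by (auto simp: local_dots_def)
 show "surround_index M D a d (s, r) = int (card (insert (s, r) (local_surrounding M D a d (Suc s) r)))" if "(s, r) \<notin> D"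
 proof -
  have "{y \<in> surrounding M D a d. y = (s, r) \<or> nested_in y (s, r)} = insert (s, r) (local_surrounding M D a d (Suc s) r)"
   using that assms bounds by (auto simp: surrounding_def local_surrounding_def nested_in_def Suc_le_eq)
  then show ?thesis by (simp add: surround_index_def)
 qed
 show "surround_dotted D a d (s, r) = int (card (local_dots D a d (Suc s) r))"
  unfolding surround_dotted_def local_dots_def by (simp add: Suc_le_eq)
qed

lemma finite_local: "finite (local_surrounding M D a d s t)" "D \<subseteq> M ==> finite (local_dots D a d s t)"
 using finite_arcs by (auto simp: local_surrounding_def local_dots_def dest: finite_subset)

text \<open>Passing an undotted arc multiplies by q and leaves behind a term in which this arc is
  dotted; passing a dotted arc multiplies by q^(-1). The term left behind at \<open>x\<close>
  carries what was accumulated before: one q for each undotted and one q^(-1) for each dotted arc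
  strictly between the hole and \<open>x\<close>.\<close>

lemma context_X:
 assumes "closed_interval M s t" "1 \<le> s" "s \<le> a" "d < t \<and> t \<le> 2 * n + 1" "D \<subseteq> M"
 shows "context_transfer M D S a d (xx * P) s t =
  qpoly (int (card (local_surrounding M D a d s t)) - int (card (local_dots D a d s t))) * (xx * context_transfer M D S a d P s t)
  + kappa * (\<Sum>x\<in>local_surrounding M D a d s t.
    qpoly (surround_index M D a d x - 1 - surround_dotted D a d x) * context_transfer M (insert x D) S a d P s t)"
 using assms(1-4)
proof (induction rule: context_induct)
 case (base t)
 have "local_surrounding M D a d a t = {}" "local_dots D a d a t = {}"
  by (auto simp: local_surrounding_def local_dots_def)
 then show ?case
  by (simp only: context_base card.empty sum.empty of_nat_0 diff_0_right qpoly_simps mult_1_left mult_zero_right add_0_right mult.assoc)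
next
 case (left s r t)
 let ?op = "(if (s, r) \<in> D then dotted_arc else plain_arc) (S s) (S r) (transfer M D S (Suc s) r)"
 have "context_transfer M (insert x D) S a d P s t = ?op * context_transfer M (insert x D) S a d P (Suc r) t"
  if "x \<in> local_surrounding M D a d (Suc r) t" for x
 proof -
  have "transfer M (insert x D) S (Suc s) r = transfer M D S (Suc s) r"
   by (rule transfer_cong[OF matching_axioms matching_axioms])
    (use left(1-9) bounds that in \<open>auto simp: inner_def local_surrounding_def\<close>)
  moreover have "(s, r) \<in> insert x D \<longleftrightarrow> (s, r) \<in> D"
   using that left(2) by (auto simp: local_surrounding_def)
  ultimately show ?thesis using left by (simp only: context_left)
 qed
 then have "(\<Sum>x\<in>local_surrounding M D a d (Suc r) t.
    qpoly (surround_index M D a d x - 1 - surround_dotted D a d x) * context_transfer M (insert x D) S a d P s t)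
   = ?op * (\<Sum>x\<in>local_surrounding M D a d (Suc r) t.
    qpoly (surround_index M D a d x - 1 - surround_dotted D a d x) * context_transfer M (insert x D) S a d P (Suc r) t)"
  unfolding sum_distrib_left by (intro sum.cong refl) (simp only: mult.left_commute)
 then show ?case
  unfolding context_left[OF left(1,3,4)] left.IH local_left[OF left(1,3) assms(5)]
  by (simp only: distrib_left mult.left_commute)
next
 case (around s r t)
 let ?L = "local_surrounding M D a d (Suc s) r" and ?E = "local_dots D a d (Suc s) r"
 let ?C = "context_transfer M D S a d P (Suc s) r"
 let ?op = "(if (s, r) \<in> D then dotted_arc else plain_arc) (S s) (S r)"
 let ?T = "transfer M D S (Suc r) t"
 let ?w = "\<lambda>x. qpoly (surround_index M D a d x - 1 - surround_dotted D a d x)"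
 have notin: "(s, r) \<notin> ?L" "(s, r) \<notin> ?E" by (auto simp: local_surrounding_def local_dots_def)
 have sum_eq: "(\<Sum>x\<in>?L. ?w x * context_transfer M (insert x D) S a d P s t)
   = (\<Sum>x\<in>?L. ?w x * ?op (context_transfer M (insert x D) S a d P (Suc s) r)) * ?T"
  unfolding sum_distrib_right
 proof (intro sum.cong refl)
  fix x assume x: "x \<in> ?L"
  have "transfer M (insert x D) S (Suc r) t = ?T"
   by (rule transfer_cong[OF matching_axioms matching_axioms])
    (use around(1-9) x bounds in \<open>auto simp: inner_def local_surrounding_def\<close>)
  moreover have "(s, r) \<in> insert x D \<longleftrightarrow> (s, r) \<in> D"
   using x by (auto simp: local_surrounding_def)
  ultimately show "?w x * context_transfer M (insert x D) S a d P s t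
    = ?w x * ?op (context_transfer M (insert x D) S a d P (Suc s) r) * ?T"
   using around by (simp only: context_around mult.assoc)
 qed
 have inner: "?op (context_transfer M D S a d (xx * P) (Suc s) r) =
   qpoly (int (card ?L) - int (card ?E)) * ?op (xx * ?C)
   + kappa * (\<Sum>x\<in>?L. ?w x * ?op (context_transfer M (insert x D) S a d P (Suc s) r))"
  unfolding around.IH by (simp only: arc_op_linear arc_op_sum)
 show ?case
 proof (cases "(s, r) \<in> D")
  case True
  have card: "int (card (local_surrounding M D a d s t)) - int (card (local_dots D a d s t)) = int (card ?L) - int (card ?E) + (-1)"
   using notin finite_local(2)[OF assms(5)]
   by (simp add: local_around[OF around(1-4) assms(5)] True)
  have op: "?op (xx * ?C) = qpoly (-1) * (xx * ?op ?C)"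
   using True dotted_arc_X[of "S s" "S r" ?C] by (simp only: if_True qpoly_simps mult.assoc)
  have L: "local_surrounding M D a d s t = ?L"
   using True by (simp add: local_around[OF around(1-4) assms(5)])
  show ?thesis
   unfolding card unfolding L sum_eq unfolding context_around[OF around(1-4)] inner unfolding op qpoly_mult[symmetric]
   by (simp only: distrib_right mult.assoc)
 next
  case False
  have L: "local_surrounding M D a d s t = insert (s, r) ?L" "local_dots D a d s t = ?E"
   using False by (simp_all add: local_around[OF around(1-4) assms(5)])
  have card: "int (card (insert (s, r) ?L)) - int (card ?E) = int (card ?L) - int (card ?E) + 1"
   using notin finite_local(1) by simp
  \<comment> \<open>\<open>surround_index\<close> counts the arc itself, hence the -1 in the
    weight.\<close>
  have "?w (s, r) = qpoly (int (card ?L) - int (card ?E))"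
   using local_around(3,4)[OF around(1-4) assms(5)] False notin finite_local(1) by simp
  moreover have "context_transfer M (insert (s, r) D) S a d P s t = dotted_arc (S s) (S r) ?C * ?T"
  proof -
   have "context_transfer M (insert (s, r) D) S a d P (Suc s) r = ?C"
    by (rule context_cong[OF matching_context_axioms matching_context_axioms])
     (use around(1-9) bounds in \<open>auto simp: inner_def\<close>)
   moreover have "transfer M (insert (s, r) D) S (Suc r) t = ?T"
    by (rule transfer_cong[OF matching_axioms matching_axioms]) (use around(1-9) bounds in \<open>auto simp: inner_def\<close>)
   ultimately show ?thesis by (simp add: context_around[OF around(1-4)])
  qed
  ultimately have sum: "(\<Sum>x\<in>insert (s, r) ?L. ?w x * context_transfer M (insert x D) S a d P s t)
    = qpoly (int (card ?L) - int (card ?E)) * (dotted_arc (S s) (S r) ?C * ?T)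
     + (\<Sum>x\<in>?L. ?w x * ?op (context_transfer M (insert x D) S a d P (Suc s) r)) * ?T"
   unfolding sum_eq[symmetric] by (subst sum.insert[OF finite_local(1) notin(1)]) simp
  have op: "?op (xx * ?C) = kappa * dotted_arc (S s) (S r) ?C + qpoly 1 * (xx * ?op ?C)"
   using False plain_arc_X[of "S s" "S r" ?C] by (simp only: if_False kappa_eq) (simp only: qpoly_simps mult.assoc)
  show ?thesis
   unfolding L unfolding card sum unfolding context_around[OF around(1-4)] inner unfolding op qpoly_mult[symmetric]
   by (simp only: distrib_left distrib_right mult.assoc mult.left_commute add.assoc add.left_commute add.commute)
 qed
qed

end

section \<open>States of diagrams and the effect of the relations on them\<close>

lemma (in matching) closed_arc: "(s, r) \<in> M ==> closed_interval M s (Suc r)" "(s, r) \<in> M ==> closed_interval M (Suc s) r"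
proof -
 assume sr: "(s, r) \<in> M"
 have *: "(s \<le> fst x \<and> fst x < Suc r) = (s \<le> snd x \<and> snd x < Suc r)
  \<and> (Suc s \<le> fst x \<and> fst x < r) = (Suc s \<le> snd x \<and> snd x < r)" if "x \<in> M" for x
  using arc_cases[of "fst x" "snd x" s r] arc_bounds[of "fst x" "snd x"] arc_bounds[OF sr] that sr by (cases x) auto
 then show "closed_interval M s (Suc r)" "closed_interval M (Suc s) r"
  unfolding closed_interval_def by blast+
qed

lemma (in matching) transfer_append:
 assumes "closed_interval M s m" "closed_interval M s t" "1 \<le> s" "s \<le> m" "m \<le> t" "t \<le> 2 * n + 1"
 shows "transfer M D S s t = transfer M D S s m * transfer M D S m t"
proof (cases "s = m")
 case False
 then obtain d where d: "m = Suc d" using assms by (cases m) auto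
 interpret matching_context n M s d
  by unfold_locales (use assms False d in auto)
 show ?thesis using transfer_split[of t D S] assms d by simp
qed simp

text \<open>Taking the constant term says that no flip is left over once all arcs have been
  used.\<close>

definition russell_state :: "nat => (nat => bool) => diagram => laurent" where
 "russell_state n S = (\<lambda>(M, D). coeff (transfer M D S 1 (2 * n + 1)) 0)"

locale surgery =
 fixes n :: nat and M D :: "arc set" and a b c d :: nat
 assumes order: "a < b" "b < c" "c < d" and D: "D \<subseteq> M"
  and M1: "crossingless_matching n (M \<union> {(a, d), (b, c)})"
  and M2: "crossingless_matching n (M \<union> {(a, b), (c, d)})"
begin

abbreviation "N \<equiv> M \<union> {(a, d), (b, c)}"
abbreviation "N' \<equiv> M \<union> {(a, b), (c, d)}"

sublocale nest: matching n N by unfold_locales (rule M1)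
sublocale side: matching n N' by unfold_locales (rule M2)

lemma bounds: "1 \<le> a" "d \<le> 2 * n"
 using nest.arc_bounds[of a d] by auto

lemma closed_base:
 "closed_interval M (Suc a) b" "closed_interval M (Suc b) c" "closed_interval M (Suc c) d" "closed_interval M a (Suc d)"
 using side.closed_arc(2)[of a b] nest.closed_arc(2)[of b c] side.closed_arc(2)[of c d] nest.closed_arc(1)[of a d]
 by (auto simp: closed_interval_def)

lemma closed_side: "closed_interval N' a (Suc d)"
 using closed_base(4) order by (auto simp: closed_interval_def)

lemma closed_nest: "closed_interval N (Suc a) b" "closed_interval N (Suc b) c" "closed_interval N (Suc c) d"
  "closed_interval N (Suc a) d" "closed_interval N b d"
proof -
 show "closed_interval N (Suc a) b" "closed_interval N (Suc b) c" "closed_interval N (Suc c) d"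
  using closed_base order by (auto simp: closed_interval_def)
 show ad: "closed_interval N (Suc a) d" by (rule nest.closed_arc(2)) simp
 have "(b \<le> fst x \<and> fst x < d) = (b \<le> snd x \<and> snd x < d)" if x: "x \<in> N" for x
 proof -
  have "(Suc a \<le> fst x \<and> fst x < d) = (Suc a \<le> snd x \<and> snd x < d)"
   "(Suc a \<le> fst x \<and> fst x < b) = (Suc a \<le> snd x \<and> snd x < b)"
   using x ad \<open>closed_interval N (Suc a) b\<close> unfolding closed_interval_def by blast+
  then show ?thesis using order by auto
 qed
 then show "closed_interval N b d" unfolding closed_interval_def by blast
qed

sublocale nest: matching_context n N a d
 by unfold_locales (use nest.closed_arc(1)[of a d] bounds order in auto)

sublocale side: matching_context n N' a d
 by unfold_locales (use closed_side bounds order in auto)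

text \<open>The condition under which the polynomials of the three gaps are the same as for
  \<open>D\<close>. Dots on the exchanged arcs and on arcs outside the hole may differ.\<close>

definition agrees :: "arc set => bool" where
 "agrees D' \<longleftrightarrow> (\<forall>x\<in>M. inner a (Suc d) x \<longrightarrow> (x \<in> D' \<longleftrightarrow> x \<in> D))"

lemma M_not_new: "x \<in> M ==> fst x \<notin> {a, b, c, d} \<and> snd x \<notin> {a, b, c, d}"
proof -
 assume x: "x \<in> M"
 have "\<not> (p = fst x \<or> p = snd x)" if p: "p \<in> {a, b, c, d}" for p
 proof
  assume px: "p = fst x \<or> p = snd x"
  have "x = (a, d)" if "p \<in> {a, d}"
   by (rule nest.arc_unique[of _ _ p]) (use that x px in auto)
  moreover have "x = (b, c)" if "p \<in> {b, c}"
   by (rule nest.arc_unique[of _ _ p]) (use that x px in auto)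
  moreover have "x = (a, b)" if "p \<in> {a, b}"
   by (rule side.arc_unique[of _ _ p]) (use that x px in auto)
  moreover have "x = (c, d)" if "p \<in> {c, d}"
   by (rule side.arc_unique[of _ _ p]) (use that x px in auto)
  ultimately show False using p order by (elim insertE) auto
 qed
 then show ?thesis by blast
qed

lemma segments:
 assumes "agrees D'"
 shows "transfer N D' S (Suc a) b = transfer N' D S (Suc a) b"
  "transfer N D' S (Suc b) c = transfer N' D S (Suc b) c"
  "transfer N D' S (Suc c) d = transfer N' D S (Suc c) d"
  "transfer N' D' S (Suc a) b = transfer N' D S (Suc a) b"
  "transfer N' D' S (Suc b) c = transfer N' D S (Suc b) c"
  "transfer N' D' S (Suc c) d = transfer N' D S (Suc c) d"
proof -
 have closed': "closed_interval N' (Suc a) b" "closed_interval N' (Suc b) c" "closed_interval N' (Suc c) d"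
  using closed_base order by (auto simp: closed_interval_def)
 note mm = nest.matching_axioms side.matching_axioms
 have "transfer N D' S s t = transfer N' D S s t" "transfer N' D' S s t = transfer N' D S s t"
  if "(s, t) \<in> {(Suc a, b), (Suc b, c), (Suc c, d)}" for s t
 proof -
  have st: "a < s" "s \<le> t" "t \<le> d" "closed_interval N s t" "closed_interval N' s t" "\<forall>x. inner s t x \<longrightarrow> fst x \<notin> {a, b, c, d}"
   using that closed_nest closed' order by (auto simp: inner_def)
  have agree: "(x \<in> N \<longleftrightarrow> x \<in> N') \<and> (x \<in> N \<longrightarrow> (x \<in> D' \<longleftrightarrow> x \<in> D))" if "inner s t x" for x
   using that st assms unfolding agrees_def inner_def by auto
  show "transfer N D' S s t = transfer N' D S s t"
   by (rule transfer_cong[OF mm]) (use st bounds order agree in auto)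
  show "transfer N' D' S s t = transfer N' D S s t"
   by (rule transfer_cong[OF mm(2) mm(2)]) (use st bounds order agree in auto)
 qed
 then show "transfer N D' S (Suc a) b = transfer N' D S (Suc a) b"
  "transfer N D' S (Suc b) c = transfer N' D S (Suc b) c"
  "transfer N D' S (Suc c) d = transfer N' D S (Suc c) d"
  "transfer N' D' S (Suc a) b = transfer N' D S (Suc a) b"
  "transfer N' D' S (Suc b) c = transfer N' D S (Suc b) c"
  "transfer N' D' S (Suc c) d = transfer N' D S (Suc c) d" by simp_all
qed

lemma transfer_nest:
 assumes "agrees D'"
 shows "transfer N D' S a (Suc d) = (if (a, d) \<in> D' then dotted_arc else plain_arc) (S a) (S d)
  (transfer N' D S (Suc a) b
   * (if (b, c) \<in> D' then dotted_arc else plain_arc) (S b) (S c) (transfer N' D S (Suc b) c)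
   * transfer N' D S (Suc c) d)"
proof -
 have "transfer N D' S (Suc a) d = transfer N D' S (Suc a) b * transfer N D' S b d"
  using nest.transfer_append[OF closed_nest(1,4)] order bounds by simp
 moreover have "transfer N D' S b d = (if (b, c) \<in> D' then dotted_arc else plain_arc) (S b) (S c) (transfer N D' S (Suc b) c)
   * transfer N D' S (Suc c) d"
  using nest.transfer_arc[of b c d] order by simp
 moreover have "transfer N D' S a (Suc d) = (if (a, d) \<in> D' then dotted_arc else plain_arc) (S a) (S d) (transfer N D' S (Suc a) d)"
  using nest.transfer_arc[of a d "Suc d" D' S] by simp
 ultimately show ?thesis by (simp only: segments[OF assms] mult.assoc)
qed

lemma transfer_side:
 assumes "agrees D'"
 shows "transfer N' D' S a (Suc d) =
  (if (a, b) \<in> D' then dotted_arc else plain_arc) (S a) (S b) (transfer N' D S (Suc a) b)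
   * transfer N' D S (Suc b) c
   * (if (c, d) \<in> D' then dotted_arc else plain_arc) (S c) (S d) (transfer N' D S (Suc c) d)"
proof -
 have closed': "closed_interval N' (Suc b) c" "closed_interval N' (Suc b) (Suc d)"
 proof -
  show bc: "closed_interval N' (Suc b) c"
   using closed_base order by (auto simp: closed_interval_def)
  have "(Suc b \<le> fst x \<and> fst x < Suc d) = (Suc b \<le> snd x \<and> snd x < Suc d)" if x: "x \<in> N'" for x
  proof -
   have "(Suc b \<le> fst x \<and> fst x < c) = (Suc b \<le> snd x \<and> snd x < c)"
    "(c \<le> fst x \<and> fst x < Suc d) = (c \<le> snd x \<and> snd x < Suc d)"
    using x bc side.closed_arc(1)[of c d] unfolding closed_interval_def by blast+
   then show ?thesis using order by auto
  qed
  then show "closed_interval N' (Suc b) (Suc d)" unfolding closed_interval_def by blast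
 qed
 have "transfer N' D' S a (Suc d) = (if (a, b) \<in> D' then dotted_arc else plain_arc) (S a) (S b) (transfer N' D' S (Suc a) b)
   * transfer N' D' S (Suc b) (Suc d)"
  using side.transfer_arc[of a b "Suc d"] order by simp
 moreover have "transfer N' D' S (Suc b) (Suc d) = transfer N' D' S (Suc b) c * transfer N' D' S c (Suc d)"
  using side.transfer_append[OF closed'] order bounds by simp
 moreover have "transfer N' D' S c (Suc d) = (if (c, d) \<in> D' then dotted_arc else plain_arc) (S c) (S d) (transfer N' D' S (Suc c) d)"
  using side.transfer_arc[of c d "Suc d" D' S] by simp
 ultimately show ?thesis by (simp only: segments[OF assms] mult.assoc)
qed

abbreviation "ctx S D' P \<equiv> context_transfer N' D' S a d P 1 (2 * n + 1)"

lemma ctx_bounds: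
 "closed_interval N' 1 (2 * n + 1)" "closed_interval N 1 (2 * n + 1)" "1 \<le> (1::nat)" "1 \<le> a" "d < 2 * n + 1 \<and> 2 * n + 1 \<le> 2 * n + 1"
 using side.closed_interval_whole nest.closed_interval_whole bounds by auto

lemma russell_state_side:
 "russell_state n S (N', D') = coeff (ctx S D' (transfer N' D' S a (Suc d))) 0"
 unfolding russell_state_def prod.case side.transfer_context[OF ctx_bounds(1,3-5)] by (rule refl)

text \<open>Outside the hole the nested and the side-by-side matching coincide, so all terms of a
  relation can be written in one and the same context.\<close>

lemma russell_state_nest:
 "russell_state n S (N, D') = coeff (ctx S D' (transfer N D' S a (Suc d))) 0"
proof -
 have "context_transfer N D' S a d P 1 (2 * n + 1) = ctx S D' P" for P
 proof (rule context_cong[OF nest.matching_context_axioms side.matching_context_axioms ctx_bounds(2-5)])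
  fix x assume "inner 1 (2 * n + 1) x" "\<not> inner a (Suc d) x"
  then show "(x \<in> N \<longleftrightarrow> x \<in> N') \<and> (x \<in> N \<longrightarrow> (x \<in> D' \<longleftrightarrow> x \<in> D'))"
   using order by (auto simp: inner_def)
 qed
 then show ?thesis
  unfolding russell_state_def prod.case nest.transfer_context[OF ctx_bounds(2-5)] by simp
qed

lemma ctx_cong:
 assumes "\<And>x. x \<in> M ==> \<not> inner a (Suc d) x ==> x \<in> D' \<longleftrightarrow> x \<in> D''"
 shows "ctx S D' P = ctx S D'' P"
 by (rule context_cong[OF side.matching_context_axioms side.matching_context_axioms ctx_bounds(1,3-5)])
  (use assms order in \<open>auto simp: inner_def\<close>)

lemma surrounding_eq: "local_surrounding N' D a d 1 (2 * n + 1) = surrounding M D a d"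
 using side.arc_bounds order by (fastforce simp: local_surrounding_def surrounding_def)

lemma index_eq: "surround_index N' D a d x = surround_index M D a d x"
proof -
 have "surrounding N' D a d = surrounding M D a d"
  using order by (auto simp: surrounding_def)
 then show ?thesis by (simp add: surround_index_def)
qed

text \<open>On the whole line the summand that still contains the variable has no constant term and
  disappears; only the terms with a newly dotted arc remain.\<close>

lemma ctx_X:
 "coeff (ctx S D (xx * P)) 0 = (1 - q_pow (-2)) * (\<Sum>x\<in>surrounding M D a d.
   q_pow (surround_index M D a d x - 1 - surround_dotted D a d x) * coeff (ctx S (insert x D) P) 0)"
proof -
 have D': "D \<subseteq> N'" using D by auto
 show ?thesis
  unfolding side.context_X[OF ctx_bounds(1,3-5) D'] surrounding_eq index_eq
  by (simp add: coeff_sum)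
qed

lemma agrees_simps:
 "agrees D" "agrees (D \<union> {(a, b)})" "agrees (D \<union> {(b, c)})" "agrees (D \<union> {(a, d)})" "agrees (D \<union> {(c, d)})"
 "agrees (D \<union> {(a, d), (b, c)})" "agrees (D \<union> {(a, b), (c, d)})"
 "x \<in> surrounding M D a d ==> agrees D' ==> agrees (D' \<union> {x})"
 using M_not_new order unfolding agrees_def surrounding_def inner_def by fastforce+

lemma new_notin: "(a, b) \<notin> D" "(b, c) \<notin> D" "(a, d) \<notin> D" "(c, d) \<notin> D"
 using M_not_new D by fastforce+

lemma ctx_simps:
 "ctx S (D \<union> {(a, b)}) P = ctx S D P" "ctx S (D \<union> {(b, c)}) P = ctx S D P"
 "ctx S (D \<union> {(a, d)}) P = ctx S D P" "ctx S (D \<union> {(c, d)}) P = ctx S D P"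
 "ctx S (D \<union> {(a, b), (c, d)}) P = ctx S D P" "ctx S (D \<union> {(a, d), (b, c)}) P = ctx S D P"
 "ctx S (D \<union> {(a, d), x}) P = ctx S (insert x D) P"
 by (rule ctx_cong; use M_not_new in fastforce)+

lemma coeff_ctx_add: "coeff (ctx S D' (P + Q)) 0 = coeff (ctx S D' P) 0 + coeff (ctx S D' Q) 0"
 unfolding side.context_add[OF ctx_bounds(1,3-5)] by (rule coeff_add)

lemma coeff_ctx_smult: "coeff (ctx S D' ([:e:] * P)) 0 = e * coeff (ctx S D' P) 0"
 unfolding side.context_smult[OF ctx_bounds(1,3-5)] by simp

lemma type_I_state:
 "russell_state n S (N, D \<union> {(b, c)}) = russell_state n S (N', D \<union> {(a, b)}) + russell_state n S (N', D \<union> {(c, d)})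
   + q_pow (-1) * russell_state n S (N, D \<union> {(a, d)})
   + (\<Sum>x\<in>surrounding M D a d. (1 - q_pow (-2)) * q_pow (surround_index M D a d x - surround_dotted D a d x)
     * russell_state n S (N', D \<union> {x}))"
proof -
 let ?A = "transfer N' D S (Suc a) b" and ?B = "transfer N' D S (Suc b) c" and ?C = "transfer N' D S (Suc c) d"
 let ?side = "plain_arc (S a) (S b) ?A * ?B * plain_arc (S c) (S d) ?C"
 have surr: "russell_state n S (N', D \<union> {x}) = coeff (ctx S (insert x D) ?side) 0" if "x \<in> surrounding M D a d" for x
 proof -
  have "(a, b) \<notin> D \<union> {x}" "(c, d) \<notin> D \<union> {x}" using that new_notin M_not_new by (auto simp: surrounding_def)
  then show ?thesis
   unfolding russell_state_side transfer_side[OF agrees_simps(8)[OF that agrees_simps(1)]] by simp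
 qed
 have mem: "(a, d) \<notin> D \<union> {(b, c)}" "(b, c) \<in> D \<union> {(b, c)}" "(a, d) \<in> D \<union> {(a, d)}" "(b, c) \<notin> D \<union> {(a, d)}"
  "(a, b) \<in> D \<union> {(a, b)}" "(c, d) \<notin> D \<union> {(a, b)}" "(c, d) \<in> D \<union> {(c, d)}" "(a, b) \<notin> D \<union> {(c, d)}"
  using new_notin order by auto
 have qx: "coeff (ctx S D (qq * (xx * ?side))) 0 = (\<Sum>x\<in>surrounding M D a d.
   (1 - q_pow (-2)) * q_pow (surround_index M D a d x - surround_dotted D a d x) * russell_state n S (N', D \<union> {x}))"
 proof -
  \<comment> \<open>The factor q in front of the variable in \<open>type_I_local\<close> raises the
    exponent i - 1 - n_i to i - n_i.\<close>
  have "q_pow 1 * ((1 - q_pow (-2)) * (q_pow (i - 1 - j) * y)) = (1 - q_pow (-2)) * q_pow (i - j) * y" for i j y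
  proof -
   have "q_pow (i - j) = q_pow 1 * q_pow (i - 1 - j)" by (simp add: q_pow_def algebra_simps)
   then show ?thesis by (simp only: mult.assoc mult.left_commute)
  qed
  then show ?thesis
   unfolding coeff_ctx_smult ctx_X qpoly_simps(1) sum_distrib_left
   by (intro sum.cong refl) (simp only: surr)
 qed
 have "russell_state n S (N, D \<union> {(b, c)}) = coeff (ctx S D (plain_arc (S a) (S d) (?A * dotted_arc (S b) (S c) ?B * ?C))) 0"
  unfolding russell_state_nest transfer_nest[OF agrees_simps(3)] ctx_simps by (simp only: mem if_True if_False)
 moreover have "russell_state n S (N', D \<union> {(a, b)}) = coeff (ctx S D (dotted_arc (S a) (S b) ?A * ?B * plain_arc (S c) (S d) ?C)) 0"
  unfolding russell_state_side transfer_side[OF agrees_simps(2)] ctx_simps by (simp only: mem if_True if_False)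
 moreover have "russell_state n S (N', D \<union> {(c, d)}) = coeff (ctx S D (plain_arc (S a) (S b) ?A * ?B * dotted_arc (S c) (S d) ?C)) 0"
  unfolding russell_state_side transfer_side[OF agrees_simps(5)] ctx_simps by (simp only: mem if_True if_False)
 moreover have "russell_state n S (N, D \<union> {(a, d)}) = coeff (ctx S D (dotted_arc (S a) (S d) (?A * plain_arc (S b) (S c) ?B * ?C))) 0"
  unfolding russell_state_nest transfer_nest[OF agrees_simps(4)] ctx_simps by (simp only: mem if_True if_False)
 ultimately show ?thesis
  unfolding type_I_local coeff_ctx_add qx unfolding qpoly_simps(2) coeff_ctx_smult by (simp only:)
qed

lemma type_II_state:
 "russell_state n S (N', D \<union> {(a, b), (c, d)}) = russell_state n S (N, D \<union> {(a, d), (b, c)})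
   + (\<Sum>x\<in>surrounding M D a d. (1 - q_pow (-2)) * q_pow (surround_index M D a d x - 1 - surround_dotted D a d x)
     * russell_state n S (N, D \<union> {(a, d), x}))"
proof -
 let ?A = "transfer N' D S (Suc a) b" and ?B = "transfer N' D S (Suc b) c" and ?C = "transfer N' D S (Suc c) d"
 let ?nest = "dotted_arc (S a) (S d) (?A * plain_arc (S b) (S c) ?B * ?C)"
 have mem: "(a, b) \<in> D \<union> {(a, b), (c, d)}" "(c, d) \<in> D \<union> {(a, b), (c, d)}"
  "(a, d) \<in> D \<union> {(a, d), (b, c)}" "(b, c) \<in> D \<union> {(a, d), (b, c)}"
  by auto
 have surr: "russell_state n S (N, D \<union> {(a, d), x}) = coeff (ctx S (insert x D) ?nest) 0" if "x \<in> surrounding M D a d" for x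
 proof -
  have "(a, d) \<in> D \<union> {(a, d), x}" "(b, c) \<notin> D \<union> {(a, d), x}"
   using that new_notin M_not_new[of x] order by (auto simp: surrounding_def)
  moreover have "agrees (D \<union> {(a, d), x})"
   using agrees_simps(8)[OF that agrees_simps(4)] by (simp add: insert_commute)
  ultimately show ?thesis
   unfolding russell_state_nest transfer_nest[OF \<open>agrees (D \<union> {(a, d), x})\<close>] ctx_simps by (simp only: if_True if_False)
 qed
 have "coeff (ctx S D (xx * ?nest)) 0 = (\<Sum>x\<in>surrounding M D a d.
   (1 - q_pow (-2)) * q_pow (surround_index M D a d x - 1 - surround_dotted D a d x) * russell_state n S (N, D \<union> {(a, d), x}))"
  unfolding ctx_X sum_distrib_left by (intro sum.cong refl) (simp only: surr mult.assoc)
 moreover have "russell_state n S (N', D \<union> {(a, b), (c, d)}) = coeff (ctx S D (dotted_arc (S a) (S b) ?A * ?B * dotted_arc (S c) (S d) ?C)) 0"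
  unfolding russell_state_side transfer_side[OF agrees_simps(7)] ctx_simps by (simp only: mem if_True if_False)
 moreover have "russell_state n S (N, D \<union> {(a, d), (b, c)}) = coeff (ctx S D (dotted_arc (S a) (S d) (?A * dotted_arc (S b) (S c) ?B * ?C))) 0"
  unfolding russell_state_nest transfer_nest[OF agrees_simps(6)] ctx_simps(6) by (simp only: mem if_True if_False)
 ultimately show ?thesis
  unfolding type_II_local coeff_ctx_add by (simp only:)
qed

end

lemma russell_relation_state:
 assumes "r \<in> russell_relations n k"
 shows "pairing (russell_state n S) r = 0"
 using assms
proof cases
 case (type_I a b c d D M)
 then interpret surgery n M D a b c d by unfold_locales
 show ?thesis
  unfolding type_I(1) pairing_diff pairing_add pairing_sum pairing_single type_I_state mult_1_left by simp
next
 case (type_II a b c d D M)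
 then interpret surgery n M D a b c d by unfold_locales
 show ?thesis
  unfolding type_II(1) pairing_diff pairing_add pairing_sum pairing_single type_II_state mult_1_left by simp
qed

section \<open>Transfer along the line\<close>

definition spin :: "bool => int" where
 "spin b = (if b then 1 else -1)"

definition open_ends :: "arc set => arc set => nat => nat set" where
 "open_ends M D t = {y. t \<le> y \<and> (\<exists>e<t. (e, y) \<in> M - D)}"

definition open_dots :: "arc set => nat => nat => arc set" where
 "open_dots D t y = {x \<in> D. fst x < t \<and> t \<le> snd x \<and> snd x < y}"

text \<open>The flip operator corresponds to multiplication by the variable of the state polynomials: it
 turns one down spin at an end of an open undotted arc.\<close>

definition flip_weight :: "arc set => arc set => nat => (nat => bool) => nat => laurent" where
 "flip_weight M D t S y = (q_pow (-1) - q_pow 1) *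
   q_pow (- (\<Sum>z\<in>{z \<in> open_ends M D t. z < y}. spin (S z)) - int (card (open_dots D t y)))"

definition flip_op :: "arc set => arc set => nat => ((nat => bool) => laurent) => (nat => bool) => laurent" where
 "flip_op M D t V S = (\<Sum>y\<in>{y \<in> open_ends M D t. \<not> S y}. flip_weight M D t S y * V (S(y := True)))"

text \<open>A scan of the points from left to right; the clause for \<open>Suc t\<close> treats the
  point \<open>t\<close>. An undotted arc is weighted at its left end, the spin of its right end
  being known from \<open>S\<close>. A dotted arc forces a down spin on its left, and if its right
  end is up, a flip at some open end is performed on the part scanned so far.\<close>

fun flow :: "arc set => arc set => nat => (nat => bool) => laurent" where
 "flow M D 0 S = 1"
| "flow M D (Suc t) S =
   (if t \<in> fst ` (M - D) then cup_weight (S t) (S (mate M t)) * flow M D t S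
   else if t \<in> fst ` D then (if S t then 0 else flow M D t S)
   else if t \<in> snd ` D \<and> S t then flip_op M D (Suc t) (flow M D t) S
   else flow M D t S)"

declare flow.simps(2) [simp del]

text \<open>Substitutes a sequence for the powers of the variable. With the iterated flips as
  sequence this is the action of a state polynomial on the scan.\<close>

definition sequence_poly :: "lpoly => (nat => laurent) => laurent" where
 "sequence_poly P a = (\<Sum>j\<le>degree P. coeff P j * a j)"

lemma sequence_poly_superset: "degree P \<le> m ==> sequence_poly P a = (\<Sum>j\<le>m. coeff P j * a j)"
 unfolding sequence_poly_def by (rule sum.mono_neutral_left) (auto simp: coeff_eq_0)

lemma sequence_poly_1 [simp]: "sequence_poly 1 a = a 0"
 by (simp add: sequence_poly_def)

lemma sequence_poly_0 [simp]: "sequence_poly 0 a = 0"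
 by (simp add: sequence_poly_def)

lemma sequence_poly_add: "sequence_poly (P + Q) a = sequence_poly P a + sequence_poly Q a"
proof -
 let ?m = "max (degree P) (degree Q)"
 have "degree (P + Q) \<le> ?m" by (rule degree_add_le_max)
 then show ?thesis
  by (simp add: sequence_poly_superset[of _ ?m] sum.distrib algebra_simps)
qed

lemma sequence_poly_smult: "sequence_poly (smult c P) a = c * sequence_poly P a"
proof -
 have "degree (smult c P) \<le> degree P" by (rule degree_smult_le)
 then show ?thesis
  by (simp add: sequence_poly_superset[of _ "degree P"] sum_distrib_left mult.assoc)
qed

lemma sequence_poly_cmult: "sequence_poly P (\<lambda>j. c * a j) = c * sequence_poly P a"
 by (simp add: sequence_poly_def sum_distrib_left mult.left_commute)

lemma sequence_poly_pCons: "sequence_poly (pCons c P) a = c * a 0 + sequence_poly P (\<lambda>j. a (Suc j))"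
proof -
 have "degree (pCons c P) \<le> Suc (degree P)" by (rule degree_pCons_le)
 from sequence_poly_superset[OF this] show ?thesis
  unfolding sum.atMost_Suc_shift by (simp add: sequence_poly_def)
qed

lemma sequence_poly_mult: "sequence_poly (P * Q) a = sequence_poly P (\<lambda>j. sequence_poly Q (\<lambda>i. a (i + j)))"
proof (induction P arbitrary: a)
 case (pCons c P)
 show ?case
  using pCons.IH[of "\<lambda>i. a (Suc i)"]
  by (simp add: sequence_poly_pCons sequence_poly_add sequence_poly_smult)
qed simp

lemma sequence_poly_dilate:
 "sequence_poly (dilate c P) a = sequence_poly P (\<lambda>j. c ^ j * a j)"
proof (induction P arbitrary: a)
 case (pCons d P)
 have "dilate c (pCons d P) = [:d:] + smult c (pCons 0 (dilate c P))"
  by (simp add: dilate_def pcompose_pCons)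
 then show ?case
  using pCons.IH[of "\<lambda>j. c * a (Suc j)"]
  by (simp add: sequence_poly_add sequence_poly_smult sequence_poly_pCons mult.assoc mult.left_commute
    flip: sequence_poly_cmult)
qed (simp add: dilate_def)

lemma q_pow_power: "q_pow i ^ j = q_pow (i * int j)"
 by (induction j) (simp_all add: q_pow_def algebra_simps)

text \<open>The coefficients that the powers of the flip operator produce on an undotted arc with both spins down.\<close>

definition flip_coeff :: "nat => laurent" where
 "flip_coeff j = q_pow (-1) * (q_pow (int j) - q_pow (- int j))"

text \<open>On sequences, dilation becomes a factor q^j or q^(-j) and the difference quotient a
  shift of the index. The truncated index \<open>j - 1\<close> is harmless at j = 0, since
  \<open>flip_coeff 0\<close> vanishes.\<close>

lemma sequence_poly_plain_arc:
 "sequence_poly (plain_arc b c P) a =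
  (if b then (if c then 0 else sequence_poly P (\<lambda>j. q_pow (int j) * a j))
   else if c then sequence_poly P (\<lambda>j. - q_pow (-1) * q_pow (- int j) * a j)
   else sequence_poly P (\<lambda>j. flip_coeff j * a (j - 1)))"
proof -
 have qh: "qhalf_pow 2 = q_pow 1" "qhalf_pow (-2) = q_pow (-1)" by (simp_all add: q_pow_def)
 have 1: "sequence_poly (Pq P) a = sequence_poly P (\<lambda>j. q_pow (int j) * a j)" for a
  by (simp add: sequence_poly_dilate q_pow_power qh)
 have 2: "sequence_poly (Pqi P) a = sequence_poly P (\<lambda>j. q_pow (- int j) * a j)" for a
  by (simp add: sequence_poly_dilate q_pow_power qh)
 have 3: "sequence_poly (poly_shift 1 Q) a = sequence_poly Q (\<lambda>j. a (j - 1))" if "coeff Q 0 = 0" for Q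
 proof (cases Q)
  case (pCons d Q')
  then have "poly_shift 1 Q = Q'" "d = 0"
   using that by (auto intro!: poly_eqI simp: coeff_poly_shift)
  then show ?thesis using pCons by (simp add: sequence_poly_pCons)
 qed
 have 4: "sequence_poly (qi * poly_shift 1 (Pq P - Pqi P)) a = sequence_poly P (\<lambda>j. flip_coeff j * a (j - 1))"
 proof -
  have "sequence_poly (qi * poly_shift 1 (Pq P - Pqi P)) a
    = q_pow (-1) * sequence_poly (Pq P - Pqi P) (\<lambda>j. a (j - 1))"
   using 3[of "Pq P - Pqi P"] by (simp add: sequence_poly_smult qh)
  also have "sequence_poly (Pq P - Pqi P) b = sequence_poly (Pq P) b - sequence_poly (Pqi P) b" for b
   using sequence_poly_add[of "Pq P - Pqi P" "Pqi P" b] by simp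
  finally show ?thesis
   unfolding 1 2 by (simp add: sequence_poly_def flip_coeff_def sum_distrib_left sum_subtractf algebra_simps)
 qed
 have 5: "sequence_poly (- qi * Pqi P) a = sequence_poly P (\<lambda>j. - q_pow (-1) * q_pow (- int j) * a j)"
 proof -
  have "sequence_poly (- qi * Pqi P) a = - q_pow (-1) * sequence_poly (Pqi P) a"
   using sequence_poly_smult[of "- q_pow (-1)" "Pqi P" a] by (simp add: qh)
  then show ?thesis unfolding 2 by (simp only: sequence_poly_cmult mult.assoc)
 qed
 show ?thesis
  unfolding plain_arc_def by (cases b; cases c) (simp_all only: if_True if_False 1 4 5 sequence_poly_0)
qed

lemma sequence_poly_dotted_arc:
 "sequence_poly (dotted_arc b c P) a =
  (if b then 0 else sequence_poly P (\<lambda>j. q_pow (- int j) * a (if c then Suc j else j)))"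
proof -
 have qh: "qhalf_pow (-2) = q_pow (-1)" by (simp_all add: q_pow_def)
 have 2: "sequence_poly (Pqi P) a = sequence_poly P (\<lambda>j. q_pow (- int j) * a j)" for a
  by (simp add: sequence_poly_dilate q_pow_power qh)
 show ?thesis
  unfolding dotted_arc_def by (simp add: sequence_poly_pCons 2)
qed

lemma sequence_poly_sum: "sequence_poly P (\<lambda>j. \<Sum>y\<in>A. f y j) = (\<Sum>y\<in>A. sequence_poly P (f y))"
 unfolding sequence_poly_def sum_distrib_left by (rule sum.swap)

lemma flip_op_cong:
 assumes "\<And>y. y \<in> open_ends M D t ==> V (S(y := True)) = V' (S(y := True))"
 shows "flip_op M D t V S = flip_op M D t V' S"
 unfolding flip_op_def using assms by (intro sum.cong refl) simp

lemma flip_op_spin_cong: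
 assumes "\<And>i. i \<in> open_ends M D t ==> S i = S' i"
  and "\<And>y. y \<in> open_ends M D t ==> V (S(y := True)) = V (S'(y := True))"
 shows "flip_op M D t V S = flip_op M D t V S'"
proof -
 have "{y \<in> open_ends M D t. \<not> S y} = {y \<in> open_ends M D t. \<not> S' y}" using assms(1) by auto
 moreover have "flip_weight M D t S y = flip_weight M D t S' y" for y
  using assms(1) by (simp add: flip_weight_def cong: sum.cong_simp)
 ultimately show ?thesis
  unfolding flip_op_def using assms(2) by (intro sum.cong) auto
qed

lemma flip_op_cmult: "flip_op M D t (\<lambda>S. c * V S) S = c * flip_op M D t V S"
 by (simp add: flip_op_def sum_distrib_left mult.left_commute)

lemma flip_op_sequence_poly:
 assumes "\<And>y. y \<in> open_ends M D t ==> Q (S(y := True)) = Q S"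
 shows "flip_op M D t (\<lambda>S. sequence_poly (Q S) (\<lambda>i. A i S)) S = sequence_poly (Q S) (\<lambda>i. flip_op M D t (A i) S)"
 unfolding flip_op_def sequence_poly_sum sequence_poly_cmult using assms by (intro sum.cong refl) simp

lemma flip_pow_sequence_poly:
 assumes "\<And>S y. y \<in> open_ends M D t ==> Q (S(y := True)) = Q S"
 shows "(flip_op M D t ^^ j) (\<lambda>S. sequence_poly (Q S) (\<lambda>i. (flip_op M D t ^^ i) V S)) S =
  sequence_poly (Q S) (\<lambda>i. (flip_op M D t ^^ (i + j)) V S)"
proof (induction j arbitrary: S)
 case (Suc j)
 have "(flip_op M D t ^^ Suc j) (\<lambda>S. sequence_poly (Q S) (\<lambda>i. (flip_op M D t ^^ i) V S)) S =
   flip_op M D t (\<lambda>S. sequence_poly (Q S) (\<lambda>i. (flip_op M D t ^^ (i + j)) V S)) S"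
  unfolding funpow.simps comp_def by (rule flip_op_cong) (rule Suc.IH)
 also have "\<dots> = sequence_poly (Q S) (\<lambda>i. flip_op M D t ((flip_op M D t ^^ (i + j)) V) S)"
  by (rule flip_op_sequence_poly) (rule assms)
 finally show ?case by simp
qed simp

section \<open>The scan of a dotted matching and its state polynomial\<close>

locale dotted_matching = matching +
 fixes D assumes D: "D \<subseteq> M"
begin

abbreviation "ends \<equiv> open_ends M D"

lemma finite_ends [simp]: "finite (ends t)"
 by (rule finite_subset[of _ "{..2 * n}"]) (auto simp: open_ends_def dest: arc_bounds)

lemma endpoint_kinds:
 assumes "(s, r) \<in> M"
 shows "s \<notin> snd ` M" "r \<notin> fst ` M" "(s, r') \<in> M ==> r' = r" "(s', r) \<in> M ==> s' = s"
proof -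
 show "s \<notin> snd ` M" using arc_unique[OF assms, of _ s] arc_bounds[OF assms] by force
 show "r \<notin> fst ` M" using arc_unique[OF assms, of _ r] arc_bounds[OF assms] by force
 show "(s, r') \<in> M ==> r' = r" using arc_unique[OF assms, of "(s, r')" s] by auto
 show "(s', r) \<in> M ==> s' = s" using arc_unique[OF assms, of "(s', r)" r] by auto
qed

lemma flow_plain: "(t, r) \<in> M - D ==> flow M D (Suc t) S = cup_weight (S t) (S r) * flow M D t S"
proof -
 assume tr: "(t, r) \<in> M - D"
 then have "t \<in> fst ` (M - D)" by (rule image_eqI[rotated]) simp
 then show ?thesis using mate_eq[of t r] tr by (simp add: flow.simps(2))
qed

lemma flow_dot: "(t, r) \<in> D ==> flow M D (Suc t) S = (if S t then 0 else flow M D t S)"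
proof -
 assume tr: "(t, r) \<in> D"
 then have "t \<in> fst ` D" by (rule image_eqI[rotated]) simp
 moreover have "t \<notin> fst ` (M - D)"
  using tr D endpoint_kinds(3)[of t r] by auto
 ultimately show ?thesis by (simp add: flow.simps(2))
qed

lemma flow_dot_close:
 assumes "(s, t) \<in> D"
 shows "flow M D (Suc t) S = (if S t then flip_op M D (Suc t) (flow M D t) S else flow M D t S)"
proof -
 have "(s, t) \<in> M" using assms D by blast
 then have "t \<notin> fst ` M" by (rule endpoint_kinds(2))
 then have "t \<notin> fst ` (M - D)" "t \<notin> fst ` D" using D by auto
 moreover have "t \<in> snd ` D" using assms by (rule image_eqI[rotated]) simp
 ultimately show ?thesis by (simp add: flow.simps(2))
qed

lemma flow_plain_close:
 assumes "(s, t) \<in> M - D"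
 shows "flow M D (Suc t) S = flow M D t S"
proof -
 have st: "(s, t) \<in> M" using assms by blast
 then have "t \<notin> fst ` M" by (rule endpoint_kinds(2))
 then have "t \<notin> fst ` (M - D)" "t \<notin> fst ` D" using D by auto
 moreover have "t \<notin> snd ` D"
 proof
  assume "t \<in> snd ` D"
  then obtain s' where "(s', t) \<in> D" by auto
  moreover from this have "s' = s" using endpoint_kinds(4)[OF st] D by blast
  ultimately show False using assms by simp
 qed
 ultimately show ?thesis by (simp add: flow.simps(2))
qed

lemma flow_cong:
 assumes "\<And>i. i < t \<or> i \<in> ends t ==> S i = S' i"
 shows "flow M D t S = flow M D t S'"
 using assms
proof (induction t arbitrary: S S')
 case (Suc t)
 have sub: "i < Suc t \<or> i \<in> ends (Suc t)" if "i < t \<or> i \<in> ends t" for i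
  using that by (auto simp: open_ends_def less_Suc_eq)
 have IH: "flow M D t S = flow M D t S'" using Suc sub by blast
 have t: "S t = S' t" using Suc.prems by auto
 have "S (mate M t) = S' (mate M t)" if mem: "t \<in> fst ` (M - D)"
 proof -
  obtain r where r: "(t, r) \<in> M - D" using mem by auto
  then have "r \<in> ends (Suc t)" using arc_bounds[of t r] by (auto simp: open_ends_def)
  then show ?thesis using Suc.prems mate_eq[of t r] r by auto
 qed
 moreover have "flip_op M D (Suc t) (flow M D t) S = flip_op M D (Suc t) (flow M D t) S'"
 proof (rule flip_op_spin_cong)
  show "S i = S' i" if "i \<in> ends (Suc t)" for i using Suc.prems[of i] that by blast
  show "flow M D t (S(y := True)) = flow M D t (S'(y := True))" for y
  proof (rule Suc.IH)
   fix i assume "i < t \<or> i \<in> ends t"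
   then have "S i = S' i" using Suc.prems[OF sub] by blast
   then show "(S(y := True)) i = (S'(y := True)) i" by simp
  qed
 qed
 ultimately show ?case using IH t by (simp add: flow.simps(2))
qed simp

lemma flip_pow_flow_cong:
 assumes "\<And>i. i < t \<or> i \<in> ends t ==> S i = S' i"
 shows "(flip_op M D t ^^ j) (flow M D t) S = (flip_op M D t ^^ j) (flow M D t) S'"
 using assms
proof (induction j arbitrary: S S')
 case 0
 have "flow M D t S = flow M D t S'" by (rule flow_cong) (rule 0)
 then show ?case by simp
next
 case (Suc j)
 show ?case unfolding funpow.simps comp_def
 proof (rule flip_op_spin_cong)
  show "S i = S' i" if "i \<in> ends t" for i using Suc.prems[of i] that by blast
  show "(flip_op M D t ^^ j) (flow M D t) (S(y := True)) = (flip_op M D t ^^ j) (flow M D t) (S'(y := True))" for y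
  proof (rule Suc.IH)
   fix i assume "i < t \<or> i \<in> ends t"
   then have "S i = S' i" by (rule Suc.prems)
   then show "(S(y := True)) i = (S'(y := True)) i" by simp
  qed
 qed
qed

text \<open>No arc crosses the border of a closed interval, so the same arcs are open at both of its
  ends. The flip operator is therefore the same before and after the interval.\<close>

lemma ends_closed:
 assumes "closed_interval M s t" "s \<le> t"
 shows "ends s = ends t" "open_dots D s y = open_dots D t y"
proof -
 have *: "(fst x < s \<and> s \<le> snd x) = (fst x < t \<and> t \<le> snd x)" if "x \<in> M" for x
 proof -
  have "(s \<le> fst x \<and> fst x < t) = (s \<le> snd x \<and> snd x < t)" "fst x < snd x"
   using assms that arc_bounds[of "fst x" "snd x"] unfolding closed_interval_def by auto
  then show ?thesis using assms(2) by linarith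
 qed
 show "ends s = ends t" using * by (force simp: open_ends_def)
 show "open_dots D s y = open_dots D t y" using * D by (auto simp: open_dots_def)
qed

lemma flip_op_closed: "closed_interval M s t ==> s \<le> t ==> flip_op M D s = flip_op M D t"
 using ends_closed[of s t] by (intro ext) (simp add: flip_op_def flip_weight_def)

lemma transfer_spin_cong:
 assumes "closed_interval M s t" "1 \<le> s" "s \<le> t" "t \<le> 2 * n + 1"
  and "\<And>i. s \<le> i ==> i < t ==> S i = S' i"
 shows "transfer M D S s t = transfer M D S' s t"
 using assms
proof (induction rule: interval_induct)
 case (arc s r t)
 then show ?case by (simp add: transfer_arc)
qed simp

text \<open>The arc opened last closes first, by noncrossing: its right end precedes all older open
  ends, and no open dotted arc ends before it.\<close>

lemma ends_after_plain:
 assumes "(s, r) \<in> M - D"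
 shows "ends (Suc s) = insert r (ends s)" "r \<notin> ends s" "y \<in> ends s ==> r < y"
  "open_dots D (Suc s) r = {}" "open_dots D (Suc s) y = open_dots D s y"
proof -
 have sr: "(s, r) \<in> M" "s < r" using assms arc_bounds[of s r] by auto
 have gt: "r < y" if "e < s" "s \<le> y" "(e, y) \<in> M" for e y
  using that arc_cases[OF that(3) sr(1)] sr(2) endpoint_kinds(1)[OF sr(1)] by force
 show "y \<in> ends s ==> r < y" for y using gt by (auto simp: open_ends_def)
 then show "r \<notin> ends s" by blast
 have "y \<in> ends (Suc s) \<longleftrightarrow> y = r \<or> y \<in> ends s" for y
 proof
  assume "y \<in> ends (Suc s)"
  then obtain e where e: "Suc s \<le> y" "e < Suc s" "(e, y) \<in> M - D" by (auto simp: open_ends_def)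
  then show "y = r \<or> y \<in> ends s"
   using endpoint_kinds(3)[OF sr(1), of y] by (cases "e = s") (auto simp: open_ends_def)
 next
  assume "y = r \<or> y \<in> ends s"
  then show "y \<in> ends (Suc s)"
  proof
   assume "y = r"
   then show ?thesis using assms sr(2) by (auto simp: open_ends_def)
  next
   assume "y \<in> ends s"
   then obtain e where e: "e < s" "s \<le> y" "(e, y) \<in> M - D" by (auto simp: open_ends_def)
   then have "s < y" using gt[of e y] sr(2) by simp
   moreover have "e < Suc s" using e(1) by simp
   ultimately show ?thesis using e(3) by (auto simp: open_ends_def)
  qed
 qed
 then show "ends (Suc s) = insert r (ends s)" by blast
 have dots: "(fst x < Suc s \<and> Suc s \<le> snd x) = (fst x < s \<and> s \<le> snd x)" if "x \<in> D" for x
 proof -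
  have "fst x \<noteq> s" using that assms D endpoint_kinds(3)[OF sr(1), of "snd x"] by (cases x) auto
  moreover have "snd x \<noteq> s" using that D endpoint_kinds(1)[OF sr(1)] by force
  ultimately show ?thesis by auto
 qed
 then show "open_dots D (Suc s) y = open_dots D s y" for y by (auto simp: open_dots_def)
 show "open_dots D (Suc s) r = {}"
 proof (rule ccontr)
  assume "open_dots D (Suc s) r \<noteq> {}"
  then obtain x where x: "x \<in> D" "fst x < Suc s \<and> Suc s \<le> snd x" "snd x < r" by (auto simp: open_dots_def)
  then have "fst x < s" "s \<le> snd x" "(fst x, snd x) \<in> M" using dots[OF x(1)] D by auto
  then show False using gt[of "fst x" "snd x"] x(3) by simp
 qed
qed

text \<open>The coproduct rule of a raising operator: a flip either hits the new strand, or passes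
  it at the cost of q to the power of minus its spin and acts on the older ones.\<close>

lemma flip_op_plain:
 assumes sr: "(s, r) \<in> M - D"
 shows "flip_op M D (Suc s) W S = (if S r then 0 else (q_pow (-1) - q_pow 1) * W (S(r := True)))
  + q_pow (- spin (S r)) * flip_op M D s W S"
proof -
 note e = ends_after_plain[OF sr]
 have w: "flip_weight M D (Suc s) S y = q_pow (- spin (S r)) * flip_weight M D s S y" if y: "y \<in> ends s" for y
 proof -
  have "{z \<in> ends (Suc s). z < y} = insert r {z \<in> ends s. z < y}" using e y by auto
  then have "(\<Sum>z\<in>{z \<in> ends (Suc s). z < y}. spin (S z)) = spin (S r) + (\<Sum>z\<in>{z \<in> ends s. z < y}. spin (S z))"
   using e(2) by simp
  then show ?thesis
   by (simp add: flip_weight_def e(5) q_pow_def algebra_simps)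
 qed
 have wr: "flip_weight M D (Suc s) S r = q_pow (-1) - q_pow 1"
 proof -
  have "{z \<in> ends (Suc s). z < r} = {}" using e(1,3) by force
  then show ?thesis by (simp only: flip_weight_def e(4)) (simp add: q_pow_def)
 qed
 have *: "(\<Sum>y\<in>{y \<in> ends s. \<not> S y}. flip_weight M D (Suc s) S y * W (S(y := True)))
   = q_pow (- spin (S r)) * flip_op M D s W S"
  unfolding flip_op_def sum_distrib_left by (intro sum.cong refl) (simp add: w mult.assoc)
 show ?thesis
 proof (cases "S r")
  case True
  then have "{y \<in> ends (Suc s). \<not> S y} = {y \<in> ends s. \<not> S y}" using e(1) by auto
  then show ?thesis using True * by (simp add: flip_op_def)
 next
  case False
  then have "{y \<in> ends (Suc s). \<not> S y} = insert r {y \<in> ends s. \<not> S y}" using e(1) by auto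
  then have "flip_op M D (Suc s) W S = flip_weight M D (Suc s) S r * W (S(r := True))
    + (\<Sum>y\<in>{y \<in> ends s. \<not> S y}. flip_weight M D (Suc s) S y * W (S(y := True)))"
   using e(2) by (simp add: flip_op_def[of _ _ "Suc s"])
  then show ?thesis using False * wr by simp
 qed
qed

text \<open>Iterating the coproduct rule on the weight of the new arc reproduces the four spin cases
  of \<open>plain_arc\<close>, power by power.\<close>

lemma flip_pow_plain:
 assumes sr: "(s, r) \<in> M - D"
 shows "(flip_op M D (Suc s) ^^ j) (flow M D (Suc s)) S =
  (if S s then (if S r then 0 else q_pow (int j) * (flip_op M D s ^^ j) (flow M D s) S)
   else if S r then - q_pow (-1) * q_pow (- int j) * (flip_op M D s ^^ j) (flow M D s) S
   else flip_coeff j * (flip_op M D s ^^ (j - 1)) (flow M D s) S)"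
proof (induction j arbitrary: S)
 case 0
 show ?case by (simp add: flow_plain[OF sr] cup_weight_def flip_coeff_def q_pow_def)
next
 case (Suc j)
 let ?W = "\<lambda>j. (flip_op M D s ^^ j) (flow M D s)"
 have s: "s < r" "s \<notin> ends s" "r \<notin> ends s"
  using sr arc_bounds[of s r] endpoint_kinds(1)[of s r] ends_after_plain(2)[OF sr] by (force simp: open_ends_def)+
 have inv: "?W j (S(r := True)) = ?W j S" for j
  by (rule flip_pow_flow_cong) (use s in auto)
 let ?F = "\<lambda>S. (if S s then (if S r then 0 else q_pow (int j) * ?W j S)
   else if S r then - q_pow (-1) * q_pow (- int j) * ?W j S else flip_coeff j * ?W (j - 1) S)"
 have flip: "flip_op M D s ?F S = (if S s then (if S r then 0 else q_pow (int j) * flip_op M D s (?W j) S)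
   else if S r then - q_pow (-1) * q_pow (- int j) * flip_op M D s (?W j) S else flip_coeff j * flip_op M D s (?W (j - 1)) S)"
 proof -
  have neq: "y \<noteq> s" "y \<noteq> r" if "y \<in> ends s" for y using that s by auto
  show ?thesis
  proof (cases "S s"; cases "S r")
   assume "S s" "S r"
   have "flip_op M D s ?F S = flip_op M D s (\<lambda>S. 0 * ?W j S) S"
    by (rule flip_op_cong) (use neq \<open>S s\<close> \<open>S r\<close> in auto)
   then show ?thesis using \<open>S s\<close> \<open>S r\<close> by (simp only: flip_op_cmult) simp
  next
   assume "S s" "\<not> S r"
   have "flip_op M D s ?F S = flip_op M D s (\<lambda>S. q_pow (int j) * ?W j S) S"
    by (rule flip_op_cong) (use neq \<open>S s\<close> \<open>\<not> S r\<close> in auto)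
   then show ?thesis using \<open>S s\<close> \<open>\<not> S r\<close> by (simp only: flip_op_cmult) simp
  next
   assume "\<not> S s" "S r"
   have "flip_op M D s ?F S = flip_op M D s (\<lambda>S. (- q_pow (-1) * q_pow (- int j)) * ?W j S) S"
    by (rule flip_op_cong) (use neq \<open>\<not> S s\<close> \<open>S r\<close> in auto)
   then show ?thesis using \<open>\<not> S s\<close> \<open>S r\<close> by (simp only: flip_op_cmult) simp
  next
   assume "\<not> S s" "\<not> S r"
   have "flip_op M D s ?F S = flip_op M D s (\<lambda>S. flip_coeff j * ?W (j - 1) S) S"
    by (rule flip_op_cong) (use neq \<open>\<not> S s\<close> \<open>\<not> S r\<close> in auto)
   then show ?thesis using \<open>\<not> S s\<close> \<open>\<not> S r\<close> by (simp only: flip_op_cmult) simp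
  qed
 qed
 have "(flip_op M D (Suc s) ^^ j) (flow M D (Suc s)) = ?F"
  using Suc.IH by (intro ext)
 then have step: "(flip_op M D (Suc s) ^^ Suc j) (flow M D (Suc s)) S =
   (if S r then 0 else (q_pow (-1) - q_pow 1) * ?F (S(r := True))) + q_pow (- spin (S r)) * flip_op M D s ?F S"
  by (simp only: funpow.simps comp_def flip_op_plain[OF sr])
 \<comment> \<open>The recursion of the coefficients with both spins down: a further flip acts
   either on the older strands, or on the new right end, which leaves an arc with spins down and
   up.\<close>
 have coeff: "q_pow 1 * flip_coeff j + (q_pow (-1) - q_pow 1) * (- q_pow (-1) * q_pow (- int j)) = flip_coeff (Suc j)"
  by (simp add: flip_coeff_def q_pow_def algebra_simps)
 have shift: "flip_coeff j * flip_op M D s (?W (j - 1)) S = flip_coeff j * ?W j S"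
  by (cases j) (simp_all add: flip_coeff_def)
 show ?case
 proof (cases "\<not> S s \<and> \<not> S r")
  case True
  then have "\<not> S s" "\<not> S r" by simp_all
  then have "(flip_op M D (Suc s) ^^ Suc j) (flow M D (Suc s)) S =
   (q_pow (-1) - q_pow 1) * (- q_pow (-1) * q_pow (- int j) * ?W j S)
    + q_pow 1 * (flip_coeff j * flip_op M D s (?W (j - 1)) S)"
   unfolding step flip using s(1) inv by (simp add: spin_def)
  also have "\<dots> = (q_pow 1 * flip_coeff j + (q_pow (-1) - q_pow 1) * (- q_pow (-1) * q_pow (- int j))) * ?W j S"
   unfolding shift by (simp only: algebra_simps)
  finally show ?thesis unfolding coeff using \<open>\<not> S s\<close> \<open>\<not> S r\<close> by simp
 next
  case False
  then show ?thesis
   unfolding step flip using s(1)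
   by (cases "S s"; cases "S r") (simp_all add: spin_def q_pow_def algebra_simps)
 qed
qed

text \<open>The newly opened dotted arc closes before every older open end, so it enters the weight
  of each possible flip with the same factor.\<close>

lemma flip_op_dot:
 assumes "(s, r) \<in> D"
 shows "flip_op M D (Suc s) W S = q_pow (-1) * flip_op M D s W S"
proof -
 have sr: "(s, r) \<in> M" "s < r" using assms D arc_bounds[of s r] by auto
 have gt: "r < y" if "e < s" "s \<le> y" "(e, y) \<in> M" for e y
  using that arc_cases[OF that(3) sr(1)] sr(2) endpoint_kinds(1)[OF sr(1)] by force
 have ends: "ends (Suc s) = ends s"
 proof (intro equalityI subsetI)
  fix y assume "y \<in> ends (Suc s)"
  then obtain e where e: "Suc s \<le> y" "e < Suc s" "(e, y) \<in> M - D" by (auto simp: open_ends_def)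
  then show "y \<in> ends s"
   using endpoint_kinds(3)[OF sr(1), of y] assms by (cases "e = s") (auto simp: open_ends_def less_Suc_eq)
 next
  fix y assume "y \<in> ends s"
  then obtain e where e: "e < s" "s \<le> y" "(e, y) \<in> M - D" by (auto simp: open_ends_def)
  then have "s < y" using gt[of e y] sr(2) by simp
  moreover have "e < Suc s" using e(1) by simp
  ultimately show "y \<in> ends (Suc s)" using e(3) by (auto simp: open_ends_def)
 qed
 have dots: "open_dots D (Suc s) y = insert (s, r) (open_dots D s y)" "(s, r) \<notin> open_dots D s y" if "y \<in> ends s" for y
 proof -
  have "r < y" using that gt by (auto simp: open_ends_def)
  moreover have "(fst x < Suc s \<and> Suc s \<le> snd x) = (x = (s, r) \<or> fst x < s \<and> s \<le> snd x)" if "x \<in> D" for x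
  proof -
   have "fst x = s \<longleftrightarrow> x = (s, r)" using that D endpoint_kinds(3)[OF sr(1), of "snd x"] by (cases x) auto
   moreover have "snd x \<noteq> s" using that D endpoint_kinds(1)[OF sr(1)] by force
   ultimately show ?thesis using sr(2) by (cases x) auto
  qed
  ultimately show "open_dots D (Suc s) y = insert (s, r) (open_dots D s y)"
   using assms by (auto simp: open_dots_def)
  show "(s, r) \<notin> open_dots D s y" by (simp add: open_dots_def)
 qed
 have fin: "finite (open_dots D s y)" for y
  using finite_subset[OF D finite_arcs] by (simp add: open_dots_def)
 have "flip_weight M D (Suc s) S y = q_pow (-1) * flip_weight M D s S y" if "y \<in> ends s" for y
  using dots[OF that] fin by (simp add: flip_weight_def ends q_pow_def algebra_simps)
 then show ?thesis
  unfolding flip_op_def ends sum_distrib_left by (intro sum.cong refl) (simp add: mult.assoc)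
qed

lemma flip_pow_dot:
 assumes sr: "(s, r) \<in> D"
 shows "(flip_op M D (Suc s) ^^ j) (flow M D (Suc s)) S =
  (if S s then 0 else q_pow (- int j) * (flip_op M D s ^^ j) (flow M D s) S)"
proof (induction j arbitrary: S)
 case 0
 show ?case by (simp add: flow_dot[OF sr] q_pow_def)
next
 case (Suc j)
 have "s \<notin> ends s" using sr D endpoint_kinds(1)[of s r] by (force simp: open_ends_def)
 have "flip_op M D s ((flip_op M D (Suc s) ^^ j) (flow M D (Suc s))) S =
   flip_op M D s (\<lambda>S'. (if S s then 0 else q_pow (- int j)) * (flip_op M D s ^^ j) (flow M D s) S') S"
 proof (rule flip_op_cong)
  fix y assume "y \<in> ends s"
  then have "s \<noteq> y" using \<open>s \<notin> ends s\<close> by blast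
  show "(flip_op M D (Suc s) ^^ j) (flow M D (Suc s)) (S(y := True)) =
    (if S s then 0 else q_pow (- int j)) * (flip_op M D s ^^ j) (flow M D s) (S(y := True))"
   unfolding Suc.IH fun_upd_other[OF \<open>s \<noteq> y\<close>] by (cases "S s") (simp_all only: if_True if_False mult_zero_left)
 qed
 also have "\<dots> = (if S s then 0 else q_pow (- int j)) * (flip_op M D s ^^ Suc j) (flow M D s) S"
  unfolding flip_op_cmult by simp
 finally have eq: "flip_op M D s ((flip_op M D (Suc s) ^^ j) (flow M D (Suc s))) S
   = (if S s then 0 else q_pow (- int j)) * (flip_op M D s ^^ Suc j) (flow M D s) S" .
 have "(flip_op M D (Suc s) ^^ Suc j) (flow M D (Suc s)) S
   = q_pow (-1) * flip_op M D s ((flip_op M D (Suc s) ^^ j) (flow M D (Suc s))) S"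
  unfolding funpow.simps comp_def by (rule flip_op_dot[OF sr])
 then show ?case
  unfolding eq by (cases "S s") (simp_all add: q_pow_def algebra_simps)
qed

text \<open>The bridge between the two orders of evaluation: scanning an interval amounts to its
  nested polynomial with powers of the variable replaced by powers of the flip operator at its left
  end. The open ends lie beyond the interval, so flips leave the polynomial unchanged and it can be
  pulled through them.\<close>

lemma flow_transfer:
 assumes "closed_interval M s t" "1 \<le> s" "s \<le> t" "t \<le> 2 * n + 1"
 shows "flow M D t S = sequence_poly (transfer M D S s t) (\<lambda>j. (flip_op M D s ^^ j) (flow M D s) S)"
 using assms
proof (induction arbitrary: S rule: interval_induct)
 case (arc s r t)
 let ?V = "\<lambda>j. (flip_op M D s ^^ j) (flow M D s)"
 let ?P = "\<lambda>S. (if (s, r) \<in> D then dotted_arc else plain_arc) (S s) (S r) (transfer M D S (Suc s) r)"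
 have sr: "closed_interval M s (Suc r)" by (rule closed_arc) (rule arc)
 have flip: "flip_op M D (Suc r) = flip_op M D s"
  using flip_op_closed[OF sr] arc by simp
 have ends_ge: "t \<le> y" "r < y" if "y \<in> ends s" for y
 proof -
  have "y \<in> ends t" using that ends_closed(1)[OF arc(7)] arc(2,3) by simp
  then show "t \<le> y" unfolding open_ends_def by blast
  then show "r < y" using arc(3) by simp
 qed
 have inv: "?P (S(y := True)) = ?P S" if "y \<in> ends s" for S y
 proof -
  have "transfer M D (S(y := True)) (Suc s) r = transfer M D S (Suc s) r"
   by (rule transfer_spin_cong) (use arc ends_ge[OF that] in auto)
  then show ?thesis using ends_ge[OF that] arc by simp
 qed
 have inner: "flow M D (Suc r) S = sequence_poly (?P S) (\<lambda>j. ?V j S)" for S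
 proof (cases "(s, r) \<in> D")
  case False
  then have "flow M D (Suc r) S = flow M D r S"
   using flow_plain_close[of s r] arc by simp
  then show ?thesis
   using False arc(1) unfolding arc.IH(1)
   by (simp add: flip_pow_plain sequence_poly_plain_arc flip: sequence_poly_cmult cong: if_cong)
    (auto simp: sequence_poly_def)
 next
  case True
  have "s \<notin> ends s" using True D endpoint_kinds(1)[of s r] by (force simp: open_ends_def)
  have r: "flow M D r S = sequence_poly (transfer M D S (Suc s) r) (\<lambda>j. if S s then 0 else q_pow (- int j) * ?V j S)" for S
   unfolding arc.IH(1) flip_pow_dot[OF True] by (rule refl)
  have "flip_op M D s (flow M D r) S = flip_op M D s (\<lambda>S. sequence_poly (transfer M D S (Suc s) r) (\<lambda>j. if S s then 0 else q_pow (- int j) * ?V j S)) S"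
   by (rule flip_op_cong) (rule r)
  also have "\<dots> = sequence_poly (transfer M D S (Suc s) r) (\<lambda>j. flip_op M D s (\<lambda>S. if S s then 0 else q_pow (- int j) * ?V j S) S)"
  proof (rule flip_op_sequence_poly)
   fix y assume y: "y \<in> ends s"
   show "transfer M D (S(y := True)) (Suc s) r = transfer M D S (Suc s) r"
    by (intro transfer_spin_cong) (use arc ends_ge[OF y] in auto)
  qed
  also have "(\<lambda>j. flip_op M D s (\<lambda>S. if S s then 0 else q_pow (- int j) * ?V j S) S) = (\<lambda>j. if S s then 0 else q_pow (- int j) * ?V (Suc j) S)"
  proof
   fix j
   have "flip_op M D s (\<lambda>S. if S s then 0 else q_pow (- int j) * ?V j S) S
     = flip_op M D s (\<lambda>S'. (if S s then 0 else q_pow (- int j)) * ?V j S') S"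
    by (rule flip_op_cong) (use \<open>s \<notin> ends s\<close> in auto)
   then show "flip_op M D s (\<lambda>S. if S s then 0 else q_pow (- int j) * ?V j S) S = (if S s then 0 else q_pow (- int j) * ?V (Suc j) S)"
    by (simp add: flip_op_cmult)
  qed
  finally have X: "flip_op M D s (flow M D r) S =
    sequence_poly (transfer M D S (Suc s) r) (\<lambda>j. if S s then 0 else q_pow (- int j) * ?V (Suc j) S)" .
  show ?thesis
   unfolding flow_dot_close[OF True] flip X r
   using True by (auto simp: sequence_poly_dotted_arc) (auto simp: sequence_poly_def)
 qed
 have "(flip_op M D (Suc r) ^^ j) (flow M D (Suc r)) S = sequence_poly (?P S) (\<lambda>i. ?V (i + j) S)" for j
 proof -
  have "flow M D (Suc r) = (\<lambda>S. sequence_poly (?P S) (\<lambda>j. ?V j S))" using inner by (rule ext)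
  then show ?thesis
   unfolding flip by (simp only: flip_pow_sequence_poly[OF inv])
 qed
 then show ?case
  unfolding arc.IH(2) transfer_arc[OF arc(1,3)]
  by (simp only: sequence_poly_mult mult.commute[of _ "transfer M D S (Suc r) t"])
qed simp

text \<open>At the first point no arc is open, so the flip operator is zero and only the constant
  term survives.\<close>

lemma flow_whole: "flow M D (2 * n + 1) S = russell_state n S (M, D)"
proof -
 have "ends 1 = {}" using arc_bounds by (force simp: open_ends_def)
 then have X: "flip_op M D 1 V S = 0" for V S by (simp add: flip_op_def)
 have 0: "0 \<notin> fst ` (M - D)" "0 \<notin> fst ` D" "0 \<notin> snd ` D" using arc_bounds D by force+
 have "flow M D 1 S = 1"
  unfolding One_nat_def flow.simps(2) using 0 by simp
 then have "(\<lambda>j. (flip_op M D 1 ^^ j) (flow M D 1) S) = (\<lambda>j. if j = 0 then 1 else 0)"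
  by (intro ext) (auto simp: X[unfolded One_nat_def] gr0_conv_Suc)
 moreover have "sequence_poly P (\<lambda>j. if j = 0 then 1 else 0) = coeff P 0" for P
  by (simp add: sequence_poly_def if_distrib[of "\<lambda>x. _ * x"] sum.delta cong: if_cong)
 ultimately show ?thesis
  using flow_transfer[OF closed_interval_whole] by (simp add: russell_state_def)
qed

end

section \<open>Strands crossing over others\<close>

definition over_chain :: "nat => nat => tangle" where
 "over_chain i m = map (\<lambda>j. (Pos, i + j)) [0..<m]"

lemma over_chain_Suc: "over_chain i (Suc m) = over_chain i m @ [(Pos, i + m)]"
 by (simp add: over_chain_def)

text \<open>An over-strand that ends in a down spin was down all along: in this case every crossing
  keeps the spins of both strands.\<close>

lemma over_chain_False:
 assumes "length pre = i"
 shows "fold apply_piece (over_chain i (length ps)) g (pre @ map S ps @ False # post) =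
  qhalf_pow (- (\<Sum>y\<leftarrow>ps. spin (S y))) * g (pre @ False # map S ps @ post)"
proof (induction ps arbitrary: post rule: rev_induct)
 case Nil
 show ?case by (simp add: over_chain_def)
next
 case (snoc p ps)
 have "fold apply_piece (over_chain i (length (ps @ [p]))) g (pre @ map S (ps @ [p]) @ False # post) =
   qhalf_pow (- spin (S p)) * fold apply_piece (over_chain i (length ps)) g (pre @ map S ps @ False # S p # post)"
  using apply_Pos[of "pre @ map S ps" "i + length ps" "fold apply_piece (over_chain i (length ps)) g" "S p" False post] assms
  by (cases "S p") (simp_all add: over_chain_Suc spin_def cup_weight_def algebra_simps)
 then show ?case by (simp add: snoc.IH algebra_simps)
qed

text \<open>Followed back from its up end, the over-strand is up throughout or exchanges its spin
  with one down strand \<open>y\<close>. Before that it is down, so a second exchange is impossible.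
  The factor q^(1/2) - q^(-3/2) is the weight of a \<open>Pos\<close> at which the exchange
  happens.\<close>

lemma over_chain_True:
 fixes ps :: "nat list"
 assumes "length pre = i" "sorted_wrt (<) ps"
 shows "fold apply_piece (over_chain i (length ps)) g (pre @ map S ps @ True # post) =
  qhalf_pow (\<Sum>y\<in>set ps. spin (S y)) * g (pre @ True # map S ps @ post)
  + (\<Sum>y\<in>{y \<in> set ps. \<not> S y}. (qhalf_pow 1 - qhalf_pow (-3))
    * qhalf_pow ((\<Sum>z\<in>{z \<in> set ps. y < z}. spin (S z)) - (\<Sum>z\<in>{z \<in> set ps. z < y}. spin (S z)))
    * g (pre @ False # map (S(y := True)) ps @ post))"
 using assms(2)
proof (induction ps arbitrary: post rule: rev_induct)
 case Nil
 show ?case by (simp add: over_chain_def)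
next
 case (snoc p ps)
 have sorted: "sorted_wrt (<) ps" and p: "\<And>y. y \<in> set ps ==> y < p"
  using snoc.prems by (auto simp: sorted_wrt_append)
 have notin: "p \<notin> set ps" using p[of p] by auto
 let ?f = "fold apply_piece (over_chain i (length ps)) g"
 let ?K = "qhalf_pow 1 - qhalf_pow (-3)"
 let ?w = "\<lambda>qs y. qhalf_pow ((\<Sum>z\<in>{z \<in> set qs. y < z}. spin (S z)) - (\<Sum>z\<in>{z \<in> set qs. z < y}. spin (S z)))"
 have step: "fold apply_piece (over_chain i (length (ps @ [p]))) g (pre @ map S (ps @ [p]) @ True # post) =
   qhalf_pow (spin (S p)) * ?f (pre @ map S ps @ True # S p # post)
   + (if S p then 0 else ?K * ?f (pre @ map S ps @ False # True # post))"
  using apply_Pos[of "pre @ map S ps" "i + length ps" ?f "S p" True post] assms(1)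
  by (cases "S p") (simp_all add: over_chain_Suc spin_def cup_weight_def algebra_simps)
 have total: "qhalf_pow (spin (S p)) * qhalf_pow (\<Sum>y\<in>set ps. spin (S y)) = qhalf_pow (\<Sum>y\<in>set (ps @ [p]). spin (S y))"
  using notin by simp
 have w: "qhalf_pow (spin (S p)) * ?w ps y = ?w (ps @ [p]) y" if y: "y \<in> set ps" for y
 proof -
  have "{z \<in> set (ps @ [p]). y < z} = insert p {z \<in> set ps. y < z}" "{z \<in> set (ps @ [p]). z < y} = {z \<in> set ps. z < y}"
   using p[OF y] by auto
  then show ?thesis using notin by (simp add: algebra_simps)
 qed
 have "qhalf_pow (spin (S p)) * (\<Sum>y\<in>{y \<in> set ps. \<not> S y}. ?K * ?w ps y * g (pre @ False # map (S(y := True)) ps @ S p # post))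
   = (\<Sum>y\<in>{y \<in> set ps. \<not> S y}. ?K * ?w (ps @ [p]) y * g (pre @ False # map (S(y := True)) (ps @ [p]) @ post))"
  unfolding sum_distrib_left
 proof (intro sum.cong refl)
  fix y assume y: "y \<in> {y \<in> set ps. \<not> S y}"
  have "qhalf_pow (spin (S p)) * (?K * ?w ps y * g (pre @ False # map (S(y := True)) ps @ S p # post))
    = ?K * (qhalf_pow (spin (S p)) * ?w ps y) * g (pre @ False # map (S(y := True)) ps @ S p # post)"
   by (simp only: mult.assoc mult.left_commute)
  also have "\<dots> = ?K * ?w (ps @ [p]) y * g (pre @ False # map (S(y := True)) (ps @ [p]) @ post)"
   using w[of y] y notin by auto
  finally show "qhalf_pow (spin (S p)) * (?K * ?w ps y * g (pre @ False # map (S(y := True)) ps @ S p # post))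
    = ?K * ?w (ps @ [p]) y * g (pre @ False # map (S(y := True)) (ps @ [p]) @ post)" .
 qed
 then have IH: "qhalf_pow (spin (S p)) * ?f (pre @ map S ps @ True # S p # post) =
   qhalf_pow (\<Sum>y\<in>set (ps @ [p]). spin (S y)) * g (pre @ True # map S (ps @ [p]) @ post)
   + (\<Sum>y\<in>{y \<in> set ps. \<not> S y}. ?K * ?w (ps @ [p]) y * g (pre @ False # map (S(y := True)) (ps @ [p]) @ post))"
  unfolding snoc.IH[OF sorted] distrib_left mult.assoc[symmetric] total by simp
 show ?case
 proof (cases "S p")
  case True
  then have "{y \<in> set (ps @ [p]). \<not> S y} = {y \<in> set ps. \<not> S y}" by auto
  show ?thesis unfolding step IH \<open>{y \<in> set (ps @ [p]). \<not> S y} = {y \<in> set ps. \<not> S y}\<close>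
   using True by (simp only: if_True add_0_right)
 next
  case False
  then have set: "{y \<in> set (ps @ [p]). \<not> S y} = insert p {y \<in> set ps. \<not> S y}" by auto
  have e: "{z \<in> set (ps @ [p]). p < z} = {}" "{z \<in> set (ps @ [p]). z < p} = set ps"
   using p by (auto dest: less_asym)
  have sum: "(\<Sum>y\<leftarrow>ps. spin (S y)) = (\<Sum>y\<in>set ps. spin (S y))"
   using sorted by (intro sum_list_distinct_conv_sum_set) (simp add: strict_sorted_iff)
  have "map (S(p := True)) ps = map S ps" using notin by auto
  then have K: "?K * ?f (pre @ map S ps @ False # True # post)
    = ?K * ?w (ps @ [p]) p * g (pre @ False # map (S(p := True)) (ps @ [p]) @ post)"
   unfolding over_chain_False[OF assms(1)] e sum
   by (simp only: map_append sum.empty list.map fun_upd_same append.assoc append_Cons append_Nil diff_0 mult.assoc)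
  have ins: "finite {y \<in> set ps. \<not> S y}" "p \<notin> {y \<in> set ps. \<not> S y}" using notin by auto
  show ?thesis
   unfolding step IH set sum.insert[OF ins] K[symmetric]
   using False by (simp only: if_False add.assoc add.commute add.left_commute)
 qed
qed

lemma cup_over_chain:
 fixes ps :: "nat list"
 assumes "length pre = i" "sorted_wrt (<) ps"
 shows "fold apply_piece ((Cup, i) # over_chain (Suc i) (length ps)) g (pre @ c # map S ps @ False # post) =
   qhalf_pow (- (\<Sum>y\<in>set ps. spin (S y))) * (cup_weight c False * g (pre @ map S ps @ post))" (is ?F)
  and "fold apply_piece ((Cup, i) # over_chain (Suc i) (length ps)) g (pre @ c # map S ps @ True # post) =
   qhalf_pow (\<Sum>y\<in>set ps. spin (S y)) * (cup_weight c True * g (pre @ map S ps @ post))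
   + (\<Sum>y\<in>{y \<in> set ps. \<not> S y}. (qhalf_pow 1 - qhalf_pow (-3))
    * qhalf_pow ((\<Sum>z\<in>{z \<in> set ps. y < z}. spin (S z)) - (\<Sum>z\<in>{z \<in> set ps. z < y}. spin (S z)))
    * (cup_weight c False * g (pre @ map (S(y := True)) ps @ post)))" (is ?T)
proof -
 have pre: "length (pre @ [c]) = Suc i" using assms(1) by simp
 have sum: "(\<Sum>y\<leftarrow>ps. spin (S y)) = (\<Sum>y\<in>set ps. spin (S y))"
  using assms(2) by (intro sum_list_distinct_conv_sum_set) (simp add: strict_sorted_iff)
 show ?F
  using over_chain_False[OF pre, of ps "apply_piece (Cup, i) g" S post] sum assms(1) by (simp add: apply_Cup)
 show ?T
  using over_chain_True[OF pre assms(2), of "apply_piece (Cup, i) g" S post] assms(1) by (simp add: apply_Cup)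
qed

section \<open>Slices of semicircle diagrams\<close>

lemma concat_map_unique:
 assumes "distinct xs" "x \<in> set xs" "\<And>y. y \<in> set xs ==> y \<noteq> x ==> f y = []"
 shows "concat (map f xs) = f x"
proof -
 obtain us vs where xs: "xs = us @ x # vs" using split_list[OF assms(2)] by blast
 have "f y = []" if "y \<in> set us \<union> set vs" for y
  using that assms(1,3) xs by auto
 then have "concat (map f us) = []" "concat (map f vs) = []" by auto
 then show ?thesis by (simp add: xs del: concat_eq_Nil_conv)
qed

definition slice :: "strand set => nat => nat => tangle" where
 "slice C m a = concat [add_strand C (a, b, h). b \<leftarrow> [a + 1..<m], h \<leftarrow> [0, 1, 2], (a, b, h) \<in> C]"

lemma semicircle_tangle_slices: "semicircle_tangle m C = concat (map (slice C m) [0..<m])"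
proof -
 have "concat (concat (map f xs)) = concat (map (\<lambda>a. concat (f a)) xs)" for f :: "nat => tangle list" and xs
  by (induction xs) simp_all
 then show ?thesis unfolding semicircle_tangle_def slice_def by simp
qed

lemma slice_empty: "(\<And>b h. (a, b, h) \<notin> C) ==> slice C m a = []"
 by (simp add: slice_def)

lemma slice_unique:
 assumes "(a, b, h) \<in> C" "a < b" "b < m" "h \<in> {0, 1, 2}"
  and "\<And>b' h'. (a, b', h') \<in> C ==> b' = b \<and> h' = h"
 shows "slice C m a = add_strand C (a, b, h)"
proof -
 let ?g = "\<lambda>b h. if (a, b, h) \<in> C then [add_strand C (a, b, h)] else []"
 have no: "(a, b', h') \<notin> C" if "b' \<noteq> b \<or> h' \<noteq> h" for b' h'
  using assms(5) that by blast
 have "concat (map (\<lambda>b. concat (map (?g b) [0, 1, 2])) [a + 1..<m]) = concat (map (?g b) [0, 1, 2])"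
  by (rule concat_map_unique) (use assms(2,3) no in auto)
 also have "\<dots> = ?g b h"
  by (rule concat_map_unique) (use assms(4) no in auto)
 finally show ?thesis unfolding slice_def using assms(1) by simp
qed

text \<open>Each endpoint is the right end of at most one strand, so the nested loops of the
  definition yield exactly one height per crossed endpoint, from left to right.\<close>

lemma crossed_heights_eq:
 assumes "\<And>a1 h1 a2 h2 e. (a1, e, h1) \<in> C ==> (a2, e, h2) \<in> C ==> a1 = a2 \<and> h1 = h2"
  and "\<And>a1 e h1. (a1, e, h1) \<in> C ==> h1 \<in> {0, 1, 2}"
 shows "crossed_heights C a b = map (\<lambda>e. THE h. \<exists>a'. (a', e, h) \<in> C) (filter (\<lambda>e. \<exists>a'<a. \<exists>h. (a', e, h) \<in> C) [a + 1..<b])"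
proof -
 let ?g = "\<lambda>e a' h. if (a', e, h) \<in> C then [h] else []"
 have inner: "concat (map (\<lambda>a'. concat (map (?g e a') [0, 1, 2])) [0..<a])
   = (if \<exists>a'<a. \<exists>h. (a', e, h) \<in> C then [THE h. \<exists>a'. (a', e, h) \<in> C] else [])" for e
 proof (cases "\<exists>a'<a. \<exists>h. (a', e, h) \<in> C")
  case True
  then obtain a' h where ah: "a' < a" "(a', e, h) \<in> C" by blast
  have no: "(a2, e, h2) \<notin> C" if "a2 \<noteq> a' \<or> h2 \<noteq> h" for a2 h2
   using assms(1)[OF _ ah(2)] that by blast
  have "concat (map (\<lambda>a'. concat (map (?g e a') [0, 1, 2])) [0..<a]) = concat (map (?g e a') [0, 1, 2])"
   by (rule concat_map_unique) (use ah(1) no in auto)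
  also have "\<dots> = ?g e a' h"
   by (rule concat_map_unique) (use assms(2)[OF ah(2)] no in auto)
  finally have "concat (map (\<lambda>a'. concat (map (?g e a') [0, 1, 2])) [0..<a]) = [h]" using ah by simp
  moreover have "(THE h. \<exists>a'. (a', e, h) \<in> C) = h"
   by (rule the_equality) (use ah assms(1) in blast)+
  ultimately show ?thesis using True by simp
 qed auto
 have filter: "concat (map (\<lambda>e. if P e then [f e] else []) xs) = map f (filter P xs)" for P :: "nat => bool" and f :: "nat => nat" and xs
  by (induction xs) simp_all
 show ?thesis
  unfolding crossed_heights_def inner by (rule filter)
qed

text \<open>All strands that are crossed have smaller height, so every crossing is a
  \<open>Pos\<close>.\<close>

lemma add_strand_over:
 assumes "\<And>a1 h1 a2 h2 e. (a1, e, h1) \<in> C ==> (a2, e, h2) \<in> C ==> a1 = a2 \<and> h1 = h2"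
  and "\<And>a1 e h1. (a1, e, h1) \<in> C ==> h1 \<in> {0, 1, 2}"
  and "\<And>a' e h'. a < e ==> e < b ==> a' < a ==> (a', e, h') \<in> C ==> h' < h"
 shows "add_strand C (a, b, h) = (Cup, a) # over_chain (Suc a) (length (filter (\<lambda>e. \<exists>a'<a. \<exists>h. (a', e, h) \<in> C) [a + 1..<b]))"
proof -
 let ?E = "filter (\<lambda>e. \<exists>a'<a. \<exists>h. (a', e, h) \<in> C) [a + 1..<b]"
 have "(THE h. \<exists>a'. (a', e, h) \<in> C) < h" if e: "e \<in> set ?E" for e
 proof -
  obtain a' h' where ah: "a < e" "e < b" "a' < a" "(a', e, h') \<in> C" using e by auto
  have "(THE h. \<exists>a'. (a', e, h) \<in> C) = h'"
   by (rule the_equality) (use ah assms(1) in blast)+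
  then show ?thesis using assms(3) ah by simp
 qed
 then have less: "(THE h. \<exists>a'. (a', ?E ! j, h) \<in> C) < h" if "j < length ?E" for j
  using nth_mem[OF that] by blast
 have "map (\<lambda>j. (if map (\<lambda>e. THE h. \<exists>a'. (a', e, h) \<in> C) ?E ! j < h then Pos else Neg, a + 1 + j)) [0..<length ?E]
   = map (\<lambda>j. (Pos, Suc a + j)) [0..<length ?E]"
  by (rule map_cong[OF refl]) (simp only: set_upt atLeastLessThan_iff nth_map less if_True Suc_eq_plus1)
 moreover have "crossed_heights C a b = map (\<lambda>e. THE h. \<exists>a'. (a', e, h) \<in> C) ?E"
  by (rule crossed_heights_eq[OF assms(1,2)])
 ultimately show ?thesis
  unfolding add_strand_def prod.case Let_def over_chain_def by (simp only: length_map)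
qed

section \<open>The strands drawn for a dotted diagram\<close>

locale strand_diagram = dotted_matching +
 fixes k :: nat
 assumes card_D: "card D = k"
begin

definition lrank :: "nat => nat" where "lrank p = card {x \<in> D. fst x \<le> p}"
definition rrank :: "nat => nat" where "rrank r = card {x \<in> D. snd x \<le> r}"

abbreviation "C \<equiv> strands n k (M, D)"

lemma finite_D: "finite D"
 using finite_subset[OF D finite_arcs] .

lemma strand_iff: "(a, b, h) \<in> C \<longleftrightarrow>
  (\<exists>p r. (p, r) \<in> D \<and> a = k - lrank p \<and> b = k + p - 1 \<and> h = 0)
  \<or> (\<exists>p r. (p, r) \<in> M - D \<and> a = k + p - 1 \<and> b = k + r - 1 \<and> h = 1)
  \<or> (\<exists>p r. (p, r) \<in> D \<and> a = k + r - 1 \<and> b = 2 * (n + k) - rrank r \<and> h = 2)"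
 by (auto simp: strands_def lrank_def rrank_def)

lemma dot_bounds: "(p, r) \<in> D ==> 1 \<le> p \<and> p < r \<and> r \<le> 2 * n"
 using D arc_bounds by blast

lemma rank_bounds:
 assumes "(p, r) \<in> D"
 shows "1 \<le> lrank p" "lrank p \<le> k" "1 \<le> rrank r" "rrank r \<le> k"
proof -
 have "card {(p, r)} \<le> lrank p" "card {(p, r)} \<le> rrank r"
  unfolding lrank_def rrank_def by (rule card_mono; use assms finite_D in auto)+
 then show "1 \<le> lrank p" "1 \<le> rrank r" by simp_all
 show "lrank p \<le> k" "rrank r \<le> k"
  unfolding lrank_def rrank_def card_D[symmetric] by (rule card_mono; use finite_D in auto)+
qed

lemma rank_mono:
 shows "(p', r') \<in> D ==> p < p' ==> lrank p < lrank p'" "(p', r') \<in> D ==> r < r' ==> rrank r < rrank r'"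
 unfolding lrank_def rrank_def by (rule psubset_card_mono; use finite_D in force)+

lemma rank_inj:
 "(p, r) \<in> D ==> (p', r') \<in> D ==> lrank p = lrank p' ==> p = p'"
 "(p, r) \<in> D ==> (p', r') \<in> D ==> rrank r = rrank r' ==> r = r'"
 using rank_mono by (metis linorder_neq_iff)+

lemma lrank_surj: "1 \<le> i ==> i \<le> k ==> \<exists>p r. (p, r) \<in> D \<and> lrank p = i"
proof -
 assume i: "1 \<le> i" "i \<le> k"
 have "inj_on (\<lambda>x. lrank (fst x)) D"
 proof (rule inj_onI)
  fix x y assume "x \<in> D" "y \<in> D" "lrank (fst x) = lrank (fst y)"
  then have "fst x = fst y" using rank_inj(1)[of "fst x" "snd x" "fst y" "snd y"] by simp
  then show "x = y" using arc_unique[of x y "fst x"] D \<open>x \<in> D\<close> \<open>y \<in> D\<close> by auto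
 qed
 moreover have "(\<lambda>x. lrank (fst x)) ` D \<subseteq> {1..k}" using rank_bounds by auto
 ultimately have "(\<lambda>x. lrank (fst x)) ` D = {1..k}"
  by (intro card_subset_eq) (simp_all add: card_image card_D)
 then have "i \<in> (\<lambda>x. lrank (fst x)) ` D" using i by simp
 then show ?thesis by auto
qed

lemma endpoint_disjoint:
 "(p, r) \<in> M ==> (p', r') \<in> M ==> p \<noteq> r'"
 "(p, r) \<in> D ==> (p, r') \<in> M - D ==> False"
 "(p, r) \<in> D ==> (p', r) \<in> M - D ==> False"
proof -
 show "(p, r) \<in> M ==> (p', r') \<in> M ==> p \<noteq> r'" using endpoint_kinds(1)[of p r] by force
 show "(p, r) \<in> D ==> (p, r') \<in> M - D ==> False" using endpoint_kinds(3)[of p r r'] D by auto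
 show "(p, r) \<in> D ==> (p', r) \<in> M - D ==> False" using endpoint_kinds(4)[of p r p'] D by auto
qed

lemma strand_height: "(a, b, h) \<in> C ==> h \<in> {0, 1, 2}"
 by (auto simp: strand_iff)

lemma strand_order: "(a, b, h) \<in> C ==> a < b \<and> b < 2 * (n + k)"
proof -
 assume "(a, b, h) \<in> C"
 then consider (l) p r where "(p, r) \<in> D" "a = k - lrank p" "b = k + p - 1"
  | (m) p r where "(p, r) \<in> M - D" "a = k + p - 1" "b = k + r - 1"
  | (r) p r where "(p, r) \<in> D" "a = k + r - 1" "b = 2 * (n + k) - rrank r"
  unfolding strand_iff by blast
 then show ?thesis
 proof cases
  case l
  then show ?thesis using rank_bounds[of p r] dot_bounds[of p r] by auto
 next
  case m
  then show ?thesis using arc_bounds[of p r] by auto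
 next
  case r
  then show ?thesis using rank_bounds[of p r] dot_bounds[of p r] by auto
 qed
qed

text \<open>The three kinds of strands have their right ends at left ends of dotted arcs, at right
  ends of undotted arcs, and in the right projector. Strands of different kinds thus share none, and
  within one kind the matching or the rank decides.\<close>

lemma strand_unique_right:
 assumes "(a1, e, h1) \<in> C" "(a2, e, h2) \<in> C"
 shows "a1 = a2 \<and> h1 = h2"
proof -
 consider (l) p r where "(p, r) \<in> D" "a1 = k - lrank p" "e = k + p - 1" "h1 = 0"
  | (m) p r where "(p, r) \<in> M - D" "a1 = k + p - 1" "e = k + r - 1" "h1 = 1"
  | (r) p r where "(p, r) \<in> D" "a1 = k + r - 1" "e = 2 * (n + k) - rrank r" "h1 = 2"
  using assms(1) unfolding strand_iff by blast
 note c1 = this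
 consider (l) p r where "(p, r) \<in> D" "a2 = k - lrank p" "e = k + p - 1" "h2 = 0"
  | (m) p r where "(p, r) \<in> M - D" "a2 = k + p - 1" "e = k + r - 1" "h2 = 1"
  | (r) p r where "(p, r) \<in> D" "a2 = k + r - 1" "e = 2 * (n + k) - rrank r" "h2 = 2"
  using assms(2) unfolding strand_iff by blast
 note c2 = this
 show ?thesis
 proof (cases rule: c1)
  case l1: (l p r)
  show ?thesis
  proof (cases rule: c2)
   case (l p' r')
   then have "p = p'" using l1 dot_bounds[of p r] dot_bounds[of p' r'] by linarith
   then show ?thesis using l l1 by simp
  next
   case (m p' r')
   then have "p = r'" using l1 dot_bounds[of p r] arc_bounds[of p' r'] by auto
   then show ?thesis using m l1 endpoint_disjoint(1)[of p r p' r'] D by auto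
  next
   case (r p' r')
   then show ?thesis using l1 dot_bounds[of p r] rank_bounds[of p' r'] by auto
  qed
 next
  case m1: (m p r)
  show ?thesis
  proof (cases rule: c2)
   case (l p' r')
   then have "r = p'" using m1 dot_bounds[of p' r'] arc_bounds[of p r] by auto
   then show ?thesis using l m1 endpoint_disjoint(1)[of p' r' p r] D by auto
  next
   case (m p' r')
   then have "r = r'" using m1 arc_bounds[of p' r'] arc_bounds[of p r] by auto
   then show ?thesis using m m1 endpoint_kinds(4)[of p r p'] by auto
  next
   case (r p' r')
   then show ?thesis using m1 arc_bounds[of p r] rank_bounds[of p' r'] by auto
  qed
 next
  case r1: (r p r)
  show ?thesis
  proof (cases rule: c2)
   case (l p' r')
   then show ?thesis using r1 dot_bounds[of p' r'] rank_bounds[of p r] by auto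
  next
   case (m p' r')
   then show ?thesis using r1 arc_bounds[of p' r'] rank_bounds[of p r] by auto
  next
   case (r p' r')
   have "rrank r = 2 * (n + k) - e" "rrank r' = 2 * (n + k) - e"
    using r(3) r1(3) rank_bounds(4)[OF r(1)] rank_bounds(4)[OF r1(1)] by simp_all
   then have "rrank r = rrank r'" by simp
   then have "r = r'" using rank_inj(2)[of p r p' r'] r r1 by simp
   then show ?thesis using r r1 by simp
  qed
 qed
qed

lemma slice_over:
 assumes "(a, b, h) \<in> C"
  and "\<And>b' h'. (a, b', h') \<in> C ==> b' = b \<and> h' = h"
  and "\<And>a' e h'. a < e ==> e < b ==> a' < a ==> (a', e, h') \<in> C ==> h' < h"
 shows "slice C (2 * (n + k)) a = (Cup, a) # over_chain (Suc a) (length (filter (\<lambda>e. \<exists>a'<a. \<exists>h. (a', e, h) \<in> C) [a + 1..<b]))"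
proof -
 have "slice C (2 * (n + k)) a = add_strand C (a, b, h)"
  by (rule slice_unique[OF assms(1) conjunct1[OF strand_order[OF assms(1)]]
     conjunct2[OF strand_order[OF assms(1)]] strand_height[OF assms(1)] assms(2)])
 also have "\<dots> = (Cup, a) # over_chain (Suc a) (length (filter (\<lambda>e. \<exists>a'<a. \<exists>h. (a', e, h) \<in> C) [a + 1..<b]))"
  by (rule add_strand_over[OF strand_unique_right strand_height assms(3)])
 finally show ?thesis .
qed

text \<open>Ranks grow with the left ends of dotted arcs, so a strand that starts further left in
  the projector ends further right. These strands are nested, and a new one crosses nothing.\<close>

lemma slice_left:
 assumes "a < k"
 shows "slice C (2 * (n + k)) a = [(Cup, a)]"
proof -
 obtain p r where pr: "(p, r) \<in> D" "lrank p = k - a" using lrank_surj[of "k - a"] assms by (auto simp: Suc_le_eq)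
 have left: "\<exists>p' r'. (p', r') \<in> D \<and> lrank p' = k - a' \<and> b' = k + p' - 1 \<and> h' = 0"
  if "(a', b', h') \<in> C" "a' \<le> a" for a' b' h'
  using that(1) unfolding strand_iff
 proof (elim disjE exE conjE)
  fix p' r' assume *: "(p', r') \<in> D" "a' = k - lrank p'" "b' = k + p' - 1" "h' = 0"
  then have "lrank p' = k - a'" using rank_bounds[of p' r'] by simp
  then show ?thesis using * by blast
 next
  fix p' r' assume "(p', r') \<in> M - D" "a' = k + p' - 1"
  then show ?thesis using that(2) assms arc_bounds[of p' r'] by auto
 next
  fix p' r' assume "(p', r') \<in> D" "a' = k + r' - 1"
  then show ?thesis using that(2) assms dot_bounds[of p' r'] by auto
 qed
 have C: "(a, k + p - 1, 0) \<in> C"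
  unfolding strand_iff using pr assms by (intro disjI1) auto
 have no: "k + p - 1 < e" if e: "a' < a" "(a', e, h') \<in> C" for a' e h'
 proof -
  obtain p' r' where "(p', r') \<in> D" "lrank p' = k - a'" "e = k + p' - 1" using left[OF e(2)] e(1) by auto
  moreover from this have "lrank p < lrank p'" using e(1) pr assms by simp
  then have "p < p'" using rank_mono(1)[OF pr(1), of p'] by (metis linorder_neq_iff less_asym)
  ultimately show ?thesis using dot_bounds[OF pr(1)] by linarith
 qed
 have "slice C (2 * (n + k)) a = (Cup, a) # over_chain (Suc a) (length (filter (\<lambda>e. \<exists>a'<a. \<exists>h. (a', e, h) \<in> C) [a + 1..<k + p - 1]))"
 proof (rule slice_over[OF C])
  fix b' h' assume "(a, b', h') \<in> C"
  then obtain p' r' where p': "(p', r') \<in> D" "lrank p' = k - a" "b' = k + p' - 1" "h' = 0" using left by blast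
  then show "b' = k + p - 1 \<and> h' = 0" using rank_inj(1)[OF pr(1) p'(1)] pr(2) by simp
 next
  fix a' e h' assume "a < e" "e < k + p - 1" "a' < a" "(a', e, h') \<in> C"
  then show "h' < 0" using no[of a' e h'] by simp
 qed
 moreover have "filter (\<lambda>e. \<exists>a'<a. \<exists>h. (a', e, h) \<in> C) [a + 1..<k + p - 1] = []"
  using no by (fastforce simp: filter_empty_conv)
 ultimately show ?thesis by (simp add: over_chain_def)
qed

lemma strand_middle_left:
 assumes "(k + t - 1, b, h) \<in> C" "1 \<le> t"
 shows "(\<exists>r. (t, r) \<in> M - D \<and> b = k + r - 1 \<and> h = 1) \<or> (\<exists>p. (p, t) \<in> D \<and> b = 2 * (n + k) - rrank t \<and> h = 2)"
 using assms(1) unfolding strand_iff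
proof (elim disjE exE conjE)
 fix p r assume "(p, r) \<in> D" "k + t - 1 = k - lrank p"
 then show ?thesis using rank_bounds[of p r] assms(2) by auto
next
 fix p r assume *: "(p, r) \<in> M - D" "k + t - 1 = k + p - 1" "b = k + r - 1" "h = 1"
 then have "p = t" using arc_bounds[of p r] assms(2) by auto
 then show ?thesis using * by blast
next
 fix p r assume *: "(p, r) \<in> D" "k + t - 1 = k + r - 1" "b = 2 * (n + k) - rrank r" "h = 2"
 then have "r = t" using dot_bounds[of p r] assms(2) by auto
 then show ?thesis using * by blast
qed

lemma strand_middle_right:
 assumes "1 \<le> t" "t < i" "i \<le> 2 * n"
 shows "a' < k + t - 1 ==> (a', k + i - 1, h) \<in> C ==> (i \<in> fst ` D \<and> h = 0) \<or> (i \<in> ends t \<and> h = 1)"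
  and "i \<in> fst ` D \<or> i \<in> ends t ==> \<exists>a'<k + t - 1. \<exists>h. (a', k + i - 1, h) \<in> C"
proof -
 assume a': "a' < k + t - 1" "(a', k + i - 1, h) \<in> C"
 show "(i \<in> fst ` D \<and> h = 0) \<or> (i \<in> ends t \<and> h = 1)"
  using a'(2) unfolding strand_iff
 proof (elim disjE exE conjE)
  fix p r assume *: "(p, r) \<in> D" "k + i - 1 = k + p - 1" "h = 0"
  then have "p = i" using dot_bounds[of p r] assms by auto
  then show ?thesis using * by force
 next
  fix p r assume *: "(p, r) \<in> M - D" "a' = k + p - 1" "k + i - 1 = k + r - 1" "h = 1"
  then have "r = i" "p < t" using arc_bounds[of p r] assms a'(1) by auto
  then show ?thesis using * assms by (auto simp: open_ends_def)
 next
  fix p r assume "(p, r) \<in> D" "k + i - 1 = 2 * (n + k) - rrank r"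
  then show ?thesis using rank_bounds[of p r] assms by auto
 qed
next
 assume "i \<in> fst ` D \<or> i \<in> ends t"
 then show "\<exists>a'<k + t - 1. \<exists>h. (a', k + i - 1, h) \<in> C"
 proof
  assume "i \<in> fst ` D"
  then obtain r where r: "(i, r) \<in> D" by auto
  then have "(k - lrank i, k + i - 1, 0) \<in> C" unfolding strand_iff by blast
  moreover have "k - lrank i < k + t - 1" using rank_bounds[OF r] assms by linarith
  ultimately show ?thesis by blast
 next
  assume "i \<in> ends t"
  then obtain e where e: "e < t" "(e, i) \<in> M - D" by (auto simp: open_ends_def)
  then have "(k + e - 1, k + i - 1, 1) \<in> C" unfolding strand_iff by blast
  moreover have "k + e - 1 < k + t - 1" using arc_bounds[of e i] e by auto
  ultimately show ?thesis by blast
 qed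
qed

lemma shift_upt: "1 \<le> t ==> [k + t..<k + r - 1] = map (\<lambda>i. k + i - 1) [t + 1..<r]"
 by (rule nth_equalityI) auto

text \<open>All undotted arcs open at \<open>t\<close> end beyond \<open>r\<close>. What is crossed
  are the left strands that end between \<open>t\<close> and \<open>r\<close>, that is, those of the
  dotted arcs that begin there.\<close>

lemma slice_plain:
 assumes "(t, r) \<in> M - D"
 shows "slice C (2 * (n + k)) (k + t - 1) = (Cup, k + t - 1) # over_chain (k + t) (length (filter (\<lambda>i. i \<in> fst ` D) [t + 1..<r]))"
proof -
 have t: "1 \<le> t" "t < r" "r \<le> 2 * n" using assms arc_bounds[of t r] by auto
 have mem: "(k + t - 1, k + r - 1, 1) \<in> C" unfolding strand_iff using assms by blast
 have not_end: "i \<notin> ends t" if "i < r" for i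
 proof
  assume "i \<in> ends t"
  then have "r < i" using ends_after_plain(3)[OF assms] by blast
  with that show False by simp
 qed
 have "slice C (2 * (n + k)) (k + t - 1) = (Cup, k + t - 1)
   # over_chain (Suc (k + t - 1)) (length (filter (\<lambda>e. \<exists>a'<k + t - 1. \<exists>h. (a', e, h) \<in> C) [k + t - 1 + 1..<k + r - 1]))"
 proof (rule slice_over[OF mem])
  fix b' h' assume "(k + t - 1, b', h') \<in> C"
  from strand_middle_left[OF this t(1)] show "b' = k + r - 1 \<and> h' = 1"
  proof
   assume "\<exists>r. (t, r) \<in> M - D \<and> b' = k + r - 1 \<and> h' = 1"
   then show ?thesis using endpoint_kinds(3)[of t r] assms by auto
  next
   assume "\<exists>p. (p, t) \<in> D \<and> b' = 2 * (n + k) - rrank t \<and> h' = 2"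
   then obtain p where "(p, t) \<in> D" by blast
   then have False using endpoint_disjoint(1)[of t r p t] assms D by auto
   then show ?thesis ..
  qed
 next
  fix a' e h' assume e: "k + t - 1 < e" "e < k + r - 1" "a' < k + t - 1" "(a', e, h') \<in> C"
  define i where "i = e + 1 - k"
  have i: "t < i" "i < r" "e = k + i - 1" using e t by (auto simp: i_def)
  then have "(i \<in> fst ` D \<and> h' = 0) \<or> (i \<in> ends t \<and> h' = 1)"
   using strand_middle_right(1)[of t i a' h'] e t by auto
  then show "h' < 1" using not_end[OF i(2)] by auto
 qed
 also have "[k + t - 1 + 1..<k + r - 1] = map (\<lambda>i. k + i - 1) [t + 1..<r]"
  using shift_upt[of t r] t by simp
 also have "length (filter (\<lambda>e. \<exists>a'<k + t - 1. \<exists>h. (a', e, h) \<in> C) (map (\<lambda>i. k + i - 1) [t + 1..<r]))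
   = length (filter (\<lambda>i. i \<in> fst ` D) [t + 1..<r])"
 proof -
  have "(\<exists>a'<k + t - 1. \<exists>h. (a', k + i - 1, h) \<in> C) \<longleftrightarrow> i \<in> fst ` D" if "i \<in> set [t + 1..<r]" for i
  proof -
   have i: "t < i" "i < r" "i \<le> 2 * n" using that t by auto
   show ?thesis
    using strand_middle_right[OF t(1) i(1,3)] not_end[OF i(2)] by blast
  qed
  then have "filter (\<lambda>i. \<exists>a'<k + t - 1. \<exists>h. (a', k + i - 1, h) \<in> C) [t + 1..<r] = filter (\<lambda>i. i \<in> fst ` D) [t + 1..<r]"
   by (intro filter_cong refl)
  then show ?thesis by (simp only: filter_map comp_def length_map)
 qed
 finally show ?thesis using t by simp
qed

text \<open>The strand to the right projector crosses all undotted arcs still open and all left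
  strands that end further right. It misses the earlier right strands, which have smaller rank and
  end beyond it.\<close>

lemma slice_dot_close:
 assumes "(p, t) \<in> D"
 shows "slice C (2 * (n + k)) (k + t - 1) = (Cup, k + t - 1)
  # over_chain (k + t) (length (filter (\<lambda>i. i \<in> fst ` D \<or> i \<in> ends t) [t + 1..<2 * n + 1]))"
proof -
 have t: "1 \<le> t" "t \<le> 2 * n" using dot_bounds[OF assms] by auto
 let ?b = "2 * (n + k) - rrank t"
 have b: "2 * n + k \<le> ?b" using rank_bounds(4)[OF assms] by simp
 have mem: "(k + t - 1, ?b, 2) \<in> C" unfolding strand_iff using assms by blast
 have beyond: False if e: "2 * n + k \<le> e" "e < ?b" "a' < k + t - 1" "(a', e, h') \<in> C" for a' e h'
  using e(4) unfolding strand_iff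
 proof (elim disjE exE conjE)
  fix p r assume "(p, r) \<in> D" "e = k + p - 1"
  then show False using e(1) dot_bounds[of p r] by auto
 next
  fix p r assume "(p, r) \<in> M - D" "e = k + r - 1"
  then show False using e(1) arc_bounds[of p r] by auto
 next
  fix p' r assume r: "(p', r) \<in> D" "a' = k + r - 1" "e = 2 * (n + k) - rrank r"
  then have "rrank t < rrank r" using e(2) rank_bounds(4)[OF assms] by simp
  then have "t < r" using rank_mono(2)[OF assms, of r] by (metis linorder_neq_iff less_asym)
  then show False using r(2) e(3) by linarith
 qed
 have "slice C (2 * (n + k)) (k + t - 1) = (Cup, k + t - 1)
   # over_chain (Suc (k + t - 1)) (length (filter (\<lambda>e. \<exists>a'<k + t - 1. \<exists>h. (a', e, h) \<in> C) [k + t - 1 + 1..<?b]))"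
 proof (rule slice_over[OF mem])
  fix b' h' assume "(k + t - 1, b', h') \<in> C"
  from strand_middle_left[OF this t(1)] show "b' = ?b \<and> h' = 2"
  proof
   assume "\<exists>r. (t, r) \<in> M - D \<and> b' = k + r - 1 \<and> h' = 1"
   then obtain r where "(t, r) \<in> M" by blast
   then have False using endpoint_disjoint(1)[of t r p t] assms D by auto
   then show ?thesis ..
  qed auto
 next
  fix a' e h' assume e: "k + t - 1 < e" "e < ?b" "a' < k + t - 1" "(a', e, h') \<in> C"
  have "\<not> 2 * n + k \<le> e" using beyond e by blast
  define i where "i = e + 1 - k"
  have i: "t < i" "i \<le> 2 * n" "e = k + i - 1" using e t \<open>\<not> 2 * n + k \<le> e\<close> by (auto simp: i_def)
  then have "(i \<in> fst ` D \<and> h' = 0) \<or> (i \<in> ends t \<and> h' = 1)"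
   using strand_middle_right(1)[of t i a' h'] e t by auto
  then show "h' < 2" by auto
 qed
 also have "[k + t - 1 + 1..<?b] = [k + t..<k + (2 * n + 1) - 1] @ [2 * n + k..<?b]"
  using b t upt_add_eq_append[of "k + t" "2 * n + k" "?b - (2 * n + k)"] by (simp add: add.commute)
 also have "filter (\<lambda>e. \<exists>a'<k + t - 1. \<exists>h. (a', e, h) \<in> C) ([k + t..<k + (2 * n + 1) - 1] @ [2 * n + k..<?b])
   = filter (\<lambda>e. \<exists>a'<k + t - 1. \<exists>h. (a', e, h) \<in> C) (map (\<lambda>i. k + i - 1) [t + 1..<2 * n + 1])"
  unfolding filter_append shift_upt[OF t(1)] using beyond by (auto simp: filter_empty_conv)
 also have "length (filter (\<lambda>e. \<exists>a'<k + t - 1. \<exists>h. (a', e, h) \<in> C) (map (\<lambda>i. k + i - 1) [t + 1..<2 * n + 1]))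
   = length (filter (\<lambda>i. i \<in> fst ` D \<or> i \<in> ends t) [t + 1..<2 * n + 1])"
 proof -
  have "(\<exists>a'<k + t - 1. \<exists>h. (a', k + i - 1, h) \<in> C) \<longleftrightarrow> i \<in> fst ` D \<or> i \<in> ends t" if "i \<in> set [t + 1..<2 * n + 1]" for i
  proof -
   have i: "t < i" "i \<le> 2 * n" using that by auto
   show ?thesis using strand_middle_right[OF t(1) i] by blast
  qed
  then have "filter (\<lambda>i. \<exists>a'<k + t - 1. \<exists>h. (a', k + i - 1, h) \<in> C) [t + 1..<2 * n + 1] = filter (\<lambda>i. i \<in> fst ` D \<or> i \<in> ends t) [t + 1..<2 * n + 1]"
   by (intro filter_cong refl)
  then show ?thesis by (simp only: filter_map comp_def length_map)
 qed
 finally show ?thesis using t by simp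
qed

lemma slice_none:
 assumes "1 \<le> t" "t \<notin> fst ` (M - D)" "t \<notin> snd ` D"
 shows "slice C (2 * (n + k)) (k + t - 1) = []"
 by (rule slice_empty) (use strand_middle_left[OF _ assms(1)] assms in force)

end

section \<open>The state sum of the tangle, slice by slice\<close>

lemma state_sum_nested_cups:
 "length v = k ==> state_sum (cups [0..<k]) (replicate k True @ v) = (if True \<in> set v then 0 else 1)"
proof (induction k arbitrary: v)
 case 0
 then show ?case by (simp add: state_sum_Nil)
next
 case (Suc k)
 then obtain b v' where v: "v = b # v'" "length v' = k" by (cases v) auto
 have "replicate (Suc k) True @ v = replicate k True @ True # b # v'"
  unfolding v(1) by (simp flip: replicate_append_same)
 then have "state_sum (cups [0..<Suc k]) (replicate (Suc k) True @ v) = cup_weight True b * state_sum (cups [0..<k]) (replicate k True @ v')"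
  by (simp add: state_sum_append apply_Cup)
 then show ?case using Suc.IH[OF v(2)] v(1) by (cases b) (auto simp: cup_weight_def)
qed

context strand_diagram
begin

definition prefix :: "nat => tangle" where
 "prefix t = concat (map (slice C (2 * (n + k))) [0..<k + t - 1])"

text \<open>A point is pending at \<open>t\<close> if it is the end of a strand that starts left of the point \<open>t\<close>; this
 includes the left end of every dotted arc, which is joined to the left projector.\<close>

definition pending :: "nat => nat => bool" where
 "pending t i \<longleftrightarrow> i < t \<or> i \<in> fst ` D \<or> i \<in> ends t"

text \<open>The number of strands that have already reached the right projector.\<close>

definition closed_dots :: "nat => nat" where
 "closed_dots t = card {x \<in> D. snd x < t}"

definition level_word :: "nat => (nat => bool) => bool list" where
 "level_word t S = replicate k True @ map S (filter (pending t) [1..<2 * n + 1]) @ replicate (closed_dots t) True"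

definition level_sum :: "nat => (nat => bool) => laurent" where
 "level_sum t S = state_sum (prefix t) (level_word t S)"

definition future_dots :: "nat => nat => nat" where
 "future_dots t y = card {x \<in> D. t \<le> snd x \<and> snd x < y}"

text \<open>The cup of a right strand, down at the point and up towards the projector, gives
  -q^(-1). Passing over the left strand of a later unnested dotted arc, which is down, gives
  q^(-1/2).\<close>

definition dot_factor :: "arc => laurent" where
 "dot_factor x = - q_pow (-1) * qhalf_pow (- int (card {y \<in> D. snd x < fst y}))"

definition level_const :: "nat => laurent" where
 "level_const t = (\<Prod>x\<in>{x \<in> D. snd x < t}. dot_factor x)"

text \<open>A dotted arc nested in an undotted one crosses it twice; if s is the spin of the right
  end of the latter and no flip occurs, the factors q^(-s/2) of the left strand and q^(s/2) of the
  right strand cancel. This is the contribution of left strands whose right strands are still to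
  come.\<close>

definition level_factor :: "nat => (nat => bool) => laurent" where
 "level_factor t S = qhalf_pow (- (\<Sum>y\<in>ends t. spin (S y) * int (future_dots t y)))"

text \<open>The invariant of the scan. An up spin at the left end of a dotted arc makes the tangle
  vanish from the start, whereas \<open>flow\<close> notices it on passing that point; hence the
  case distinction.\<close>

definition level_claim :: "nat => bool" where
 "level_claim t \<longleftrightarrow> (\<forall>S. level_sum t S =
   (if \<exists>x\<in>D. S (fst x) then 0 else level_const t * level_factor t S * flow M D t S))"

lemma prefix_Suc: "1 \<le> t ==> prefix (Suc t) = prefix t @ slice C (2 * (n + k)) (k + t - 1)"
proof -
 assume "1 \<le> t"
 then have "[0..<k + Suc t - 1] = [0..<k + t - 1] @ [k + t - 1]"
  by (cases t) auto
 then show ?thesis by (simp only: prefix_def map_append concat_append list.map concat.simps append_Nil2)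
qed

lemma prefix_1: "prefix 1 = cups [0..<k]"
proof -
 have "map (slice C (2 * (n + k))) [0..<k] = map (\<lambda>a. [(Cup, a)]) [0..<k]"
  by (rule map_cong[OF refl], rule slice_left) simp
 then show ?thesis
  by (simp only: prefix_def add_diff_cancel_right' cups_def concat_map_singleton)
qed

lemma semicircle_prefix: "semicircle_tangle (2 * (n + k)) C = prefix (2 * n + 1)"
proof -
 have "slice C (2 * (n + k)) a = []" if a: "a \<in> set [2 * n + k..<2 * (n + k)]" for a
 proof -
  have "slice C (2 * (n + k)) (k + (a + 1 - k) - 1) = []"
   by (rule slice_none) (use a D arc_bounds in fastforce)+
  moreover have "k + (a + 1 - k) - 1 = a" using a by simp
  ultimately show ?thesis by simp
 qed
 then have "concat (map (slice C (2 * (n + k))) [2 * n + k..<2 * (n + k)]) = []" by simp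
 moreover have "[0..<2 * (n + k)] = [0..<2 * n + k] @ [2 * n + k..<2 * (n + k)]"
  using upt_add_eq_append[of 0 "2 * n + k" k] by (simp add: add.assoc mult_2)
 ultimately show ?thesis
  unfolding semicircle_tangle_slices prefix_def by (simp only: map_append concat_append append_Nil2) (simp add: add.commute)
qed

lemma sorted_filter_upt: "sorted_wrt (<) (filter P [a..<b])"
 by (rule sorted_wrt_filter) (rule sorted_wrt_upt)

lemma ends_1: "ends 1 = {}"
 using arc_bounds by (force simp: open_ends_def)

lemma fst_inj: "inj_on fst D"
proof (rule inj_onI)
 fix x y assume "x \<in> D" "y \<in> D" "fst x = fst y"
 then show "x = y" using arc_unique[of x y "fst x"] D by auto
qed

lemma pending_1:
 "set (filter (pending 1) [1..<2 * n + 1]) = fst ` D" "length (filter (pending 1) [1..<2 * n + 1]) = k"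
 "{x \<in> D. snd x < 1} = {}" "closed_dots 1 = 0"
proof -
 let ?ps = "filter (pending 1) [1..<2 * n + 1]"
 show set: "set ?ps = fst ` D"
 proof -
  have bounds: "1 \<le> i \<and> i < 2 * n + 1" if i: "i \<in> fst ` D" for i
  proof -
   obtain r where "(i, r) \<in> D" using i by auto
   then show ?thesis using dot_bounds[of i r] by simp
  qed
  have "pending 1 i \<longleftrightarrow> i \<in> fst ` D" if "1 \<le> i" for i
   unfolding pending_def ends_1 using that by simp
  then show ?thesis using bounds unfolding set_filter set_upt by auto
 qed
 have "length ?ps = card (fst ` D)"
  unfolding set[symmetric] by (rule distinct_card[symmetric]) simp
 then show "length ?ps = k"
  using card_image[OF fst_inj] card_D by simp
 have "1 \<le> snd x" if "x \<in> D" for x using dot_bounds[of "fst x" "snd x"] that by simp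
 then show none: "{x \<in> D. snd x < 1} = {}" by fastforce
 then show "closed_dots 1 = 0" by (simp only: closed_dots_def card.empty)
qed

lemma base_claim: "level_claim 1"
 unfolding level_claim_def
proof
 fix S :: "nat => bool"
 let ?ps = "filter (pending 1) [1..<2 * n + 1]"
 note set = pending_1(1) and none = pending_1(3)
 have len: "length (map S ?ps) = k" unfolding length_map by (rule pending_1(2))
 have "level_sum 1 S = (if True \<in> set (map S ?ps) then 0 else 1)"
  unfolding level_sum_def level_word_def prefix_1 using state_sum_nested_cups[OF len] pending_1(4) by (simp del: One_nat_def)
 also have "True \<in> set (map S ?ps) \<longleftrightarrow> (\<exists>x\<in>D. S (fst x))"
  unfolding set_map set by auto
 finally have "level_sum 1 S = (if \<exists>x\<in>D. S (fst x) then 0 else 1)" .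
 moreover have "level_const 1 = 1" by (simp only: level_const_def none prod.empty)
 moreover have "level_factor 1 S = 1" by (simp add: level_factor_def ends_1[unfolded One_nat_def])
 moreover have "flow M D 1 S = 1"
 proof -
  have "0 \<notin> fst ` (M - D)" "0 \<notin> fst ` D" "0 \<notin> snd ` D" using arc_bounds D by force+
  then show ?thesis unfolding One_nat_def flow.simps(2) by simp
 qed
 ultimately show "level_sum 1 S = (if \<exists>x\<in>D. S (fst x) then 0 else level_const 1 * level_factor 1 S * flow M D 1 S)"
  by simp
qed

lemma dot_close_unique: "(p, t) \<in> D ==> x \<in> D ==> snd x = t \<longleftrightarrow> x = (p, t)"
 using arc_unique[of x "(p, t)" t] D by auto

lemma future_dots_Suc:
 "t \<notin> snd ` D ==> future_dots (Suc t) y = future_dots t y"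
 "(p, t) \<in> D ==> t < y ==> future_dots t y = Suc (future_dots (Suc t) y)"
proof -
 assume "t \<notin> snd ` D"
 then have "{x \<in> D. Suc t \<le> snd x \<and> snd x < y} = {x \<in> D. t \<le> snd x \<and> snd x < y}"
  by (force simp: Suc_le_eq le_less)
 then show "future_dots (Suc t) y = future_dots t y" by (simp add: future_dots_def)
next
 assume pt: "(p, t) \<in> D" "t < y"
 have "{x \<in> D. t \<le> snd x \<and> snd x < y} = insert (p, t) {x \<in> D. Suc t \<le> snd x \<and> snd x < y}"
 proof -
  have "t \<le> snd x \<and> snd x < y \<longleftrightarrow> x = (p, t) \<or> Suc t \<le> snd x \<and> snd x < y" if "x \<in> D" for x
   using dot_close_unique[OF pt(1) that] pt(2) by fastforce
  then show ?thesis using pt(1) by blast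
 qed
 then show "future_dots t y = Suc (future_dots (Suc t) y)"
  using finite_D by (simp add: future_dots_def)
qed

lemma closed_dots_Suc:
 "t \<notin> snd ` D ==> {x \<in> D. snd x < Suc t} = {x \<in> D. snd x < t}"
 "(p, t) \<in> D ==> {x \<in> D. snd x < Suc t} = insert (p, t) {x \<in> D. snd x < t}"
proof -
 show "t \<notin> snd ` D ==> {x \<in> D. snd x < Suc t} = {x \<in> D. snd x < t}"
  by (force simp: less_Suc_eq)
 assume pt: "(p, t) \<in> D"
 have "snd x < Suc t \<longleftrightarrow> x = (p, t) \<or> snd x < t" if "x \<in> D" for x
  using dot_close_unique[OF pt that] by fastforce
 then show "{x \<in> D. snd x < Suc t} = insert (p, t) {x \<in> D. snd x < t}"
  using pt by blast
qed

lemma level_const_Suc: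
 "t \<notin> snd ` D ==> level_const (Suc t) = level_const t"
 "(p, t) \<in> D ==> level_const (Suc t) = dot_factor (p, t) * level_const t"
 unfolding level_const_def using closed_dots_Suc finite_D by simp_all

lemma ends_Suc: "t \<notin> fst ` (M - D) ==> ends (Suc t) = ends t - {t}"
proof -
 assume "t \<notin> fst ` (M - D)"
 then have "e < Suc t \<longleftrightarrow> e < t" if "(e, y) \<in> M - D" for e y
  using that by (force simp: less_Suc_eq)
 then show ?thesis by (auto simp: open_ends_def Suc_le_eq le_less)
qed

lemma pending_quiet:
 assumes t: "1 \<le> t" "t \<le> 2 * n" and quiet: "t \<notin> fst ` (M - D)" "t \<notin> snd ` D"
 shows "pending (Suc t) = pending t" "closed_dots (Suc t) = closed_dots t"
proof -
 obtain x where x: "x \<in> M" "t = fst x \<or> t = snd x" using arc_exists[OF t] by blast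
 then have tD: "t \<in> fst ` D \<or> t \<in> ends t"
  using quiet arc_bounds[of "fst x" "snd x"] by (cases x) (force simp: open_ends_def)
 then show "pending (Suc t) = pending t"
  unfolding pending_def ends_Suc[OF quiet(1)] by (auto simp: less_Suc_eq)
 show "closed_dots (Suc t) = closed_dots t"
  unfolding closed_dots_def closed_dots_Suc(1)[OF quiet(2)] by (rule refl)
qed

text \<open>Left ends of dotted arcs and right ends of undotted arcs start no strand, so the tangle
  does not change there.\<close>

lemma quiet_step:
 assumes t: "1 \<le> t" "t \<le> 2 * n" and quiet: "t \<notin> fst ` (M - D)" "t \<notin> snd ` D"
  and claim: "level_claim t"
 shows "level_claim (Suc t)"
 unfolding level_claim_def
proof
 fix S :: "nat => bool"
 have "level_sum (Suc t) S = level_sum t S"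
  unfolding level_sum_def level_word_def prefix_Suc[OF t(1)] slice_none[OF t(1) quiet] pending_quiet[OF t quiet] by (simp only: append_Nil2)
 \<comment> \<open>If \<open>t\<close> itself is an open end it leaves \<open>ends\<close>, but no
   dot closes in the empty range from \<open>t\<close> to \<open>t\<close>, so its summand was
   zero.\<close>
 moreover have "level_factor (Suc t) S = level_factor t S"
 proof -
  have "(\<Sum>y\<in>ends t - {t}. spin (S y) * int (future_dots t y)) = (\<Sum>y\<in>ends t. spin (S y) * int (future_dots t y))"
  proof (rule sum.mono_neutral_left)
   have "{x \<in> D. t \<le> snd x \<and> snd x < t} = {}" by auto
   then show "\<forall>i\<in>ends t - (ends t - {t}). spin (S i) * int (future_dots t i) = 0"
    by (auto simp only: future_dots_def card.empty)
  qed auto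
  then show ?thesis
   unfolding level_factor_def ends_Suc[OF quiet(1)] future_dots_Suc(1)[OF quiet(2)] by simp
 qed
 moreover have "flow M D (Suc t) S = flow M D t S" if "\<not> (\<exists>x\<in>D. S (fst x))"
  using that quiet by (auto simp: flow.simps(2))
 ultimately show "level_sum (Suc t) S =
   (if \<exists>x\<in>D. S (fst x) then 0 else level_const (Suc t) * level_factor (Suc t) S * flow M D (Suc t) S)"
  using claim unfolding level_claim_def level_const_Suc(1)[OF quiet(2)] by simp
qed

lemma pending_split: "1 \<le> t ==> t \<le> 2 * n + 1 ==> filter (pending t) [1..<2 * n + 1] = [1..<t] @ filter (pending t) [t..<2 * n + 1]"
proof -
 assume t: "1 \<le> t" "t \<le> 2 * n + 1"
 then have "[1..<2 * n + 1] = [1..<t] @ [t..<2 * n + 1]"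
  using upt_add_eq_append[of 1 t "2 * n + 1 - t"] by simp
 then show ?thesis by (simp add: pending_def filter_True)
qed

lemma pending_plain:
 assumes tr: "(t, r) \<in> M - D"
 shows "filter (pending t) [1..<2 * n + 1] =
   [1..<t] @ filter (\<lambda>i. i \<in> fst ` D) [t + 1..<r] @ filter (pending t) [r + 1..<2 * n + 1]"
  and "filter (pending (Suc t)) [1..<2 * n + 1] =
   [1..<t] @ t # filter (\<lambda>i. i \<in> fst ` D) [t + 1..<r] @ r # filter (pending t) [r + 1..<2 * n + 1]"
  and "closed_dots (Suc t) = closed_dots t"
proof -
 have t: "1 \<le> t" "t < r" "r \<le> 2 * n" using tr arc_bounds[of t r] by auto
 have tM: "t \<notin> snd ` M" "r \<notin> fst ` M" using endpoint_kinds[of t r] tr by auto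
 note e = ends_after_plain[OF tr]
 let ?Q = "filter (\<lambda>i. i \<in> fst ` D) [t + 1..<r]" and ?R = "filter (pending t) [r + 1..<2 * n + 1]"
 have upt: "[t..<2 * n + 1] = [t] @ [t + 1..<r] @ [r] @ [r + 1..<2 * n + 1]"
 proof -
  have "[t..<2 * n + 1] = t # [t + 1..<2 * n + 1]" using t by (simp add: upt_conv_Cons)
  also have "[t + 1..<2 * n + 1] = [t + 1..<r] @ [r..<2 * n + 1]"
   using t upt_add_eq_append[of "t + 1" r "2 * n + 1 - r"] by simp
  also have "[r..<2 * n + 1] = r # [r + 1..<2 * n + 1]" using t by (simp add: upt_conv_Cons)
  finally show ?thesis by simp
 qed
 have tD: "t \<notin> fst ` D" "t \<notin> ends t" "r \<notin> fst ` D"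
 proof -
  show "t \<notin> fst ` D"
  proof
   assume "t \<in> fst ` D"
   then obtain y where "(t, y) \<in> D" by auto
   then show False using endpoint_kinds(3)[of t r y] tr D by blast
  qed
  show "r \<notin> fst ` D" using tM(2) D by blast
  show "t \<notin> ends t"
  proof
   assume "t \<in> ends t"
   then obtain y where "(y, t) \<in> M" by (auto simp: open_ends_def)
   then show False using tM(1) by force
  qed
 qed
 have Q: "filter (pending t) [t + 1..<r] = ?Q" "filter (pending (Suc t)) [t + 1..<r] = ?Q"
  "filter (pending (Suc t)) [r + 1..<2 * n + 1] = ?R"
 proof -
  have not_end: "i \<notin> ends t" if "i < r" for i using e(3)[of i] that by linarith
  have *: "pending t i \<longleftrightarrow> i \<in> fst ` D" "pending (Suc t) i \<longleftrightarrow> i \<in> fst ` D" if "t + 1 \<le> i" "i < r" for i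
   unfolding pending_def e(1) using that not_end[of i] by simp_all
  have **: "pending (Suc t) i \<longleftrightarrow> pending t i" if "r + 1 \<le> i" for i
   unfolding pending_def e(1) using that t by auto
  show "filter (pending t) [t + 1..<r] = ?Q" "filter (pending (Suc t)) [t + 1..<r] = ?Q"
   "filter (pending (Suc t)) [r + 1..<2 * n + 1] = ?R"
   by (rule filter_cong[OF refl]; unfold set_upt atLeastLessThan_iff; use * ** in blast)+
 qed
 show "filter (pending t) [1..<2 * n + 1] = [1..<t] @ ?Q @ ?R"
  using t e(2) tD pending_split[of t] Q(1) unfolding upt
  by (simp add: pending_def[of _ t] pending_def[of _ r])
 have "filter (pending (Suc t)) [1..<2 * n + 1] = filter (pending (Suc t)) [1..<t] @ filter (pending (Suc t)) [t..<2 * n + 1]"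
  using upt_add_eq_append[of 1 t "2 * n + 1 - t"] t by simp
 moreover have "filter (pending (Suc t)) [1..<t] = [1..<t]" by (auto simp: pending_def filter_id_conv)
 ultimately show "filter (pending (Suc t)) [1..<2 * n + 1] = [1..<t] @ t # ?Q @ r # ?R"
  using e(1) Q(2) Q(3)
  unfolding upt by (simp add: pending_def[of _ t] pending_def[of _ r])
 show "closed_dots (Suc t) = closed_dots t"
  unfolding closed_dots_def using closed_dots_Suc(1)[of t] tM D by fastforce
qed

text \<open>The new arc passes over left strands only. An exchange of spins would turn one of them
  up and make the sum vanish, so the diagonal term alone remains, and it is absorbed by
  \<open>level_factor\<close>.\<close>

lemma plain_step:
 assumes tr: "(t, r) \<in> M - D" and claim: "level_claim t"
 shows "level_claim (Suc t)"
 unfolding level_claim_def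
proof
 fix S :: "nat => bool"
 have t: "1 \<le> t" "t < r" "r \<le> 2 * n" using tr arc_bounds[of t r] by auto
 have tM: "t \<notin> snd ` M" "r \<notin> fst ` M" using endpoint_kinds[of t r] tr by auto
 note e = ends_after_plain[OF tr]
 let ?Q = "filter (\<lambda>i. i \<in> fst ` D) [t + 1..<r]" and ?R = "filter (pending t) [r + 1..<2 * n + 1]"
 note old = pending_plain(1)[OF tr] and new = pending_plain(2)[OF tr] and dots = pending_plain(3)[OF tr]
 have sorted: "sorted_wrt (<) ?Q" by (rule sorted_filter_upt)
 have len: "length (replicate k True @ map S [1..<t]) = k + t - 1" for S :: "nat => bool" using t by simp
 let ?post = "\<lambda>S. map S ?R @ replicate (closed_dots t) True"
 let ?g = "\<lambda>S. state_sum (prefix t) ((replicate k True @ map S [1..<t]) @ map S ?Q @ ?post S)"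
 have g: "level_sum t S = ?g S" for S
  unfolding level_sum_def level_word_def old by simp
 have step: "level_sum (Suc t) S = fold apply_piece ((Cup, k + t - 1) # over_chain (Suc (k + t - 1)) (length ?Q)) (state_sum (prefix t))
   ((replicate k True @ map S [1..<t]) @ S t # map S ?Q @ S r # ?post S)"
  unfolding level_sum_def level_word_def new dots prefix_Suc[OF t(1)] slice_plain[OF tr] using t
  by (simp add: state_sum_append)
 have upd: "((replicate k True @ map S [1..<t]) @ map (S(y := True)) ?Q @ ?post S) =
   ((replicate k True @ map (S(y := True)) [1..<t]) @ map (S(y := True)) ?Q @ ?post (S(y := True)))" if "y \<in> set ?Q" for y
 proof -
  have "map (S(y := True)) [1..<t] = map S [1..<t]" "map (S(y := True)) ?R = map S ?R"
   using that t by auto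
  then show ?thesis by simp
 qed
 have zero: "level_sum t (S(y := True)) = 0" if "y \<in> set ?Q" for y
  using claim that unfolding level_claim_def by auto
 have main: "level_sum (Suc t) S = qhalf_pow (if S r then \<Sum>y\<in>set ?Q. spin (S y) else - (\<Sum>y\<in>set ?Q. spin (S y)))
   * (cup_weight (S t) (S r) * level_sum t S)"
 proof (cases "S r")
  case True
  have vanish: "(\<Sum>y\<in>{y \<in> set ?Q. \<not> S y}. F y
    * (c * state_sum (prefix t) ((replicate k True @ map S [1..<t]) @ map (S(y := True)) ?Q @ ?post S))) = 0"
   (is "(\<Sum>y\<in>_. F y * (c * ?z y)) = 0") for F c
  proof (rule sum.neutral, rule ballI)
   fix y assume "y \<in> {y \<in> set ?Q. \<not> S y}"
   then have y: "y \<in> set ?Q" by blast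
   have "?z y = 0" unfolding upd[OF y] g[symmetric] by (rule zero[OF y])
   then show "F y * (c * ?z y) = 0" by (simp only: mult_zero_right)
  qed
  have "S r = True" using True by simp
  then show ?thesis unfolding step g
   by (simp only: cup_over_chain(2)[OF len sorted] if_True vanish add_0_right)
 next
  case False
  then have "S r = False" by simp
  then show ?thesis unfolding step g by (simp only: cup_over_chain(1)[OF len sorted] if_False)
 qed
 show "level_sum (Suc t) S =
   (if \<exists>x\<in>D. S (fst x) then 0 else level_const (Suc t) * level_factor (Suc t) S * flow M D (Suc t) S)"
 proof (cases "\<exists>x\<in>D. S (fst x)")
  case True
  then show ?thesis using claim main unfolding level_claim_def by simp
 next
  case False
  have "(\<Sum>y\<in>set ?Q. spin (S y)) = (\<Sum>y\<in>set ?Q. - 1)"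
   by (rule sum.cong) (use False in \<open>auto simp: spin_def\<close>)
  also have "\<dots> = - int (future_dots t r)"
  proof -
   \<comment> \<open>By noncrossing, the dotted arcs that begin between \<open>t\<close> and
     \<open>r\<close> are those that end there.\<close>
   have Q: "set ?Q = fst ` {x \<in> D. t \<le> snd x \<and> snd x < r}"
   proof -
    have "t \<le> snd x \<and> snd x < r \<longleftrightarrow> t < fst x \<and> fst x < r" if "x \<in> D" for x
    proof -
     have x: "(fst x, snd x) \<in> M" "(fst x, snd x) \<noteq> (t, r)" using that D tr by auto
     show ?thesis using arc_cases[OF x(1), of t r] arc_bounds[OF x(1)] x(2) tr t by auto
    qed
    then show ?thesis using t by force
   qed
   have "card (set ?Q) = future_dots t r"
    unfolding Q future_dots_def by (rule card_image) (rule inj_on_subset[OF fst_inj], blast)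
   then show ?thesis by simp
  qed
  finally have sum: "(\<Sum>y\<in>set ?Q. spin (S y)) = - int (future_dots t r)" .
  have tnD: "t \<notin> snd ` D" using tM D by blast
  have "level_factor (Suc t) S = qhalf_pow (- (spin (S r) * int (future_dots t r))) * level_factor t S"
   unfolding level_factor_def e(1) future_dots_Suc(1)[OF tnD] using e(2)
   by (simp add: qhalf_pow_mult)
  then show ?thesis
   using claim False unfolding main sum level_claim_def level_const_Suc(1)[OF tnD] flow_plain[OF tr]
   by (cases "S r") (simp_all add: spin_def algebra_simps)
 qed
qed

lemma pending_dot_close:
 assumes tr: "(p, t) \<in> D"
 shows "filter (pending t) [1..<2 * n + 1] = [1..<t] @ filter (\<lambda>i. i \<in> fst ` D \<or> i \<in> ends t) [t + 1..<2 * n + 1]"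
  and "filter (pending (Suc t)) [1..<2 * n + 1] = [1..<t] @ t # filter (\<lambda>i. i \<in> fst ` D \<or> i \<in> ends t) [t + 1..<2 * n + 1]"
  and "closed_dots (Suc t) = Suc (closed_dots t)"
proof -
 have ptM: "(p, t) \<in> M" using tr D by blast
 have t: "1 \<le> t" "p < t" "t \<le> 2 * n" using ptM arc_bounds[of p t] by auto
 have tM: "t \<notin> fst ` M" using endpoint_kinds(2)[OF ptM] .
 have tD: "t \<notin> fst ` (M - D)" "t \<notin> fst ` D" "t \<notin> ends t"
 proof -
  show "t \<notin> fst ` (M - D)" "t \<notin> fst ` D" using tM D by blast+
  show "t \<notin> ends t"
  proof
   assume "t \<in> ends t"
   then obtain y where "(y, t) \<in> M - D" by (auto simp: open_ends_def)
   then show False using endpoint_kinds(4)[OF ptM, of y] tr by blast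
  qed
 qed
 have e: "ends (Suc t) = ends t" using ends_Suc[OF tD(1)] tD(3) by simp
 let ?Q = "filter (\<lambda>i. i \<in> fst ` D \<or> i \<in> ends t) [t + 1..<2 * n + 1]"
 have upt: "[t..<2 * n + 1] = t # [t + 1..<2 * n + 1]" using t by (simp add: upt_conv_Cons)
 have Q: "filter (pending t) [t + 1..<2 * n + 1] = ?Q" "filter (pending (Suc t)) [t + 1..<2 * n + 1] = ?Q"
  by (rule filter_cong[OF refl]; auto simp: pending_def e)+
 show "filter (pending t) [1..<2 * n + 1] = [1..<t] @ ?Q"
  using pending_split[of t] t tD Q(1) unfolding upt by (simp add: pending_def[of t t])
 show "filter (pending (Suc t)) [1..<2 * n + 1] = [1..<t] @ t # ?Q"
  using pending_split[of "Suc t"] t Q(2) by simp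
 show "closed_dots (Suc t) = Suc (closed_dots t)"
  unfolding closed_dots_def closed_dots_Suc(2)[OF tr] using finite_D by simp
qed

text \<open>With a down spin at \<open>t\<close> the right strand is up all the way. With an up spin
  at \<open>t\<close> it starts down and must exchange its spin with one strand before it reaches
  the projector; left strands are ruled out, and the sum over the open ends is
  \<open>flip_op\<close>.\<close>

lemma dot_close_step:
 assumes tr: "(p, t) \<in> D" and claim: "level_claim t"
 shows "level_claim (Suc t)"
 unfolding level_claim_def
proof
 fix S :: "nat => bool"
 have ptM: "(p, t) \<in> M" using tr D by blast
 have t: "1 \<le> t" "p < t" "t \<le> 2 * n" using ptM arc_bounds[of p t] by auto
 have tM: "t \<notin> fst ` M" using endpoint_kinds(2)[OF ptM] .
 have tD: "t \<notin> fst ` (M - D)" "t \<notin> fst ` D" "t \<notin> ends t"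
 proof -
  show "t \<notin> fst ` (M - D)" "t \<notin> fst ` D" using tM D by blast+
  show "t \<notin> ends t"
  proof
   assume "t \<in> ends t"
   then obtain y where "(y, t) \<in> M - D" by (auto simp: open_ends_def)
   then show False using endpoint_kinds(4)[OF ptM, of y] tr by blast
  qed
 qed
 have e: "ends (Suc t) = ends t" using ends_Suc[OF tD(1)] tD(3) by simp
 let ?Q = "filter (\<lambda>i. i \<in> fst ` D \<or> i \<in> ends t) [t + 1..<2 * n + 1]"
 note old = pending_dot_close(1)[OF tr] and new = pending_dot_close(2)[OF tr] and dots = pending_dot_close(3)[OF tr]
 have sorted: "sorted_wrt (<) ?Q" by (rule sorted_filter_upt)
 have len: "length (replicate k True @ map S [1..<t]) = k + t - 1" using t by simp
 let ?post = "replicate (closed_dots t) True"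
 have g: "level_sum t (S(y := True)) = state_sum (prefix t) ((replicate k True @ map S [1..<t]) @ map (S(y := True)) ?Q @ ?post)"
  if "y \<in> set ?Q" for y
 proof -
  have "map (S(y := True)) [1..<t] = map S [1..<t]" using that by auto
  then show ?thesis unfolding level_sum_def level_word_def old by (simp only: map_append append_assoc)
 qed
 have g0: "level_sum t S = state_sum (prefix t) ((replicate k True @ map S [1..<t]) @ map S ?Q @ ?post)"
  unfolding level_sum_def level_word_def old by (simp only: map_append append_assoc)
 let ?w = "\<lambda>y. (qhalf_pow 1 - qhalf_pow (-3))
    * qhalf_pow ((\<Sum>z\<in>{z \<in> set ?Q. y < z}. spin (S z)) - (\<Sum>z\<in>{z \<in> set ?Q. z < y}. spin (S z)))"
 have "level_sum (Suc t) S = fold apply_piece ((Cup, k + t - 1) # over_chain (Suc (k + t - 1)) (length ?Q)) (state_sum (prefix t))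
   ((replicate k True @ map S [1..<t]) @ S t # map S ?Q @ True # ?post)"
  unfolding level_sum_def level_word_def new dots prefix_Suc[OF t(1)] slice_dot_close[OF tr] using t
  by (simp add: state_sum_append)
 also have "\<dots> = qhalf_pow (\<Sum>y\<in>set ?Q. spin (S y)) * (cup_weight (S t) True * level_sum t S)
   + (\<Sum>y\<in>{y \<in> set ?Q. \<not> S y}. ?w y * (cup_weight (S t) False * level_sum t (S(y := True))))"
  unfolding cup_over_chain(2)[OF len sorted] g0
  by (intro arg_cong2[where f = "(+)"] refl sum.cong) (simp only: g mem_Collect_eq)
 finally have main: "level_sum (Suc t) S = qhalf_pow (\<Sum>y\<in>set ?Q. spin (S y)) * (cup_weight (S t) True * level_sum t S)
   + (\<Sum>y\<in>{y \<in> set ?Q. \<not> S y}. ?w y * (cup_weight (S t) False * level_sum t (S(y := True))))" .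
 show "level_sum (Suc t) S =
   (if \<exists>x\<in>D. S (fst x) then 0 else level_const (Suc t) * level_factor (Suc t) S * flow M D (Suc t) S)"
 proof (cases "\<exists>x\<in>D. S (fst x)")
  case True
  have "level_sum t S = 0" "level_sum t (S(y := True)) = 0" for y
   using claim True unfolding level_claim_def by auto
  then show ?thesis using main True by simp
 next
  case False
  let ?N = "{i \<in> fst ` D. t < i}"
  have bounds: "i \<le> 2 * n" if "i \<in> fst ` D" for i using that D arc_bounds by fastforce
  have ends: "t < y \<and> y \<le> 2 * n" if "y \<in> ends t" for y
  proof -
   have "t \<le> y" "y \<le> 2 * n" using that arc_bounds by (auto simp: open_ends_def)
   then show ?thesis using that tD(3) by (cases "y = t") auto
  qed
  have setQ: "set ?Q = ?N \<union> ends t" using bounds ends by force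
  have disj: "?N \<inter> ends t = {}"
   using endpoint_kinds(2) D by (force simp: open_ends_def)
  have split: "(\<Sum>z\<in>{z \<in> set ?Q. P z}. spin (S z)) = (\<Sum>z\<in>{z \<in> ends t. P z}. spin (S z)) - int (card {z \<in> ?N. P z})" for P
  proof -
   have "{z \<in> set ?Q. P z} = {z \<in> ?N. P z} \<union> {z \<in> ends t. P z}" unfolding setQ by blast
   moreover have "(\<Sum>z\<in>{z \<in> ?N. P z}. spin (S z)) = (\<Sum>z\<in>{z \<in> ?N. P z}. - 1)"
    by (rule sum.cong) (use False in \<open>auto simp: spin_def\<close>)
   moreover have "(\<Sum>z\<in>{z \<in> ?N. P z} \<union> {z \<in> ends t. P z}. spin (S z)) =
     (\<Sum>z\<in>{z \<in> ?N. P z}. spin (S z)) + (\<Sum>z\<in>{z \<in> ends t. P z}. spin (S z))"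
    by (rule sum.union_disjoint) (use disj finite_D in auto)
   ultimately show ?thesis by simp
  qed
  define f where "f = future_dots t"
  have future: "future_dots (Suc t) y = f y - 1" "1 \<le> f y" if "y \<in> ends t" for y
   using future_dots_Suc(2)[OF tr, of y] ends[OF that] by (simp_all add: f_def)
  have cardN: "card {y \<in> D. t < fst y} = card ?N"
  proof -
   have "?N = fst ` {y \<in> D. t < fst y}" by auto
   then show ?thesis using card_image[OF inj_on_subset[OF fst_inj], of "{y \<in> D. t < fst y}"] by auto
  qed
  define s where "s = (\<lambda>z. spin (S z))"
  have factor: "level_factor (Suc t) S = qhalf_pow (sum s (ends t) - (\<Sum>z\<in>ends t. s z * int (f z)))"
  proof -
   have "(\<Sum>y\<in>ends t. spin (S y) * int (future_dots (Suc t) y)) = (\<Sum>z\<in>ends t. s z * int (f z) - s z)"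
    by (rule sum.cong) (use future in \<open>simp_all add: s_def of_nat_diff algebra_simps\<close>)
   then show ?thesis by (simp add: level_factor_def e sum_subtractf)
  qed
  have Pt: "level_sum t S = level_const t * level_factor t S * flow M D t S"
   using claim False unfolding level_claim_def by simp
  show ?thesis
  proof (cases "S t")
   case True
   \<comment> \<open>Turning \<open>y\<close> up raises its spin by 2, so the exponent in
     \<open>level_factor\<close> moves by twice the number of dots that weigh on
     \<open>y\<close>.\<close>
   have flipped: "level_sum t (S(y := True)) = level_const t * qhalf_pow (- (\<Sum>z\<in>ends t. s z * int (f z)) - 2 * int (f y)) * flow M D t (S(y := True))"
    if y: "y \<in> ends t" "\<not> S y" for y
   proof -
    have "y \<notin> fst ` D" using disj ends[OF y(1)] y(1) by blast
    then have "\<not> (\<exists>x\<in>D. (S(y := True)) (fst x))" using False by (metis fun_upd_other image_eqI)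
    moreover have "(\<Sum>z\<in>ends t. spin ((S(y := True)) z) * int (f z)) = (\<Sum>z\<in>ends t. s z * int (f z)) + 2 * int (f y)"
    proof -
     have "(\<Sum>z\<in>ends t. spin ((S(y := True)) z) * int (f z)) =
       spin True * int (f y) + (\<Sum>z\<in>ends t - {y}. s z * int (f z))"
      using y(1) by (subst sum.remove[of _ y]) (auto simp: s_def intro!: sum.cong)
     moreover have "(\<Sum>z\<in>ends t. s z * int (f z)) = spin False * int (f y) + (\<Sum>z\<in>ends t - {y}. s z * int (f z))"
      using y by (subst sum.remove[of _ y]) (auto simp: s_def)
     ultimately show ?thesis by (simp add: spin_def)
    qed
    ultimately show ?thesis
     using claim unfolding level_claim_def level_factor_def f_def[symmetric] by simp
   qed
   have vanish: "level_sum t (S(y := True)) = 0" if y: "y \<in> ?N" for y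
   proof -
    obtain x where "x \<in> D" "fst x = y" using y by auto
    then have "\<exists>x\<in>D. (S(y := True)) (fst x)" by auto
    then show ?thesis using claim unfolding level_claim_def by simp
   qed
   \<comment> \<open>The dots yet to close before \<open>y\<close> are the present one, those not
     begun, and those already open. The second kind matches the left strands crossed before
     \<open>y\<close>, the third the dots in \<open>flip_weight\<close>.\<close>
   have f_eq: "f y = 1 + card {z \<in> ?N. z < y} + card (open_dots D (Suc t) y)" if y: "y \<in> ends t" for y
   proof -
    obtain e where e: "e < t" "(e, y) \<in> M - D" using y by (auto simp: open_ends_def)
    have close: "snd x < y" if "x \<in> D" "t < fst x" "fst x < y" for x
    proof -
     have x: "(fst x, snd x) \<in> M" using that(1) D by auto
     have "(fst x, snd x) \<noteq> (e, y)" using e that by auto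
     then show ?thesis using arc_cases[OF x, of e y] e that arc_bounds[OF x] by auto
    qed
    have "{x \<in> D. t \<le> snd x \<and> snd x < y} = insert (p, t) ({x \<in> D. t < fst x \<and> fst x < y} \<union> open_dots D (Suc t) y)"
    proof (intro Set.set_eqI iffI)
     fix x assume x: "x \<in> {x \<in> D. t \<le> snd x \<and> snd x < y}"
     then have "fst x < snd x" "fst x \<noteq> t"
      using dot_bounds[of "fst x" "snd x"] tD(2) by auto
     moreover have "x = (p, t) \<or> snd x \<noteq> t" using dot_close_unique[OF tr] x by blast
     ultimately show "x \<in> insert (p, t) ({x \<in> D. t < fst x \<and> fst x < y} \<union> open_dots D (Suc t) y)"
      using x by (auto simp: open_dots_def)
    next
     fix x assume "x \<in> insert (p, t) ({x \<in> D. t < fst x \<and> fst x < y} \<union> open_dots D (Suc t) y)"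
     then consider "x = (p, t)" | "x \<in> D" "t < fst x" "fst x < y" | "x \<in> open_dots D (Suc t) y" by blast
     then show "x \<in> {x \<in> D. t \<le> snd x \<and> snd x < y}"
     proof cases
      case 1
      then show ?thesis using tr ends[OF y] by simp
     next
      case 2
      then show ?thesis using close[OF 2] dot_bounds[of "fst x" "snd x"] by simp
     qed (auto simp: open_dots_def)
    qed
    moreover have "(p, t) \<notin> {x \<in> D. t < fst x \<and> fst x < y} \<union> open_dots D (Suc t) y"
     using t by (simp add: open_dots_def)
    moreover have "finite (open_dots D (Suc t) y)" "{x \<in> D. t < fst x \<and> fst x < y} \<inter> open_dots D (Suc t) y = {}"
     using finite_D by (auto simp: open_dots_def)
    moreover have "card {z \<in> ?N. z < y} = card {x \<in> D. t < fst x \<and> fst x < y}"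
    proof -
     have "{z \<in> ?N. z < y} = fst ` {x \<in> D. t < fst x \<and> fst x < y}" by auto
     then show ?thesis using card_image[OF inj_on_subset[OF fst_inj], of "{x \<in> D. t < fst x \<and> fst x < y}"] by auto
    qed
    ultimately show ?thesis
     unfolding f_def future_dots_def using finite_D by (simp add: card_Un_disjoint)
   qed
   have "level_sum (Suc t) S = (\<Sum>y\<in>{y \<in> set ?Q. \<not> S y}. ?w y * level_sum t (S(y := True)))"
    using True unfolding main by (simp add: cup_weight_def)
   also have "\<dots> = (\<Sum>y\<in>{y \<in> ends t. \<not> S y}. ?w y * level_sum t (S(y := True)))"
    unfolding setQ by (rule sum.mono_neutral_right) (use vanish finite_D in auto)
   also have "\<dots> = (\<Sum>y\<in>{y \<in> ends t. \<not> S y}. level_const (Suc t) * level_factor (Suc t) S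
     * (flip_weight M D (Suc t) S y * flow M D t (S(y := True))))"
   proof (rule sum.cong[OF refl])
    fix y assume "y \<in> {y \<in> ends t. \<not> S y}"
    then have y: "y \<in> ends t" "\<not> S y" by auto
    have N: "card ?N = card {z \<in> ?N. y < z} + card {z \<in> ?N. z < y}"
    proof -
     have "?N = {z \<in> ?N. y < z} \<union> {z \<in> ?N. z < y}" using y(1) disj by auto
     then have "card ?N = card ({z \<in> ?N. y < z} \<union> {z \<in> ?N. z < y})" by (rule arg_cong)
     also have "\<dots> = card {z \<in> ?N. y < z} + card {z \<in> ?N. z < y}"
      by (rule card_Un_disjoint) (use finite_D in auto)
     finally show ?thesis .
    qed
    have E: "sum s (ends t) = sum s {z \<in> ends t. y < z} + sum s {z \<in> ends t. z < y} - 1"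
    proof -
     have "ends t = insert y ({z \<in> ends t. y < z} \<union> {z \<in> ends t. z < y})" using y(1) by auto
     then have "sum s (ends t) = sum s (insert y ({z \<in> ends t. y < z} \<union> {z \<in> ends t. z < y}))" by (rule arg_cong)
     also have "\<dots> = s y + (sum s {z \<in> ends t. y < z} + sum s {z \<in> ends t. z < y})"
      by (subst sum.insert) (auto intro!: sum.union_disjoint)
     finally show ?thesis using y(2) by (simp add: s_def spin_def)
    qed
    show "?w y * level_sum t (S(y := True)) = level_const (Suc t) * level_factor (Suc t) S
     * (flip_weight M D (Suc t) S y * flow M D t (S(y := True)))"
     unfolding split
     unfolding flipped[OF y] level_const_Suc(2)[OF tr] dot_factor_def snd_conv cardN factor flip_weight_def e
      s_def[symmetric] q_pow_def
     by (simp add: f_eq[OF y(1)] N E algebra_simps)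
   qed
   also have "\<dots> = level_const (Suc t) * level_factor (Suc t) S * flow M D (Suc t) S"
    unfolding flow_dot_close[OF tr] using True by (simp add: flip_op_def e sum_distrib_left)
   finally show ?thesis using False by simp
  next
   case False
   have total: "(\<Sum>y\<in>set ?Q. spin (S y)) = sum s (ends t) - int (card ?N)"
    using split[of "\<lambda>_. True"] unfolding s_def by simp
   have t_factor: "level_factor t S = qhalf_pow (- (\<Sum>z\<in>ends t. s z * int (f z)))"
    by (simp add: level_factor_def s_def f_def)
   show ?thesis
    unfolding main total Pt factor t_factor flow_dot_close[OF tr] level_const_Suc(2)[OF tr] dot_factor_def snd_conv cardN q_pow_def
    using False \<open>\<not> (\<exists>x\<in>D. S (fst x))\<close> by (simp add: cup_weight_def algebra_simps)
  qed
 qed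
qed

lemma level_claim: "1 \<le> t ==> t \<le> 2 * n + 1 ==> level_claim t"
proof (induction t rule: dec_induct)
 case base
 show ?case by (rule base_claim)
next
 case (step t)
 then have t: "1 \<le> t" "t \<le> 2 * n" "level_claim t" by auto
 consider r where "(t, r) \<in> M - D" | p where "(p, t) \<in> D" | "t \<notin> fst ` (M - D)" "t \<notin> snd ` D" by force
 then show ?case
  using plain_step dot_close_step quiet_step t by cases blast+
qed

text \<open>Once all points are scanned, this removes the case distinction of
  \<open>level_claim\<close>.\<close>

lemma flow_zero: "x \<in> D ==> fst x < t ==> S (fst x) ==> flow M D t S = 0"
proof (induction t arbitrary: S)
 case (Suc t)
 show ?case
 proof (cases "fst x = t")
  case True
  then have "(t, snd x) \<in> D" using Suc.prems(1) by auto
  then show ?thesis using flow_dot[of t "snd x" S] Suc.prems(3) True by simp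
 next
  case False
  then have "fst x < t" using Suc.prems(2) by simp
  moreover have "(S(y := True)) (fst x)" for y using Suc.prems(3) by simp
  ultimately have "flow M D t S = 0" "flow M D t (S(y := True)) = 0" for y
   using Suc.IH Suc.prems(1,3) by blast+
  then show ?thesis by (simp add: flow.simps(2) flip_op_def)
 qed
qed simp

lemma pending_whole: "filter (pending (2 * n + 1)) [1..<2 * n + 1] = [1..<2 * n + 1]" "closed_dots (2 * n + 1) = k"
proof -
 show "filter (pending (2 * n + 1)) [1..<2 * n + 1] = [1..<2 * n + 1]"
  by (rule filter_True) (unfold Ball_def pending_def set_upt atLeastLessThan_iff, blast)
 have "{x \<in> D. snd x < 2 * n + 1} = D" using dot_bounds by fastforce
 then show "closed_dots (2 * n + 1) = k" by (simp only: closed_dots_def card_D)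
qed

text \<open>Behind the last point no arc is open, so the correction \<open>level_factor\<close> is 1
  and the invariant compares the tangle directly with the complete scan.\<close>

lemma strand_state_sum:
 "state_sum (semicircle_tangle (2 * (n + k)) C) (good_word n k S) =
  level_const (2 * n + 1) * russell_state n S (M, D)"
proof -
 have "level_sum (2 * n + 1) S = level_const (2 * n + 1) * (level_factor (2 * n + 1) S * flow M D (2 * n + 1) S)"
 proof (cases "\<exists>x\<in>D. S (fst x)")
  case True
  then obtain x where x: "x \<in> D" "S (fst x)" by blast
  then have "fst x < 2 * n + 1" using dot_bounds[of "fst x" "snd x"] by simp
  then have "flow M D (2 * n + 1) S = 0" using flow_zero x by blast
  then show ?thesis using level_claim[of "2 * n + 1"] True unfolding level_claim_def by simp
 next
  case False
  then show ?thesis using level_claim[of "2 * n + 1"] unfolding level_claim_def by simp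
 qed
 moreover have "ends (2 * n + 1) = {}" using arc_bounds by (fastforce simp: open_ends_def)
 then have "level_factor (2 * n + 1) S = 1" by (simp only: level_factor_def sum.empty minus_zero qhalf_pow_0)
 ultimately show ?thesis unfolding level_sum_def level_word_def semicircle_prefix flow_whole pending_whole by simp
qed

lemma over_chain_width: "i + m + 1 \<le> w ==> top_width w (over_chain i m) = Some w"
 by (induction m) (simp add: over_chain_def, simp add: over_chain_Suc top_width_append)

lemma prefix_tangle:
 "1 \<le> t ==> t \<le> 2 * n + 1 ==> prefix t \<in> tangles (k + length (filter (pending t) [1..<2 * n + 1]) + closed_dots t)"
proof (induction t rule: dec_induct)
 case base
 have "cups [0..<j] \<in> tangles (2 * j)" for j
 proof (induction j)
  case (Suc j)
  have "[0..<Suc j] = [0..<j] @ [j]" by simp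
  then show ?case using Suc cups_snoc_tangles[of "[0..<j]" j "2 * Suc j"] by simp
 qed (simp add: tangles_def)
 then show ?case unfolding prefix_1 pending_1(2,4) by (simp add: mult_2)
next
 case (step t)
 then have t: "1 \<le> t" "t \<le> 2 * n" and IH: "prefix t \<in> tangles (k + length (filter (pending t) [1..<2 * n + 1]) + closed_dots t)"
  by auto
 consider r where "(t, r) \<in> M - D" | p where "(p, t) \<in> D" | "t \<notin> fst ` (M - D)" "t \<notin> snd ` D" by force
 then show ?case
 proof cases
  case 1
  show ?thesis
   using IH t unfolding prefix_Suc[OF t(1)] slice_plain[OF 1] pending_plain[OF 1] tangles_append[of "prefix t"]
   by (auto intro!: exI over_chain_width simp del: upt_Suc)
 next
  case 2
  show ?thesis
   using IH t unfolding prefix_Suc[OF t(1)] slice_dot_close[OF 2] pending_dot_close[OF 2] tangles_append[of "prefix t"]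
   by (auto intro!: exI over_chain_width simp del: upt_Suc)
 next
  case 3
  show ?thesis
   using IH unfolding prefix_Suc[OF t(1)] slice_none[OF t(1) 3] pending_quiet[OF t 3] by (simp only: append_Nil2)
 qed
qed

lemma semicircle_tangle_tangles: "semicircle_tangle (2 * (n + k)) C \<in> tangles (2 * (n + k))"
proof -
 have "k + length [1..<2 * n + 1] + k = 2 * (n + k)" by (simp del: upt_Suc)
 moreover have "prefix (2 * n + 1) \<in> tangles (k + length [1..<2 * n + 1] + k)"
  using prefix_tangle[of "2 * n + 1"] unfolding pending_whole by simp
 ultimately show ?thesis unfolding semicircle_prefix by (simp only:)
qed

end

section \<open>Standard diagrams\<close>

text \<open>One factor -q^(-1) for each dotted arc and one q^(-1/2) for each pair of dotted
  arcs.\<close>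

definition diagram_const :: "nat => laurent" where
 "diagram_const k = (- q_pow (-1)) ^ k * qhalf_pow (- int (k * (k - 1) div 2))"

lemma qhalf_pow_sum: "finite A ==> (\<Prod>x\<in>A. qhalf_pow (f x)) = qhalf_pow (\<Sum>x\<in>A. f x)"
 by (induction A rule: finite_induct) simp_all

lemma diagram_const_nonzero: "diagram_const k \<noteq> 0"
 by (simp add: diagram_const_def q_pow_def)

context strand_diagram
begin

text \<open>Two dotted arcs are either nested or side by side. The normalisation of the map pays for
  the first kind and \<open>dot_factor\<close> for the second, so each pair contributes q^(-1/2)
  whatever its position.\<close>

lemma psi_const:
 "level_const (2 * n + 1) * qhalf_pow (- int (card {(y, z). y \<in> D \<and> z \<in> D \<and> nested_in y z})) = diagram_const k"
proof -
 let ?A = "Sigma D (\<lambda>x. {y \<in> D. snd x < fst y})" and ?N = "{(y, z). y \<in> D \<and> z \<in> D \<and> nested_in y z}"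
 have fin: "finite (D \<times> D)" using finite_D by simp
 have sub: "?A \<subseteq> D \<times> D" "?A\<inverse> \<subseteq> D \<times> D" "?N \<subseteq> D \<times> D" "?N\<inverse> \<subseteq> D \<times> D" by auto
 note finite = finite_subset[OF sub(1) fin] finite_subset[OF sub(2) fin] finite_subset[OF sub(3) fin] finite_subset[OF sub(4) fin]
 have order: "fst x < snd x" if "x \<in> D" for x using dot_bounds[of "fst x" "snd x"] that by simp
 have "D \<times> D = Id_on D \<union> (?A \<union> ?A\<inverse>) \<union> (?N \<union> ?N\<inverse>)"
 proof
  show "D \<times> D \<subseteq> Id_on D \<union> (?A \<union> ?A\<inverse>) \<union> (?N \<union> ?N\<inverse>)"
  proof
   fix z assume "z \<in> D \<times> D"
   then obtain x y where z: "z = (x, y)" "x \<in> D" "y \<in> D" by blast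
   then have "(fst x, snd x) \<in> M" "(fst y, snd y) \<in> M" using D by auto
   from arc_cases[OF this] show "z \<in> Id_on D \<union> (?A \<union> ?A\<inverse>) \<union> (?N \<union> ?N\<inverse>)"
    using z order[of x] order[of y] by (auto simp: nested_in_def)
  qed
 qed auto
 then have "card (D \<times> D) = card (Id_on D \<union> (?A \<union> ?A\<inverse>) \<union> (?N \<union> ?N\<inverse>))" by (rule arg_cong)
 also have "\<dots> = card (Id_on D) + (card ?A + card (?A\<inverse>)) + (card ?N + card (?N\<inverse>))"
 proof -
  have "finite (Id_on D)" by (rule finite_subset[OF _ fin]) auto
  moreover have "?A \<inter> ?A\<inverse> = {}" by (fastforce dest: dot_bounds)
  moreover have "?N \<inter> ?N\<inverse> = {}" by (auto simp: nested_in_def)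
  moreover have "Id_on D \<inter> (?A \<union> ?A\<inverse>) = {}" by (fastforce dest: dot_bounds)
  moreover have "(Id_on D \<union> (?A \<union> ?A\<inverse>)) \<inter> (?N \<union> ?N\<inverse>) = {}" by (fastforce simp: nested_in_def dest: dot_bounds)
  ultimately show ?thesis using finite by (simp only: card_Un_disjoint finite_UnI)
 qed
 also have "card (Id_on D) = k"
 proof -
  have "Id_on D = (\<lambda>x. (x, x)) ` D" by auto
  then show ?thesis by (simp add: card_image inj_on_def card_D)
 qed
 finally have "2 * (card ?A + card ?N) = k * (k - 1)"
  by (simp add: card_cartesian_product card_D algebra_simps diff_mult_distrib2)
 then have half: "card ?A + card ?N = k * (k - 1) div 2" by simp
 have whole: "{x \<in> D. snd x < 2 * n + 1} = D" using dot_bounds by fastforce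
 have "level_const (2 * n + 1) = (- q_pow (-1)) ^ k * qhalf_pow (\<Sum>x\<in>D. - int (card {y \<in> D. snd x < fst y}))"
  unfolding level_const_def whole dot_factor_def prod.distrib qhalf_pow_sum[OF finite_D] by (simp add: card_D)
 also have "(\<Sum>x\<in>D. - int (card {y \<in> D. snd x < fst y})) = - int (card ?A)"
  using finite_D by (subst card_SigmaI) (simp_all add: sum_negf)
 finally show ?thesis unfolding diagram_const_def half[symmetric] by (simp add: algebra_simps)
qed

lemma evaluate_psi_diagram:
 "evaluate (good_word n k S) (psi_diagram n k (M, D))
  = diagram_const k * russell_state n S (M, D)"
 unfolding psi_diagram_def psi_const[symmetric] pairing_single strand_state_sum snd_conv by (simp only: ac_simps)

end

lemma strand_diagramI: "(M, D) \<in> diagrams n k ==> strand_diagram n M D k"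
 by unfold_locales (auto simp: diagrams_def)

definition standard :: "diagram => bool" where
 "standard x \<longleftrightarrow> (\<forall>y\<in>snd x. \<forall>z\<in>fst x. \<not> nested_in y z)"

definition endpoints :: "arc set => nat set" where
 "endpoints A = fst ` A \<union> snd ` A"

text \<open>The state of a partial matching whose unmatched points are forced down. Standard
  diagrams and surviving cup diagrams both reduce to it, which makes them comparable.\<close>

definition cap_state :: "nat => arc set => (nat => bool) => laurent" where
 "cap_state n A S = (if \<exists>p\<in>{1..2 * n} - endpoints A. S p then 0 else \<Prod>x\<in>A. cup_weight (S (fst x)) (S (snd x)))"

context dotted_matching
begin

definition arc_weight :: "(nat => bool) => arc => laurent" where
 "arc_weight S x = (if x \<in> D then (if S (fst x) \<or> S (snd x) then 0 else 1) else cup_weight (S (fst x)) (S (snd x)))"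

lemma interval_arcs:
 assumes "(s, r) \<in> M" "s < r" "r < t" "closed_interval M (Suc s) r"
 shows "{x \<in> M. inner s t x} = insert (s, r) ({x \<in> M. inner (Suc s) r x} \<union> {x \<in> M. inner (Suc r) t x})"
proof -
 have "x = (s, r) \<or> inner (Suc s) r x \<or> inner (Suc r) t x" if "x \<in> M" "inner s t x" for x
  using that arc_unique[OF assms(1) that(1), of s] endpoint_kinds(2)[OF assms(1)] by (force simp: inner_def)
 then show ?thesis using assms by (auto simp: inner_def)
qed

lemma prod_interval:
 assumes "(s, r) \<in> M" "s < r" "r < t" "closed_interval M (Suc s) r"
 shows "(\<Prod>x\<in>{x \<in> M. inner s t x}. f x) = (f (s, r) :: laurent) * ((\<Prod>x\<in>{x \<in> M. inner (Suc s) r x}. f x) * (\<Prod>x\<in>{x \<in> M. inner (Suc r) t x}. f x))"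
 unfolding interval_arcs[OF assms] using finite_arcs assms(2)
 by (subst prod.insert) (auto simp: inner_def intro!: prod.union_disjoint)

lemma transfer_undotted:
 assumes "closed_interval M s t" "1 \<le> s" "s \<le> t" "t \<le> 2 * n + 1" "\<And>x. x \<in> D ==> \<not> inner s t x"
 shows "transfer M D S s t = [:\<Prod>x\<in>{x \<in> M. inner s t x}. arc_weight S x:]"
 using assms
proof (induction rule: interval_induct)
 case (empty s)
 have "{x \<in> M. inner s s x} = {}" by (auto simp: inner_def)
 then show ?case by (simp only: transfer_empty prod.empty) (simp add: one_pCons)
next
 case (arc s r t)
 have "inner s t x" if "inner (Suc s) r x \<or> inner (Suc r) t x" for x
  using that arc.hyps by (auto simp: inner_def)
 then have IH: "transfer M D S (Suc s) r = [:\<Prod>x\<in>{x \<in> M. inner (Suc s) r x}. arc_weight S x:]"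
  "transfer M D S (Suc r) t = [:\<Prod>x\<in>{x \<in> M. inner (Suc r) t x}. arc_weight S x:]"
  using arc.IH arc.prems by blast+
 have notin: "(s, r) \<notin> D" using arc.prems[of "(s, r)"] arc.hyps by (auto simp: inner_def)
 have "plain_arc a b [:c:] = [:cup_weight a b * c:]" for a b c
  by (cases a; cases b) (simp_all add: plain_arc_def dilate_simps cup_weight_def)
 then show ?case
  unfolding transfer_arc[OF arc.hyps(1,3)] prod_interval[OF arc.hyps(1-3,8)] IH
  using notin by (simp add: arc_weight_def mult.assoc)
qed

text \<open>In a standard diagram no arc encloses a dot, so each operator is applied to a constant,
  and the constant term becomes a product over arcs.\<close>

lemma coeff_transfer_standard:
 assumes "closed_interval M s t" "1 \<le> s" "s \<le> t" "t \<le> 2 * n + 1"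
  "\<And>x y. x \<in> D ==> y \<in> M ==> inner s t x ==> inner s t y ==> \<not> nested_in x y"
 shows "coeff (transfer M D S s t) 0 = (\<Prod>x\<in>{x \<in> M. inner s t x}. arc_weight S x)"
 using assms
proof (induction rule: interval_induct)
 case (empty s)
 have "{x \<in> M. inner s s x} = {}" by (auto simp: inner_def)
 then show ?case by (simp only: transfer_empty prod.empty) simp
next
 case (arc s r t)
 have inner: "inner s t x" if "inner (Suc s) r x \<or> inner (Suc r) t x" for x
  using that arc.hyps by (auto simp: inner_def)
 have undotted: "\<not> inner (Suc s) r x" if x: "x \<in> D" for x
 proof
  assume i: "inner (Suc s) r x"
  then have "snd x < r" "fst x < snd x"
   using arc.hyps(8) x D arc_bounds[of "fst x" "snd x"] by (auto simp: closed_interval_def inner_def)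
  then have "nested_in x (s, r)" using i by (simp add: nested_in_def inner_def)
  then show False using arc.prems[OF x arc.hyps(1)] inner i arc.hyps by (simp add: inner_def)
 qed
 have left: "transfer M D S (Suc s) r = [:\<Prod>x\<in>{x \<in> M. inner (Suc s) r x}. arc_weight S x:]"
  by (rule transfer_undotted) (use arc.hyps undotted in auto)
 have right: "coeff (transfer M D S (Suc r) t) 0 = (\<Prod>x\<in>{x \<in> M. inner (Suc r) t x}. arc_weight S x)"
  by (rule arc.IH(2)) (use arc.prems inner in blast)
 have "coeff (plain_arc a b [:c:]) 0 = cup_weight a b * c" for a b c
  by (cases a; cases b) (simp_all add: plain_arc_def dilate_simps cup_weight_def)
 moreover have "coeff (dotted_arc a b [:c:]) 0 = (if a \<or> b then 0 else c)" for a b c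
  by (cases a; cases b) (simp_all add: dotted_arc_def dilate_simps)
 ultimately show ?case
  unfolding transfer_arc[OF arc.hyps(1,3)] prod_interval[OF arc.hyps(1-3,8)] left
  using right by (simp add: arc_weight_def coeff_mult_0 mult.assoc)
qed

lemma free_points_eq: "{1..2 * n} - endpoints (M - D) = endpoints D"
proof (intro Set.set_eqI iffI)
 fix p assume p: "p \<in> {1..2 * n} - endpoints (M - D)"
 then obtain x where x: "x \<in> M" "p = fst x \<or> p = snd x" using arc_exists[of p] by auto
 then have "x \<in> D" using p by (auto simp: endpoints_def)
 then show "p \<in> endpoints D" using x(2) by (auto simp: endpoints_def)
next
 fix p assume "p \<in> endpoints D"
 then obtain x where x: "x \<in> D" "p = fst x \<or> p = snd x" by (auto simp: endpoints_def)
 then have xM: "x \<in> M" using D by blast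
 have "1 \<le> p \<and> p \<le> 2 * n" using arc_bounds[of "fst x" "snd x"] xM x(2) by auto
 moreover have "p \<notin> endpoints (M - D)"
 proof
  assume "p \<in> endpoints (M - D)"
  then obtain y where "y \<in> M - D" "p = fst y \<or> p = snd y" by (auto simp: endpoints_def)
  then show False using arc_unique[OF xM, of y p] x by auto
 qed
 ultimately show "p \<in> {1..2 * n} - endpoints (M - D)" by simp
qed

lemma russell_state_standard:
 assumes "standard (M, D)"
 shows "russell_state n S (M, D) = cap_state n (M - D) S"
proof -
 have "{x \<in> M. inner 1 (2 * n + 1) x} = M" using arc_bounds by (fastforce simp: inner_def)
 moreover have "coeff (transfer M D S 1 (2 * n + 1)) 0 = (\<Prod>x\<in>{x \<in> M. inner 1 (2 * n + 1) x}. arc_weight S x)"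
  by (rule coeff_transfer_standard[OF closed_interval_whole]) (use assms in \<open>auto simp: standard_def\<close>)
 ultimately have "russell_state n S (M, D) = (\<Prod>x\<in>M. arc_weight S x)"
  by (simp only: russell_state_def prod.case)
 also have "\<dots> = (\<Prod>x\<in>D. arc_weight S x) * (\<Prod>x\<in>M - D. arc_weight S x)"
  using prod.subset_diff[OF D finite_arcs] by (simp add: mult.commute)
 also have "(\<Prod>x\<in>M - D. arc_weight S x) = (\<Prod>x\<in>M - D. cup_weight (S (fst x)) (S (snd x)))"
  by (rule prod.cong) (simp_all add: arc_weight_def)
 also have "(\<Prod>x\<in>D. arc_weight S x) = (if \<exists>x\<in>D. S (fst x) \<or> S (snd x) then 0 else 1)"
  using finite_subset[OF D finite_arcs] by (auto simp: arc_weight_def intro!: prod.neutral)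
 also have "(\<exists>x\<in>D. S (fst x) \<or> S (snd x)) \<longleftrightarrow> (\<exists>p\<in>{1..2 * n} - endpoints (M - D). S p)"
  unfolding free_points_eq unfolding endpoints_def by blast
 finally show ?thesis by (simp add: cap_state_def)
qed

end

section \<open>Standard diagrams span the Russell space\<close>

definition depth :: "arc set => arc => nat" where
 "depth M y = card {z \<in> M. nested_in y z}"

text \<open>The measure by which rewriting terminates. Type I solved for its nested diagram with the
  inner dot, and Type II solved for its nested diagram with both dots, express it by terms of
  smaller disorder.\<close>

definition disorder :: "diagram => nat" where
 "disorder x = (\<Sum>y\<in>snd x. depth (fst x) y)"

text \<open>A reconnected arc could be crossed only by an arc lying between \<open>(b, c)\<close>
  and \<open>(a, d)\<close>.\<close>

lemma (in matching) uncross: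
 assumes ad: "(a, d) \<in> M" and bc: "(b, c) \<in> M" and order: "a < b" "b < c" "c < d"
  and between: "\<And>z. z \<in> M ==> nested_in (b, c) z ==> nested_in z (a, d) ==> False"
 shows "crossingless_matching n (M - {(a, d), (b, c)} \<union> {(a, b), (c, d)})" (is "crossingless_matching n ?N")
proof -
 have rest: "fst x \<notin> {a, b, c, d} \<and> snd x \<notin> {a, b, c, d}" if "x \<in> M - {(a, d), (b, c)}" for x
  using that arc_unique[OF ad, of x a] arc_unique[OF ad, of x d] arc_unique[OF bc, of x b] arc_unique[OF bc, of x c] by auto
 have bounds: "1 \<le> e \<and> e < f \<and> f \<le> 2 * n" if "(e, f) \<in> ?N" for e f
  using that arc_bounds[of e f] arc_bounds[OF ad] arc_bounds[OF bc] order by auto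
 have unique: "\<exists>!x. x \<in> ?N \<and> (p = fst x \<or> p = snd x)" if p: "p \<in> {1..2 * n}" for p
 proof -
  consider "p \<in> {a, b}" | "p \<in> {c, d}" | "p \<notin> {a, b, c, d}" by blast
  then show ?thesis
  proof cases
   case 1
   have "x = (a, b)" if x: "x \<in> ?N" "p = fst x \<or> p = snd x" for x
   proof (rule ccontr)
    assume "x \<noteq> (a, b)"
    then consider "x \<in> M - {(a, d), (b, c)}" | "x = (c, d)" using x(1) by blast
    then show False using rest[of x] 1 x(2) order by cases auto
   qed
   moreover have "p = fst (a, b) \<or> p = snd (a, b)" using 1 by auto
   ultimately show ?thesis by (intro ex1I[of _ "(a, b)"]) blast+
  next
   case 2
   have "x = (c, d)" if x: "x \<in> ?N" "p = fst x \<or> p = snd x" for x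
   proof (rule ccontr)
    assume "x \<noteq> (c, d)"
    then consider "x \<in> M - {(a, d), (b, c)}" | "x = (a, b)" using x(1) by blast
    then show False using rest[of x] 2 x(2) order by cases auto
   qed
   moreover have "p = fst (c, d) \<or> p = snd (c, d)" using 2 by auto
   ultimately show ?thesis by (intro ex1I[of _ "(c, d)"]) blast+
  next
   case 3
   obtain x where x: "x \<in> M" "p = fst x \<or> p = snd x" using arc_exists[of p] p by auto
   then have "x \<in> ?N" using 3 by auto
   moreover have "y = x" if "y \<in> ?N" "p = fst y \<or> p = snd y" for y
    using that 3 arc_unique[OF x(1), of y p] x(2) by auto
   ultimately show ?thesis using x(2) by blast
  qed
 qed
 have noncrossing: "\<not> (e < g \<and> g < f \<and> f < h)" if new: "(e, f) \<in> ?N" "(g, h) \<in> ?N" for e f g h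
 proof -
  have old: "\<not> (e < g \<and> g < f \<and> f < h)" if "(e, f) \<in> M" "(g, h) \<in> M" for e f g h
   using no_crossing[OF that] by blast
  have old_new: "\<not> (e < a \<and> a < f \<and> f < b)" "\<not> (a < e \<and> e < b \<and> b < f)" "\<not> (e < c \<and> c < f \<and> f < d)" "\<not> (c < e \<and> e < d \<and> d < f)"
   if ef: "(e, f) \<in> M - {(a, d), (b, c)}" for e f
  proof -
   have m: "(e, f) \<in> M" using ef by blast
   note crossings = old[OF m ad] old[OF ad m] old[OF m bc] old[OF bc m]
   have r: "e \<noteq> a" "e \<noteq> b" "e \<noteq> c" "e \<noteq> d" "f \<noteq> a" "f \<noteq> b" "f \<noteq> c" "f \<noteq> d" using rest[OF ef] by auto
   have "\<not> (a < e \<and> e < b \<and> c < f \<and> f < d)"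
    using between[OF m] order by (auto simp: nested_in_def)
   then show "\<not> (e < a \<and> a < f \<and> f < b)" "\<not> (a < e \<and> e < b \<and> b < f)" "\<not> (e < c \<and> c < f \<and> f < d)" "\<not> (c < e \<and> e < d \<and> d < f)"
    using crossings r order by (smt (verit) linorder_neqE_nat order.strict_trans)+
  qed
  let ?R = "M - {(a, d), (b, c)}"
  consider "(e, f) \<in> ?R" "(g, h) \<in> ?R" | "(e, f) \<in> ?R" "g = a \<and> h = b \<or> g = c \<and> h = d"
   | "(g, h) \<in> ?R" "e = a \<and> f = b \<or> e = c \<and> f = d" | "e = a \<and> f = b \<or> e = c \<and> f = d" "g = a \<and> h = b \<or> g = c \<and> h = d"
   using new by blast
  then show ?thesis
  proof cases
   case 1
   then show ?thesis using old[of e f g h] by blast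
  next
   case 2
   then show ?thesis using old_new[OF 2(1)] by blast
  next
   case 3
   then show ?thesis using old_new[OF 3(1)] by blast
  next
   case 4
   then show ?thesis using order by linarith
  qed
 qed
 have "\<forall>(e, f)\<in>?N. 1 \<le> e \<and> e < f \<and> f \<le> 2 * n" using bounds by blast
 moreover have "\<forall>(e, f)\<in>?N. \<forall>(g, h)\<in>?N. \<not> (e < g \<and> g < f \<and> f < h)" using noncrossing by blast
 moreover have "\<forall>p\<in>{1..2 * n}. \<exists>!x. x \<in> ?N \<and> (p = fst x \<or> p = snd x)" by (intro ballI unique)
 ultimately show ?thesis unfolding crossingless_matching_def by (intro conjI)
qed

context surgery
begin

text \<open>Sending both new arcs to \<open>(a, d)\<close> is injective on the arcs around
  \<open>y\<close>, because two arcs side by side cannot both surround it.\<close>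

lemma depth_side: "y \<in> M ==> depth N' y \<le> depth N y"
proof -
 assume y: "y \<in> M"
 let ?f = "\<lambda>z. if z = (a, b) \<or> z = (c, d) then (a, d) else z"
 have "(a, d) \<notin> M" using M_not_new[of "(a, d)"] by auto
 then have "inj_on ?f {z \<in> N'. nested_in y z}"
  using order by (auto simp: inj_on_def nested_in_def)
 moreover have "?f ` {z \<in> N'. nested_in y z} \<subseteq> {z \<in> N. nested_in y z}"
  using order by (auto simp: nested_in_def)
 ultimately show ?thesis
  unfolding depth_def using nest.finite_arcs by (intro card_inj_on_le[where f = ?f]) auto
qed

lemma depth_new: "depth N' (a, b) \<le> depth N (a, d)" "depth N' (c, d) \<le> depth N (a, d)" "depth N (a, d) < depth N (b, c)"
proof -
 have side: "nested_in (a, d) z" if z: "z \<in> N'" and nested: "nested_in (a, b) z \<or> nested_in (c, d) z" for z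
 proof -
  obtain e f where ef: "z = (e, f)" by (cases z)
  have "z \<in> M" using z nested order by (auto simp: nested_in_def)
  then have "(e, f) \<in> N" "(e, f) \<in> N'" "e \<noteq> a" "e \<noteq> b" "f \<noteq> c" "f \<noteq> d" using M_not_new[of z] ef by auto
  moreover have "(a, d) \<in> N" "(b, c) \<in> N" "(a, b) \<in> N'" "(c, d) \<in> N'" by simp_all
  ultimately have "\<not> (e < b \<and> b < f \<and> f < c)" "\<not> (b < e \<and> e < c \<and> c < f)" "\<not> (a < e \<and> e < b \<and> b < f)"
   "\<not> (e < c \<and> c < f \<and> f < d)" "e \<noteq> a" "e \<noteq> b" "f \<noteq> c" "f \<noteq> d"
   using nest.no_crossing[of e f b c] nest.no_crossing[of b c e f] side.no_crossing[of a b e f] side.no_crossing[of e f c d]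
   by blast+
  then show ?thesis
   using nested order unfolding ef nested_in_def fst_conv snd_conv by (smt (verit) linorder_neqE_nat order.strict_trans)
 qed
 have sub: "{z \<in> N'. nested_in y z} \<subseteq> {z \<in> N. nested_in (a, d) z}" if "y = (a, b) \<or> y = (c, d)" for y
 proof
  fix z assume z: "z \<in> {z \<in> N'. nested_in y z}"
  then have "nested_in (a, d) z" using side that by blast
  moreover from this have "z \<in> M" using z order by (auto simp: nested_in_def)
  ultimately show "z \<in> {z \<in> N. nested_in (a, d) z}" by blast
 qed
 show "depth N' (a, b) \<le> depth N (a, d)" "depth N' (c, d) \<le> depth N (a, d)"
  unfolding depth_def using sub nest.finite_arcs by (intro card_mono; simp)+
 have "(a, d) \<in> {z \<in> N. nested_in (b, c) z}" "(a, d) \<notin> {z \<in> N. nested_in (a, d) z}"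
  using order by (auto simp: nested_in_def)
 moreover have "{z \<in> N. nested_in (a, d) z} \<subseteq> {z \<in> N. nested_in (b, c) z}"
  using order by (auto simp: nested_in_def)
 ultimately show "depth N (a, d) < depth N (b, c)"
  unfolding depth_def using nest.finite_arcs by (intro psubset_card_mono) auto
qed

lemma depth_surrounding:
 assumes "x \<in> surrounding M D a d"
 shows "depth N x < depth N (b, c)" "depth N' x < depth N (b, c)"
proof -
 have x: "x \<in> M" "fst x < a" "d < snd x" using assms by (auto simp: surrounding_def)
 then have "(a, d) \<in> {z \<in> N. nested_in (b, c) z}" "(a, d) \<notin> {z \<in> N. nested_in x z}"
  using order by (auto simp: nested_in_def)
 moreover have "{z \<in> N. nested_in x z} \<subseteq> {z \<in> N. nested_in (b, c) z}"
  using order x by (auto simp: nested_in_def)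
 ultimately show less: "depth N x < depth N (b, c)"
  unfolding depth_def using nest.finite_arcs by (intro psubset_card_mono) auto
 show "depth N' x < depth N (b, c)" using depth_side[OF x(1)] less by simp
qed

lemma finite_D: "finite D"
 using finite_subset[OF D] nest.finite_arcs by simp

lemma not_dotted: "x \<in> surrounding M D a d ==> x \<notin> D \<and> x \<in> M"
 by (auto simp: surrounding_def)

lemma sum_depth: "(\<Sum>y\<in>D. depth N' y) \<le> (\<Sum>y\<in>D. depth N y)"
 using D by (intro sum_mono depth_side) auto

lemma disorder_type_I:
 "disorder (N', D \<union> {(a, b)}) < disorder (N, D \<union> {(b, c)})" "disorder (N', D \<union> {(c, d)}) < disorder (N, D \<union> {(b, c)})"
 "disorder (N, D \<union> {(a, d)}) < disorder (N, D \<union> {(b, c)})"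
 "x \<in> surrounding M D a d ==> disorder (N', D \<union> {x}) < disorder (N, D \<union> {(b, c)})"
 using sum_depth depth_new depth_surrounding[of x] new_notin finite_D not_dotted[of x] by (simp_all add: disorder_def)

lemma disorder_type_II:
 "disorder (N', D \<union> {(a, b), (c, d)}) < disorder (N, D \<union> {(a, d), (b, c)})"
 "x \<in> surrounding M D a d ==> disorder (N, D \<union> {(a, d), x}) < disorder (N, D \<union> {(a, d), (b, c)})"
proof -
 have "x \<noteq> (a, d)" if "x \<in> surrounding M D a d" using that by (auto simp: surrounding_def)
 then show "disorder (N', D \<union> {(a, b), (c, d)}) < disorder (N, D \<union> {(a, d), (b, c)})"
  "x \<in> surrounding M D a d ==> disorder (N, D \<union> {(a, d), x}) < disorder (N, D \<union> {(a, d), (b, c)})"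
  using sum_depth depth_new depth_surrounding[of x] new_notin finite_D not_dotted[of x] order by (simp_all add: disorder_def)
qed

lemma diagrams_type_I:
 assumes "card D + 1 = k"
 shows "(N, D \<union> {(b, c)}) \<in> diagrams n k" "(N', D \<union> {(a, b)}) \<in> diagrams n k" "(N', D \<union> {(c, d)}) \<in> diagrams n k"
  "(N, D \<union> {(a, d)}) \<in> diagrams n k" "x \<in> surrounding M D a d ==> (N', D \<union> {x}) \<in> diagrams n k"
 using assms M1 M2 D new_notin finite_D not_dotted[of x] by (auto simp: diagrams_def)

lemma diagrams_type_II:
 assumes "card D + 2 = k"
 shows "(N, D \<union> {(a, d), (b, c)}) \<in> diagrams n k" "(N', D \<union> {(a, b), (c, d)}) \<in> diagrams n k"
  "x \<in> surrounding M D a d ==> (N, D \<union> {(a, d), x}) \<in> diagrams n k"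
proof -
 have "x \<noteq> (a, d)" if "x \<in> surrounding M D a d" using that by (auto simp: surrounding_def)
 then show "(N, D \<union> {(a, d), (b, c)}) \<in> diagrams n k" "(N', D \<union> {(a, b), (c, d)}) \<in> diagrams n k"
  "x \<in> surrounding M D a d ==> (N, D \<union> {(a, d), x}) \<in> diagrams n k"
  using assms M1 M2 D new_notin finite_D not_dotted[of x] order by (auto simp: diagrams_def)
qed

end

section \<open>Rewriting with Type I and II\<close>

abbreviation "free_r n k \<equiv> carrier (free_russell n k)"

definition russell_span :: "nat => nat => (diagram \<Rightarrow>\<^sub>0 laurent) set" where
 "russell_span n k = module_span Laurent_q (free_russell n k) (russell_relations n k)"

lemma free_r_closed [simp]:
 "f \<in> free_r n k ==> g \<in> free_r n k ==> f + g \<in> free_r n k"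
 "f \<in> free_r n k ==> g \<in> free_r n k ==> f - g \<in> free_r n k"
 "c \<in> carrier Laurent_q ==> f \<in> free_r n k ==> scale c f \<in> free_r n k"
 "c \<in> carrier Laurent_q ==> x \<in> diagrams n k ==> single x c \<in> free_r n k"
 "(\<And>x. x \<in> A ==> F x \<in> free_r n k) ==> sum F A \<in> free_r n k"
 by (simp_all add: free_russell_def)

lemma russell_relations_closed: "russell_relations n k \<subseteq> free_r n k"
proof
 fix r assume "r \<in> russell_relations n k"
 then show "r \<in> free_r n k"
 proof cases
  case (type_I a b c d D M)
  then interpret surgery n M D a b c d by unfold_locales
  show ?thesis unfolding type_I(1) using diagrams_type_I[OF type_I(6)] by (intro free_r_closed) simp_all
 next
  case (type_II a b c d D M)
  then interpret surgery n M D a b c d by unfold_locales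
  show ?thesis unfolding type_II(1) using diagrams_type_II[OF type_II(6)] by (intro free_r_closed) simp_all
 qed
qed

lemma submodule_russell_span: "submodule (russell_span n k) Laurent_q (free_russell n k)"
 unfolding russell_span_def free_russell_def
 by (rule qring.submodule_span) (rule russell_relations_closed[unfolded free_russell_def])

lemmas russell_span_closed = qring.submodule_freeD[OF submodule_russell_span[unfolded free_russell_def], folded free_russell_def]

lemma russell_span_inc: "r \<in> russell_relations n k ==> r \<in> russell_span n k"
 unfolding russell_span_def free_russell_def using qring.span_inc by blast

text \<open>The reduction takes place over the even subring, since the Russell relations span a
  module over that ring; scalars are extended afterwards.\<close>

definition reducible :: "nat => nat => (diagram \<Rightarrow>\<^sub>0 laurent) set" where
 "reducible n k = {f. \<exists>g\<in>free_r n k. keys g \<subseteq> Collect standard \<and> f - g \<in> russell_span n k}"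

lemma reducible_closed:
 "f \<in> reducible n k ==> g \<in> reducible n k ==> f + g \<in> reducible n k"
 "c \<in> carrier Laurent_q ==> f \<in> reducible n k ==> scale c f \<in> reducible n k"
 "r \<in> russell_span n k ==> r \<in> reducible n k"
proof -
 assume "f \<in> reducible n k" "g \<in> reducible n k"
 then obtain f' g' where *: "f' \<in> free_r n k" "keys f' \<subseteq> Collect standard" "f - f' \<in> russell_span n k"
  "g' \<in> free_r n k" "keys g' \<subseteq> Collect standard" "g - g' \<in> russell_span n k" by (auto simp: reducible_def)
 have "(f - f') + (g - g') \<in> russell_span n k" using * russell_span_closed(3) by blast
 then have "(f + g) - (f' + g') \<in> russell_span n k" by (simp add: algebra_simps)
 moreover have "keys (f' + g') \<subseteq> Collect standard" using keys_add[of f' g'] * by blast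
 ultimately show "f + g \<in> reducible n k" using * by (auto simp: reducible_def intro!: bexI[of _ "f' + g'"])
next
 assume c: "c \<in> carrier Laurent_q" and "f \<in> reducible n k"
 then obtain f' where *: "f' \<in> free_r n k" "keys f' \<subseteq> Collect standard" "f - f' \<in> russell_span n k"
  by (auto simp: reducible_def)
 have "scale c f - scale c f' \<in> russell_span n k" using * c russell_span_closed(5) by (simp flip: scale_diff_right)
 moreover have "keys (scale c f') \<subseteq> Collect standard" using keys_scale[of c f'] * by blast
 ultimately show "scale c f \<in> reducible n k" using * c by (auto simp: reducible_def intro!: bexI[of _ "scale c f'"])
next
 assume "r \<in> russell_span n k"
 then show "r \<in> reducible n k"
  using qring.free_closed(1) by (auto simp: reducible_def free_russell_def intro!: bexI[of _ 0])
qed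

lemma reducible_single: "c \<in> carrier Laurent_q ==> single x 1 \<in> reducible n k ==> single x c \<in> reducible n k"
 using reducible_closed(2)[of c "single x 1"] by simp

lemma reducible_sum: "(\<And>x. x \<in> A ==> f x \<in> reducible n k) ==> sum f A \<in> reducible n k"
 by (induction A rule: infinite_finite_induct) (auto intro: reducible_closed russell_span_closed(2))

text \<open>Around a dotted arc that violates the condition the shortest arc is chosen; nothing lies
  between the two, so they can be uncrossed. Type II applies if the outer arc is dotted too and Type
  I otherwise. The given diagram occurs in the relation with coefficient -1 or 1 and can be solved
  for.\<close>

lemma diagram_reducible: "x \<in> diagrams n k ==> single x 1 \<in> reducible n k"
proof (induction "disorder x" arbitrary: x rule: less_induct)
 case less
 obtain M0 D0 where x: "x = (M0, D0)" by (cases x)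
 have M0: "crossingless_matching n M0" "D0 \<subseteq> M0" "card D0 = k" using less.prems by (auto simp: x diagrams_def)
 interpret matching n M0 by unfold_locales (rule M0)
 have coeff: "(1 - q_pow (-2)) * q_pow i \<in> carrier Laurent_q" for i by simp
 show ?case
 proof (cases "standard x")
  case True
  then show ?thesis
   using less.prems russell_span_closed(2) by (auto simp: reducible_def intro!: bexI[of _ "single x 1"])
 next
  case False
  then obtain y z0 where y: "y \<in> D0" "z0 \<in> M0" "nested_in y z0" by (auto simp: standard_def x)
  define P where "P z \<longleftrightarrow> z \<in> M0 \<and> nested_in y z" for z
  have "P z0" using y by (simp add: P_def)
  then have "\<exists>z. P z \<and> (\<forall>z'. P z' \<longrightarrow> snd z - fst z \<le> snd z' - fst z')"
   by (rule ex_has_least_nat)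
  then obtain z where z: "P z" "\<And>z'. P z' ==> snd z - fst z \<le> snd z' - fst z'" by blast
  obtain a d b c where abcd: "z = (a, d)" "y = (b, c)" by (cases z, cases y)
  have mem: "(a, d) \<in> M0" "(b, c) \<in> M0" "(b, c) \<in> D0" and order: "a < b" "b < c" "c < d"
   using z(1) y M0 by (auto simp: P_def nested_in_def abcd)
  define M where "M = M0 - {(a, d), (b, c)}"
  define D where "D = D0 - {(a, d), (b, c)}"
  have M0_eq: "M0 = M \<union> {(a, d), (b, c)}" using mem by (auto simp: M_def)
  have "False" if "w \<in> M0" "nested_in (b, c) w" "nested_in w (a, d)" for w
   using z(2)[of w] that by (auto simp: P_def abcd nested_in_def)
  then have M2: "crossingless_matching n (M \<union> {(a, b), (c, d)})"
   unfolding M_def by (intro uncross[OF mem(1,2) order]) blast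
  have DM: "D \<subseteq> M" using M0 by (auto simp: D_def M_def)
  interpret surgery n M D a b c d
   by unfold_locales (use order DM M2 M0(1) M0_eq in simp_all)
  show ?thesis
  proof (cases "(a, d) \<in> D0")
   case True
   then have D0_eq: "D0 = D \<union> {(a, d), (b, c)}" using mem by (auto simp: D_def)
   have "card D + 2 = k" using M0(3) new_notin finite_D order unfolding D0_eq by simp
   note diag = diagrams_type_II[OF this] and rel = russell_relations.type_II[OF order DM this M1 M2, THEN russell_span_inc]
   have side: "single (N', D \<union> {(a, b), (c, d)}) 1 \<in> reducible n k"
    by (rule less.hyps) (use disorder_type_II(1) diag in \<open>simp_all add: x M0_eq D0_eq\<close>)
   have surr: "single (N, D \<union> {(a, d), w}) 1 \<in> reducible n k" if "w \<in> surrounding M D a d" for w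
    by (rule less.hyps) (use disorder_type_II(2)[OF that] diag that in \<open>simp_all add: x M0_eq D0_eq\<close>)
   have sum: "(\<Sum>w\<in>surrounding M D a d. single (N, D \<union> {(a, d), w})
     ((1 - q_pow (-2)) * q_pow (surround_index M D a d w - 1 - surround_dotted D a d w))) \<in> reducible n k" (is "?T \<in> _")
    by (rule reducible_sum, rule reducible_single[OF coeff surr])
   have neg: "- 1 \<in> carrier Laurent_q" by simp
   \<comment> \<open>Type II is stated for the side-by-side diagram; here it is turned
     around.\<close>
   have "single x 1 = single (N', D \<union> {(a, b), (c, d)}) 1 + scale (- 1) ?T
     + scale (- 1) (single (N', D \<union> {(a, b), (c, d)}) 1 - (single (N, D \<union> {(a, d), (b, c)}) 1 + ?T))"
    unfolding x M0_eq D0_eq by (simp add: scale_minus_left)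
   then show ?thesis
    using reducible_closed(1)[OF reducible_closed(1)[OF side reducible_closed(2)[OF neg sum]] reducible_closed(2)[OF neg reducible_closed(3)[OF rel]]]
    by simp
  next
   case False
   then have D0_eq: "D0 = D \<union> {(b, c)}" using mem by (auto simp: D_def)
   have "card D + 1 = k" using M0(3) new_notin finite_D unfolding D0_eq by simp
   note diag = diagrams_type_I[OF this] and rel = russell_relations.type_I[OF order DM this M1 M2, THEN russell_span_inc]
   have side: "single (N', D \<union> {(a, b)}) 1 \<in> reducible n k" "single (N', D \<union> {(c, d)}) 1 \<in> reducible n k"
    "single (N, D \<union> {(a, d)}) 1 \<in> reducible n k"
    by (rule less.hyps; use disorder_type_I diag in \<open>simp add: x M0_eq D0_eq\<close>)+
   have surr: "single (N', D \<union> {w}) 1 \<in> reducible n k" if "w \<in> surrounding M D a d" for w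
    by (rule less.hyps) (use disorder_type_I(4)[OF that] diag that in \<open>simp_all add: x M0_eq D0_eq\<close>)
   have sum: "(\<Sum>w\<in>surrounding M D a d. single (N', D \<union> {w})
     ((1 - q_pow (-2)) * q_pow (surround_index M D a d w - surround_dotted D a d w))) \<in> reducible n k" (is "?T \<in> _")
    by (rule reducible_sum, rule reducible_single[OF coeff surr])
   have last: "single (N, D \<union> {(a, d)}) (q_pow (-1)) \<in> reducible n k"
    by (rule reducible_single[OF _ side(3)]) simp
   show ?thesis
    using reducible_closed(1)[OF reducible_closed(3)[OF rel]
      reducible_closed(1)[OF reducible_closed(1)[OF reducible_closed(1)[OF side(1,2)] last] sum]]
    unfolding x M0_eq D0_eq diff_add_cancel .
  qed
 qed
qed

lemma russell_reducible:
 assumes "f \<in> free_r n k"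
 obtains g where "g \<in> free_r n k" "keys g \<subseteq> Collect standard" "f - g \<in> russell_span n k"
proof -
 have "(\<Sum>x\<in>keys f. single x (lookup f x)) \<in> reducible n k"
  by (rule reducible_sum, rule reducible_single; use assms diagram_reducible in \<open>auto simp: free_russell_def free_module_carrier\<close>)
 then show thesis using that unfolding reducible_def by (subst (asm) poly_mapping_expand[symmetric]) blast
qed

section \<open>Linear independence\<close>

text \<open>The arcs of a ray matching are the undotted arcs of a standard diagram, and also the arcs between
 points outside the projectors of a cup diagram; the points they leave free are the ends of the dotted arcs
 and of the rays to the projectors, respectively.\<close>

locale ray_matching =
 fixes n :: nat and A :: "arc set"
 assumes bounds: "(a, b) \<in> A ==> 1 \<le> a \<and> a < b \<and> b \<le> 2 * n"
  and unique: "\<lbrakk>x \<in> A; y \<in> A; p = fst x \<or> p = snd x; p = fst y \<or> p = snd y\<rbrakk> \<Longrightarrow> x = y"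
  and noncrossing: "\<lbrakk>(a, b) \<in> A; (c, d) \<in> A; a < c; c < b; b < d\<rbrakk> \<Longrightarrow> False"
  and covered: "\<lbrakk>(a, b) \<in> A; a < p; p < b\<rbrakk> \<Longrightarrow> p \<in> endpoints A"
begin

lemma finite: "finite A"
 by (rule finite_subset[of _ "{1..2 * n} \<times> {1..2 * n}"]) (use bounds in fastforce, simp)

lemma fst_inj: "inj_on fst A"
proof (rule inj_onI)
 fix x y assume "x \<in> A" "y \<in> A" "fst x = fst y"
 then show "x = y" using unique[of x y "fst x"] by simp
qed

lemma not_both: "x \<in> A ==> snd x \<notin> fst ` A"
proof
 assume x: "x \<in> A" and "snd x \<in> fst ` A"
 then obtain y where y: "y \<in> A" "snd x = fst y" by auto
 then have "x = y" using unique[OF x y(1), of "snd x"] by simp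
 moreover have "fst x < snd x" using bounds[of "fst x" "snd x"] x by simp
 ultimately show False using y(2) by simp
qed

lemma nested_cover:
 assumes "(a, b) \<in> A" "a < p" "p < b"
 obtains x where "x \<in> A" "p = fst x \<or> p = snd x" "a < fst x" "fst x < snd x" "snd x < b"
proof -
 obtain x where x: "x \<in> A" "p = fst x \<or> p = snd x" using covered[OF assms] by (auto simp: endpoints_def)
 have "(a, b) \<noteq> x" using x(2) assms(2,3) by auto
 then have ends: "q = a \<or> q = b ==> fst x \<noteq> q \<and> snd x \<noteq> q" for q
  using unique[OF assms(1) x(1), of q] by auto
 have "fst x < snd x" using bounds[of "fst x" "snd x"] x(1) by simp
 moreover have "\<not> (fst x < a \<and> a < snd x \<and> snd x < b)" "\<not> (a < fst x \<and> fst x < b \<and> b < snd x)"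
  using noncrossing[of "fst x" "snd x" a b] noncrossing[of a b "fst x" "snd x"] x(1) assms(1) by auto
 ultimately have "a < fst x" "snd x < b"
  using ends[of a] ends[of b] x(2) assms(2,3) by auto
 then show thesis using that x \<open>fst x < snd x\<close> by blast
qed

end

text \<open>All points under an arc are covered, so left ends determine their partners as opening
  brackets do. Induction on the length of the arc excludes both a shorter and a longer partner in
  \<open>B\<close>.\<close>

lemma ray_matching_subset:
 assumes "ray_matching n A" "ray_matching n B" "fst ` A = fst ` B" "(a, b) \<in> A"
 shows "(a, b) \<in> B"
proof -
 interpret A: ray_matching n A by (rule assms)
 interpret B: ray_matching n B by (rule assms)
 show ?thesis using assms(4)
 proof (induction "b - a" arbitrary: a b rule: less_induct)
  case less
  have IH: "x \<in> B" if "x \<in> A" "a < fst x" "fst x < snd x" "snd x < b" for x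
   using less.hyps[of "snd x" "fst x"] that by simp
  have "a \<in> fst ` B" using less.prems assms(3) by force
  then obtain b' where b': "(a, b') \<in> B" by auto
  have ab: "a < b" "a < b'" using A.bounds[OF less.prems] B.bounds[OF b'] by auto
  have "\<not> b' < b"
  proof
   assume "b' < b"
   with ab(2) obtain x where x: "x \<in> A" "b' = fst x \<or> b' = snd x" "a < fst x" "fst x < snd x" "snd x < b"
    using A.nested_cover[OF less.prems] by blast
   then have "x = (a, b')" using B.unique[OF IH b', of x b'] by auto
   then show False using x by simp
  qed
  moreover have "\<not> b < b'"
  proof
   assume "b < b'"
   with ab(1) obtain y where y: "y \<in> B" "b = fst y \<or> b = snd y" "a < fst y" "fst y < snd y" "snd y < b'"
    using B.nested_cover[OF b'] by blast
   have "b \<notin> fst ` B" using A.not_both[OF less.prems] assms(3) by simp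
   then have yb: "snd y = b" using y by auto
   then have "fst y < b" using y(4) by simp
   with y(3) obtain x where x: "x \<in> A" "fst y = fst x \<or> fst y = snd x" "a < fst x" "fst x < snd x" "snd x < b"
    using A.nested_cover[OF less.prems] by blast
   then have "x = y" using B.unique[OF IH y(1), of x "fst y"] by auto
   then show False using x yb by simp
  qed
  ultimately show ?case using b' by (cases "b' = b") auto
 qed
qed

lemma ray_matching_eq: "ray_matching n A ==> ray_matching n B ==> fst ` A = fst ` B ==> A = B"
 using ray_matching_subset[of n A B] ray_matching_subset[of n B A] by auto

lemma cap_state_leading:
 assumes "ray_matching n A"
 shows "cap_state n A (\<lambda>i. i \<in> fst ` A) = 1"
proof -
 interpret ray_matching n A by (rule assms)
 have "(\<Prod>x\<in>A. cup_weight (fst x \<in> fst ` A) (snd x \<in> fst ` A)) = 1"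
  by (rule prod.neutral) (simp add: not_both cup_weight_def)
 then show ?thesis by (auto simp: cap_state_def endpoints_def)
qed

text \<open>If the word of \<open>A\<close> contributes to \<open>B\<close>, each arc of
  \<open>B\<close> has exactly one end among the left ends of \<open>A\<close>. This choice
  \<open>g\<close> is a bijection onto them with \<open>fst x \<le> g x\<close>, so the inequality
  of the sums forces \<open>g\<close> to pick left ends throughout, and left ends determine a ray
  matching.\<close>

lemma cap_state_triangular:
 assumes "ray_matching n A" "ray_matching n B" "cap_state n B (\<lambda>i. i \<in> fst ` A) \<noteq> 0"
  and weight: "(\<Sum>x\<in>A. fst x) \<le> (\<Sum>x\<in>B. fst x)"
 shows "A = B"
proof -
 interpret A: ray_matching n A by (rule assms)
 interpret B: ray_matching n B by (rule assms)
 define g where "g x = (if fst x \<in> fst ` A then fst x else snd x)" for x :: arc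
 have free: "p \<notin> fst ` A" if "p \<in> {1..2 * n} - endpoints B" for p
  using assms(3) that by (auto simp: cap_state_def split: if_splits)
 have "(\<Prod>x\<in>B. cup_weight (fst x \<in> fst ` A) (snd x \<in> fst ` A)) \<noteq> 0"
  using assms(3) by (auto simp: cap_state_def split: if_splits)
 then have one: "(fst x \<in> fst ` A) \<noteq> (snd x \<in> fst ` A)" if "x \<in> B" for x
  using B.finite that by (auto simp: cup_weight_def split: if_splits)
 have range: "g ` B = fst ` A"
 proof
  show "g ` B \<subseteq> fst ` A" using one by (auto simp: g_def)
  show "fst ` A \<subseteq> g ` B"
  proof
   fix p assume p: "p \<in> fst ` A"
   then have "p \<in> {1..2 * n}" using A.bounds by fastforce
   then have "p \<in> endpoints B" using free p by blast
   then obtain x where x: "x \<in> B" "p = fst x \<or> p = snd x" by (auto simp: endpoints_def)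
   then have "p = g x" using one[OF x(1)] p unfolding g_def by metis
   then show "p \<in> g ` B" using x(1) by blast
  qed
 qed
 have inj: "inj_on g B"
 proof (rule inj_onI)
  fix x y assume "x \<in> B" "y \<in> B" "g x = g y"
  then show "x = y" using B.unique[of x y "g x"] by (auto simp: g_def split: if_splits)
 qed
 have le: "fst x \<le> g x" if "x \<in> B" for x
  using B.bounds[of "fst x" "snd x"] that by (simp add: g_def)
 have "(\<Sum>x\<in>B. g x) = sum id (g ` B)" using inj by (simp add: sum.reindex)
 also have "\<dots> = (\<Sum>x\<in>A. fst x)" unfolding range using A.fst_inj by (simp add: sum.reindex)
 finally have "(\<Sum>x\<in>B. g x) \<le> (\<Sum>x\<in>B. fst x)" using weight by simp
 then have eq: "g x = fst x" if "x \<in> B" for x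
  using sum_strict_mono_ex1[OF B.finite, of fst g] le that by (metis leD le_neq_implies_less)
 have "g ` B = fst ` B" by (rule image_cong[OF HOL.refl]) (rule eq)
 then show ?thesis using ray_matching_eq[OF assms(1,2)] range by simp
qed

text \<open>Among the matchings with nonzero coefficient one with least sum of left ends is taken.
  At its word the states of all the others vanish.\<close>

lemma cap_state_independent:
 assumes "finite I" "\<And>A. A \<in> I ==> ray_matching n A" "\<And>S. (\<Sum>A\<in>I. c A * cap_state n A S) = 0" "A \<in> I"
 shows "c A = 0"
proof (rule ccontr)
 define P where "P B \<longleftrightarrow> B \<in> I \<and> c B \<noteq> 0" for B
 assume "c A \<noteq> 0"
 then have "P A" using assms(4) by (simp add: P_def)
 then have "\<exists>B. P B \<and> (\<forall>B'. P B' \<longrightarrow> (\<Sum>x\<in>B. fst x) \<le> (\<Sum>x\<in>B'. fst x))" by (rule ex_has_least_nat)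
 then obtain B where B: "P B" "\<And>B'. P B' ==> (\<Sum>x\<in>B. fst x) \<le> (\<Sum>x\<in>B'. fst x)" by blast
 let ?S = "\<lambda>i. i \<in> fst ` B"
 have BI: "B \<in> I" "ray_matching n B" using B(1) assms(2) by (auto simp: P_def)
 have "c B' * cap_state n B' ?S = 0" if B': "B' \<in> I - {B}" for B'
 proof (rule ccontr)
  assume "c B' * cap_state n B' ?S \<noteq> 0"
  then have "P B'" "cap_state n B' ?S \<noteq> 0" using B' by (auto simp: P_def)
  then have "B = B'" using cap_state_triangular[OF BI(2) assms(2)] B' B(2) by blast
  then show False using B' by simp
 qed
 then have "(\<Sum>A\<in>I - {B}. c A * cap_state n A ?S) = 0" by (intro sum.neutral ballI)
 then have "(\<Sum>A\<in>I. c A * cap_state n A ?S) = c B * cap_state n B ?S"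
  using sum.remove[OF assms(1) BI(1), of "\<lambda>A. c A * cap_state n A ?S"] by simp
 then show False using assms(3)[of ?S] cap_state_leading[OF BI(2)] B(1) by (simp add: P_def)
qed

lemma (in dotted_matching) dot_order: "(p, r) \<in> D ==> p < r"
 using D arc_bounds by blast

lemma (in dotted_matching) standard_ray_matching:
 assumes "standard (M, D)"
 shows "ray_matching n (M - D)"
proof
 show "(a, b) \<in> M - D ==> 1 \<le> a \<and> a < b \<and> b \<le> 2 * n" for a b using arc_bounds by blast
 show "x = y" if "x \<in> M - D" "y \<in> M - D" "p = fst x \<or> p = snd x" "p = fst y \<or> p = snd y" for x y p
  using arc_unique[of x y p] that by blast
 show "\<lbrakk>(a, b) \<in> M - D; (c, d) \<in> M - D; a < c; c < b; b < d\<rbrakk> \<Longrightarrow> False" for a b c d using no_crossing by blast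
 show "p \<in> endpoints (M - D)" if ab: "(a, b) \<in> M - D" and p: "a < p" "p < b" for a b p
 proof (rule ccontr)
  assume "p \<notin> endpoints (M - D)"
  then have "p \<in> endpoints D" using free_points_eq arc_bounds[of a b] ab p by auto
  then obtain x where x: "x \<in> D" "p = fst x \<or> p = snd x" by (auto simp: endpoints_def)
  then have xM: "(fst x, snd x) \<in> M" using D by auto
  have "nested_in x (a, b)"
   using arc_cases[OF xM, of a b] arc_bounds[OF xM] ab x p by (auto simp: nested_in_def)
  then show False using assms x ab by (auto simp: standard_def)
 qed
qed

text \<open>A dotted arc of a standard diagram encloses no end of a dotted arc, so dotted arcs join
  consecutive free points, and these are determined by the undotted arcs. Induction on the left end
  rules out a pairing shifted by one.\<close>

lemma standard_dots_subset:
 assumes "dotted_matching n M D" "dotted_matching n M' D'" "standard (M, D)" "standard (M', D')" "M - D = M' - D'"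
  and "(p, r) \<in> D"
 shows "(p, r) \<in> D'"
proof -
 interpret A: dotted_matching n M D by (rule assms)
 interpret B: dotted_matching n M' D' by (rule assms)
 have ends: "endpoints D = endpoints D'" using A.free_points_eq B.free_points_eq assms(5) by simp
 have bad: False if E: "dotted_matching n N E" "standard (N, E)" "(a, b) \<in> E" "a < x" "x < b" "x \<in> endpoints E" for N E a b x
 proof -
  interpret dotted_matching n N E by (rule E)
  obtain y where y: "y \<in> E" "x = fst y \<or> x = snd y" using E(6) by (auto simp: endpoints_def)
  then have yN: "(fst y, snd y) \<in> N" "(a, b) \<in> N" using D E by auto
  have "nested_in y (a, b)"
   using arc_cases[OF yN] arc_bounds[OF yN(1)] E(4,5) y by (auto simp: nested_in_def)
  then show False using E(2) y yN by (auto simp: standard_def)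
 qed
 show ?thesis using assms(6)
 proof (induction p arbitrary: r rule: less_induct)
  case (less p)
  have pr: "(p, r) \<in> M" using less.prems A.D by blast
  have "p \<in> endpoints D" using less.prems by (force simp: endpoints_def)
  then obtain y where y: "y \<in> D'" "p = fst y \<or> p = snd y" unfolding ends by (auto simp: endpoints_def)
  have yM: "(fst y, snd y) \<in> M'" using y B.D by auto
  have "snd y \<noteq> p"
  proof
   assume yp: "snd y = p"
   have lt: "fst y < p" using B.arc_bounds[OF yM] yp by simp
   have "fst y \<in> endpoints D" unfolding ends using y(1) by (auto simp: endpoints_def)
   then obtain x where x: "x \<in> D" "fst y = fst x \<or> fst y = snd x" by (auto simp: endpoints_def)
   have xM: "(fst x, snd x) \<in> M" using x(1) A.D by auto
   have "fst x < p" using x(2) lt A.arc_bounds[OF xM] by auto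
   then have "x \<in> D'" using less.IH[of "fst x" "snd x"] x(1) by simp
   then have "x = y" using B.arc_unique[of x y "fst y"] y(1) x(2) B.D by blast
   then have "(p, r) = x" using A.arc_unique[of "(p, r)" x p] pr x(1) yp A.D by auto
   then show False using \<open>x = y\<close> lt by auto
  qed
  then have y': "(p, snd y) \<in> D'" using y by (cases y) auto
  have "\<not> snd y < r"
  proof
   assume "snd y < r"
   moreover have "snd y \<in> endpoints D" unfolding ends using y(1) by (auto simp: endpoints_def)
   moreover have "p < snd y" using B.dot_order[OF y'] .
   ultimately show False using bad[OF assms(1,3) less.prems] by blast
  qed
  moreover have "\<not> r < snd y"
  proof
   assume "r < snd y"
   moreover have "r \<in> endpoints D'" unfolding ends[symmetric] using less.prems by (force simp: endpoints_def)
   moreover have "p < r" using A.dot_order[OF less.prems] .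
   ultimately show False using bad[OF assms(2,4) y'] by blast
  qed
  ultimately have "snd y = r" by simp
  then show ?case using y' by simp
 qed
qed

lemma standard_inj:
 assumes "x \<in> diagrams n k" "y \<in> diagrams n k" "standard x" "standard y" "fst x - snd x = fst y - snd y"
 shows "x = y"
proof -
 have dm: "dotted_matching n (fst z) (snd z)" if "z \<in> diagrams n k" for z
  using that by unfold_locales (auto simp: diagrams_def)
 have "snd x = snd y"
  using standard_dots_subset[OF dm[OF assms(1)] dm[OF assms(2)]] standard_dots_subset[OF dm[OF assms(2)] dm[OF assms(1)]] assms(3-5)
  by auto
 moreover have "snd x \<subseteq> fst x" "snd y \<subseteq> fst y" using assms(1,2) by (auto simp: diagrams_def)
 ultimately show ?thesis using assms(5) by (auto simp: prod_eq_iff)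
qed

text \<open>Coefficients range over all Laurent polynomials in q^(1/2), as injectivity after
  extension of scalars requires.\<close>

lemma standard_independent:
 assumes "f \<in> carrier (free_module Laurent_qhalf (diagrams n k))" "keys f \<subseteq> Collect standard"
  and "\<And>S. pairing (russell_state n S) f = 0"
 shows "f = 0"
proof (rule ccontr)
 let ?K = "keys f" and ?a = "\<lambda>x :: diagram. fst x - snd x"
 assume "f \<noteq> 0"
 then have "?K \<noteq> {}" by simp
 then obtain x where x: "x \<in> ?K" by blast
 have K: "?K \<subseteq> diagrams n k" using assms(1) by (simp add: free_module_carrier)
 have inj: "inj_on ?a ?K" by (rule inj_onI, rule standard_inj) (use K assms(2) in auto)
 have dm: "dotted_matching n (fst z) (snd z)" if "z \<in> diagrams n k" for z
  using that by unfold_locales (auto simp: diagrams_def)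
 let ?c = "\<lambda>A. lookup f (the_inv_into ?K ?a A)"
 have "?c (?a x) = 0"
 proof (rule cap_state_independent)
  show "finite (?a ` ?K)" by simp
  show "ray_matching n A" if A: "A \<in> ?a ` ?K" for A
  proof -
   obtain z where z: "z \<in> ?K" "A = ?a z" using A by blast
   then show ?thesis using dotted_matching.standard_ray_matching[OF dm, of z] K assms(2) by auto
  qed
  show "(\<Sum>A\<in>?a ` ?K. ?c A * cap_state n A S) = 0" for S
  proof -
   have "(\<Sum>A\<in>?a ` ?K. ?c A * cap_state n A S) = (\<Sum>z\<in>?K. lookup f z * russell_state n S z)"
   proof (subst sum.reindex[OF inj], rule sum.cong[OF HOL.refl])
    fix z assume z: "z \<in> ?K"
    then have "z \<in> diagrams n k" "standard (fst z, snd z)" using K assms(2) by auto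
    then have "russell_state n S z = cap_state n (?a z) S"
     using dotted_matching.russell_state_standard[OF dm, of z S] by simp
    then show "((\<lambda>A. ?c A * cap_state n A S) \<circ> ?a) z = lookup f z * russell_state n S z"
     using the_inv_into_f_f[OF inj z] by simp
   qed
   then show ?thesis using assms(3)[of S] by (simp add: pairing_def)
  qed
  show "?a x \<in> ?a ` ?K" using x by blast
 qed
 then show False using x the_inv_into_f_f[OF inj x] by (simp add: in_keys_iff)
qed

section \<open>Cup diagrams as states\<close>

locale perfect =
 fixes m :: nat and P :: "arc set"
 assumes perfect: "perfect_matching m P"
begin

lemma P_bounds: "(a, b) \<in> P ==> a < b \<and> b < m"
 using perfect unfolding perfect_matching_def by blast

lemma P_unique: "\<lbrakk>x \<in> P; y \<in> P; p = fst x \<or> p = snd x; p = fst y \<or> p = snd y\<rbrakk> \<Longrightarrow> x = y"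
proof -
 assume xy: "x \<in> P" "y \<in> P" "p = fst x \<or> p = snd x" "p = fst y \<or> p = snd y"
 then have "p < m" using P_bounds[of "fst x" "snd x"] by auto
 then have "\<exists>!x. x \<in> P \<and> (p = fst x \<or> p = snd x)" using perfect unfolding perfect_matching_def by blast
 then show "x = y" using xy by blast
qed

lemma P_same: "(i, p) \<in> P ==> (i, p') \<in> P ==> p' = p" "(p, i) \<in> P ==> (p', i) \<in> P ==> p' = p"
 using P_unique[of "(i, p)" "(i, p')" i] P_unique[of "(p, i)" "(p', i)" i] by auto

lemma P_exists: "p < m ==> \<exists>x\<in>P. p = fst x \<or> p = snd x"
 using perfect unfolding perfect_matching_def by (meson ex1_implies_ex)

lemma P_noncrossing: "\<lbrakk>(a, b) \<in> P; (c, d) \<in> P; a < c; c < b; b < d\<rbrakk> \<Longrightarrow> False"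
 using perfect unfolding perfect_matching_def by blast

end

text \<open>As \<open>a < b\<close> for every arc, the three conditions exclude an arc within the
  left projector, within the right projector, and from one projector to the other.\<close>

locale ray_cups = perfect "2 * (n + k)" P for n k :: nat and P :: "arc set" +
 assumes no_left: "(a, b) \<in> P ==> k \<le> b"
  and no_right: "(a, b) \<in> P ==> a < 2 * n + k"
  and no_through: "(a, b) \<in> P ==> k \<le> a \<or> b < 2 * n + k"
begin

definition middle :: "arc set" where
 "middle = {x \<in> P. k \<le> fst x \<and> snd x < 2 * n + k}"

text \<open>The shift \<open>i + 1 - k\<close> converts endpoints of the tangle, counted from 0,
  into points of a diagram, counted from 1.\<close>

definition arcs :: "arc set" where
 "arcs = map_prod (\<lambda>i. i + 1 - k) (\<lambda>i. i + 1 - k) ` middle"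

lemma arcs_iff: "(a, b) \<in> arcs \<longleftrightarrow> 1 \<le> a \<and> 1 \<le> b \<and> b \<le> 2 * n \<and> (a + k - 1, b + k - 1) \<in> P"
proof
 assume "(a, b) \<in> arcs"
 then obtain i j where ij: "(i, j) \<in> P" "k \<le> i" "j < 2 * n + k" "a = i + 1 - k" "b = j + 1 - k"
  by (auto simp: arcs_def middle_def)
 then have "a + k - 1 = i" "b + k - 1 = j" using P_bounds[OF ij(1)] by auto
 then show "1 \<le> a \<and> 1 \<le> b \<and> b \<le> 2 * n \<and> (a + k - 1, b + k - 1) \<in> P" using ij P_bounds[OF ij(1)] by auto
next
 assume ab: "1 \<le> a \<and> 1 \<le> b \<and> b \<le> 2 * n \<and> (a + k - 1, b + k - 1) \<in> P"
 then have "(a + k - 1, b + k - 1) \<in> middle" by (auto simp: middle_def)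
 moreover have "map_prod (\<lambda>i. i + 1 - k) (\<lambda>i. i + 1 - k) (a + k - 1, b + k - 1) = (a, b)" using ab by auto
 ultimately show "(a, b) \<in> arcs" unfolding arcs_def by (metis image_eqI)
qed

lemma left_partner: "i < k ==> \<exists>p. (i, p) \<in> P \<and> k \<le> p \<and> p < 2 * n + k"
proof -
 assume i: "i < k"
 then obtain x where x: "x \<in> P" "i = fst x \<or> i = snd x" using P_exists[of i] by auto
 have "i \<noteq> snd x" using no_left[of "fst x" "snd x"] x(1) i by auto
 then have "(i, snd x) \<in> P" using x by auto
 then show ?thesis using no_left[of i "snd x"] no_through[of i "snd x"] i by auto
qed

lemma right_partner: "2 * n + k \<le> j ==> j < 2 * (n + k) ==> \<exists>p. (p, j) \<in> P \<and> k \<le> p \<and> p < 2 * n + k"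
proof -
 assume j: "2 * n + k \<le> j" "j < 2 * (n + k)"
 then obtain x where x: "x \<in> P" "j = fst x \<or> j = snd x" using P_exists[of j] by auto
 have "j \<noteq> fst x" using no_right[of "fst x" "snd x"] x(1) j by auto
 then have "(fst x, j) \<in> P" using x by auto
 then show ?thesis using no_right[of "fst x" j] no_through[of "fst x" j] j by auto
qed

abbreviation "free \<equiv> {1..2 * n} - endpoints arcs"

lemma endpoints_arcs: "p \<in> endpoints arcs \<longleftrightarrow> 1 \<le> p \<and> p \<le> 2 * n \<and> (\<exists>x\<in>middle. p + k - 1 = fst x \<or> p + k - 1 = snd x)"
proof
 assume "p \<in> endpoints arcs"
 then obtain x where x: "x \<in> middle" "p = fst x + 1 - k \<or> p = snd x + 1 - k" by (auto simp: endpoints_def arcs_def)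
 then have "k \<le> fst x" "fst x < snd x" "snd x < 2 * n + k" using P_bounds[of "fst x" "snd x"] by (auto simp: middle_def)
 then show "1 \<le> p \<and> p \<le> 2 * n \<and> (\<exists>x\<in>middle. p + k - 1 = fst x \<or> p + k - 1 = snd x)"
  using x by (intro conjI bexI[of _ x]) auto
next
 assume p: "1 \<le> p \<and> p \<le> 2 * n \<and> (\<exists>x\<in>middle. p + k - 1 = fst x \<or> p + k - 1 = snd x)"
 then obtain x where x: "x \<in> middle" "p + k - 1 = fst x \<or> p + k - 1 = snd x" by blast
 then have "p = fst x + 1 - k \<or> p = snd x + 1 - k" using p by auto
 moreover have "(fst x + 1 - k, snd x + 1 - k) \<in> arcs"
  unfolding arcs_def using x(1) by (cases x) (auto intro!: rev_image_eqI)
 ultimately show "p \<in> endpoints arcs" unfolding endpoints_def by (metis UnI1 UnI2 fst_conv snd_conv image_eqI)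
qed

lemma free_iff:
 "p \<in> free \<longleftrightarrow> 1 \<le> p \<and> p \<le> 2 * n \<and> ((\<exists>i<k. (i, p + k - 1) \<in> P) \<or> (\<exists>j\<ge>2 * n + k. (p + k - 1, j) \<in> P))" (is "_ \<longleftrightarrow> ?r")
proof
 assume p: "p \<in> free"
 then have "p + k - 1 < 2 * (n + k)" by auto
 then obtain x where x: "x \<in> P" "p + k - 1 = fst x \<or> p + k - 1 = snd x" using P_exists by blast
 have notm: "x \<notin> middle" using p x(2) by (auto simp: endpoints_arcs)
 then have "\<not> (k \<le> fst x \<and> snd x < 2 * n + k)" using x(1) by (simp add: middle_def)
 then have "p + k - 1 = snd x \<and> fst x < k \<or> p + k - 1 = fst x \<and> 2 * n + k \<le> snd x"
  using x p by auto
 then show ?r using p x(1) by auto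
next
 assume r: ?r
 have "p \<notin> endpoints arcs"
 proof
  assume "p \<in> endpoints arcs"
  then obtain x where x: "x \<in> P" "k \<le> fst x" "snd x < 2 * n + k" "p + k - 1 = fst x \<or> p + k - 1 = snd x"
   by (auto simp: endpoints_arcs middle_def)
  show False using r x P_unique[OF x(1), of _ "p + k - 1"] by fastforce
 qed
 then show "p \<in> free" using r by auto
qed

text \<open>Only the covering condition is special: the ray from a free point under an arc would
  have to cross that arc on its way to a projector.\<close>

lemma ray_matching_arcs: "ray_matching n arcs"
proof
 show "1 \<le> a \<and> a < b \<and> b \<le> 2 * n" if "(a, b) \<in> arcs" for a b
  using that P_bounds[of "a + k - 1" "b + k - 1"] by (auto simp: arcs_iff)
 show "x = y" if xy: "x \<in> arcs" "y \<in> arcs" "p = fst x \<or> p = snd x" "p = fst y \<or> p = snd y" for x y p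
 proof -
  have x: "1 \<le> fst x" "1 \<le> snd x" "(fst x + k - 1, snd x + k - 1) \<in> P" using xy(1) arcs_iff[of "fst x" "snd x"] by auto
  have y: "1 \<le> fst y" "1 \<le> snd y" "(fst y + k - 1, snd y + k - 1) \<in> P" using xy(2) arcs_iff[of "fst y" "snd y"] by auto
  have "(fst x + k - 1, snd x + k - 1) = (fst y + k - 1, snd y + k - 1)"
   using P_unique[OF x(3) y(3), of "p + k - 1"] xy(3,4) by auto
  then show ?thesis using x y by (auto simp: prod_eq_iff)
 qed
 have shift: "x + k - 1 < y + k - 1 \<longleftrightarrow> x < y" if "1 \<le> x" "1 \<le> y" for x y using that by linarith
 show False if "(a, b) \<in> arcs" "(c, d) \<in> arcs" "a < c" "c < b" "b < d" for a b c d
  using that P_noncrossing[of "a + k - 1" "b + k - 1" "c + k - 1" "d + k - 1"] shift unfolding arcs_iff by metis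
 show "p \<in> endpoints arcs" if ab: "(a, b) \<in> arcs" "a < p" "p < b" for a b p
 proof (rule ccontr)
  assume "p \<notin> endpoints arcs"
  then have "p \<in> free" using ab by (auto simp: arcs_iff)
  then consider i where "i < k" "(i, p + k - 1) \<in> P" | j where "2 * n + k \<le> j" "(p + k - 1, j) \<in> P" unfolding free_iff by blast
  then show False
  proof cases
   case 1
   moreover have "i < a + k - 1" using 1(1) ab(1) unfolding arcs_iff by linarith
   ultimately show False
    using ab P_noncrossing[OF 1(2), of "a + k - 1" "b + k - 1"] shift[of a p] shift[of p b] unfolding arcs_iff by auto
  next
   case 2
   moreover have "b + k - 1 < j" using 2(1) ab(1) unfolding arcs_iff by linarith
   ultimately show False
    using ab P_noncrossing[OF _ 2(2), of "a + k - 1" "b + k - 1"] shift[of a p] shift[of p b] unfolding arcs_iff by auto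
  qed
 qed
qed

text \<open>The rays, read from the inner end of the left projector to its outer end and then from the outer
 end of the right projector to its inner end, meet the free points in increasing order.\<close>

definition ray_end :: "nat => nat" where
 "ray_end t = (if t < k then (THE p. (k - 1 - t, p) \<in> P) else (THE p. (p, 2 * n + 3 * k - 1 - t) \<in> P)) + 1 - k"

lemma ray_end_left: "t < k ==> (k - 1 - t, ray_end t + k - 1) \<in> P \<and> 1 \<le> ray_end t \<and> ray_end t \<le> 2 * n"
proof -
 assume t: "t < k"
 then obtain p where p: "(k - 1 - t, p) \<in> P" "k \<le> p" "p < 2 * n + k" using left_partner[of "k - 1 - t"] by auto
 have "(THE p. (k - 1 - t, p) \<in> P) = p"
  by (rule the_equality, rule p(1), rule P_same(1)[OF p(1)])
 then have "ray_end t = p + 1 - k" using t by (simp add: ray_end_def)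
 moreover have "p + 1 - k + k - 1 = p" "1 \<le> p + 1 - k" "p + 1 - k \<le> 2 * n" using p by linarith+
 ultimately show ?thesis using p by simp
qed

lemma ray_end_right:
 "k \<le> t ==> t < 2 * k ==> (ray_end t + k - 1, 2 * n + 3 * k - 1 - t) \<in> P \<and> 1 \<le> ray_end t \<and> ray_end t \<le> 2 * n"
proof -
 assume t: "k \<le> t" "t < 2 * k"
 let ?j = "2 * n + 3 * k - 1 - t"
 have "2 * n + k \<le> ?j" "?j < 2 * (n + k)" using t by (simp_all add: algebra_simps less_diff_conv2)
 then obtain p where p: "(p, ?j) \<in> P" "k \<le> p" "p < 2 * n + k" using right_partner by blast
 have "(THE p. (p, ?j) \<in> P) = p"
  by (rule the_equality, rule p(1), rule P_same(2)[OF p(1)])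
 then have "ray_end t = p + 1 - k" using t by (simp add: ray_end_def)
 moreover have "p + 1 - k + k - 1 = p" "1 \<le> p + 1 - k" "p + 1 - k \<le> 2 * n" using p by linarith+
 ultimately show ?thesis using p by simp
qed

text \<open>Two rays that meet the line in the wrong order would have interleaved endpoints, whether
  they go to the same projector or to different ones.\<close>

lemma ray_end_mono:
 assumes "s < t" "t < 2 * k"
 shows "ray_end s < ray_end t"
proof (rule ccontr)
 assume "\<not> ray_end s < ray_end t"
 then have le: "ray_end t + k - 1 \<le> ray_end s + k - 1" by simp
 consider "t < k" | "s < k" "k \<le> t" | "k \<le> s" by linarith
 then show False
 proof cases
  case 1
  then have s: "(k - 1 - s, ray_end s + k - 1) \<in> P" "1 \<le> ray_end s" and t: "(k - 1 - t, ray_end t + k - 1) \<in> P" "1 \<le> ray_end t"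
   using ray_end_left assms by auto
  have "ray_end t + k - 1 \<noteq> ray_end s + k - 1" using P_unique[OF s(1) t(1), of "ray_end s + k - 1"] 1 assms by auto
  moreover have "k - 1 - t < k - 1 - s" "k - 1 - s < ray_end t + k - 1" using 1 assms(1) t(2) by linarith+
  ultimately show False using P_noncrossing[OF t(1) s(1)] le by linarith
 next
  case 2
  then have s: "(k - 1 - s, ray_end s + k - 1) \<in> P" "1 \<le> ray_end s" "ray_end s \<le> 2 * n"
   and t: "(ray_end t + k - 1, 2 * n + 3 * k - 1 - t) \<in> P" "1 \<le> ray_end t"
   using ray_end_left ray_end_right assms by auto
  have "ray_end t + k - 1 \<noteq> ray_end s + k - 1" using P_unique[OF s(1) t(1), of "ray_end s + k - 1"] 2 t assms by auto
  moreover have "k - 1 - s < ray_end t + k - 1" "ray_end s + k - 1 < 2 * n + 3 * k - 1 - t"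
   using 2 assms(2) t(2) s(2,3) by auto
  ultimately show False using P_noncrossing[OF s(1) t(1)] le by linarith
 next
  case 3
  then have s: "(ray_end s + k - 1, 2 * n + 3 * k - 1 - s) \<in> P" "1 \<le> ray_end s" "ray_end s \<le> 2 * n"
   and t: "(ray_end t + k - 1, 2 * n + 3 * k - 1 - t) \<in> P" "1 \<le> ray_end t"
   using ray_end_right assms by auto
  have "ray_end t + k - 1 \<noteq> ray_end s + k - 1" using P_unique[OF s(1) t(1), of "ray_end s + k - 1"] 3 assms by auto
  moreover have "2 * n + 3 * k - 1 - t < 2 * n + 3 * k - 1 - s" "ray_end s + k - 1 < 2 * n + 3 * k - 1 - t"
   using 3 assms s(2,3) by auto
  ultimately show False using P_noncrossing[OF t(1) s(1)] le by linarith
 qed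
qed

lemma ray_end_range: "ray_end ` {..<2 * k} = free"
proof (intro Set.set_eqI iffI)
 fix p assume "p \<in> ray_end ` {..<2 * k}"
 then obtain t where t: "t < 2 * k" "p = ray_end t" by auto
 show "p \<in> free"
 proof (cases "t < k")
  case True
  then have "k - 1 - t < k" by simp
  then show ?thesis using ray_end_left[OF True] t(2) unfolding free_iff by blast
 next
  case False
  then have "2 * n + k \<le> 2 * n + 3 * k - 1 - t" using t by simp
  then show ?thesis using ray_end_right[of t] False t unfolding free_iff by auto
 qed
next
 fix p assume "p \<in> free"
 then have "1 \<le> p" and "(\<exists>i<k. (i, p + k - 1) \<in> P) \<or> (\<exists>j\<ge>2 * n + k. (p + k - 1, j) \<in> P)" unfolding free_iff by auto
 then consider i where "i < k" "(i, p + k - 1) \<in> P" | j where "2 * n + k \<le> j" "(p + k - 1, j) \<in> P" by blast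
 then show "p \<in> ray_end ` {..<2 * k}"
 proof cases
  case 1
  then have "(i, ray_end (k - 1 - i) + k - 1) \<in> P" "1 \<le> ray_end (k - 1 - i)" using ray_end_left[of "k - 1 - i"] by auto
  then have "p = ray_end (k - 1 - i)" using P_same(1)[OF 1(2)] \<open>1 \<le> p\<close> by fastforce
  then show ?thesis using 1 by auto
 next
  case 2
  let ?t = "2 * n + 3 * k - 1 - j"
  have j: "j < 2 * (n + k)" using P_bounds[OF 2(2)] by simp
  then have "(ray_end ?t + k - 1, j) \<in> P" "1 \<le> ray_end ?t" using ray_end_right[of ?t] 2 by auto
  then have "p = ray_end ?t" using P_same(2)[OF 2(2)] \<open>1 \<le> p\<close> by fastforce
  then show ?thesis using 2 j by auto
 qed
qed

text \<open>The rays are thus recovered from the free points, so a surviving cup diagram is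
  determined by its middle arcs.\<close>

lemma ray_end_sorted: "map ray_end [0..<2 * k] = sorted_list_of_set free"
proof (rule strict_sorted_equal[symmetric])
 show "sorted_wrt (<) (map ray_end [0..<2 * k])"
  by (auto simp: sorted_wrt_iff_nth_less intro: ray_end_mono)
 show "set (sorted_list_of_set free) = set (map ray_end [0..<2 * k])"
  using ray_end_range by (simp add: atLeast0LessThan)
qed (rule strict_sorted_list_of_set)

lemma P_cases: "x \<in> P \<longleftrightarrow> (\<exists>t<k. x = (k - 1 - t, ray_end t + k - 1))
  \<or> (\<exists>t. k \<le> t \<and> t < 2 * k \<and> x = (ray_end t + k - 1, 2 * n + 3 * k - 1 - t))
  \<or> (\<exists>a b. (a, b) \<in> arcs \<and> x = (a + k - 1, b + k - 1))" (is "_ \<longleftrightarrow> ?r")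
proof
 assume x: "x \<in> P"
 obtain a b where ab: "x = (a, b)" by (cases x)
 consider "a < k" | "2 * n + k \<le> b" | "k \<le> a" "b < 2 * n + k" by linarith
 then show ?r
 proof cases
  case 1
  then have t: "k - 1 - a < k" "k - 1 - (k - 1 - a) = a" by auto
  then have "(a, ray_end (k - 1 - a) + k - 1) \<in> P" using ray_end_left[of "k - 1 - a"] by simp
  then have "b = ray_end (k - 1 - a) + k - 1" using P_same(1)[of a b] x ab by blast
  then show ?thesis using t ab by (intro disjI1 exI[of _ "k - 1 - a"]) simp
 next
  case 2
  let ?t = "2 * n + 3 * k - 1 - b"
  have b: "b < 2 * (n + k)" using P_bounds x ab by blast
  then have t: "k \<le> ?t" "?t < 2 * k" "2 * n + 3 * k - 1 - ?t = b" using 2 by auto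
  then have "(ray_end ?t + k - 1, b) \<in> P" using ray_end_right[of ?t] by simp
  then have "a = ray_end ?t + k - 1" using P_same(2)[of a b] x ab by blast
  then show ?thesis using t ab by (intro disjI2 disjI1 exI[of _ ?t]) simp
 next
  case 3
  have "a < b" using P_bounds x ab by blast
  then have "(a + 1 - k, b + 1 - k) \<in> arcs" using x ab 3 unfolding arcs_iff by auto
  then show ?thesis using ab 3 \<open>a < b\<close> by (intro disjI2 exI[of _ "a + 1 - k"] exI[of _ "b + 1 - k"]) auto
 qed
next
 assume ?r
 then show "x \<in> P" using ray_end_left ray_end_right arcs_iff by auto
qed

end

lemma ray_cups_eq:
 assumes "ray_cups n k P" "ray_cups n k P'" "ray_cups.arcs n k P = ray_cups.arcs n k P'"
 shows "P = P'"
proof -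
 interpret A: ray_cups n k P by (rule assms)
 interpret B: ray_cups n k P' by (rule assms)
 have "map A.ray_end [0..<2 * k] = map B.ray_end [0..<2 * k]"
  using A.ray_end_sorted B.ray_end_sorted assms(3) by simp
 then have eq: "A.ray_end t = B.ray_end t" if "t < 2 * k" for t
  using that by (auto simp: list_eq_iff_nth_eq)
 have "x \<in> P \<longleftrightarrow> x \<in> P'" for x
  unfolding A.P_cases B.P_cases assms(3) using eq by auto
 then show ?thesis by blast
qed

lemma nth_good_word:
 "1 \<le> p ==> p \<le> 2 * n ==> good_word n k S ! (p + k - 1) = S p"
 "i < k ==> good_word n k S ! i"
 "2 * n + k \<le> j ==> j < 2 * (n + k) ==> good_word n k S ! j"
proof -
 show "1 \<le> p ==> p \<le> 2 * n ==> good_word n k S ! (p + k - 1) = S p"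
  by (cases p) (simp_all add: nth_append del: upt_Suc)
 show "i < k ==> good_word n k S ! i"
  by (simp add: nth_append)
 assume "2 * n + k \<le> j" "j < 2 * (n + k)"
 moreover from this obtain j' where "j = 2 * n + k + j'" using le_Suc_ex by blast
 ultimately show "good_word n k S ! j"
  by (simp add: nth_append del: upt_Suc)
qed

lemma cup_weight_prod:
 "finite I ==> (\<Prod>t\<in>I. cup_weight True (f t)) = (if \<exists>t\<in>I. f t then 0 else 1)"
 "finite I ==> (\<Prod>t\<in>I. cup_weight (f t) True) = (if \<exists>t\<in>I. f t then 0 else (- q_pow (-1)) ^ card I)"
 by (induction I rule: finite_induct) (auto simp: cup_weight_def q_pow_def)

lemma (in ray_cups) prod_P:
 fixes g :: "arc => laurent"
 shows "(\<Prod>x\<in>P. g x) = (\<Prod>t\<in>{..<k}. g (k - 1 - t, ray_end t + k - 1))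
  * (\<Prod>t\<in>{k..<2 * k}. g (ray_end t + k - 1, 2 * n + 3 * k - 1 - t)) * (\<Prod>x\<in>arcs. g (fst x + k - 1, snd x + k - 1))"
proof -
 let ?l = "\<lambda>t. (k - 1 - t, ray_end t + k - 1)" and ?r = "\<lambda>t. (ray_end t + k - 1, 2 * n + 3 * k - 1 - t)"
  and ?m = "\<lambda>x. (fst x + k - 1, snd x + k - 1)"
 have P: "P = (?l ` {..<k} \<union> ?r ` {k..<2 * k}) \<union> ?m ` arcs"
 proof (rule Set.set_eqI)
  fix x
  have "x \<in> ?m ` arcs \<longleftrightarrow> (\<exists>a b. (a, b) \<in> arcs \<and> x = (a + k - 1, b + k - 1))"
   unfolding image_iff Bex_def split_paired_Ex fst_conv snd_conv ..
  then show "x \<in> P \<longleftrightarrow> x \<in> (?l ` {..<k} \<union> ?r ` {k..<2 * k}) \<union> ?m ` arcs"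
   unfolding P_cases by auto
 qed
 have arcs: "1 \<le> fst x \<and> 1 \<le> snd x \<and> snd x \<le> 2 * n" if "x \<in> arcs" for x
  using that arcs_iff[of "fst x" "snd x"] by simp
 have fin: "finite arcs" using ray_matching.finite[OF ray_matching_arcs] .
 have disj1: "?l ` {..<k} \<inter> ?r ` {k..<2 * k} = {}"
 proof -
  have "k \<le> ray_end t + k - 1" if "k \<le> t" "t < 2 * k" for t using ray_end_right[OF that] by linarith
  then show ?thesis by fastforce
 qed
 have disj2: "(?l ` {..<k} \<union> ?r ` {k..<2 * k}) \<inter> ?m ` arcs = {}"
 proof -
  have "k - 1 - t \<noteq> fst x + k - 1" if "x \<in> arcs" "t < k" for x t using arcs[OF that(1)] that(2) by linarith
  moreover have "2 * n + 3 * k - 1 - t \<noteq> snd x + k - 1" if "x \<in> arcs" "t < 2 * k" for x t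
   using arcs[OF that(1)] that(2) by linarith
  ultimately show ?thesis by fastforce
 qed
 have "(\<Prod>x\<in>P. g x) = (\<Prod>x\<in>(?l ` {..<k} \<union> ?r ` {k..<2 * k}) \<union> ?m ` arcs. g x)"
  by (rule prod.cong[OF P HOL.refl])
 also have "\<dots> = (\<Prod>x\<in>?l ` {..<k}. g x) * (\<Prod>x\<in>?r ` {k..<2 * k}. g x) * (\<Prod>x\<in>?m ` arcs. g x)"
  unfolding prod.union_disjoint[OF finite_UnI[OF finite_imageI[OF finite_lessThan] finite_imageI[OF finite_atLeastLessThan]]
    finite_imageI[OF fin] disj2] prod.union_disjoint[OF finite_imageI[OF finite_lessThan] finite_imageI[OF finite_atLeastLessThan] disj1]
  by (rule HOL.refl)
 also have "(\<Prod>x\<in>?l ` {..<k}. g x) = (\<Prod>t\<in>{..<k}. g (?l t))"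
  by (rule prod.reindex_cong[OF _ HOL.refl HOL.refl]) (auto simp: inj_on_def)
 also have "(\<Prod>x\<in>?r ` {k..<2 * k}. g x) = (\<Prod>t\<in>{k..<2 * k}. g (?r t))"
  by (rule prod.reindex_cong[OF _ HOL.refl HOL.refl]) (auto simp: inj_on_def)
 also have "(\<Prod>x\<in>?m ` arcs. g x) = (\<Prod>x\<in>arcs. g (?m x))"
 proof (rule prod.reindex_cong[OF _ HOL.refl HOL.refl], rule inj_onI)
  fix x y assume xy: "x \<in> arcs" "y \<in> arcs" "?m x = ?m y"
  then have "fst x + k - 1 = fst y + k - 1" "snd x + k - 1 = snd y + k - 1" by auto
  then have "fst x = fst y" "snd x = snd y" using arcs[OF xy(1)] arcs[OF xy(2)] by linarith+
  then show "x = y" by (simp add: prod_eq_iff)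
 qed
 finally show ?thesis .
qed

text \<open>A ray whose free end is up makes the product vanish. With its free end down, a ray to
  the left projector has weight 1 and a ray to the right projector has weight -q^(-1).\<close>

lemma (in ray_cups) state_sum_ray_cups:
 assumes "cups c \<in> tangles (2 * (n + k))" "cup_matching c = P"
 shows "state_sum (cups c) (good_word n k S) = (- q_pow (-1)) ^ k * cap_state n arcs S"
proof -
 let ?w = "good_word n k S"
 have "length ?w = 2 * (n + k)" by (simp del: upt_Suc)
 then have "state_sum (cups c) ?w = (\<Prod>x\<in>P. cup_weight (?w ! fst x) (?w ! snd x))"
  using state_sum_cups[OF assms(1), of ?w] unfolding assms(2) case_prod_beta by blast
 also have "\<dots> = (\<Prod>t\<in>{..<k}. cup_weight True (S (ray_end t))) * (\<Prod>t\<in>{k..<2 * k}. cup_weight (S (ray_end t)) True)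
   * (\<Prod>x\<in>arcs. cup_weight (S (fst x)) (S (snd x)))"
  unfolding prod_P fst_conv snd_conv
 proof (intro arg_cong2[where f = "(*)"] prod.cong HOL.refl)
  fix t assume "t \<in> {..<k}"
  then show "cup_weight (?w ! (k - 1 - t)) (?w ! (ray_end t + k - 1)) = cup_weight True (S (ray_end t))"
   using ray_end_left[of t] nth_good_word[where S = S and n = n and k = k] by (simp del: upt_Suc)
 next
  fix t assume "t \<in> {k..<2 * k}"
  then have t: "k \<le> t" "t < 2 * k" by auto
  then have "2 * n + k \<le> 2 * n + 3 * k - 1 - t" "2 * n + 3 * k - 1 - t < 2 * (n + k)"
   by (simp_all add: algebra_simps less_diff_conv2)
  then show "cup_weight (?w ! (ray_end t + k - 1)) (?w ! (2 * n + 3 * k - 1 - t)) = cup_weight (S (ray_end t)) True"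
   using ray_end_right[OF t] nth_good_word[where S = S and n = n and k = k] by (simp del: upt_Suc)
 next
  fix x assume x: "x \<in> arcs"
  then have "1 \<le> fst x" "fst x \<le> 2 * n" "1 \<le> snd x" "snd x \<le> 2 * n"
   using ray_matching.bounds[OF ray_matching_arcs, of "fst x" "snd x"] by auto
  then show "cup_weight (?w ! (fst x + k - 1)) (?w ! (snd x + k - 1)) = cup_weight (S (fst x)) (S (snd x))"
   using nth_good_word(1)[where S = S and n = n and k = k] by (simp del: upt_Suc)
 qed
 also have "\<dots> = (- q_pow (-1)) ^ k * cap_state n arcs S"
 proof -
  have "(\<exists>p\<in>free. S p) \<longleftrightarrow> (\<exists>t\<in>{..<k}. S (ray_end t)) \<or> (\<exists>t\<in>{k..<2 * k}. S (ray_end t))"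
  proof -
   have "{..<2 * k} = {..<k} \<union> {k..<2 * k}" by auto
   then show ?thesis unfolding ray_end_range[symmetric] by auto
  qed
  then show ?thesis by (simp add: cup_weight_prod cap_state_def)
 qed
 finally show ?thesis .
qed

text \<open>If some arc joins the two projectors, the arc at the point 0 encloses it and reaches the
  right projector too. It must end at the last point: the arc ending there would otherwise cross it
  or lie in the right projector. So the diagram is an outer arc around a smaller one.\<close>

lemma cups_kernel_cases:
 assumes "cups c \<in> tangles (2 * (n + k))" "single (cups c) 1 \<notin> kl_kernel n k"
 shows "ray_cups n k (cup_matching c)"
proof -
 interpret perfect "2 * (n + k)" "cup_matching c" by unfold_locales (rule perfect_cup_matching[OF assms(1)])
 have no_arc: False if "(a, b) \<in> cup_matching c" "{a, b} \<subseteq> left_projector n k \<or> {a, b} \<subseteq> right_projector n k" for a b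
  using projector_arc_kernel[OF assms(1) that(1) _ that(2)] P_bounds[OF that(1)] assms(2) by auto
 have left: "k \<le> b" if "(a, b) \<in> cup_matching c" for a b
  using no_arc[OF that] P_bounds[OF that] by (force simp: left_projector_def)
 have right: "a < 2 * n + k" if "(a, b) \<in> cup_matching c" for a b
  using no_arc[OF that] P_bounds[OF that] by (force simp: right_projector_def)
 have through: "k \<le> a \<or> b < 2 * n + k" if ab: "(a, b) \<in> cup_matching c" for a b
 proof (rule ccontr)
  assume "\<not> (k \<le> a \<or> b < 2 * n + k)"
  then have far: "a < k" "2 * n + k \<le> b" by auto
  let ?z = "2 * (n + k) - 1"
  obtain x where x: "x \<in> cup_matching c" "0 = fst x \<or> 0 = snd x" using P_exists[of 0] far by auto
  then have y: "(0, snd x) \<in> cup_matching c" using P_bounds[of "fst x" "snd x"] by (cases x) auto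
  have bx: "b \<le> snd x"
  proof (rule ccontr)
   assume "\<not> b \<le> snd x"
   then show False
    using P_noncrossing[OF y ab] left[OF y] P_unique[OF y ab, of 0] far by (cases "a = 0") auto
  qed
  obtain x' where x': "x' \<in> cup_matching c" "?z = fst x' \<or> ?z = snd x'" using P_exists[of ?z] far by auto
  then have z: "(fst x', ?z) \<in> cup_matching c" using P_bounds[of "fst x'" "snd x'"] by (cases x') auto
  have "snd x = ?z"
  proof (rule ccontr)
   assume "snd x \<noteq> ?z"
   then have "snd x < ?z" "fst x' \<noteq> 0" using P_bounds[OF y] P_unique[OF y z, of 0] by auto
   moreover have "fst x' \<noteq> snd x" using P_unique[OF y z, of "snd x"] P_bounds[OF y] by auto
   ultimately show False using P_noncrossing[OF y z] right[OF z] bx far by auto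
  qed
  moreover obtain k' where "k = Suc k'" using far(1) by (cases k) auto
  ultimately show False using outer_arc_kernel[of c n k'] assms y by simp
 qed
 show ?thesis by unfold_locales (use left right through in blast)+
qed

text \<open>Consecutive free points are paired by dotted arcs. No free point lies under an arc of
  \<open>A\<close>, so nothing is crossed and no dotted arc is nested in another arc.\<close>

lemma (in ray_matching) completion:
 assumes "card ({1..2 * n} - endpoints A) = 2 * k"
 obtains D where "(A \<union> D, D) \<in> diagrams n k" "standard (A \<union> D, D)" "A \<inter> D = {}"
proof -
 define F where "F = sorted_list_of_set ({1..2 * n} - endpoints A)"
 have F: "set F = {1..2 * n} - endpoints A" "length F = 2 * k" "sorted_wrt (<) F"
  using assms by (simp_all add: F_def)
 have less: "F ! i < F ! j \<longleftrightarrow> i < j" if "i < 2 * k" "j < 2 * k" for i j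
  using sorted_wrt_nth_less[OF F(3)] that F(2) by (metis linorder_neqE_nat not_less_iff_gr_or_eq)
 have free: "F ! i \<in> {1..2 * n} - endpoints A" if "i < 2 * k" for i
  using nth_mem[of i F] that F by auto
 have outside: "\<not> (a < F ! i \<and> F ! i < b)" if "(a, b) \<in> A" "i < 2 * k" for a b i
  using covered[OF that(1), of "F ! i"] free[OF that(2)] by blast
 define D where "D = (\<lambda>i. (F ! (2 * i), F ! (2 * i + 1))) ` {..<k}"
 have D: "x \<in> D \<longleftrightarrow> (\<exists>i<k. x = (F ! (2 * i), F ! (2 * i + 1)))" for x by (auto simp: D_def)
 have D_ends: "fst x \<in> set F \<and> snd x \<in> set F" if "x \<in> D" for x using that free F(1) by (auto simp: D)
 have A_ends: "fst x \<notin> set F \<and> snd x \<notin> set F" if "x \<in> A" for x using that F(1) by (auto simp: endpoints_def)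
 have disjoint: "A \<inter> D = {}" using D_ends A_ends by blast
 have D_unique: "x = y" if xy: "x \<in> D" "y \<in> D" "p = fst x \<or> p = snd x" "p = fst y \<or> p = snd y" for x y p
 proof -
  obtain i j where ij: "i < k" "j < k" "x = (F ! (2 * i), F ! (2 * i + 1))" "y = (F ! (2 * j), F ! (2 * j + 1))"
   using xy(1,2) D by blast
  have inj: "F ! s = F ! t \<longleftrightarrow> s = t" if "s < 2 * k" "t < 2 * k" for s t
   using less[OF that] less[OF that(2,1)] by (metis linorder_neqE_nat less_irrefl)
  obtain s t where "s < 2 * k" "t < 2 * k" "s div 2 = i" "t div 2 = j" "p = F ! s" "p = F ! t"
  proof
   show "(if p = fst x then 2 * i else 2 * i + 1) < 2 * k" "(if p = fst y then 2 * j else 2 * j + 1) < 2 * k" using ij by auto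
  qed (use ij xy(3,4) in auto)
  then have "i = j" using inj by metis
  then show ?thesis using ij by simp
 qed
 have "crossingless_matching n (A \<union> D)"
  unfolding crossingless_matching_def
 proof (intro conjI)
  show "\<forall>(a, b)\<in>A \<union> D. 1 \<le> a \<and> a < b \<and> b \<le> 2 * n"
   using bounds free less by (fastforce simp: D)
  show "\<forall>p\<in>{1..2 * n}. \<exists>!x. x \<in> A \<union> D \<and> (p = fst x \<or> p = snd x)"
  proof
   fix p assume p: "p \<in> {1..2 * n}"
   show "\<exists>!x. x \<in> A \<union> D \<and> (p = fst x \<or> p = snd x)"
   proof (cases "p \<in> set F")
    case True
    then obtain t where t: "t < 2 * k" "p = F ! t" using F(2) by (auto simp: in_set_conv_nth)
    let ?x = "(F ! (2 * (t div 2)), F ! (2 * (t div 2) + 1))"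
    have "t div 2 < k" using t(1) by simp
    then have x1: "?x \<in> D" unfolding D by blast
    have "t = 2 * (t div 2) \<or> t = 2 * (t div 2) + 1" by presburger
    then have x2: "p = fst ?x \<or> p = snd ?x" unfolding fst_conv snd_conv t(2) by metis
    note x = x1 x2
    show ?thesis
    proof (rule ex1I[of _ ?x])
     fix y assume y: "y \<in> A \<union> D \<and> (p = fst y \<or> p = snd y)"
     then have "y \<in> D" using A_ends[of y] True by auto
     then show "y = ?x" using D_unique[OF _ x(1) _ x(2)] y by blast
    qed (use x in blast)
   next
    case False
    then obtain x where x: "x \<in> A" "p = fst x \<or> p = snd x" using p F(1) by (auto simp: endpoints_def)
    show ?thesis
    proof (rule ex1I[of _ x])
     fix y assume y: "y \<in> A \<union> D \<and> (p = fst y \<or> p = snd y)"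
     then have "y \<in> A" using D_ends[of y] False by auto
     then show "y = x" using unique[OF _ x(1) _ x(2)] y by blast
    qed (use x in blast)
   qed
  qed
  have "\<not> (a < c \<and> c < b \<and> b < d)" if "(a, b) \<in> A \<union> D" "(c, d) \<in> A \<union> D" for a b c d
  proof -
   consider "(a, b) \<in> A" "(c, d) \<in> A" | "(a, b) \<in> A" "(c, d) \<in> D" | "(a, b) \<in> D" "(c, d) \<in> A" | "(a, b) \<in> D" "(c, d) \<in> D"
    using \<open>(a, b) \<in> A \<union> D\<close> \<open>(c, d) \<in> A \<union> D\<close> by blast
   then show ?thesis
   proof cases
    case 1
    then show ?thesis using noncrossing by blast
   next
    case 2
    then show ?thesis using outside[of a b] by (auto simp: D)
   next
    case 3
    then show ?thesis using outside[of c d] by (fastforce simp: D)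
   next
    case 4
    then obtain i j where ij: "i < k" "j < k" "a = F ! (2 * i)" "b = F ! (2 * i + 1)" "c = F ! (2 * j)" by (auto simp: D)
    then show ?thesis using less[of "2 * i" "2 * j"] less[of "2 * j" "2 * i + 1"] by auto
   qed
  qed
  then show "\<forall>(a, b)\<in>A \<union> D. \<forall>(c, d)\<in>A \<union> D. \<not> (a < c \<and> c < b \<and> b < d)" by blast
 qed
 moreover have "card D = k"
 proof -
  have "inj_on (\<lambda>i. (F ! (2 * i), F ! (2 * i + 1))) {..<k}"
  proof (rule inj_onI)
   fix i j assume "i \<in> {..<k}" "j \<in> {..<k}" "(F ! (2 * i), F ! (2 * i + 1)) = (F ! (2 * j), F ! (2 * j + 1))"
   then show "i = j" using less[of "2 * i" "2 * j"] less[of "2 * j" "2 * i"] by (cases i j rule: linorder_cases) auto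
  qed
  then show ?thesis by (simp add: D_def card_image)
 qed
 ultimately have "(A \<union> D, D) \<in> diagrams n k" by (simp add: diagrams_def)
 moreover have "standard (A \<union> D, D)"
  unfolding standard_def
 proof (intro ballI notI)
  fix y z assume y: "y \<in> snd (A \<union> D, D)" and z: "z \<in> fst (A \<union> D, D)" and nested: "nested_in y z"
  obtain i where i: "i < k" "y = (F ! (2 * i), F ! (2 * i + 1))" using y D by auto
  consider "z \<in> A" | "z \<in> D" using z by auto
  then show False
  proof cases
   case 1
   then show False using outside[of "fst z" "snd z" "2 * i"] i nested by (auto simp: nested_in_def)
  next
   case 2
   then obtain j where j: "j < k" "z = (F ! (2 * j), F ! (2 * j + 1))" using D by auto
   then show False
    using less[of "2 * j" "2 * i"] less[of "2 * i + 1" "2 * j + 1"] i nested by (auto simp: nested_in_def)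
  qed
 qed
 ultimately show thesis using that disjoint by blast
qed

lemma good_word_form:
 assumes "w \<in> good_words n k"
 obtains S where "w = good_word n k S"
proof -
 obtain v where v: "w = replicate k True @ v @ replicate k True" "length v = 2 * n" using assms by (auto simp: good_words_def)
 have "v = map (\<lambda>i. v ! (i - 1)) [1..<2 * n + 1]"
  by (rule nth_equalityI) (use v(2) in \<open>simp_all del: upt_Suc\<close>)
 then show thesis using that v(1) by metis
qed

lemma good_wordI: "good_word n k S \<in> good_words n k"
 by (simp add: good_words_def del: upt_Suc)

abbreviation "matching_of u \<equiv> cup_matching (map snd u)"
abbreviation "arcs_of n k u \<equiv> ray_cups.arcs n k (matching_of u)"

lemma cup_tangles_cups: "u \<in> cup_tangles n k ==> cups (map snd u) = u \<and> u \<in> tangles (2 * (n + k))"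
 by (auto simp: cup_tangles_def cups_def comp_def)

lemma cup_tangle_ray_cups:
 "u \<in> cup_tangles n k ==> single u 1 \<notin> kl_kernel n k ==> ray_cups n k (matching_of u)"
 using cups_kernel_cases[of "map snd u" n k] cup_tangles_cups by simp

lemma cup_tangle_state:
 "u \<in> cup_tangles n k ==> ray_cups n k (matching_of u) ==>
  state_sum u (good_word n k S) = (- q_pow (-1)) ^ k * cap_state n (arcs_of n k u) S"
 using ray_cups.state_sum_ray_cups[of n k "matching_of u" "map snd u" S] cup_tangles_cups by (simp del: upt_Suc)

lemma cup_tangle_equiv:
 assumes "u \<in> cup_tangles n k" "v \<in> cup_tangles n k" "ray_cups n k (matching_of u)" "ray_cups n k (matching_of v)"
  "arcs_of n k u = arcs_of n k v"
 shows "kl_equiv n k (single u 1) (single v 1)"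
 using cup_equiv_kl[OF cup_equivI[of _ "2 * (n + k)", OF _ _ ray_cups_eq[OF assms(3-5)]], of n k]
  cup_tangles_cups[OF assms(1)] cup_tangles_cups[OF assms(2)] by simp

lemma free_kl_spanned: "f \<in> free_kl n k ==> f \<in> spanned n k (cup_tangles n k)"
proof -
 assume f: "f \<in> free_kl n k"
 have "(\<Sum>u\<in>keys f. single u (lookup f u)) \<in> spanned n k (cup_tangles n k)"
  by (rule spanned_sum, rule spanned_mult, rule tangle_spanned) (use f in \<open>auto simp: free_kl_iff\<close>)
 then show ?thesis by (subst poly_mapping_expand)
qed

text \<open>The hard half of the description of the kernel. Modulo the kernel only surviving cup
  diagrams remain, grouped by their middle arcs. Independence of states makes the coefficients of
  each group add up to zero, and the members of a group are equal in the quotient.\<close>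

lemma annihilator_kernel:
 assumes f: "f \<in> free_kl n k" and zero: "\<And>w. w \<in> good_words n k ==> evaluate w f = 0"
 shows "f \<in> kl_kernel n k"
proof -
 obtain g where g: "keys g \<subseteq> cup_tangles n k" "kl_equiv n k f g"
  using free_kl_spanned[OF f] by (auto simp: spanned_def)
 define V where "V = {u \<in> keys g. single u 1 \<notin> kl_kernel n k}"
 let ?g = "lookup g"
 have V: "finite V" "V \<subseteq> cup_tangles n k" "u \<in> V ==> ray_cups n k (matching_of u)" for u
  using g(1) cup_tangle_ray_cups by (auto simp: V_def)
 have single: "kl_equiv n k (single u c) 0" if "single u 1 \<in> kl_kernel n k" for u c
  using kl_kernel_closed(4)[OF that, of c] by (simp add: kl_equiv_def)
 have "kl_equiv n k g (\<Sum>u\<in>V. single u (?g u))"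
 proof -
  have split: "g = (\<Sum>u\<in>V. single u (?g u)) + (\<Sum>u\<in>keys g - V. single u (?g u))"
   by (subst poly_mapping_expand, subst sum.subset_diff[of V]) (auto simp: V_def add.commute)
  have "kl_equiv n k (\<Sum>u\<in>keys g - V. single u (?g u)) (\<Sum>u\<in>keys g - V. 0)"
   by (rule kl_equiv_sum, rule single) (auto simp: V_def)
  from kl_equiv_add[OF kl_equiv_refl this, of "\<Sum>u\<in>V. single u (?g u)"]
  show ?thesis unfolding split[symmetric] by simp
 qed
 then have fV: "kl_equiv n k f (\<Sum>u\<in>V. single u (?g u))" using kl_equiv_trans[OF g(2)] by blast
 \<comment> \<open>Several cup lists may draw the same diagram, so only these sums of coefficients
   are determined by the states.\<close>
 define c where "c A = (\<Sum>u\<in>{u \<in> V. arcs_of n k u = A}. ?g u)" for A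
 have "c A = 0" if A: "A \<in> arcs_of n k ` V" for A
 proof (rule cap_state_independent[OF _ _ _ A])
  show "finite (arcs_of n k ` V)" using V(1) by simp
  show "ray_matching n B" if "B \<in> arcs_of n k ` V" for B
   using that ray_cups.ray_matching_arcs[OF V(3)] by blast
  show "(\<Sum>B\<in>arcs_of n k ` V. c B * cap_state n B S) = 0" for S
  proof -
   let ?w = "good_word n k S"
   have w: "?w \<in> good_words n k" by (rule good_wordI)
   have "0 = evaluate ?w (\<Sum>u\<in>V. single u (?g u))"
    using evaluate_kernel[OF fV[unfolded kl_equiv_def] w] zero[OF w] by (simp add: pairing_diff del: upt_Suc)
   also have "\<dots> = (\<Sum>u\<in>V. (- q_pow (-1)) ^ k * (?g u * cap_state n (arcs_of n k u) S))"
    unfolding pairing_sum pairing_single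
    by (rule sum.cong[OF HOL.refl]) (use cup_tangle_state V(2,3) in \<open>simp add: subset_iff mult.left_commute del: upt_Suc\<close>)
   also have "\<dots> = (- q_pow (-1)) ^ k * (\<Sum>u\<in>V. ?g u * cap_state n (arcs_of n k u) S)"
    by (simp only: sum_distrib_left)
   also have "(\<Sum>u\<in>V. ?g u * cap_state n (arcs_of n k u) S) =
     (\<Sum>B\<in>arcs_of n k ` V. \<Sum>u\<in>{u \<in> V. arcs_of n k u = B}. ?g u * cap_state n (arcs_of n k u) S)"
    by (rule sum.group[symmetric]) (use V(1) in auto)
   also have "\<dots> = (\<Sum>B\<in>arcs_of n k ` V. c B * cap_state n B S)"
    unfolding c_def sum_distrib_right by (intro sum.cong HOL.refl) auto
   finally show ?thesis by (simp add: q_pow_def)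
  qed
 qed
 then have zero: "kl_equiv n k (\<Sum>u\<in>{u \<in> V. arcs_of n k u = A}. single u (?g u)) 0" if A: "A \<in> arcs_of n k ` V" for A
 proof -
  obtain v where v: "v \<in> V" "A = arcs_of n k v" using A by blast
  have "kl_equiv n k (single u (?g u)) (single v (?g u))" if "u \<in> {u \<in> V. arcs_of n k u = A}" for u
   using kl_equiv_scale[OF cup_tangle_equiv, of u n k v "?g u"] that v V(2,3) by auto
  then have "kl_equiv n k (\<Sum>u\<in>{u \<in> V. arcs_of n k u = A}. single u (?g u))
    (\<Sum>u\<in>{u \<in> V. arcs_of n k u = A}. single v (?g u))" by (rule kl_equiv_sum)
  also have "(\<Sum>u\<in>{u \<in> V. arcs_of n k u = A}. single v (?g u)) = single v (c A)"
   unfolding c_def by (rule poly_mapping_eqI) (simp add: lookup_sum lookup_single when_def)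
  also have "\<dots> = 0" using \<open>\<And>A. A \<in> arcs_of n k ` V ==> c A = 0\<close>[OF A] by simp
  finally show ?thesis .
 qed
 have "kl_equiv n k (\<Sum>A\<in>arcs_of n k ` V. \<Sum>u\<in>{u \<in> V. arcs_of n k u = A}. single u (?g u)) (\<Sum>A\<in>arcs_of n k ` V. 0)"
  by (rule kl_equiv_sum) (rule zero)
 then have "kl_equiv n k (\<Sum>u\<in>V. single u (?g u)) 0"
  using V(1) by (subst (asm) sum.group) simp_all
 then have "kl_equiv n k f 0" using kl_equiv_trans[OF fV] by blast
 then show ?thesis by (simp add: kl_equiv_def)
qed

section \<open>The map on combinations of diagrams\<close>

lemma psi_diagram_closed: "x \<in> diagrams n k ==> psi_diagram n k x \<in> free_kl n k"
 using strand_diagram.semicircle_tangle_tangles[OF strand_diagramI, of "fst x" "snd x" n k]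
 by (auto simp: psi_diagram_def intro: free_kl_single)

lemma evaluate_psi:
 assumes "keys f \<subseteq> diagrams n k"
 shows "evaluate (good_word n k S) (linear_extension (psi_diagram n k) f)
  = diagram_const k * pairing (russell_state n S) f"
 unfolding pairing_linear_extension
proof -
 let ?w = "good_word n k S"
 have "evaluate ?w (psi_diagram n k x) = diagram_const k * russell_state n S x" if "x \<in> diagrams n k" for x
  using strand_diagram.evaluate_psi_diagram[OF strand_diagramI, of "fst x" "snd x" n k S] that by (simp del: upt_Suc)
 then show "pairing (\<lambda>x. evaluate ?w (psi_diagram n k x)) f = diagram_const k * pairing (russell_state n S) f"
  unfolding pairing_def[of _ f] sum_distrib_left by (intro sum.cong) (simp_all add: subsetD[OF assms] mult.left_commute del: upt_Suc)
qed

abbreviation "psi_map n k \<equiv> linear_extension (psi_diagram n k)"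

lemma psi_map_closed: "keys f \<subseteq> diagrams n k ==> psi_map n k f \<in> free_kl n k"
proof -
 assume f: "keys f \<subseteq> diagrams n k"
 have "finite I ==> (\<And>x. x \<in> I ==> F x \<in> free_kl n k) ==> sum F I \<in> free_kl n k" for F :: "diagram => _" and I
  by (induction I rule: finite_induct) simp_all
 then show ?thesis unfolding linear_extension_def using psi_diagram_closed[OF subsetD[OF f]] by simp
qed

text \<open>Yields well-definedness on the Russell space: the relations have vanishing states, hence
  their images have vanishing state sums and lie in the kernel.\<close>

lemma psi_map_kernel:
 assumes "keys f \<subseteq> diagrams n k" "\<And>S. pairing (russell_state n S) f = 0"
 shows "psi_map n k f \<in> kl_kernel n k"
proof (rule annihilator_kernel[OF psi_map_closed[OF assms(1)]])
 fix w assume "w \<in> good_words n k"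
 then obtain S where w: "w = good_word n k S" by (rule good_word_form)
 show "evaluate w (psi_map n k f) = 0" unfolding w evaluate_psi[OF assms(1)] assms(2) by simp
qed

lemma psi_map_kernel_state:
 assumes "keys f \<subseteq> diagrams n k" "psi_map n k f \<in> kl_kernel n k"
 shows "pairing (russell_state n S) f = 0"
 using evaluate_kernel[OF assms(2) good_wordI, of S] diagram_const_nonzero[of k] unfolding evaluate_psi[OF assms(1)] by simp

text \<open>The preimage is the standard completion of the middle arcs, whose state is that of the
  cup diagram up to a unit.\<close>

lemma cup_tangle_psi:
 assumes "u \<in> cup_tangles n k"
 shows "\<exists>g. keys g \<subseteq> diagrams n k \<and> kl_equiv n k (single u 1) (psi_map n k g)"
proof (cases "single u 1 \<in> kl_kernel n k")
 case True
 then show ?thesis by (intro exI[of _ 0]) (simp add: kl_equiv_def)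
next
 case False
 interpret ray_cups n k "matching_of u" by (rule cup_tangle_ray_cups[OF assms False])
 interpret ray: ray_matching n arcs by (rule ray_matching_arcs)
 have "card free = 2 * k"
  using arg_cong[OF ray_end_sorted, of length] by simp
 then obtain D where dots: "(arcs \<union> D, D) \<in> diagrams n k" "standard (arcs \<union> D, D)" "arcs \<inter> D = {}" by (rule ray.completion)
 interpret strand_diagram n "arcs \<union> D" D k by (rule strand_diagramI[OF dots(1)])
 have state: "russell_state n S (arcs \<union> D, D) = cap_state n arcs S" for S
  using russell_state_standard[OF dots(2), of S] dots(3) by (simp add: Un_Diff Diff_triv)
 \<comment> \<open>The coefficient cancels the factor of \<open>diagram_const\<close> that comes
   from pairs of dots; the remaining power of -q^(-1) also occurs in the state sum of the cup
   diagram.\<close>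
 let ?g = "single (arcs \<union> D, D) (qhalf_pow (int (k * (k - 1) div 2)))"
 have keys: "keys ?g \<subseteq> diagrams n k" using dots(1) by simp
 have "single u 1 - psi_map n k ?g \<in> kl_kernel n k"
 proof (rule annihilator_kernel)
  show "single u 1 - psi_map n k ?g \<in> free_kl n k"
   using psi_map_closed[OF keys] free_kl_single cup_tangles_cups[OF assms] by simp
  fix w assume "w \<in> good_words n k"
  then obtain S where w: "w = good_word n k S" by (rule good_word_form)
  show "evaluate w (single u 1 - psi_map n k ?g) = 0"
   unfolding w pairing_diff evaluate_psi[OF keys] pairing_single state cup_tangle_state[OF assms ray_cups_axioms]
   by (simp add: diagram_const_def mult.assoc)
 qed
 then show ?thesis unfolding kl_equiv_def using keys by blast
qed

lemma psi_map_surj: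
 assumes "f \<in> free_kl n k"
 shows "\<exists>g. keys g \<subseteq> diagrams n k \<and> kl_equiv n k f (psi_map n k g)"
proof -
 obtain h where h: "keys h \<subseteq> cup_tangles n k" "kl_equiv n k f h"
  using free_kl_spanned[OF assms] by (auto simp: spanned_def)
 obtain G where G: "\<And>u. u \<in> keys h ==> keys (G u) \<subseteq> diagrams n k \<and> kl_equiv n k (single u 1) (psi_map n k (G u))"
  using cup_tangle_psi h(1) by (meson subsetD)
 let ?g = "\<Sum>u\<in>keys h. scale (lookup h u) (G u)"
 have "kl_equiv n k (\<Sum>u\<in>keys h. single u (lookup h u)) (\<Sum>u\<in>keys h. scale (lookup h u) (psi_map n k (G u)))"
 proof (rule kl_equiv_sum)
  fix u assume "u \<in> keys h"
  then show "kl_equiv n k (single u (lookup h u)) (scale (lookup h u) (psi_map n k (G u)))"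
   using kl_equiv_scale[of n k "single u 1" "psi_map n k (G u)" "lookup h u"] G by simp
 qed
 then have "kl_equiv n k h (psi_map n k ?g)"
  by (subst poly_mapping_expand) (simp add: linear_extension_sum linear_extension_scale)
 moreover have "keys ?g \<subseteq> diagrams n k"
 proof -
  have "keys (\<Sum>u\<in>I. scale (c u) (G u)) \<subseteq> diagrams n k" if "finite I" "I \<subseteq> keys h" for I c
   using that
  proof (induction I rule: finite_induct)
   case (insert u I)
   then have "keys (scale (c u) (G u)) \<subseteq> diagrams n k" using G keys_scale by fastforce
   then show ?case using insert keys_add[of "scale (c u) (G u)" "\<Sum>u\<in>I. scale (c u) (G u)"] by auto
  qed simp
  then show ?thesis by simp
 qed
 ultimately show ?thesis using kl_equiv_trans[OF h(2)] by blast
qed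

section \<open>Extension of scalars\<close>

lemma tensor_pairs_simps [simp]:
 "x \<oplus>\<^bsub>tensor_pairs M S\<^esub> y = x + y" "\<zero>\<^bsub>tensor_pairs M S\<^esub> = 0"
 "c \<odot>\<^bsub>tensor_pairs M S\<^esub> x = frag_extend (\<lambda>(m, s). frag_of (m, c \<otimes>\<^bsub>S\<^esub> s)) x"
 by (simp_all add: tensor_pairs_def)

lemma tensor_pairs_carrier: "f \<in> carrier (tensor_pairs M S) \<longleftrightarrow> keys f \<subseteq> carrier M \<times> carrier S"
 by (simp add: tensor_pairs_def)

lemma tensor_pairs_closed:
 "0 \<in> carrier (tensor_pairs M S)"
 "f \<in> carrier (tensor_pairs M S) ==> g \<in> carrier (tensor_pairs M S) ==> f + g \<in> carrier (tensor_pairs M S)"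
 "f \<in> carrier (tensor_pairs M S) ==> g \<in> carrier (tensor_pairs M S) ==> f - g \<in> carrier (tensor_pairs M S)"
 "f \<in> carrier (tensor_pairs M S) ==> - f \<in> carrier (tensor_pairs M S)"
 "m \<in> carrier M ==> s \<in> carrier S ==> frag_of (m, s) \<in> carrier (tensor_pairs M S)"
 using keys_add[of f g] keys_diff[of f g] by (auto simp: tensor_pairs_carrier)

lemma abelian_group_tensor: "abelian_group (tensor_pairs M S)"
 by (rule abelian_groupI) (auto simp: tensor_pairs_closed algebra_simps intro: bexI[of _ "- x" for x])

lemma tensor_pairs_uminus: "f \<in> carrier (tensor_pairs M S) ==> \<ominus>\<^bsub>tensor_pairs M S\<^esub> f = - f"
 by (rule abelian_group.minus_equality[OF abelian_group_tensor]) (simp_all add: tensor_pairs_closed)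

locale laurent_module = module Laurent_q M for M :: "(laurent, 'm) module"
begin

abbreviation "T \<equiv> tensor_pairs M Laurent_qhalf"
abbreviation "relations \<equiv> tensor_relations Laurent_q M Laurent_qhalf"
definition G where "G = generate (add_monoid T) relations"

lemma relations_closed: "relations \<subseteq> carrier T"
proof
 fix r assume "r \<in> relations"
 then show "r \<in> carrier T"
  by cases (auto intro!: tensor_pairs_closed simp del: Laurent_qhalf_simps(2,3))
qed

lemma subgroup_G: "subgroup G (add_monoid T)"
 unfolding G_def using group.generate_is_subgroup[OF abelian_group.a_group[OF abelian_group_tensor]] relations_closed by simp

lemma relations_G: "r \<in> relations ==> r \<in> G"
 unfolding G_def by (rule generate.incl)

lemma G_closed:
 "G \<subseteq> carrier T" "0 \<in> G" "f \<in> G ==> g \<in> G ==> f + g \<in> G" "f \<in> G ==> - f \<in> G" "f \<in> G ==> g \<in> G ==> f - g \<in> G"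
proof -
 show sub: "G \<subseteq> carrier T" using subgroup.subset[OF subgroup_G] by simp
 show "0 \<in> G" using subgroup.one_closed[OF subgroup_G] by simp
 show add: "f \<in> G ==> g \<in> G ==> f + g \<in> G" for f g using subgroup.m_closed[OF subgroup_G, of f g] by simp
 show neg: "f \<in> G ==> - f \<in> G" for f
  using subgroup.m_inv_closed[OF subgroup_G, of f] tensor_pairs_uminus[of f M Laurent_qhalf] sub by (auto simp: a_inv_def)
 show "f \<in> G ==> g \<in> G ==> f - g \<in> G" using add[of f "- g"] neg[of g] by simp
qed

lemma G_induct [consumes 1, case_names zero relation add uminus]:
 assumes "f \<in> G" "P 0" "\<And>r. r \<in> relations ==> P r" "\<And>f g. P f ==> P g ==> P (f + g)" "\<And>f. P f ==> P (- f)"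
 shows "P f"
 using assms(1) unfolding G_def
proof (induction rule: generate.induct)
 case (inv r)
 have "inv\<^bsub>add_monoid T\<^esub> r = - r"
  using tensor_pairs_uminus[of r M Laurent_qhalf] relations_closed inv by (auto simp: a_inv_def)
 then show ?case using assms(3,5) inv by simp
qed (use assms in simp_all)

text \<open>Scalars act on the right-hand factor only, so they carry each tensor relation to one of
  the same kind.\<close>

lemma smult_G: "f \<in> G ==> c \<odot>\<^bsub>T\<^esub> f \<in> G"
proof (induction rule: G_induct)
 case (relation r)
 then have "c \<odot>\<^bsub>T\<^esub> r \<in> relations"
 proof cases
  case (add_left m m' s)
  then show ?thesis using tensor_relations.add_left[of m M m' "c * s" Laurent_qhalf Laurent_q] by (simp add: frag_extend_diff)
 next
  case (add_right m s s')
  then show ?thesis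
   using tensor_relations.add_right[of m M "c * s" Laurent_qhalf "c * s'" Laurent_q] by (simp add: frag_extend_diff distrib_left)
 next
  case (balanced a m s)
  then show ?thesis
   using tensor_relations.balanced[of a Laurent_q m M "c * s" Laurent_qhalf] by (simp add: frag_extend_diff mult.left_commute)
 qed
 then show ?case by (rule relations_G)
qed (simp_all add: G_closed frag_extend_add frag_extend_minus)

sublocale tensor: additive_quotient T G
 using abelian_group_tensor subgroup_G by (simp add: additive_quotient_def additive_quotient_axioms_def)

definition tclass :: "(('m \<times> laurent) \<Rightarrow>\<^sub>0 int) => (('m \<times> laurent) \<Rightarrow>\<^sub>0 int) set" where
 "tclass f = G +>\<^bsub>T\<^esub> f"

abbreviation (input) "E \<equiv> extend_scalars Laurent_q Laurent_qhalf M"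

lemma E_eq: "E = quot_module T G"
 by (simp add: extend_scalars_def G_def)

lemma smult_T_closed: "f \<in> carrier T ==> c \<odot>\<^bsub>T\<^esub> f \<in> carrier T"
 using keys_frag_extend[of "\<lambda>(m, s). frag_of (m, c * s)" f] by (fastforce simp: tensor_pairs_carrier)

lemma carrier_E: "carrier E = tclass ` carrier T"
 by (simp add: E_eq tensor.carrier_quot tclass_def)

lemma add_E: "f \<in> carrier T ==> g \<in> carrier T ==> tclass f \<oplus>\<^bsub>E\<^esub> tclass g = tclass (f + g)"
 using tensor.add_quot[of f g] by (simp add: E_eq tclass_def)

lemma minus_T: "f \<in> carrier T ==> g \<in> carrier T ==> f \<ominus>\<^bsub>T\<^esub> g = f - g"
 by (simp add: a_minus_def tensor_pairs_uminus)

lemma smult_E: "f \<in> carrier T ==> c \<odot>\<^bsub>E\<^esub> tclass f = tclass (c \<odot>\<^bsub>T\<^esub> f)"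
 unfolding E_eq tclass_def
proof (rule tensor.smult_quot)
 fix y g assume y: "y \<in> carrier T" and g: "g \<in> G"
 then have "g \<in> carrier T" using G_closed(1) by blast
 then have "(c \<odot>\<^bsub>T\<^esub> (g \<oplus>\<^bsub>T\<^esub> y)) \<ominus>\<^bsub>T\<^esub> (c \<odot>\<^bsub>T\<^esub> y) = c \<odot>\<^bsub>T\<^esub> g"
  using y smult_T_closed[of y c] smult_T_closed[of g c] by (subst minus_T) (simp_all add: frag_extend_add tensor_pairs_closed)
 then show "(c \<odot>\<^bsub>T\<^esub> (g \<oplus>\<^bsub>T\<^esub> y)) \<ominus>\<^bsub>T\<^esub> (c \<odot>\<^bsub>T\<^esub> y) \<in> G" using smult_G[OF g] by simp
qed (use smult_T_closed in blast)+

lemma tclass_eq_iff: "f \<in> carrier T ==> g \<in> carrier T ==> tclass f = tclass g \<longleftrightarrow> f - g \<in> G"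
 using tensor.coset_eq_iff[of f g] minus_T[of f g] by (simp add: tclass_def)

lemma tclass_member: "f \<in> carrier T ==> g \<in> tclass f \<longleftrightarrow> g \<in> carrier T \<and> g - f \<in> G"
 using tensor.sub.a_rcos_module[of f g] tensor.sub.a_elemrcos_carrier[of f g] minus_T[of g f]
 by (auto simp: tclass_def a_minus_def)

end

section \<open>Sums and multiples of classes in the Kauffman--Lins space\<close>

lemma finsum_kl_class:
 "finite I ==> (\<And>p. p \<in> I ==> g p \<in> free_kl n k) ==>
  (\<Oplus>\<^bsub>kauffman_lins n k\<^esub>p\<in>I. kl_class n k (g p)) = kl_class n k (\<Sum>p\<in>I. g p) \<and> (\<Sum>p\<in>I. g p) \<in> free_kl n k"
proof (induction I rule: finite_induct)
 case empty
 then show ?case by (simp add: kl_class_zero)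
next
 case (insert p I)
 have "(\<Oplus>\<^bsub>kauffman_lins n k\<^esub>p\<in>insert p I. kl_class n k (g p)) =
   kl_class n k (g p) \<oplus>\<^bsub>kauffman_lins n k\<^esub> (\<Oplus>\<^bsub>kauffman_lins n k\<^esub>p\<in>I. kl_class n k (g p))"
  by (rule kl.finsum_insert) (use insert in \<open>auto simp: kl_class_closed\<close>)
 then show ?case using insert by (simp add: kl_class_add)
qed

lemma nat_pow_kl_class:
 "g \<in> free_kl n k ==> [j] \<cdot>\<^bsub>kauffman_lins n k\<^esub> kl_class n k g = kl_class n k (scale (of_nat j) g)"
proof (induction j)
 case 0
 then show ?case by (simp add: add_pow_def kl_class_zero)
next
 case (Suc j)
 have "[Suc j] \<cdot>\<^bsub>kauffman_lins n k\<^esub> kl_class n k g = [j] \<cdot>\<^bsub>kauffman_lins n k\<^esub> kl_class n k g \<oplus>\<^bsub>kauffman_lins n k\<^esub> kl_class n k g"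
  by (simp add: add_pow_def)
 then show ?case using Suc by (simp add: kl_class_add scale_add_left add.commute)
qed

text \<open>\<open>extend_map\<close> is phrased through the additive group of its target. Its
  integer multiples are traced back to scalar multiples of representatives here.\<close>

lemma int_pow_kl_class:
 fixes z :: int
 assumes "g \<in> free_kl n k"
 shows "[z] \<cdot>\<^bsub>kauffman_lins n k\<^esub> kl_class n k g = kl_class n k (scale (of_int z) g)"
proof (cases z rule: int_cases2)
 case (nonneg j)
 then show ?thesis using nat_pow_kl_class[OF assms] by (simp add: add_pow_def int_pow_int)
next
 case (nonpos j)
 have "[z] \<cdot>\<^bsub>kauffman_lins n k\<^esub> kl_class n k g = \<ominus>\<^bsub>kauffman_lins n k\<^esub> ([j] \<cdot>\<^bsub>kauffman_lins n k\<^esub> kl_class n k g)"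
  using group.int_pow_neg_int[OF kl.a_group, of "kl_class n k g" n k j] kl_class_closed[OF assms]
  by (simp add: add_pow_def nonpos a_inv_def)
 also have "\<dots> = kl_class n k (scale (of_int z) g)"
  using assms by (intro kl.minus_equality)
   (simp_all add: nat_pow_kl_class kl_class_closed kl_class_add kl_class_zero nonpos flip: scale_add_left)
 finally show ?thesis .
qed

text \<open>The additive extension to formal integer combinations, with values taken before passing
  to the quotient.\<close>

definition frag_sum :: "('p => ('y \<Rightarrow>\<^sub>0 laurent)) => ('p \<Rightarrow>\<^sub>0 int) => ('y \<Rightarrow>\<^sub>0 laurent)" where
 "frag_sum F f = (\<Sum>p\<in>keys f. scale (of_int (lookup f p)) (F p))"

lemma frag_sum_superset:
 "finite I ==> keys f \<subseteq> I ==> frag_sum F f = (\<Sum>p\<in>I. scale (of_int (lookup f p)) (F p))"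
 unfolding frag_sum_def by (intro sum.mono_neutral_left) (auto simp: in_keys_iff)

lemma frag_sum_add: "frag_sum F (f + g) = frag_sum F f + frag_sum F g"
proof -
 let ?I = "keys f \<union> keys g"
 have "frag_sum F h = (\<Sum>p\<in>?I. scale (of_int (lookup h p)) (F p))" if "h \<in> {f, g, f + g}" for h
  using that keys_add[of f g] by (intro frag_sum_superset) auto
 then show ?thesis by (simp add: lookup_add scale_add_left sum.distrib)
qed

lemma frag_sum_of [simp]: "frag_sum F (frag_of p) = F p"
 by (simp add: frag_sum_def)

lemma frag_sum_0 [simp]: "frag_sum F 0 = 0"
 by (simp add: frag_sum_def)

lemma frag_sum_minus: "frag_sum F (- f) = - frag_sum F f"
 using frag_sum_add[of F f "- f"] by (simp add: eq_neg_iff_add_eq_0 add.commute)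

lemma frag_sum_diff: "frag_sum F (f - g) = frag_sum F f - frag_sum F g"
 using frag_sum_add[of F f "- g"] by (simp add: frag_sum_minus)

section \<open>The isomorphism\<close>

lemma russell_eq: "russell n k = quot_module (free_russell n k) (russell_span n k)"
 by (simp add: russell_def russell_span_def)

lemma module_free_russell: "module Laurent_q (free_russell n k)"
 by (simp add: free_russell_def qring.module_free)

interpretation russell_quotient: additive_quotient "free_russell n k" "russell_span n k" for n k
 by (rule module_quotient(1)[OF module_free_russell submodule_russell_span])

interpretation russell_tensor: laurent_module "russell n k" for n k
 unfolding laurent_module_def russell_eq by (rule module_quotient(2)[OF module_free_russell submodule_russell_span])

definition russell_class :: "nat => nat => (diagram \<Rightarrow>\<^sub>0 laurent) => (diagram \<Rightarrow>\<^sub>0 laurent) set" where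
 "russell_class n k f = russell_span n k +>\<^bsub>free_russell n k\<^esub> f"

lemma free_russell_simps:
 "x \<oplus>\<^bsub>free_russell n k\<^esub> y = x + y" "a \<odot>\<^bsub>free_russell n k\<^esub> x = scale a x"
 "f \<in> free_r n k ==> g \<in> free_r n k ==> f \<ominus>\<^bsub>free_russell n k\<^esub> g = f - g"
 by (simp_all add: free_russell_def qring.free_minus)

lemma carrier_russell: "carrier (russell n k) = russell_class n k ` free_r n k"
 by (simp add: russell_eq russell_quotient.carrier_quot russell_class_def)

lemma russell_class_closed: "f \<in> free_r n k ==> russell_class n k f \<in> carrier (russell n k)"
 by (simp add: carrier_russell)

lemma russell_class_add: "f \<in> free_r n k ==> g \<in> free_r n k ==>
  russell_class n k f \<oplus>\<^bsub>russell n k\<^esub> russell_class n k g = russell_class n k (f + g)"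
 using russell_quotient.add_quot[of f n k g] by (simp add: russell_eq russell_class_def free_russell_simps)

lemma russell_class_smult: "a \<in> carrier Laurent_q ==> f \<in> free_r n k ==>
  a \<odot>\<^bsub>russell n k\<^esub> russell_class n k f = russell_class n k (scale a f)"
 using module_quotient(3)[OF module_free_russell submodule_russell_span, of a f n k]
 by (simp add: russell_eq russell_class_def free_russell_simps)

lemma russell_class_eq_iff: "f \<in> free_r n k ==> g \<in> free_r n k ==>
  russell_class n k f = russell_class n k g \<longleftrightarrow> f - g \<in> russell_span n k"
 by (simp add: russell_class_def russell_quotient.coset_eq_iff free_russell_simps)

lemma russell_class_member: "f \<in> free_r n k ==> g \<in> russell_class n k f ==> g \<in> free_r n k \<and> g - f \<in> russell_span n k"
 using russell_quotient.sub.a_rcos_module[of f n k g] russell_quotient.sub.a_elemrcos_carrier[of f n k g]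
  free_russell_simps(3)[of g n k f]
 by (auto simp: russell_class_def a_minus_def)

lemma russell_class_self: "f \<in> free_r n k ==> f \<in> russell_class n k f"
 unfolding russell_class_def by (rule russell_quotient.sub.a_rcos_self)

lemma free_r_keys: "f \<in> free_r n k ==> keys f \<subseteq> diagrams n k"
 by (simp add: free_russell_def free_module_carrier)

lemma russell_span_state: "f \<in> russell_span n k ==> pairing (russell_state n S) f = 0"
proof -
 let ?N = "{f \<in> free_r n k. pairing (russell_state n S) f = 0}"
 have "russell_span n k \<subseteq> ?N"
  unfolding russell_span_def free_russell_def
 proof (rule qring.span_minimal)
  show "russell_relations n k \<subseteq> {f \<in> carrier (free_module Laurent_q (diagrams n k)). pairing (russell_state n S) f = 0}"
   using russell_relations_closed russell_relation_state by (auto simp: free_russell_def)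
 qed (rule qring.submodule_freeI; auto simp: pairing_add pairing_scale)
 then show "f \<in> russell_span n k ==> pairing (russell_state n S) f = 0" by blast
qed

lemma psi_map_equiv:
 assumes "f \<in> free_r n k" "g \<in> free_r n k" "f - g \<in> russell_span n k"
 shows "kl_equiv n k (psi_map n k f) (psi_map n k g)"
proof -
 have "psi_map n k (f - g) \<in> kl_kernel n k"
  by (rule psi_map_kernel) (use assms free_r_keys[of "f - g" n k] russell_span_state in auto)
 then show ?thesis by (simp add: kl_equiv_def linear_extension_diff)
qed

lemma psi_russell_class:
 assumes "f \<in> free_r n k"
 shows "psi_russell n k (russell_class n k f) = kl_class n k (psi_map n k f)"
proof -
 have "class_kl n k (psi_tilde n k g) = class_kl n k (psi_tilde n k f)" if "g \<in> russell_class n k f" for g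
 proof -
  have g: "g \<in> free_r n k" "g - f \<in> russell_span n k" using russell_class_member[OF assms that] by auto
  then show ?thesis
   using psi_map_equiv[OF g(1) assms g(2)]
    kl_class_eq_iff[OF psi_map_closed[OF free_r_keys[OF g(1)]] psi_map_closed[OF free_r_keys[OF assms]]]
   by (simp add: psi_tilde_def kl_class_def kl_equiv_def)
 qed
 then have "psi_russell n k (russell_class n k f) = class_kl n k (psi_tilde n k f)"
  unfolding psi_russell_def by (rule induced_eq[OF russell_class_self[OF assms]])
 then show ?thesis by (simp add: psi_tilde_def kl_class_def)
qed

text \<open>A choice of preimages that lifts the extended map to free modules; by
  \<open>pair_map_equiv\<close> the choice does not matter modulo \<open>kl_kernel\<close>.\<close>

definition representative :: "nat => nat => (diagram \<Rightarrow>\<^sub>0 laurent) set => (diagram \<Rightarrow>\<^sub>0 laurent)" where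
 "representative n k m = (SOME f. f \<in> free_r n k \<and> russell_class n k f = m)"

lemma representative: "m \<in> carrier (russell n k) ==> representative n k m \<in> free_r n k \<and> russell_class n k (representative n k m) = m"
 unfolding representative_def carrier_russell by (rule someI_ex) auto

definition pair_map :: "nat => nat => (diagram \<Rightarrow>\<^sub>0 laurent) set \<times> laurent => (tangle \<Rightarrow>\<^sub>0 laurent)" where
 "pair_map n k p = scale (snd p) (psi_map n k (representative n k (fst p)))"

abbreviation "lift n k \<equiv> frag_sum (pair_map n k)"
abbreviation "pairs n k \<equiv> carrier (tensor_pairs (russell n k) Laurent_qhalf)"

lemma pair_map_closed: "fst p \<in> carrier (russell n k) ==> pair_map n k p \<in> free_kl n k"
 using representative[of "fst p" n k] psi_map_closed[OF free_r_keys] by (simp add: pair_map_def)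

lemma pair_map_class:
 "fst p \<in> carrier (russell n k) ==>
  snd p \<odot>\<^bsub>kauffman_lins n k\<^esub> psi_russell n k (fst p) = kl_class n k (pair_map n k p)"
proof -
 assume "fst p \<in> carrier (russell n k)"
 then have r: "representative n k (fst p) \<in> free_r n k" "russell_class n k (representative n k (fst p)) = fst p"
  using representative by auto
 show ?thesis
  using psi_russell_class[OF r(1)] kl_class_smult[OF psi_map_closed[OF free_r_keys[OF r(1)]]] unfolding r(2) pair_map_def by simp
qed

lemma pair_map_equiv: "f \<in> free_r n k ==> kl_equiv n k (pair_map n k (russell_class n k f, s)) (scale s (psi_map n k f))"
 unfolding pair_map_def fst_conv snd_conv
proof (rule kl_equiv_scale, rule psi_map_equiv)
 assume f: "f \<in> free_r n k"
 have r: "representative n k (russell_class n k f) \<in> free_r n k"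
  "russell_class n k (representative n k (russell_class n k f)) = russell_class n k f"
  using representative[OF russell_class_closed[OF f]] by auto
 show "representative n k (russell_class n k f) \<in> free_r n k" by (rule r(1))
 show "representative n k (russell_class n k f) - f \<in> russell_span n k"
  using russell_class_eq_iff[OF r(1) f] r(2) by simp
qed

lemma lift_closed: "f \<in> pairs n k ==> lift n k f \<in> free_kl n k"
 unfolding frag_sum_def
proof (rule finsum_kl_class[THEN conjunct2], simp)
 fix p assume "f \<in> pairs n k" "p \<in> keys f"
 then have "fst p \<in> carrier (russell n k)" by (auto simp: tensor_pairs_carrier)
 then show "scale (of_int (lookup f p)) (pair_map n k p) \<in> free_kl n k"
  by (intro free_kl_closed pair_map_closed)
qed

lemma extension_lift:
 assumes "f \<in> pairs n k"
 shows "(\<Oplus>\<^bsub>kauffman_lins n k\<^esub>p\<in>keys f.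
   [lookup f p] \<cdot>\<^bsub>kauffman_lins n k\<^esub> (snd p \<odot>\<^bsub>kauffman_lins n k\<^esub> psi_russell n k (fst p)))
  = kl_class n k (lift n k f)"
proof -
 have fst: "fst p \<in> carrier (russell n k)" if "p \<in> keys f" for p
  using assms that by (auto simp: tensor_pairs_carrier)
 have closed: "scale (of_int (lookup f p)) (pair_map n k p) \<in> free_kl n k" if "p \<in> keys f" for p
  by (intro free_kl_closed pair_map_closed fst that)
 have summand: "[lookup f p] \<cdot>\<^bsub>kauffman_lins n k\<^esub> (snd p \<odot>\<^bsub>kauffman_lins n k\<^esub> psi_russell n k (fst p))
   = kl_class n k (scale (of_int (lookup f p)) (pair_map n k p))" if "p \<in> keys f" for p
  unfolding pair_map_class[OF fst[OF that]] by (rule int_pow_kl_class[OF pair_map_closed[OF fst[OF that]]])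
 have "(\<Oplus>\<^bsub>kauffman_lins n k\<^esub>p\<in>keys f.
   [lookup f p] \<cdot>\<^bsub>kauffman_lins n k\<^esub> (snd p \<odot>\<^bsub>kauffman_lins n k\<^esub> psi_russell n k (fst p)))
  = (\<Oplus>\<^bsub>kauffman_lins n k\<^esub>p\<in>keys f. kl_class n k (scale (of_int (lookup f p)) (pair_map n k p)))"
  by (rule kl.finsum_cong'[OF HOL.refl Pi_I], rule kl_class_closed[OF closed])
   (assumption, erule summand)
 also have "\<dots> = kl_class n k (lift n k f)"
  unfolding frag_sum_def by (rule finsum_kl_class[THEN conjunct1, OF finite_keys closed])
 finally show ?thesis .
qed

abbreviation "balanced n k \<equiv> russell_tensor.G n k"

text \<open>Each tensor relation becomes an identity of linear extensions once the chosen
  representatives are traded for compatible ones, which is allowed modulo the kernel.\<close>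

lemma lift_balanced: "f \<in> balanced n k ==> lift n k f \<in> kl_kernel n k"
proof (induction rule: russell_tensor.G_induct)
 case (relation r)
 have diff: "a - b - c \<in> kl_kernel n k" if "kl_equiv n k a a'" "kl_equiv n k b b'" "kl_equiv n k c c'" "a' = b' + c'" for a a' b b' c c'
 proof -
  have "(a - a') + (- (b - b')) + (- (c - c')) \<in> kl_kernel n k"
   using that unfolding kl_equiv_def by (intro kl_kernel_closed(3) kl_kernel_uminus)
  then show ?thesis using that(4) by (simp add: algebra_simps)
 qed
 from relation show ?case
 proof cases
  case (add_left m m' s)
  then obtain f f' where f: "f \<in> free_r n k" "m = russell_class n k f" "f' \<in> free_r n k" "m' = russell_class n k f'"
   by (auto simp: carrier_russell)
  then show ?thesis
   unfolding add_left(1) frag_sum_diff frag_sum_of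
   by (simp only: russell_class_add) (rule diff[OF pair_map_equiv pair_map_equiv pair_map_equiv],
     auto simp: linear_extension_add scale_add_right)
 next
  case (add_right m s s')
  then obtain f where f: "f \<in> free_r n k" "m = russell_class n k f" by (auto simp: carrier_russell)
  then show ?thesis
   unfolding add_right(1) frag_sum_diff frag_sum_of f(2)
   by (intro diff[OF pair_map_equiv pair_map_equiv pair_map_equiv]) (auto simp: scale_add_left)
 next
  case (balanced a m s)
  then obtain f where f: "f \<in> free_r n k" "m = russell_class n k f" by (auto simp: carrier_russell)
  have "kl_equiv n k (pair_map n k (russell_class n k (scale a f), s)) (scale s (psi_map n k (scale a f)))"
   by (rule pair_map_equiv) (use f balanced in simp)
  moreover have "kl_equiv n k (scale s (psi_map n k (scale a f))) (pair_map n k (russell_class n k f, a * s))"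
   using kl_equiv_sym[OF pair_map_equiv[OF f(1), of "a * s"]] by (simp add: linear_extension_scale scale_scale mult.commute)
  ultimately show ?thesis
   unfolding balanced(1) frag_sum_diff frag_sum_of f(2) using kl_equiv_trans f(1) balanced(2)
   by (fastforce simp: kl_equiv_def russell_class_smult)
 qed
qed (simp_all add: kl_kernel_closed frag_sum_add frag_sum_minus kl_kernel_uminus)

lemma psi_class:
 assumes "f \<in> pairs n k"
 shows "psi n k (russell_tensor.tclass n k f) = kl_class n k (lift n k f)"
proof -
 let ?L = "\<lambda>f. \<Oplus>\<^bsub>kauffman_lins n k\<^esub>p\<in>keys f.
   [lookup f p] \<cdot>\<^bsub>kauffman_lins n k\<^esub> (snd p \<odot>\<^bsub>kauffman_lins n k\<^esub> psi_russell n k (fst p))"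
 have "?L g = ?L f" if "g \<in> russell_tensor.tclass n k f" for g
 proof -
  have g: "g \<in> pairs n k" "g - f \<in> balanced n k"
   using that russell_tensor.tclass_member[OF assms] by auto
  then have "kl_class n k (lift n k g) = kl_class n k (lift n k f)"
   using lift_balanced[OF g(2)] kl_class_eq_iff[OF lift_closed lift_closed, OF g(1) assms] by (simp add: frag_sum_diff)
  then show ?thesis unfolding extension_lift[OF g(1)] extension_lift[OF assms] .
 qed
 moreover have "f \<in> russell_tensor.tclass n k f"
  using russell_tensor.tclass_member[OF assms, of f] assms russell_tensor.G_closed(2) by simp
 ultimately have "psi n k (russell_tensor.tclass n k f) = ?L f"
  unfolding psi_def extend_map_def by (intro induced_eq)
 then show ?thesis unfolding extension_lift[OF assms] .
qed

lemma lift_smult: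
 assumes "f \<in> pairs n k"
 shows "lift n k (c \<odot>\<^bsub>tensor_pairs (russell n k) Laurent_qhalf\<^esub> f) = scale c (lift n k f)"
proof -
 have "keys f \<subseteq> UNIV" by simp
 then show ?thesis
  by (induction rule: frag_induction)
   (auto simp: pair_map_def scale_scale frag_extend_diff frag_sum_diff scale_diff_right split: prod.splits)
qed

text \<open>Reads a combination of diagrams over the larger ring as a sum of pure tensors. It is
  additive only modulo the tensor relations, which is why \<open>teq\<close> is used below.\<close>

definition embed :: "nat => nat => (diagram \<Rightarrow>\<^sub>0 laurent) => ((diagram \<Rightarrow>\<^sub>0 laurent) set \<times> laurent) \<Rightarrow>\<^sub>0 int" where
 "embed n k g = (\<Sum>x\<in>keys g. frag_of (russell_class n k (single x 1), lookup g x))"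

lemma pairs_sum: "(\<And>x. x \<in> I ==> F x \<in> pairs n k) ==> sum F I \<in> pairs n k"
 by (induction I rule: infinite_finite_induct) (simp_all add: tensor_pairs_closed)

lemma single_pair_closed: "x \<in> diagrams n k ==> frag_of (russell_class n k (single x 1), s) \<in> pairs n k"
 by (rule tensor_pairs_closed(5)) (auto intro!: russell_class_closed)

lemma embed_closed: "keys g \<subseteq> diagrams n k ==> embed n k g \<in> pairs n k"
 unfolding embed_def by (rule pairs_sum) (rule single_pair_closed, blast)

lemma lift_embed: "keys g \<subseteq> diagrams n k ==> kl_equiv n k (lift n k (embed n k g)) (psi_map n k g)"
proof -
 assume g: "keys g \<subseteq> diagrams n k"
 have sum: "lift n k (sum F I) = (\<Sum>x\<in>I. lift n k (F x))" for F and I :: "diagram set"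
  by (induction I rule: infinite_finite_induct) (simp_all add: frag_sum_add)
 have "kl_equiv n k (pair_map n k (russell_class n k (single x 1), lookup g x))
   (scale (lookup g x) (psi_diagram n k x))" if "x \<in> keys g" for x
  using pair_map_equiv[of "single x 1" n k "lookup g x"] that g by (simp add: subsetD)
 then show ?thesis
  unfolding embed_def sum linear_extension_def frag_sum_of by (rule kl_equiv_sum)
qed

definition teq :: "nat => nat => (((diagram \<Rightarrow>\<^sub>0 laurent) set \<times> laurent) \<Rightarrow>\<^sub>0 int) => (((diagram \<Rightarrow>\<^sub>0 laurent) set \<times> laurent) \<Rightarrow>\<^sub>0 int) => bool" where
 "teq n k a b \<longleftrightarrow> a - b \<in> balanced n k"

lemma teq_refl: "teq n k a a"
 by (simp add: teq_def russell_tensor.G_closed)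

lemma teq_sym: "teq n k a b ==> teq n k b a"
 using russell_tensor.G_closed(4)[of "a - b" n k] by (simp add: teq_def)

lemma teq_trans [trans]: "teq n k a b ==> teq n k b c ==> teq n k a c"
 using russell_tensor.G_closed(3)[of "a - b" n k "b - c"] by (simp add: teq_def)

lemma teq_add: "teq n k a b ==> teq n k c d ==> teq n k (a + c) (b + d)"
 using russell_tensor.G_closed(3)[of "a - b" n k "c - d"] by (simp add: teq_def algebra_simps)

lemma teq_diff: "teq n k a b ==> teq n k c d ==> teq n k (a - c) (b - d)"
 using russell_tensor.G_closed(5)[of "a - b" n k "c - d"] by (simp add: teq_def algebra_simps)

lemma teq_sum: "(\<And>x. x \<in> I ==> teq n k (F x) (F' x)) ==> teq n k (sum F I) (sum F' I)"
 by (induction I rule: infinite_finite_induct) (simp_all add: teq_refl teq_add)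

lemma teq_relations:
 "m \<in> carrier (russell n k) ==> m' \<in> carrier (russell n k) ==>
  teq n k (frag_of (m \<oplus>\<^bsub>russell n k\<^esub> m', s)) (frag_of (m, s) + frag_of (m', s))"
 "m \<in> carrier (russell n k) ==> teq n k (frag_of (m, s + s')) (frag_of (m, s) + frag_of (m, s'))"
 "a \<in> carrier Laurent_q ==> m \<in> carrier (russell n k) ==> teq n k (frag_of (a \<odot>\<^bsub>russell n k\<^esub> m, s)) (frag_of (m, a * s))"
 using tensor_relations.add_left[of m "russell n k" m' s Laurent_qhalf Laurent_q, THEN russell_tensor.relations_G]
  tensor_relations.add_right[of m "russell n k" s Laurent_qhalf s' Laurent_q, THEN russell_tensor.relations_G]
  tensor_relations.balanced[of a Laurent_q m "russell n k" s Laurent_qhalf, THEN russell_tensor.relations_G]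
 by (simp_all add: teq_def diff_diff_eq)

lemma teq_zero_right: "m \<in> carrier (russell n k) ==> teq n k (frag_of (m, 0)) 0"
 using teq_diff[OF teq_relations(2)[of m n k 0 0] teq_refl[of n k "frag_of (m, 0)"]] teq_sym by fastforce

lemma teq_zero_left: "teq n k (frag_of (russell_class n k 0, s)) 0"
proof -
 have z: "0 \<in> free_r n k" by (simp add: free_russell_def)
 have "teq n k (frag_of (russell_class n k 0, s)) (frag_of (russell_class n k 0, s) + frag_of (russell_class n k 0, s))"
  using teq_relations(1)[OF russell_class_closed[OF z] russell_class_closed[OF z], of s] by (simp add: russell_class_add z)
 from teq_diff[OF this teq_refl[of n k "frag_of (russell_class n k 0, s)"]] show ?thesis
  using teq_sym by fastforce
qed

lemma embed_superset:
 assumes "finite I" "keys g \<subseteq> I" "I \<subseteq> diagrams n k"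
 shows "teq n k (\<Sum>x\<in>I. frag_of (russell_class n k (single x 1), lookup g x)) (embed n k g)"
proof -
 let ?e = "\<lambda>x. frag_of (russell_class n k (single x 1), lookup g x)"
 have "teq n k (\<Sum>x\<in>I - keys g. ?e x) (\<Sum>x\<in>I - keys g. 0)"
 proof (rule teq_sum)
  fix x assume x: "x \<in> I - keys g"
  then have "single x 1 \<in> free_r n k" using assms(3) by (intro free_r_closed(4)) auto
  from teq_zero_right[OF russell_class_closed[OF this]] show "teq n k (?e x) 0" using x by (simp add: in_keys_iff)
 qed
 from teq_add[OF this teq_refl[of n k "embed n k g"]] show ?thesis
  using sum.subset_diff[OF assms(2,1), of ?e] by (simp add: embed_def)
qed

lemma embed_add:
 assumes "keys g \<subseteq> diagrams n k" "keys g' \<subseteq> diagrams n k"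
 shows "teq n k (embed n k (g + g')) (embed n k g + embed n k g')"
proof -
 let ?I = "keys g \<union> keys g'"
 let ?e = "\<lambda>h x. frag_of (russell_class n k (single x 1), lookup h x)"
 have super: "teq n k (\<Sum>x\<in>?I. ?e h x) (embed n k h)" if "h \<in> {g, g', g + g'}" for h
  using that keys_add[of g g'] assms by (intro embed_superset) auto
 have "teq n k (\<Sum>x\<in>?I. ?e (g + g') x) (\<Sum>x\<in>?I. ?e g x + ?e g' x)"
 proof (rule teq_sum)
  fix x assume "x \<in> ?I"
  then have "single x 1 \<in> free_r n k" using assms by (intro free_r_closed(4)) auto
  from teq_relations(2)[OF russell_class_closed[OF this]] show "teq n k (?e (g + g') x) (?e g x + ?e g' x)"
   by (simp add: lookup_add)
 qed
 then have "teq n k (\<Sum>x\<in>?I. ?e (g + g') x) ((\<Sum>x\<in>?I. ?e g x) + (\<Sum>x\<in>?I. ?e g' x))" by (simp only: sum.distrib)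
 then have "teq n k (embed n k (g + g')) ((\<Sum>x\<in>?I. ?e g x) + (\<Sum>x\<in>?I. ?e g' x))"
  using teq_trans[OF teq_sym[OF super[of "g + g'"]]] by simp
 then show ?thesis using teq_trans[OF _ teq_add[OF super[of g] super[of g']]] by simp
qed

text \<open>The coefficients of \<open>f\<close> lie in the even subring, so they may be moved
  across the tensor sign one diagram at a time.\<close>

lemma pair_embed:
 assumes "f \<in> free_r n k"
 shows "teq n k (frag_of (russell_class n k f, s)) (embed n k (scale s f))"
proof -
 let ?c = "lookup f" and ?s = "\<lambda>x. single x 1 :: diagram \<Rightarrow>\<^sub>0 laurent"
 have keys: "keys f \<subseteq> diagrams n k" and coeffs: "?c x \<in> carrier Laurent_q" for x
  using assms unfolding free_russell_def free_module_carrier by blast+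
 have "finite I ==> I \<subseteq> keys f ==>
   (\<Sum>x\<in>I. single x (?c x)) \<in> free_r n k \<and>
   teq n k (frag_of (russell_class n k (\<Sum>x\<in>I. single x (?c x)), s))
    (\<Sum>x\<in>I. frag_of (russell_class n k (?s x), s * ?c x))" for I
 proof (induction I rule: finite_induct)
  case empty
  then show ?case using teq_zero_left by (simp add: free_russell_def)
 next
  case (insert x I)
  let ?r = "\<Sum>x\<in>I. single x (?c x)"
  have x: "?s x \<in> free_r n k" "single x (?c x) \<in> free_r n k"
   using insert.prems keys coeffs[of x] by (auto intro!: free_r_closed(4))
  have r: "?r \<in> free_r n k" using insert by simp
  have scale: "russell_class n k (single x (?c x)) = ?c x \<odot>\<^bsub>russell n k\<^esub> russell_class n k (?s x)"
   by (simp add: russell_class_smult coeffs x(1))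
  have "teq n k (frag_of (russell_class n k (single x (?c x) + ?r), s))
    (frag_of (russell_class n k (single x (?c x)), s) + frag_of (russell_class n k ?r, s))"
   using teq_relations(1)[OF russell_class_closed[OF x(2)] russell_class_closed[OF r], of s] by (simp add: russell_class_add x(2) r)
  also have "teq n k \<dots> (frag_of (russell_class n k (?s x), s * ?c x) + (\<Sum>x\<in>I. frag_of (russell_class n k (?s x), s * ?c x)))"
  proof (rule teq_add)
   show "teq n k (frag_of (russell_class n k (single x (?c x)), s)) (frag_of (russell_class n k (?s x), s * ?c x))"
    unfolding scale mult.commute[of s] by (rule teq_relations(3)[OF coeffs russell_class_closed[OF x(1)]])
  qed (use insert in simp)
  finally show ?case using insert x(2) r by simp
 qed
 from this[OF finite_keys order.refl]
 have "teq n k (frag_of (russell_class n k f, s)) (\<Sum>x\<in>keys f. frag_of (russell_class n k (?s x), s * ?c x))"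
  using poly_mapping_expand[of f] by simp
 also have "teq n k \<dots> (embed n k (scale s f))"
  using embed_superset[OF finite_keys keys_scale keys, of s] by simp
 finally show ?thesis .
qed

text \<open>The reduction to standard diagrams is applied inside the left-hand factor of each pure
  tensor, before its coefficients are moved to the right.\<close>

lemma pairs_standard:
 assumes "f \<in> pairs n k"
 shows "\<exists>g. keys g \<subseteq> diagrams n k \<inter> Collect standard \<and> teq n k f (embed n k g)"
proof -
 have "keys f \<subseteq> carrier (russell n k) \<times> UNIV" using assms by (simp add: tensor_pairs_carrier)
 then show ?thesis
 proof (induction rule: frag_induction)
  case zero
  show ?case by (rule exI[of _ 0]) (simp add: embed_def teq_refl)
 next
  case (one p)
  then obtain f0 s where p: "p = (russell_class n k f0, s)" "f0 \<in> free_r n k" by (auto simp: carrier_russell)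
  obtain f' where f': "f' \<in> free_r n k" "keys f' \<subseteq> Collect standard" "f0 - f' \<in> russell_span n k"
   using russell_reducible[OF p(2)] .
  have "russell_class n k f0 = russell_class n k f'" using russell_class_eq_iff[OF p(2) f'(1)] f'(3) by simp
  then have "teq n k (frag_of p) (embed n k (scale s f'))" using pair_embed[OF f'(1), of s] p(1) by simp
  moreover have "keys (scale s f') \<subseteq> diagrams n k \<inter> Collect standard"
   using keys_scale[of s f'] free_r_keys[OF f'(1)] f'(2) by blast
  ultimately show ?case by blast
 next
  case (diff a b)
  then obtain g h where gh: "keys g \<subseteq> diagrams n k \<inter> Collect standard" "teq n k a (embed n k g)"
   "keys h \<subseteq> diagrams n k \<inter> Collect standard" "teq n k b (embed n k h)" by blast
  have keys: "keys (g - h) \<subseteq> diagrams n k \<inter> Collect standard" using keys_diff[of g h] gh by blast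
  then have "teq n k (embed n k (g - h + h)) (embed n k (g - h) + embed n k h)" using gh by (intro embed_add) auto
  from teq_diff[OF this teq_refl[of n k "embed n k h"]]
  have "teq n k (embed n k g - embed n k h) (embed n k (g - h))" by simp
  then have "teq n k (a - b) (embed n k (g - h))" using teq_trans[OF teq_diff[OF gh(2,4)]] by blast
  then show ?case using keys by blast
 qed
qed

text \<open>Written with standard diagrams, a tensor is lifted to \<open>psi_map n k g\<close>
  modulo the kernel. If this lies in the kernel, all states of \<open>g\<close> vanish, and
  independence gives \<open>g = 0\<close>.\<close>

lemma lift_kernel:
 assumes f: "f \<in> pairs n k" and kernel: "lift n k f \<in> kl_kernel n k"
 shows "f \<in> balanced n k"
proof -
 obtain g where g: "keys g \<subseteq> diagrams n k \<inter> Collect standard" "teq n k f (embed n k g)"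
  using pairs_standard[OF f] by blast
 have keys: "keys g \<subseteq> diagrams n k" using g(1) by blast
 have "kl_equiv n k (lift n k f) (lift n k (embed n k g))"
  using lift_balanced[of "f - embed n k g" n k] g(2) by (simp add: teq_def kl_equiv_def frag_sum_diff)
 then have "kl_equiv n k (lift n k f) (psi_map n k g)" using lift_embed[OF keys] kl_equiv_trans by blast
 from kl_equiv_trans[OF kl_equiv_sym[OF this], of 0] have "psi_map n k g \<in> kl_kernel n k"
  using kernel by (simp add: kl_equiv_def)
 then have "pairing (russell_state n S) g = 0" for S by (rule psi_map_kernel_state[OF keys])
 then have "g = 0" using standard_independent[of g n k] g(1) by (auto simp: free_module_carrier)
 then show ?thesis using g(2) by (simp add: teq_def embed_def)
qed

theorem proposition4p4p6:
  fixes n k :: nat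
  assumes "k \<le> n"
  shows "psi n k \<in> module_iso Laurent_qhalf
           (extend_scalars Laurent_q Laurent_qhalf (russell n k)) (kauffman_lins n k)"
proof -
 note carrier = russell_tensor.carrier_E[of n k] and closed = lift_closed[of _ n k]
 have hom: "psi n k \<in> module_hom Laurent_qhalf (russell_tensor.E n k) (kauffman_lins n k)"
  unfolding module_hom_def
 proof (intro CollectI conjI ballI Pi_I)
  fix C assume "C \<in> carrier (russell_tensor.E n k)"
  then obtain f where f: "f \<in> pairs n k" "C = russell_tensor.tclass n k f" unfolding carrier by blast
  show "psi n k C \<in> carrier (kauffman_lins n k)"
   unfolding f(2) psi_class[OF f(1)] by (rule kl_class_closed[OF closed[OF f(1)]])
  show "psi n k (c \<odot>\<^bsub>russell_tensor.E n k\<^esub> C) = c \<odot>\<^bsub>kauffman_lins n k\<^esub> psi n k C" for c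
   unfolding f(2) russell_tensor.smult_E[OF f(1)] psi_class[OF russell_tensor.smult_T_closed[OF f(1)]] psi_class[OF f(1)]
    lift_smult[OF f(1)] kl_class_smult[OF closed[OF f(1)]] ..
  fix C' assume "C' \<in> carrier (russell_tensor.E n k)"
  then obtain f' where f': "f' \<in> pairs n k" "C' = russell_tensor.tclass n k f'" unfolding carrier by blast
  show "psi n k (C \<oplus>\<^bsub>russell_tensor.E n k\<^esub> C') = psi n k C \<oplus>\<^bsub>kauffman_lins n k\<^esub> psi n k C'"
   unfolding f(2) f'(2) russell_tensor.add_E[OF f(1) f'(1)] psi_class[OF tensor_pairs_closed(2)[OF f(1) f'(1)]]
    psi_class[OF f(1)] psi_class[OF f'(1)] kl_class_add[OF closed[OF f(1)] closed[OF f'(1)]] frag_sum_add ..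
 qed
 moreover have "bij_betw (psi n k) (carrier (russell_tensor.E n k)) (carrier (kauffman_lins n k))"
  unfolding bij_betw_def
 proof (intro conjI inj_onI)
  fix C C' assume "C \<in> carrier (russell_tensor.E n k)"
   "C' \<in> carrier (russell_tensor.E n k)" and eq: "psi n k C = psi n k C'"
  then obtain f f' where f: "f \<in> pairs n k" "C = russell_tensor.tclass n k f" "f' \<in> pairs n k" "C' = russell_tensor.tclass n k f'"
   unfolding carrier by blast
  have "lift n k (f - f') \<in> kl_kernel n k"
   using eq kl_class_eq_iff[OF closed[OF f(1)] closed[OF f(3)]] unfolding f(2,4) psi_class[OF f(1)] psi_class[OF f(3)] frag_sum_diff by simp
  then have "f - f' \<in> balanced n k" by (rule lift_kernel[OF tensor_pairs_closed(3)[OF f(1,3)]])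
  then show "C = C'" unfolding f(2,4) russell_tensor.tclass_eq_iff[OF f(1,3)] .
 next
  show "psi n k ` carrier (russell_tensor.E n k) = carrier (kauffman_lins n k)"
  proof
   show "psi n k ` carrier (russell_tensor.E n k) \<subseteq> carrier (kauffman_lins n k)"
    using hom by (auto simp: module_hom_def)
   show "carrier (kauffman_lins n k) \<subseteq> psi n k ` carrier (russell_tensor.E n k)"
   proof
    fix C assume "C \<in> carrier (kauffman_lins n k)"
    then obtain f where f: "f \<in> free_kl n k" "C = kl_class n k f" unfolding carrier_kl by blast
    obtain g where g: "keys g \<subseteq> diagrams n k" "kl_equiv n k f (psi_map n k g)" using psi_map_surj[OF f(1)] by blast
    have e: "embed n k g \<in> pairs n k" by (rule embed_closed[OF g(1)])
    have "kl_equiv n k f (lift n k (embed n k g))" using kl_equiv_trans[OF g(2) kl_equiv_sym[OF lift_embed[OF g(1)]]] .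
    then have "C = psi n k (russell_tensor.tclass n k (embed n k g))"
     using kl_class_eq_iff[OF f(1) closed[OF e]] unfolding f(2) psi_class[OF e] kl_equiv_def by simp
    then show "C \<in> psi n k ` carrier (russell_tensor.E n k)"
     unfolding carrier using e by blast
   qed
  qed
 qed
 ultimately show ?thesis by (simp add: module_iso_def)
qed

end
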